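(* Let $(\{E_\lambda\}_{\lambda\in\Lambda},\{m_{\lambda,\lambda'}\}_{\lambda\preceq\lambda'})$ be a projective system of topological graphs over a directed set $\Lambda$. Then $$\mathcal{T}\big(\varprojlim E_\lambda\big)\cong\varinjlim\mathcal{T}(E_\lambda),$$ where the inductive limit is taken with respect to the $*$-homomorphisms $\mu_{\lambda,\lambda'}\colon\mathcal{T}(E_\lambda)\to\mathcal{T}(E_{\lambda'})$ induced by the factor maps $m_{\lambda,\lambda'}$.
   Context: A topological graph $E=(E^0,E^1,d,r)$ consists of two locally compact (Hausdorff) spaces $E^0,E^1$, a local homeomorphism $d\colon E^1\to E^0$ and a continuous map $r\colon E^1\to E^0$. $C_d(E^1)$ is the set of continuous functions $\xi$ on $E^1$ such that $\langle\xi,\xi\rangle(v)=\sum_{e\in d^{-1}(v)}|\xi(e)|^2<\infty$ for all $v\in E^0$ and $\langle\xi,\xi\rangle\in C_0(E^0)$. It is a right Hilbert $C_0(E^0)$-module with $(\xi f)(e)=\xi(e)f(d(e))$ and $\langle\xi,\eta\rangle(v)=\sum_{e\in d^{-1}(v)}\overline{\xi(e)}\eta(e)$. The left action $\pi_r$ of $C_0(E^0)$ is $(\pi_r(f)\xi)(e)=f(r(e))\xi(e)$. A Toeplitz $E$-pair in a $C^*$-algebra $A$ is a pair $T=(T^0,T^1)$ of a $*$-homomorphism $T^0\colon C_0(E^0)\to A$ and a linear map $T^1\colon C_d(E^1)\to A$ with $T^1(\xi)^*T^1(\eta)=T^0(\langle\xi,\eta\rangle)$ and $T^0(f)T^1(\xi)=T^1(\pi_r(f)\xi)$.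 $\mathcal{T}(E)$ is the universal $C^*$-algebra generated by a Toeplitz $E$-pair $T_E=(T_E^0,T_E^1)$. For a locally compact space $X$, $\widetilde X=X\cup\{\infty\}$ is its one-point compactification ($\infty$ is isolated if $X$ is compact). Functions in $C_0(X)$ are regarded as continuous functions on $\widetilde X$ vanishing at $\infty$; elements of $C_d(E^1)$ (which lie in $C_0(E^1)$) are extended likewise. A factor map from $F=(F^0,F^1,d_F,r_F)$ to $E=(E^0,E^1,d_E,r_E)$ is a pair $m=(m^0,m^1)$ of continuous maps $m^0\colon\widetilde F^0\to\widetilde E^0$, $m^1\colon\widetilde F^1\to\widetilde E^1$ sending $\infty$ to $\infty$ such that: (i) for every $e\in F^1$ with $m^1(e)\in E^1$, $r_E(m^1(e))=m^0(r_F(e))$ and $d_E(m^1(e))=m^0(d_F(e))$; (ii) if $e'\in E^1$ and $v\in F^0$ satisfy $d_E(e')=m^0(v)$, then there is a unique $e\in F^1$ with $m^1(e)=e'$ and $d_F(e)=v$. Such $m$ induces a unique $*$-homomorphism $\mu\colon\mathcal{T}(E)\to\mathcal{T}(F)$ with $\mu(T_E^0(f))=T_F^0(f\circ m^0)$ and $\mu(T_E^1(\xi))=T_F^1(\xi\circ m^1)$. Composition of factor maps is componentwise. A projective system of topological graphs over a directed set $\Lambda$ consists of topological graphs $E_\lambda=(E_\lambda^0,E_\lambda^1,d_\lambda,r_\lambda)$ and factor maps $m_{\lambda,\lambda'}$ from $E_{\lambda'}$ to $E_\lambda$ for $\lambda\preceq\lambda'$, with $m_{\lambda,\lambda}=\mathrm{id}$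 and $m_{\lambda,\lambda'}\circ m_{\lambda',\lambda''}=m_{\lambda,\lambda''}$. Its projective limit $\varprojlim E_\lambda=(E^0,E^1,d,r)$: for $i=0,1$ let $\widetilde E^i$ be the projective limit of the compact spaces $\widetilde E_\lambda^i$ along the $m_{\lambda,\lambda'}^i$, with natural maps $m_\lambda^i\colon\widetilde E^i\to\widetilde E_\lambda^i$; let $\infty\in\widetilde E^i$ be the point with $m_\lambda^i(\infty)=\infty$ for all $\lambda$, and $E^i=\widetilde E^i\setminus\{\infty\}$. For $e\in E^1$ choose $\lambda_0$ with $m_{\lambda_0}^1(e)\in E_{\lambda_0}^1$; then $d(e)$ and $r(e)$ are the points of $E^0$ determined by $m_\lambda^0(d(e))=d_\lambda(m_\lambda^1(e))$ and $m_\lambda^0(r(e))=r_\lambda(m_\lambda^1(e))$ for all $\lambda\succeq\lambda_0$. This is a topological graph. *)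

theory Defs
  imports "HOL-Analysis.Analysis"
begin

section \<open>Complex *-algebras, C*-algebras and *-homomorphisms\<close>

text \<open>Algebras live on explicit carriers and need not have a unit.\<close>

record 'a star_alg =
  carr :: "'a set"
  zer :: 'a
  add :: "'a \<Rightarrow> 'a \<Rightarrow> 'a"
  scal :: "complex \<Rightarrow> 'a \<Rightarrow> 'a"
  mul :: "'a \<Rightarrow> 'a \<Rightarrow> 'a"
  star :: "'a \<Rightarrow> 'a"
  nrm :: "'a \<Rightarrow> real"

definition sub :: "'a star_alg \<Rightarrow> 'a \<Rightarrow> 'a \<Rightarrow> 'a" where
  "sub A x y = add A x (scal A (- 1) y)"

locale star_algebra =
  fixes A :: "'a star_alg"
  assumes zer_closed: "zer A \<in> carr A"
    and add_closed: "\<lbrakk>x \<in> carr A; y \<in> carr A\<rbrakk> \<Longrightarrow> add A x y \<in> carr A"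
    and scal_closed: "x \<in> carr A \<Longrightarrow> scal A c x \<in> carr A"
    and mul_closed: "\<lbrakk>x \<in> carr A; y \<in> carr A\<rbrakk> \<Longrightarrow> mul A x y \<in> carr A"
    and star_closed: "x \<in> carr A \<Longrightarrow> star A x \<in> carr A"
    and add_assoc: "\<lbrakk>x \<in> carr A; y \<in> carr A; z \<in> carr A\<rbrakk>
          \<Longrightarrow> add A (add A x y) z = add A x (add A y z)"
    and add_commute: "\<lbrakk>x \<in> carr A; y \<in> carr A\<rbrakk> \<Longrightarrow> add A x y = add A y x"
    and add_zer: "x \<in> carr A \<Longrightarrow> add A x (zer A) = x"
    and sub_self: "x \<in> carr A \<Longrightarrow> sub A x x = zer A"
    and scal_add: "\<lbrakk>x \<in> carr A; y \<in> carr A\<rbrakk>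
          \<Longrightarrow> scal A c (add A x y) = add A (scal A c x) (scal A c y)"
    and add_scal: "x \<in> carr A \<Longrightarrow> scal A (c + c') x = add A (scal A c x) (scal A c' x)"
    and scal_scal: "x \<in> carr A \<Longrightarrow> scal A c (scal A c' x) = scal A (c * c') x"
    and scal_one: "x \<in> carr A \<Longrightarrow> scal A 1 x = x"
    and mul_assoc: "\<lbrakk>x \<in> carr A; y \<in> carr A; z \<in> carr A\<rbrakk>
          \<Longrightarrow> mul A (mul A x y) z = mul A x (mul A y z)"
    and mul_add: "\<lbrakk>x \<in> carr A; y \<in> carr A; z \<in> carr A\<rbrakk>
          \<Longrightarrow> mul A x (add A y z) = add A (mul A x y) (mul A x z)"
    and add_mul: "\<lbrakk>x \<in> carr A; y \<in> carr A; z \<in> carr A\<rbrakk>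
          \<Longrightarrow> mul A (add A x y) z = add A (mul A x z) (mul A y z)"
    and mul_scal: "\<lbrakk>x \<in> carr A; y \<in> carr A\<rbrakk> \<Longrightarrow> mul A x (scal A c y) = scal A c (mul A x y)"
    and scal_mul: "\<lbrakk>x \<in> carr A; y \<in> carr A\<rbrakk> \<Longrightarrow> mul A (scal A c x) y = scal A c (mul A x y)"
    and star_star: "x \<in> carr A \<Longrightarrow> star A (star A x) = x"
    and star_add: "\<lbrakk>x \<in> carr A; y \<in> carr A\<rbrakk> \<Longrightarrow> star A (add A x y) = add A (star A x) (star A y)"
    and star_scal: "x \<in> carr A \<Longrightarrow> star A (scal A c x) = scal A (cnj c) (star A x)"
    and star_mul: "\<lbrakk>x \<in> carr A; y \<in> carr A\<rbrakk> \<Longrightarrow> star A (mul A x y) = mul A (star A y) (star A x)"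

text \<open>A *-algebra whose \<^term>\<open>nrm\<close> is a C*-seminorm.\<close>

locale cstar_seminormed = star_algebra +
  assumes nrm_nonneg: "x \<in> carr A \<Longrightarrow> 0 \<le> nrm A x"
    and nrm_add: "\<lbrakk>x \<in> carr A; y \<in> carr A\<rbrakk> \<Longrightarrow> nrm A (add A x y) \<le> nrm A x + nrm A y"
    and nrm_scal: "x \<in> carr A \<Longrightarrow> nrm A (scal A c x) = cmod c * nrm A x"
    and nrm_mul: "\<lbrakk>x \<in> carr A; y \<in> carr A\<rbrakk> \<Longrightarrow> nrm A (mul A x y) \<le> nrm A x * nrm A y"
    and nrm_star_mul: "x \<in> carr A \<Longrightarrow> nrm A (mul A (star A x) x) = (nrm A x)\<^sup>2"

definition cauchy_seqs :: "'a star_alg \<Rightarrow> (nat \<Rightarrow> 'a) set" where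
  "cauchy_seqs A = {X. (\<forall>n. X n \<in> carr A) \<and>
     (\<forall>\<epsilon>>0. \<exists>N. \<forall>m\<ge>N. \<forall>n\<ge>N. nrm A (sub A (X m) (X n)) < \<epsilon>)}"

locale cstar_algebra = cstar_seminormed +
  assumes nrm_definite: "\<lbrakk>x \<in> carr A; nrm A x = 0\<rbrakk> \<Longrightarrow> x = zer A"
    and complete: "X \<in> cauchy_seqs A
          \<Longrightarrow> \<exists>x\<in>carr A. (\<lambda>n. nrm A (sub A (X n) x)) \<longlonglongrightarrow> 0"

definition star_hom :: "'a star_alg \<Rightarrow> 'b star_alg \<Rightarrow> ('a \<Rightarrow> 'b) \<Rightarrow> bool" where
  "star_hom A B \<phi> \<longleftrightarrow>
     (\<forall>x\<in>carr A. \<phi> x \<in> carr B) \<and>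
     (\<forall>x\<in>carr A. \<forall>y\<in>carr A. \<phi> (add A x y) = add B (\<phi> x) (\<phi> y)) \<and>
     (\<forall>c. \<forall>x\<in>carr A. \<phi> (scal A c x) = scal B c (\<phi> x)) \<and>
     (\<forall>x\<in>carr A. \<forall>y\<in>carr A. \<phi> (mul A x y) = mul B (\<phi> x) (\<phi> y)) \<and>
     (\<forall>x\<in>carr A. \<phi> (star A x) = star B (\<phi> x))"

definition cstar_isomorphic :: "'a star_alg \<Rightarrow> 'b star_alg \<Rightarrow> bool" where
  "cstar_isomorphic A B \<longleftrightarrow> cstar_algebra A \<and> cstar_algebra B \<and>
     (\<exists>\<phi>. star_hom A B \<phi> \<and> bij_betw \<phi> (carr A) (carr B))"

section \<open>The C*-algebra obtained from a C*-seminorm\<close>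

text \<open>Hausdorff completion: Cauchy sequences modulo sequences of seminorm tending to 0.
  (This both divides out the null space of the seminorm and completes.)\<close>

definition cauchy_rel :: "'a star_alg \<Rightarrow> ((nat \<Rightarrow> 'a) \<times> (nat \<Rightarrow> 'a)) set" where
  "cauchy_rel A = {(X, Y). X \<in> cauchy_seqs A \<and> Y \<in> cauchy_seqs A \<and>
     (\<lambda>n. nrm A (sub A (X n) (Y n))) \<longlonglongrightarrow> 0}"

definition cauchy_class :: "'a star_alg \<Rightarrow> (nat \<Rightarrow> 'a) \<Rightarrow> (nat \<Rightarrow> 'a) set" where
  "cauchy_class A X = cauchy_rel A `` {X}"

definition completion :: "'a star_alg \<Rightarrow> (nat \<Rightarrow> 'a) set star_alg" where
  "completion A = \<lparr>
     carr = cauchy_seqs A // cauchy_rel A,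
     zer = cauchy_class A (\<lambda>n. zer A),
     add = (\<lambda>P Q. \<Union>X\<in>P. \<Union>Y\<in>Q. cauchy_class A (\<lambda>n. add A (X n) (Y n))),
     scal = (\<lambda>c P. \<Union>X\<in>P. cauchy_class A (\<lambda>n. scal A c (X n))),
     mul = (\<lambda>P Q. \<Union>X\<in>P. \<Union>Y\<in>Q. cauchy_class A (\<lambda>n. mul A (X n) (Y n))),
     star = (\<lambda>P. \<Union>X\<in>P. cauchy_class A (\<lambda>n. star A (X n))),
     nrm = (\<lambda>P. lim (\<lambda>n. nrm A ((SOME X. X \<in> P) n)))\<rparr>"

definition to_completion :: "'a star_alg \<Rightarrow> 'a \<Rightarrow> (nat \<Rightarrow> 'a) set" where
  "to_completion A x = cauchy_class A (\<lambda>n. x)"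

section \<open>Directed sets and inductive limits of C*-algebras\<close>

definition directed_set :: "'l set \<Rightarrow> ('l \<Rightarrow> 'l \<Rightarrow> bool) \<Rightarrow> bool" where
  "directed_set \<Lambda> le \<longleftrightarrow> \<Lambda> \<noteq> {} \<and>
     (\<forall>a\<in>\<Lambda>. le a a) \<and>
     (\<forall>a\<in>\<Lambda>. \<forall>b\<in>\<Lambda>. \<forall>c\<in>\<Lambda>. le a b \<longrightarrow> le b c \<longrightarrow> le a c) \<and>
     (\<forall>a\<in>\<Lambda>. \<forall>b\<in>\<Lambda>. \<exists>c\<in>\<Lambda>. le a c \<and> le b c)"

definition net_filter :: "'l set \<Rightarrow> ('l \<Rightarrow> 'l \<Rightarrow> bool) \<Rightarrow> 'l filter" where
  "net_filter \<Lambda> le = (INF a\<in>\<Lambda>. principal {b \<in> \<Lambda>. le a b})"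

text \<open>The *-algebra of families in the product of the \<open>A \<lambda>\<close> that are eventually transported
  by the connecting maps, with the C*-seminorm given by the limit of the norms.  Families that
  agree eventually have distance 0, so the Hausdorff completion is the completion of the
  algebraic direct limit.\<close>

definition eventual_families ::
  "'l set \<Rightarrow> ('l \<Rightarrow> 'l \<Rightarrow> bool) \<Rightarrow> ('l \<Rightarrow> 'a star_alg) \<Rightarrow> ('l \<Rightarrow> 'l \<Rightarrow> 'a \<Rightarrow> 'a) \<Rightarrow> ('l \<Rightarrow> 'a) star_alg"
where
  "eventual_families \<Lambda> le A \<mu> = \<lparr>
     carr = {a \<in> (\<Pi>\<^sub>E l\<in>\<Lambda>. carr (A l)).
               \<exists>l0\<in>\<Lambda>. \<forall>l\<in>\<Lambda>. le l0 l \<longrightarrow> a l = \<mu> l0 l (a l0)},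
     zer = (\<lambda>l\<in>\<Lambda>. zer (A l)),
     add = (\<lambda>a b. \<lambda>l\<in>\<Lambda>. add (A l) (a l) (b l)),
     scal = (\<lambda>c a. \<lambda>l\<in>\<Lambda>. scal (A l) c (a l)),
     mul = (\<lambda>a b. \<lambda>l\<in>\<Lambda>. mul (A l) (a l) (b l)),
     star = (\<lambda>a. \<lambda>l\<in>\<Lambda>. star (A l) (a l)),
     nrm = (\<lambda>a. Lim (net_filter \<Lambda> le) (\<lambda>l. nrm (A l) (a l)))\<rparr>"

definition inductive_limit ::
  "'l set \<Rightarrow> ('l \<Rightarrow> 'l \<Rightarrow> bool) \<Rightarrow> ('l \<Rightarrow> 'a star_alg) \<Rightarrow> ('l \<Rightarrow> 'l \<Rightarrow> 'a \<Rightarrow> 'a)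
     \<Rightarrow> (nat \<Rightarrow> 'l \<Rightarrow> 'a) set star_alg"
where
  "inductive_limit \<Lambda> le A \<mu> = completion (eventual_families \<Lambda> le A \<mu>)"

section \<open>Topological graphs\<close>

record ('v, 'e) topgraph =
  vertices :: "'v topology"
  edges :: "'e topology"
  dmap :: "'e \<Rightarrow> 'v"
  rmap :: "'e \<Rightarrow> 'v"

definition local_homeomorphism :: "'a topology \<Rightarrow> 'b topology \<Rightarrow> ('a \<Rightarrow> 'b) \<Rightarrow> bool" where
  "local_homeomorphism X Y f \<longleftrightarrow>
     (\<forall>x\<in>topspace X. \<exists>U. openin X U \<and> x \<in> U \<and> openin Y (f ` U) \<and>
        homeomorphic_map (subtopology X U) (subtopology Y (f ` U)) f)"

definition topological_graph :: "('v, 'e) topgraph \<Rightarrow> bool" where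
  "topological_graph E \<longleftrightarrow>
     locally_compact_space (vertices E) \<and> Hausdorff_space (vertices E) \<and>
     locally_compact_space (edges E) \<and> Hausdorff_space (edges E) \<and>
     local_homeomorphism (edges E) (vertices E) (dmap E) \<and>
     continuous_map (edges E) (vertices E) (rmap E)"

text \<open>Functions on a space are total functions that are 0 off its carrier, so that equality of
  elements is equality in HOL.\<close>

definition C0 :: "'a topology \<Rightarrow> ('a \<Rightarrow> complex) set" where
  "C0 X = {f. continuous_map X euclidean f \<and> (\<forall>x. x \<notin> topspace X \<longrightarrow> f x = 0) \<and>
     (\<forall>\<epsilon>>0. compactin X {x \<in> topspace X. \<epsilon> \<le> cmod (f x)})}"

definition C0_algebra :: "'a topology \<Rightarrow> ('a \<Rightarrow> complex) star_alg" where
  "C0_algebra X = \<lparr>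
     carr = C0 X,
     zer = (\<lambda>x. 0),
     add = (\<lambda>f g x. f x + g x),
     scal = (\<lambda>c f x. c * f x),
     mul = (\<lambda>f g x. f x * g x),
     star = (\<lambda>f x. cnj (f x)),
     nrm = (\<lambda>f. Sup (insert 0 ((\<lambda>x. cmod (f x)) ` topspace X)))\<rparr>"

definition d_fibre :: "('v, 'e) topgraph \<Rightarrow> 'v \<Rightarrow> 'e set" where
  "d_fibre E v = {e \<in> topspace (edges E). dmap E e = v}"

definition inner_Cd ::
  "('v, 'e) topgraph \<Rightarrow> ('e \<Rightarrow> complex) \<Rightarrow> ('e \<Rightarrow> complex) \<Rightarrow> 'v \<Rightarrow> complex" where
  "inner_Cd E \<xi> \<eta> v = (\<Sum>\<^sub>\<infinity>e\<in>d_fibre E v. cnj (\<xi> e) * \<eta> e)"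

definition Cd :: "('v, 'e) topgraph \<Rightarrow> ('e \<Rightarrow> complex) set" where
  "Cd E = {\<xi>. continuous_map (edges E) euclidean \<xi> \<and>
     (\<forall>e. e \<notin> topspace (edges E) \<longrightarrow> \<xi> e = 0) \<and>
     (\<forall>v\<in>topspace (vertices E). (\<lambda>e. (cmod (\<xi> e))\<^sup>2) summable_on d_fibre E v) \<and>
     inner_Cd E \<xi> \<xi> \<in> C0 (vertices E)}"

definition left_act :: "('v, 'e) topgraph \<Rightarrow> ('v \<Rightarrow> complex) \<Rightarrow> ('e \<Rightarrow> complex) \<Rightarrow> 'e \<Rightarrow> complex"
where
  "left_act E f \<xi> e = f (rmap E e) * \<xi> e"

section \<open>Toeplitz pairs and the Toeplitz algebra\<close>

definition toeplitz_pair ::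
  "('v, 'e) topgraph \<Rightarrow> 'a star_alg \<Rightarrow> (('v \<Rightarrow> complex) \<Rightarrow> 'a) \<Rightarrow> (('e \<Rightarrow> complex) \<Rightarrow> 'a) \<Rightarrow> bool"
where
  "toeplitz_pair E A T0 T1 \<longleftrightarrow>
     cstar_algebra A \<and>
     star_hom (C0_algebra (vertices E)) A T0 \<and>
     (\<forall>\<xi>\<in>Cd E. T1 \<xi> \<in> carr A) \<and>
     (\<forall>\<xi>\<in>Cd E. \<forall>\<eta>\<in>Cd E. T1 (\<lambda>e. \<xi> e + \<eta> e) = add A (T1 \<xi>) (T1 \<eta>)) \<and>
     (\<forall>c. \<forall>\<xi>\<in>Cd E. T1 (\<lambda>e. c * \<xi> e) = scal A c (T1 \<xi>)) \<and>
     (\<forall>\<xi>\<in>Cd E. \<forall>\<eta>\<in>Cd E. mul A (star A (T1 \<xi>)) (T1 \<eta>) = T0 (inner_Cd E \<xi> \<eta>)) \<and>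
     (\<forall>f\<in>C0 (vertices E). \<forall>\<xi>\<in>Cd E. mul A (T0 f) (T1 \<xi>) = T1 (left_act E f \<xi>))"

text \<open>The free (non-unital) *-algebra on a set \<open>G\<close>: finitely supported functions on nonempty
  words in the letters \<open>(g, False)\<close>, standing for \<open>g\<close>, and \<open>(g, True)\<close>, standing for \<open>g\<^sup>*\<close>.
  The \<^term>\<open>nrm\<close> field is a placeholder.\<close>

definition free_star_algebra :: "'g set \<Rightarrow> (('g \<times> bool) list \<Rightarrow> complex) star_alg" where
  "free_star_algebra G = \<lparr>
     carr = {p. finite {w. p w \<noteq> 0} \<and> (\<forall>w. p w \<noteq> 0 \<longrightarrow> w \<noteq> [] \<and> fst ` set w \<subseteq> G)},
     zer = (\<lambda>w. 0),
     add = (\<lambda>p q w. p w + q w),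
     scal = (\<lambda>c p w. c * p w),
     mul = (\<lambda>p q w. \<Sum>k\<le>length w. p (take k w) * q (drop k w)),
     star = (\<lambda>p w. cnj (p (rev (map (\<lambda>(g, b). (g, \<not> b)) w)))),
     nrm = (\<lambda>p. 0)\<rparr>"

definition free_gen :: "'g \<Rightarrow> ('g \<times> bool) list \<Rightarrow> complex" where
  "free_gen g w = (if w = [(g, False)] then 1 else 0)"

type_synonym ('v, 'e) toeplitz_pre = "((('v \<Rightarrow> complex) + ('e \<Rightarrow> complex)) \<times> bool) list \<Rightarrow> complex"

type_synonym ('v, 'e) toeplitz_elem = "(nat \<Rightarrow> ('v, 'e) toeplitz_pre) set"

definition toeplitz_free :: "('v, 'e) topgraph \<Rightarrow> ('v, 'e) toeplitz_pre star_alg" where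
  "toeplitz_free E = free_star_algebra (C0 (vertices E) <+> Cd E)"

text \<open>C*-seminorms on the free *-algebra for which the generators become a Toeplitz pair in the
  associated C*-algebra.  Every Toeplitz pair in any C*-algebra arises in this way up to passing to
  the C*-subalgebra it generates, by pulling back the norm.\<close>

definition toeplitz_seminorm :: "('v, 'e) topgraph \<Rightarrow> (('v, 'e) toeplitz_pre \<Rightarrow> real) \<Rightarrow> bool" where
  "toeplitz_seminorm E p \<longleftrightarrow>
     (let F = (toeplitz_free E)\<lparr>nrm := p\<rparr> in
        cstar_seminormed F \<and>
        toeplitz_pair E (completion F)
          (\<lambda>f. to_completion F (free_gen (Inl f)))
          (\<lambda>\<xi>. to_completion F (free_gen (Inr \<xi>))))"

text \<open>The universal C*-algebra generated by a Toeplitz pair: the completion of the free *-algebra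
  in the largest such C*-seminorm, together with the images of the generators.\<close>

definition toeplitz_universal :: "('v, 'e) topgraph \<Rightarrow> ('v, 'e) toeplitz_pre star_alg" where
  "toeplitz_universal E =
     (toeplitz_free E)\<lparr>nrm := (\<lambda>x. SUP p\<in>{p. toeplitz_seminorm E p}. p x)\<rparr>"

definition toeplitz_algebra :: "('v, 'e) topgraph \<Rightarrow> ('v, 'e) toeplitz_elem star_alg" where
  "toeplitz_algebra E = completion (toeplitz_universal E)"

definition univ_T0 :: "('v, 'e) topgraph \<Rightarrow> ('v \<Rightarrow> complex) \<Rightarrow> ('v, 'e) toeplitz_elem" where
  "univ_T0 E f = to_completion (toeplitz_universal E) (free_gen (Inl f))"

definition univ_T1 :: "('v, 'e) topgraph \<Rightarrow> ('e \<Rightarrow> complex) \<Rightarrow> ('v, 'e) toeplitz_elem" where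
  "univ_T1 E \<xi> = to_completion (toeplitz_universal E) (free_gen (Inr \<xi>))"

section \<open>Factor maps\<close>

text \<open>In \<^term>\<open>Alexandroff_compactification X\<close> the point at infinity is \<^term>\<open>None\<close>; it is isolated
  if \<open>X\<close> is compact.\<close>

definition factor_map ::
  "('w, 'f) topgraph \<Rightarrow> ('v, 'e) topgraph \<Rightarrow> ('w option \<Rightarrow> 'v option) \<Rightarrow> ('f option \<Rightarrow> 'e option) \<Rightarrow> bool"
where
  "factor_map F E m0 m1 \<longleftrightarrow>
     continuous_map (Alexandroff_compactification (vertices F))
       (Alexandroff_compactification (vertices E)) m0 \<and>
     continuous_map (Alexandroff_compactification (edges F))
       (Alexandroff_compactification (edges E)) m1 \<and>
     m0 None = None \<and> m1 None = None \<and>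
     (\<forall>e\<in>topspace (edges F). \<forall>e'\<in>topspace (edges E). m1 (Some e) = Some e' \<longrightarrow>
        Some (rmap E e') = m0 (Some (rmap F e)) \<and> Some (dmap E e') = m0 (Some (dmap F e))) \<and>
     (\<forall>e'\<in>topspace (edges E). \<forall>v\<in>topspace (vertices F). Some (dmap E e') = m0 (Some v) \<longrightarrow>
        (\<exists>!e. e \<in> topspace (edges F) \<and> m1 (Some e) = Some e' \<and> dmap F e = v))"

text \<open>The function \<open>f \<circ> m\<close> on \<open>X\<close>, where \<open>f\<close> is extended by \<open>f(\<infinity>) = 0\<close>.\<close>

definition pull_back ::
  "'a topology \<Rightarrow> ('a option \<Rightarrow> 'b option) \<Rightarrow> ('b \<Rightarrow> complex) \<Rightarrow> 'a \<Rightarrow> complex" where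
  "pull_back X m f x =
     (if x \<in> topspace X then (case m (Some x) of None \<Rightarrow> 0 | Some y \<Rightarrow> f y) else 0)"

text \<open>The *-homomorphism induced by a factor map from \<open>F\<close> to \<open>E\<close>.  Extensionality only fixes the
  values outside the carrier, as needed for uniqueness in HOL.\<close>

definition induced_hom ::
  "('w, 'f) topgraph \<Rightarrow> ('v, 'e) topgraph \<Rightarrow> ('w option \<Rightarrow> 'v option) \<Rightarrow> ('f option \<Rightarrow> 'e option)
     \<Rightarrow> ('v, 'e) toeplitz_elem \<Rightarrow> ('w, 'f) toeplitz_elem"
where
  "induced_hom F E m0 m1 = (THE \<mu>.
     star_hom (toeplitz_algebra E) (toeplitz_algebra F) \<mu> \<and>
     \<mu> \<in> extensional (carr (toeplitz_algebra E)) \<and>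
     (\<forall>f\<in>C0 (vertices E). \<mu> (univ_T0 E f) = univ_T0 F (pull_back (vertices F) m0 f)) \<and>
     (\<forall>\<xi>\<in>Cd E. \<mu> (univ_T1 E \<xi>) = univ_T1 F (pull_back (edges F) m1 \<xi>)))"

section \<open>Projective systems and projective limits\<close>

text \<open>\<open>(m0 l k, m1 l k)\<close> is the factor map from \<open>E k\<close> to \<open>E l\<close>, for \<open>le l k\<close>.  A family of graphs
  indexed by \<open>\<Lambda>\<close> can always be realised on common types \<open>'v\<close> and \<open>'e\<close>, since
  the underlying sets are given by \<^term>\<open>topspace\<close>.\<close>

definition projective_system ::
  "'l set \<Rightarrow> ('l \<Rightarrow> 'l \<Rightarrow> bool) \<Rightarrow> ('l \<Rightarrow> ('v, 'e) topgraph) \<Rightarrow>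
     ('l \<Rightarrow> 'l \<Rightarrow> 'v option \<Rightarrow> 'v option) \<Rightarrow> ('l \<Rightarrow> 'l \<Rightarrow> 'e option \<Rightarrow> 'e option) \<Rightarrow> bool"
where
  "projective_system \<Lambda> le E m0 m1 \<longleftrightarrow>
     (\<forall>l\<in>\<Lambda>. topological_graph (E l)) \<and>
     (\<forall>l\<in>\<Lambda>. \<forall>k\<in>\<Lambda>. le l k \<longrightarrow> factor_map (E k) (E l) (m0 l k) (m1 l k)) \<and>
     (\<forall>l\<in>\<Lambda>.
        (\<forall>x\<in>topspace (Alexandroff_compactification (vertices (E l))). m0 l l x = x) \<and>
        (\<forall>x\<in>topspace (Alexandroff_compactification (edges (E l))). m1 l l x = x)) \<and>
     (\<forall>l\<in>\<Lambda>. \<forall>k\<in>\<Lambda>. \<forall>j\<in>\<Lambda>. le l k \<longrightarrow> le k j \<longrightarrow>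
        (\<forall>x\<in>topspace (Alexandroff_compactification (vertices (E j))). m0 l k (m0 k j x) = m0 l j x) \<and>
        (\<forall>x\<in>topspace (Alexandroff_compactification (edges (E j))). m1 l k (m1 k j x) = m1 l j x))"

text \<open>The projective limit of the one-point compactifications; its natural maps are the
  coordinate projections.\<close>

definition lim_compact ::
  "'l set \<Rightarrow> ('l \<Rightarrow> 'l \<Rightarrow> bool) \<Rightarrow> ('l \<Rightarrow> 'a topology) \<Rightarrow> ('l \<Rightarrow> 'l \<Rightarrow> 'a option \<Rightarrow> 'a option)
     \<Rightarrow> ('l \<Rightarrow> 'a option) topology"
where
  "lim_compact \<Lambda> le X m =
     subtopology (product_topology (\<lambda>l. Alexandroff_compactification (X l)) \<Lambda>)
       {x. \<forall>l\<in>\<Lambda>. \<forall>k\<in>\<Lambda>. le l k \<longrightarrow> m l k (x k) = x l}"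

definition lim_infty :: "'l set \<Rightarrow> 'l \<Rightarrow> 'a option" where
  "lim_infty \<Lambda> = (\<lambda>l\<in>\<Lambda>. None)"

definition lim_space ::
  "'l set \<Rightarrow> ('l \<Rightarrow> 'l \<Rightarrow> bool) \<Rightarrow> ('l \<Rightarrow> 'a topology) \<Rightarrow> ('l \<Rightarrow> 'l \<Rightarrow> 'a option \<Rightarrow> 'a option)
     \<Rightarrow> ('l \<Rightarrow> 'a option) topology"
where
  "lim_space \<Lambda> le X m =
     subtopology (lim_compact \<Lambda> le X m) (topspace (lim_compact \<Lambda> le X m) - {lim_infty \<Lambda>})"

definition lim_point ::
  "'l set \<Rightarrow> ('l \<Rightarrow> 'l \<Rightarrow> bool) \<Rightarrow> ('l \<Rightarrow> ('v, 'e) topgraph) \<Rightarrow>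
     ('l \<Rightarrow> 'l \<Rightarrow> 'v option \<Rightarrow> 'v option) \<Rightarrow> ('l \<Rightarrow> 'e \<Rightarrow> 'v) \<Rightarrow> ('l \<Rightarrow> 'e option) \<Rightarrow> 'l \<Rightarrow> 'v option"
where
  "lim_point \<Lambda> le E m0 g e =
     (THE v. v \<in> topspace (lim_space \<Lambda> le (\<lambda>l. vertices (E l)) m0) \<and>
        (\<exists>l0\<in>\<Lambda>. e l0 \<noteq> None \<and>
           (\<forall>l\<in>\<Lambda>. le l0 l \<longrightarrow> v l = Some (g l (the (e l))))))"

definition projective_limit ::
  "'l set \<Rightarrow> ('l \<Rightarrow> 'l \<Rightarrow> bool) \<Rightarrow> ('l \<Rightarrow> ('v, 'e) topgraph) \<Rightarrow>
     ('l \<Rightarrow> 'l \<Rightarrow> 'v option \<Rightarrow> 'v option) \<Rightarrow> ('l \<Rightarrow> 'l \<Rightarrow> 'e option \<Rightarrow> 'e option)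
     \<Rightarrow> ('l \<Rightarrow> 'v option, 'l \<Rightarrow> 'e option) topgraph"
where
  "projective_limit \<Lambda> le E m0 m1 = \<lparr>
     vertices = lim_space \<Lambda> le (\<lambda>l. vertices (E l)) m0,
     edges = lim_space \<Lambda> le (\<lambda>l. edges (E l)) m1,
     dmap = lim_point \<Lambda> le E m0 (\<lambda>l. dmap (E l)),
     rmap = lim_point \<Lambda> le E m0 (\<lambda>l. rmap (E l))\<rparr>"

end

theory Submission
  imports Defs
begin

text \<open>The natural maps \<open>m\<^sub>\<lambda>\<close> are factor maps from the limit graph \<open>E\<close> to \<open>E\<^sub>\<lambda>\<close>, and the homomorphisms they
  induce on Toeplitz algebras give a *-homomorphism from the inductive limit \<open>B\<close> to \<open>\<T>(E)\<close>.  An inverse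
  is obtained from a Toeplitz \<open>E\<close>-pair in \<open>B\<close>, which is prescribed on functions pulled back from some
  \<open>E\<^sub>\<lambda>\<close>.  These are dense: on vertices this is an iterated Urysohn argument on compact projective limits, on
  edges one truncates a uniform approximation and controls the fibre sums by Dini's theorem.  The
  prescription is contractive because, by compactness, the sup norm of \<open>f \<circ> m\<^sub>\<lambda>\<close> on \<open>E\<close> is the limit of the sup
  norms of \<open>f \<circ> m\<^sub>\<lambda>\<^sub>,\<^sub>\<mu>\<close>, and *-homomorphisms on \<open>C\<^sub>0\<close> are contractive; the C*-identity
  \<open>\<parallel>T\<^sup>1(\<xi>)\<parallel>\<^sup>2 = \<parallel>T\<^sup>0(\<langle>\<xi>, \<xi>\<rangle>)\<parallel>\<close> transfers this to edges.  So the pair extends by continuity.\<close>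

text \<open>The coordinate map from the limit to \<open>E l\<close> need not be onto, so a function
  on \<open>E l\<close> can have a larger sup norm than its pullback to the limit. A bound on the
  pullback becomes effective only at a later stage, and the norm of the inductive limit is free to
  use that stage. For the same reason the pair on the limit is first prescribed as a relation:
  different functions, at different stages, can share a pullback. Contractivity is obtained without
  spectral theory and without a unit, from an algebraic certificate: a self-adjoint \<open>t\<close>
  that commutes with \<open>b\<close> and satisfies (1 - t)^2 + b^2 = 1, written without the 1,
  forces norm at most 1 on a self-adjoint \<open>b\<close>. Homomorphisms carry such certificates
  along. Fibres of \<open>d\<close> can be infinite and \<open>d\<close> need not be a covering.
  Statements on fibre sums are therefore reduced to finitely many disjoint sheets over a
  neighbourhood plus a tail; the tail is small near a point because the total sum and the finite
  partial sum are both continuous there.\<close>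

context star_algebra
begin

declare zer_closed [simp] add_closed [simp] scal_closed [simp] mul_closed [simp] star_closed [simp]
  add_zer [simp] scal_one [simp] star_star [simp] scal_scal [simp]

lemma sub_closed [simp]: "\<lbrakk>x \<in> carr A; y \<in> carr A\<rbrakk> \<Longrightarrow> sub A x y \<in> carr A"
  by (simp add: sub_def)

lemma zer_add [simp]: "x \<in> carr A \<Longrightarrow> add A (zer A) x = x"
  using add_commute [of "zer A" x] by simp

lemma add_left_commute:
  "\<lbrakk>x \<in> carr A; y \<in> carr A; z \<in> carr A\<rbrakk> \<Longrightarrow> add A x (add A y z) = add A y (add A x z)"
  by (metis add_assoc add_commute)

lemma add_minus [simp]: "x \<in> carr A \<Longrightarrow> add A x (scal A (- 1) x) = zer A"
  using sub_self by (simp add: sub_def)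

lemma minus_add [simp]: "x \<in> carr A \<Longrightarrow> add A (scal A (- 1) x) x = zer A"
  using add_minus add_commute by simp

lemma add_minus_left [simp]:
  "\<lbrakk>x \<in> carr A; y \<in> carr A\<rbrakk> \<Longrightarrow> add A x (add A (scal A (- 1) x) y) = y"
  using add_assoc [of x "scal A (- 1) x" y] by simp

lemma minus_add_left [simp]:
  "\<lbrakk>x \<in> carr A; y \<in> carr A\<rbrakk> \<Longrightarrow> add A (scal A (- 1) x) (add A x y) = y"
  using add_assoc [of "scal A (- 1) x" x y] by simp

lemma scal_zero [simp]: "x \<in> carr A \<Longrightarrow> scal A 0 x = zer A"
  using add_scal [of x 1 "- 1"] by simp

lemma scal_zer [simp]: "scal A c (zer A) = zer A"
  using scal_scal [of "zer A" c 0] by simp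

lemma sub_eq_zer_iff: "\<lbrakk>x \<in> carr A; y \<in> carr A\<rbrakk> \<Longrightarrow> sub A x y = zer A \<longleftrightarrow> x = y"
  by (metis add_assoc add_zer minus_add scal_closed sub_def sub_self zer_add)

lemma sub_zer [simp]: "x \<in> carr A \<Longrightarrow> sub A x (zer A) = x"
  by (simp add: sub_def)

lemma mul_zer [simp]: "x \<in> carr A \<Longrightarrow> mul A x (zer A) = zer A"
  using mul_scal [of x "zer A" 0] by simp

lemma zer_mul [simp]: "x \<in> carr A \<Longrightarrow> mul A (zer A) x = zer A"
  using scal_mul [of "zer A" x 0] by simp

lemma star_zer [simp]: "star A (zer A) = zer A"
  using star_scal [of "zer A" 0] by simp

lemma sub_add_add:
  "\<lbrakk>x \<in> carr A; y \<in> carr A; x' \<in> carr A; y' \<in> carr A\<rbrakk>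
    \<Longrightarrow> sub A (add A x y) (add A x' y') = add A (sub A x x') (sub A y y')"
  by (simp add: sub_def scal_add add_assoc add_left_commute)

lemma sub_split:
  "\<lbrakk>x \<in> carr A; y \<in> carr A; z \<in> carr A\<rbrakk> \<Longrightarrow> sub A x z = add A (sub A x y) (sub A y z)"
  by (simp add: sub_def add_assoc)

lemma add_sub_cancel: "\<lbrakk>x \<in> carr A; y \<in> carr A\<rbrakk> \<Longrightarrow> add A (sub A x y) y = x"
  by (simp add: sub_def add_assoc)

lemma sub_swap: "\<lbrakk>x \<in> carr A; y \<in> carr A\<rbrakk> \<Longrightarrow> sub A y x = scal A (- 1) (sub A x y)"
  by (simp add: sub_def scal_add add_commute)

lemma scal_sub:
  "\<lbrakk>x \<in> carr A; y \<in> carr A\<rbrakk> \<Longrightarrow> scal A c (sub A x y) = sub A (scal A c x) (scal A c y)"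
  by (simp add: sub_def scal_add mult.commute)

lemma mul_sub:
  "\<lbrakk>x \<in> carr A; y \<in> carr A; z \<in> carr A\<rbrakk> \<Longrightarrow> mul A x (sub A y z) = sub A (mul A x y) (mul A x z)"
  by (simp add: sub_def mul_add mul_scal)

lemma sub_mul:
  "\<lbrakk>x \<in> carr A; y \<in> carr A; z \<in> carr A\<rbrakk> \<Longrightarrow> mul A (sub A x y) z = sub A (mul A x z) (mul A y z)"
  by (simp add: sub_def add_mul scal_mul)

lemma star_sub:
  "\<lbrakk>x \<in> carr A; y \<in> carr A\<rbrakk> \<Longrightarrow> star A (sub A x y) = sub A (star A x) (star A y)"
  by (simp add: sub_def star_add star_scal)

lemma sub_mul_mul:
  "\<lbrakk>x \<in> carr A; y \<in> carr A; x' \<in> carr A; y' \<in> carr A\<rbrakk>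
    \<Longrightarrow> sub A (mul A x y) (mul A x' y') = add A (mul A x (sub A y y')) (mul A (sub A x x') y')"
  by (simp add: mul_sub sub_mul sub_split [symmetric])

end

section \<open>Norm estimates in a C*-seminormed algebra\<close>

context cstar_seminormed
begin

lemma nrm_zer [simp]: "nrm A (zer A) = 0"
  using nrm_scal [of "zer A" 0] by simp

lemma nrm_sub_self [simp]: "x \<in> carr A \<Longrightarrow> nrm A (sub A x x) = 0"
  by (simp add: sub_self)

lemma nrm_sub_commute: "\<lbrakk>x \<in> carr A; y \<in> carr A\<rbrakk> \<Longrightarrow> nrm A (sub A x y) = nrm A (sub A y x)"
  by (subst sub_swap) (simp_all add: nrm_scal)

lemma nrm_triangle:
  "\<lbrakk>x \<in> carr A; y \<in> carr A; z \<in> carr A\<rbrakk>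
    \<Longrightarrow> nrm A (sub A x z) \<le> nrm A (sub A x y) + nrm A (sub A y z)"
  by (metis nrm_add sub_closed sub_split)

lemma nrm_le_sub: "\<lbrakk>x \<in> carr A; y \<in> carr A\<rbrakk> \<Longrightarrow> nrm A x \<le> nrm A (sub A x y) + nrm A y"
  by (metis add_sub_cancel nrm_add sub_closed)

lemma abs_nrm_diff: "\<lbrakk>x \<in> carr A; y \<in> carr A\<rbrakk> \<Longrightarrow> \<bar>nrm A x - nrm A y\<bar> \<le> nrm A (sub A x y)"
  using nrm_le_sub [of x y] nrm_le_sub [of y x] nrm_sub_commute [of x y] by linarith

text \<open>The isometry of the involution is not an axiom. The C*-identity and submultiplicativity
  bound the square of \<open>nrm A y\<close> by \<open>nrm A (star A y) * nrm A y\<close>;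
  cancelling one factor, and then applying the result to the adjoint, gives both
  inequalities.\<close>

lemma nrm_star [simp]:
  assumes "x \<in> carr A" shows "nrm A (star A x) = nrm A x"
proof -
  have le: "nrm A y \<le> nrm A (star A y)" if y: "y \<in> carr A" for y
  proof (cases "nrm A y = 0")
    case False
    then have "nrm A y > 0" using nrm_nonneg y by force
    moreover have "nrm A y * nrm A y \<le> nrm A (star A y) * nrm A y"
      using nrm_star_mul [of y] nrm_mul [of "star A y" y] y by (simp add: power2_eq_square)
    ultimately show ?thesis by simp
  qed (use nrm_nonneg y in auto)
  show ?thesis using le [of x] le [of "star A x"] assms by simp
qed

lemma nrm_sub_add_add:
  "\<lbrakk>x \<in> carr A; y \<in> carr A; x' \<in> carr A; y' \<in> carr A\<rbrakk>
    \<Longrightarrow> nrm A (sub A (add A x y) (add A x' y')) \<le> nrm A (sub A x x') + nrm A (sub A y y')"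
  by (simp add: sub_add_add nrm_add)

lemma nrm_sub_scal:
  "\<lbrakk>x \<in> carr A; y \<in> carr A\<rbrakk> \<Longrightarrow> nrm A (sub A (scal A c x) (scal A c y)) = cmod c * nrm A (sub A x y)"
  by (simp add: scal_sub [symmetric] nrm_scal)

lemma nrm_sub_star:
  "\<lbrakk>x \<in> carr A; y \<in> carr A\<rbrakk> \<Longrightarrow> nrm A (sub A (star A x) (star A y)) = nrm A (sub A x y)"
  by (simp add: star_sub [symmetric])

lemma nrm_sub_mul_mul:
  assumes "x \<in> carr A" "y \<in> carr A" "x' \<in> carr A" "y' \<in> carr A"
  shows "nrm A (sub A (mul A x y) (mul A x' y'))
    \<le> nrm A x * nrm A (sub A y y') + nrm A (sub A x x') * nrm A y'"
proof -
  have "nrm A (sub A (mul A x y) (mul A x' y'))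
      \<le> nrm A (mul A x (sub A y y')) + nrm A (mul A (sub A x x') y')"
    using assms by (simp add: sub_mul_mul nrm_add)
  also have "\<dots> \<le> nrm A x * nrm A (sub A y y') + nrm A (sub A x x') * nrm A y'"
    using assms by (intro add_mono nrm_mul) auto
  finally show ?thesis .
qed

end

lemma star_homD:
  assumes "star_hom A B \<phi>"
  shows "\<And>x. x \<in> carr A \<Longrightarrow> \<phi> x \<in> carr B"
    and "\<And>x y. \<lbrakk>x \<in> carr A; y \<in> carr A\<rbrakk> \<Longrightarrow> \<phi> (add A x y) = add B (\<phi> x) (\<phi> y)"
    and "\<And>c x. x \<in> carr A \<Longrightarrow> \<phi> (scal A c x) = scal B c (\<phi> x)"
    and "\<And>x y. \<lbrakk>x \<in> carr A; y \<in> carr A\<rbrakk> \<Longrightarrow> \<phi> (mul A x y) = mul B (\<phi> x) (\<phi> y)"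
    and "\<And>x. x \<in> carr A \<Longrightarrow> \<phi> (star A x) = star B (\<phi> x)"
  using assms unfolding star_hom_def by blast+

lemma star_hom_zer:
  assumes "star_hom A B \<phi>" "star_algebra A" "star_algebra B"
  shows "\<phi> (zer A) = zer B"
proof -
  interpret A: star_algebra A by fact
  interpret B: star_algebra B by fact
  show ?thesis using star_homD(1,3) [OF assms(1) A.zer_closed] by (metis A.scal_zer B.scal_zero)
qed

lemma star_hom_sub:
  "\<lbrakk>star_hom A B \<phi>; star_algebra A; x \<in> carr A; y \<in> carr A\<rbrakk> \<Longrightarrow> \<phi> (sub A x y) = sub B (\<phi> x) (\<phi> y)"
  by (simp add: sub_def star_homD star_algebra.scal_closed)

lemma star_hom_compose:
  "\<lbrakk>star_hom A B \<phi>; star_hom B C \<psi>\<rbrakk> \<Longrightarrow> star_hom A C (\<lambda>x. \<psi> (\<phi> x))"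
  by (simp add: star_hom_def)

section \<open>Hausdorff completion\<close>

context cstar_seminormed
begin

lemma cauchy_seqsD: "X \<in> cauchy_seqs A \<Longrightarrow> X n \<in> carr A"
  by (simp add: cauchy_seqs_def)

lemma cauchy_seqs_eps:
  "\<lbrakk>X \<in> cauchy_seqs A; 0 < e\<rbrakk> \<Longrightarrow> \<exists>N. \<forall>m\<ge>N. \<forall>n\<ge>N. nrm A (sub A (X m) (X n)) < e"
  by (simp add: cauchy_seqs_def)

lemma cauchy_nrm:
  assumes X: "X \<in> cauchy_seqs A" shows "convergent (\<lambda>n. nrm A (X n))"
  unfolding Cauchy_convergent_iff [symmetric]
proof (rule metric_CauchyI)
  fix e :: real assume "e > 0"
  with X obtain N where N: "\<forall>m\<ge>N. \<forall>n\<ge>N. nrm A (sub A (X m) (X n)) < e"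
    unfolding cauchy_seqs_def by auto
  have "dist (nrm A (X m)) (nrm A (X n)) < e" if "m \<ge> N" "n \<ge> N" for m n
    using N that abs_nrm_diff [OF X [THEN cauchy_seqsD, of m] X [THEN cauchy_seqsD, of n]]
    unfolding dist_real_def by (meson order_le_less_trans)
  then show "\<exists>M. \<forall>m\<ge>M. \<forall>n\<ge>M. dist (nrm A (X m)) (nrm A (X n)) < e" by blast
qed

lemma cauchy_bounded:
  assumes "X \<in> cauchy_seqs A" shows "\<exists>M>0. \<forall>n. nrm A (X n) \<le> M"
proof -
  have "Bseq (\<lambda>n. nrm A (X n))" using cauchy_nrm [OF assms] by (rule convergent_imp_Bseq)
  then obtain K where "K > 0" "\<And>n. \<bar>nrm A (X n)\<bar> \<le> K" unfolding Bseq_def real_norm_def by blast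
  then show ?thesis by (intro exI [of _ K] conjI allI) (simp_all add: abs_le_iff)
qed

lemma cauchy_const: "x \<in> carr A \<Longrightarrow> (\<lambda>n. x) \<in> cauchy_seqs A"
  by (auto simp: cauchy_seqs_def)

lemma cauchy_add:
  assumes "X \<in> cauchy_seqs A" "Y \<in> cauchy_seqs A"
  shows "(\<lambda>n. add A (X n) (Y n)) \<in> cauchy_seqs A"
  unfolding cauchy_seqs_def
proof (intro CollectI conjI allI impI)
  note [simp] = assms [THEN cauchy_seqsD]
  fix e :: real assume "e > 0"
  then have "e/2 > 0" by simp
  with assms obtain N1 N2 where
    N: "\<forall>m\<ge>N1. \<forall>n\<ge>N1. nrm A (sub A (X m) (X n)) < e/2" "\<forall>m\<ge>N2. \<forall>n\<ge>N2. nrm A (sub A (Y m) (Y n)) < e/2"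
    unfolding cauchy_seqs_def by blast
  have "nrm A (sub A (add A (X m) (Y m)) (add A (X n) (Y n))) < e" if "m \<ge> max N1 N2" "n \<ge> max N1 N2" for m n
  proof -
    have "nrm A (sub A (X m) (X n)) < e/2" "nrm A (sub A (Y m) (Y n)) < e/2" using N that by auto
    then show ?thesis using nrm_sub_add_add [of "X m" "Y m" "X n" "Y n"] assms by simp
  qed
  then show "\<exists>N. \<forall>m\<ge>N. \<forall>n\<ge>N. nrm A (sub A (add A (X m) (Y m)) (add A (X n) (Y n))) < e" by blast
qed (use assms [THEN cauchy_seqsD] in auto)

lemma cauchy_scal:
  assumes "X \<in> cauchy_seqs A"
  shows "(\<lambda>n. scal A c (X n)) \<in> cauchy_seqs A"
  unfolding cauchy_seqs_def
proof (intro CollectI conjI allI impI)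
  note [simp] = assms [THEN cauchy_seqsD]
  fix e :: real assume "e > 0"
  \<comment> \<open>Adding 1 keeps the denominator positive when \<open>c = 0\<close>.\<close>
  then have "e / (cmod c + 1) > 0" by (simp add: add_nonneg_pos)
  with assms obtain N where
    N: "\<forall>m\<ge>N. \<forall>n\<ge>N. nrm A (sub A (X m) (X n)) < e / (cmod c + 1)"
    unfolding cauchy_seqs_def by blast
  have "nrm A (sub A (scal A c (X m)) (scal A c (X n))) < e" if "m \<ge> N" "n \<ge> N" for m n
  proof -
    have "nrm A (sub A (X m) (X n)) < e / (cmod c + 1)" using N that by auto
    then have "(cmod c + 1) * nrm A (sub A (X m) (X n)) < e"
      by (simp add: pos_less_divide_eq add_nonneg_pos mult.commute)
    moreover have "nrm A (sub A (X m) (X n)) \<ge> 0" by (simp add: nrm_nonneg)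
    ultimately show ?thesis using assms by (simp add: nrm_sub_scal algebra_simps)
  qed
  then show "\<exists>N. \<forall>m\<ge>N. \<forall>n\<ge>N. nrm A (sub A (scal A c (X m)) (scal A c (X n))) < e" by blast
qed (use assms [THEN cauchy_seqsD] in auto)

lemma cauchy_star: "X \<in> cauchy_seqs A \<Longrightarrow> (\<lambda>n. star A (X n)) \<in> cauchy_seqs A"
  by (simp add: cauchy_seqs_def nrm_sub_star)

lemma cauchy_mul:
  assumes "X \<in> cauchy_seqs A" "Y \<in> cauchy_seqs A"
  shows "(\<lambda>n. mul A (X n) (Y n)) \<in> cauchy_seqs A"
proof -
  note [simp] = assms [THEN cauchy_seqsD]
  obtain M1 where M1: "M1 > 0" "\<And>n. nrm A (X n) \<le> M1" using cauchy_bounded [OF assms(1)] by blast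
  obtain M2 where M2: "M2 > 0" "\<And>n. nrm A (Y n) \<le> M2" using cauchy_bounded [OF assms(2)] by blast
  show ?thesis
    unfolding cauchy_seqs_def
  proof (intro CollectI conjI allI impI)
    fix e :: real assume "e > 0"
    then have "e/(2*M2) > 0" "e/(2*M1) > 0" using M1(1) M2(1) by simp_all
    then obtain N1 N2 where
      N: "\<forall>m\<ge>N1. \<forall>n\<ge>N1. nrm A (sub A (X m) (X n)) < e/(2*M2)"
         "\<forall>m\<ge>N2. \<forall>n\<ge>N2. nrm A (sub A (Y m) (Y n)) < e/(2*M1)"
      using cauchy_seqs_eps [OF assms(1)] cauchy_seqs_eps [OF assms(2)] by meson
    have "nrm A (sub A (mul A (X m) (Y m)) (mul A (X n) (Y n))) < e"
      if "m \<ge> max N1 N2" "n \<ge> max N1 N2" for m n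
    proof -
      have a: "nrm A (sub A (X m) (X n)) < e/(2*M2)" "nrm A (sub A (Y m) (Y n)) < e/(2*M1)" using N that by auto
      have 1: "nrm A (sub A (X m) (X n)) * M2 < e/2" "M1 * nrm A (sub A (Y m) (Y n)) < e/2"
        using mult_strict_right_mono [OF a(1) M2(1)] mult_strict_left_mono [OF a(2) M1(1)] M1(1) M2(1)
        by simp_all
      have "nrm A (X m) * nrm A (sub A (Y m) (Y n)) \<le> M1 * nrm A (sub A (Y m) (Y n))"
        "nrm A (sub A (X m) (X n)) * nrm A (Y n) \<le> nrm A (sub A (X m) (X n)) * M2"
        by (simp_all add: M1 M2 mult_right_mono mult_left_mono nrm_nonneg)
      then show ?thesis using 1 nrm_sub_mul_mul [of "X m" "Y m" "X n" "Y n"] by simp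
    qed
    then show "\<exists>N. \<forall>m\<ge>N. \<forall>n\<ge>N. nrm A (sub A (mul A (X m) (Y m)) (mul A (X n) (Y n))) < e" by blast
  qed (use assms [THEN cauchy_seqsD] in auto)
qed

lemma cauchy_sub:
  assumes "X \<in> cauchy_seqs A" "Y \<in> cauchy_seqs A"
  shows "(\<lambda>n. sub A (X n) (Y n)) \<in> cauchy_seqs A"
  unfolding sub_def using assms by (intro cauchy_add cauchy_scal)

lemma nrm_null_le:
  assumes "\<And>n. X n \<in> carr A" "\<And>n. nrm A (X n) \<le> f n" "f \<longlonglongrightarrow> 0"
  shows "(\<lambda>n. nrm A (X n)) \<longlonglongrightarrow> 0"
  by (rule tendsto_sandwich [OF _ _ tendsto_const assms(3)]) (use assms nrm_nonneg in auto)

lemma equiv_cauchy_rel: "equiv (cauchy_seqs A) (cauchy_rel A)"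
proof (rule equivI)
  show "refl_on (cauchy_seqs A) (cauchy_rel A)"
    by (rule refl_onI) (simp add: cauchy_rel_def cauchy_seqs_def)
  show "sym (cauchy_rel A)"
    by (rule symI) (auto simp: cauchy_rel_def cauchy_seqs_def nrm_sub_commute)
  show "trans (cauchy_rel A)"
  proof (rule transI)
    fix X Y Z assume *: "(X, Y) \<in> cauchy_rel A" "(Y, Z) \<in> cauchy_rel A"
    then have [simp]: "X n \<in> carr A" "Y n \<in> carr A" "Z n \<in> carr A" for n
      by (auto simp: cauchy_rel_def cauchy_seqs_def)
    have "(\<lambda>n. nrm A (sub A (X n) (Y n)) + nrm A (sub A (Y n) (Z n))) \<longlonglongrightarrow> 0 + 0"
      using * by (intro tendsto_add) (auto simp: cauchy_rel_def)
    then have "(\<lambda>n. nrm A (sub A (X n) (Z n))) \<longlonglongrightarrow> 0"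
      using * by (intro nrm_null_le [where f="\<lambda>n. nrm A (sub A (X n) (Y n)) + nrm A (sub A (Y n) (Z n))"])
        (auto simp: cauchy_rel_def nrm_triangle)
    then show "(X, Z) \<in> cauchy_rel A" using * by (auto simp: cauchy_rel_def)
  qed
  show "cauchy_rel A \<subseteq> cauchy_seqs A \<times> cauchy_seqs A"
    by (auto simp: cauchy_rel_def)
qed

lemma cauchy_class_eq_iff:
  "\<lbrakk>X \<in> cauchy_seqs A; Y \<in> cauchy_seqs A\<rbrakk>
    \<Longrightarrow> cauchy_class A X = cauchy_class A Y \<longleftrightarrow> (\<lambda>n. nrm A (sub A (X n) (Y n))) \<longlonglongrightarrow> 0"
  unfolding cauchy_class_def
  by (subst eq_equiv_class_iff [OF equiv_cauchy_rel]) (auto simp: cauchy_rel_def)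

lemma carr_completion: "carr (completion A) = cauchy_class A ` cauchy_seqs A"
  by (auto simp: completion_def quotient_def cauchy_class_def)

lemma class_in_completion: "X \<in> cauchy_seqs A \<Longrightarrow> cauchy_class A X \<in> carr (completion A)"
  by (simp add: carr_completion)

lemma zer_completion: "zer (completion A) = cauchy_class A (\<lambda>n. zer A)"
  by (simp add: completion_def)

lemma add_completion:
  assumes "X \<in> cauchy_seqs A" "Y \<in> cauchy_seqs A"
  shows "add (completion A) (cauchy_class A X) (cauchy_class A Y) = cauchy_class A (\<lambda>n. add A (X n) (Y n))"
proof -
  have "congruent2 (cauchy_rel A) (cauchy_rel A) (\<lambda>X Y. cauchy_class A (\<lambda>n. add A (X n) (Y n)))"
  proof (rule congruent2I')
    fix X X' Y Y' assume *: "(X, X') \<in> cauchy_rel A" "(Y, Y') \<in> cauchy_rel A"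
    then have [simp]: "X n \<in> carr A" "Y n \<in> carr A" "X' n \<in> carr A" "Y' n \<in> carr A" for n
      by (auto simp: cauchy_rel_def cauchy_seqs_def)
    have "(\<lambda>n. nrm A (sub A (X n) (X' n)) + nrm A (sub A (Y n) (Y' n))) \<longlonglongrightarrow> 0 + 0"
      using * by (intro tendsto_add) (auto simp: cauchy_rel_def)
    then have "(\<lambda>n. nrm A (sub A (add A (X n) (Y n)) (add A (X' n) (Y' n)))) \<longlonglongrightarrow> 0"
      using * by (intro nrm_null_le [where f="\<lambda>n. nrm A (sub A (X n) (X' n)) + nrm A (sub A (Y n) (Y' n))"])
        (auto simp: cauchy_rel_def nrm_sub_add_add)
    then show "cauchy_class A (\<lambda>n. add A (X n) (Y n)) = cauchy_class A (\<lambda>n. add A (X' n) (Y' n))"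
      using * by (subst cauchy_class_eq_iff) (auto simp: cauchy_rel_def cauchy_add)
  qed
  from UN_equiv_class2 [OF equiv_cauchy_rel equiv_cauchy_rel this assms]
  show ?thesis by (simp add: completion_def cauchy_class_def)
qed

lemma mul_completion:
  assumes "X \<in> cauchy_seqs A" "Y \<in> cauchy_seqs A"
  shows "mul (completion A) (cauchy_class A X) (cauchy_class A Y) = cauchy_class A (\<lambda>n. mul A (X n) (Y n))"
proof -
  have "congruent2 (cauchy_rel A) (cauchy_rel A) (\<lambda>X Y. cauchy_class A (\<lambda>n. mul A (X n) (Y n)))"
  proof (rule congruent2I')
    fix X X' Y Y' assume *: "(X, X') \<in> cauchy_rel A" "(Y, Y') \<in> cauchy_rel A"
    then have [simp]: "X n \<in> carr A" "Y n \<in> carr A" "X' n \<in> carr A" "Y' n \<in> carr A" for n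
      by (auto simp: cauchy_rel_def cauchy_seqs_def)
    let ?f = "\<lambda>n. nrm A (X n) * nrm A (sub A (Y n) (Y' n)) + nrm A (sub A (X n) (X' n)) * nrm A (Y' n)"
    obtain L L' where "(\<lambda>n. nrm A (X n)) \<longlonglongrightarrow> L" "(\<lambda>n. nrm A (Y' n)) \<longlonglongrightarrow> L'"
      using * cauchy_nrm unfolding cauchy_rel_def convergent_def by blast
    then have "?f \<longlonglongrightarrow> L * 0 + 0 * L'"
      using * by (intro tendsto_add tendsto_mult) (auto simp: cauchy_rel_def)
    then have "(\<lambda>n. nrm A (sub A (mul A (X n) (Y n)) (mul A (X' n) (Y' n)))) \<longlonglongrightarrow> 0"
      using * by (intro nrm_null_le [where f="?f"])
        (auto simp: cauchy_rel_def nrm_sub_mul_mul)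
    then show "cauchy_class A (\<lambda>n. mul A (X n) (Y n)) = cauchy_class A (\<lambda>n. mul A (X' n) (Y' n))"
      using * by (subst cauchy_class_eq_iff) (auto simp: cauchy_rel_def cauchy_mul)
  qed
  from UN_equiv_class2 [OF equiv_cauchy_rel equiv_cauchy_rel this assms]
  show ?thesis by (simp add: completion_def cauchy_class_def)
qed

lemma scal_completion:
  assumes "X \<in> cauchy_seqs A"
  shows "scal (completion A) c (cauchy_class A X) = cauchy_class A (\<lambda>n. scal A c (X n))"
proof -
  have "congruent (cauchy_rel A) (\<lambda>X. cauchy_class A (\<lambda>n. scal A c (X n)))"
  proof (rule congruentI)
    fix X X' assume *: "(X, X') \<in> cauchy_rel A"
    then have [simp]: "X n \<in> carr A" "X' n \<in> carr A" for n
      by (auto simp: cauchy_rel_def cauchy_seqs_def)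
    from * have "(\<lambda>n. cmod c * nrm A (sub A (X n) (X' n))) \<longlonglongrightarrow> cmod c * 0"
      by (intro tendsto_mult) (auto simp: cauchy_rel_def)
    then have "(\<lambda>n. nrm A (sub A (scal A c (X n)) (scal A c (X' n)))) \<longlonglongrightarrow> 0"
      using * by (simp add: cauchy_rel_def nrm_sub_scal)
    then show "cauchy_class A (\<lambda>n. scal A c (X n)) = cauchy_class A (\<lambda>n. scal A c (X' n))"
      using * by (subst cauchy_class_eq_iff) (auto simp: cauchy_rel_def cauchy_scal)
  qed
  from UN_equiv_class [OF equiv_cauchy_rel this assms]
  show ?thesis by (simp add: completion_def cauchy_class_def)
qed

lemma star_completion:
  assumes "X \<in> cauchy_seqs A"
  shows "star (completion A) (cauchy_class A X) = cauchy_class A (\<lambda>n. star A (X n))"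
proof -
  have "congruent (cauchy_rel A) (\<lambda>X. cauchy_class A (\<lambda>n. star A (X n)))"
  proof (rule congruentI)
    fix X X' assume *: "(X, X') \<in> cauchy_rel A"
    then have [simp]: "X n \<in> carr A" "X' n \<in> carr A" for n
      by (auto simp: cauchy_rel_def cauchy_seqs_def)
    from * have "(\<lambda>n. nrm A (sub A (star A (X n)) (star A (X' n)))) \<longlonglongrightarrow> 0"
      by (simp add: cauchy_rel_def nrm_sub_star)
    then show "cauchy_class A (\<lambda>n. star A (X n)) = cauchy_class A (\<lambda>n. star A (X' n))"
      using * by (subst cauchy_class_eq_iff) (auto simp: cauchy_rel_def cauchy_star)
  qed
  from UN_equiv_class [OF equiv_cauchy_rel this assms]
  show ?thesis by (simp add: completion_def cauchy_class_def)
qed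

text \<open>The norm of a class is read off a representative picked by \<open>SOME\<close>.
  Equivalent sequences have norms whose difference tends to 0, so every representative yields the
  same limit; all norm laws of the completion are derived through this.\<close>

lemma nrm_completion:
  assumes X: "X \<in> cauchy_seqs A"
  shows "(\<lambda>n. nrm A (X n)) \<longlonglongrightarrow> nrm (completion A) (cauchy_class A X)"
proof -
  define X' where "X' = (SOME Y. Y \<in> cauchy_class A X)"
  note [simp] = X [THEN cauchy_seqsD]
  have "(\<lambda>n. nrm A (sub A (X n) (X n))) \<longlonglongrightarrow> 0"
    by simp
  then have "X \<in> cauchy_class A X"
    using X by (simp only: cauchy_class_def cauchy_rel_def Image_singleton_iff mem_Collect_eq case_prod_conv simp_thms)
  then have "X' \<in> cauchy_class A X" unfolding X'_def by (rule someI [where P="\<lambda>Y. Y \<in> cauchy_class A X"])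
  then have *: "X' \<in> cauchy_seqs A" "(\<lambda>n. nrm A (sub A (X n) (X' n))) \<longlonglongrightarrow> 0"
    by (auto simp: cauchy_class_def cauchy_rel_def)
  have nrm: "nrm (completion A) (cauchy_class A X) = lim (\<lambda>n. nrm A (X' n))"
    by (simp add: completion_def X'_def)
  have 1: "(\<lambda>n. nrm A (X' n)) \<longlonglongrightarrow> lim (\<lambda>n. nrm A (X' n))"
    using cauchy_nrm [OF *(1)] by (simp add: convergent_LIMSEQ_iff)
  have 2: "(\<lambda>n. nrm A (X n) - nrm A (X' n)) \<longlonglongrightarrow> 0"
    by (rule Lim_null_comparison [OF _ *(2)]) (simp add: abs_nrm_diff cauchy_seqsD [OF *(1)])
  show ?thesis using tendsto_add [OF 1 2] by (simp add: nrm)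
qed

lemmas completion_simps = zer_completion add_completion mul_completion scal_completion star_completion
  cauchy_add cauchy_mul cauchy_scal cauchy_star cauchy_const cauchy_sub

lemma sub_completion:
  "\<lbrakk>X \<in> cauchy_seqs A; Y \<in> cauchy_seqs A\<rbrakk>
    \<Longrightarrow> sub (completion A) (cauchy_class A X) (cauchy_class A Y) = cauchy_class A (\<lambda>n. sub A (X n) (Y n))"
  by (simp add: sub_def completion_simps)

lemma completionE:
  assumes "P \<in> carr (completion A)"
  obtains X where "X \<in> cauchy_seqs A" "\<And>n. X n \<in> carr A" "P = cauchy_class A X"
proof -
  obtain X where "X \<in> cauchy_seqs A" "P = cauchy_class A X"
    using assms unfolding carr_completion by blast
  with that cauchy_seqsD [OF this(1)] show thesis by blast
qed

lemma star_algebra_completion: "star_algebra (completion A)"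
proof
  show "sub (completion A) x x = zer (completion A)" if "x \<in> carr (completion A)" for x
    using that by (elim completionE) (simp add: sub_completion completion_simps sub_self)
qed (((elim completionE)?; simp add: class_in_completion completion_simps add_assoc add_left_commute
    add_commute scal_add add_scal mul_assoc mul_add add_mul mul_scal scal_mul star_add star_scal star_mul)+)

end

context cstar_seminormed
begin

lemma completion_ex:
  assumes "P \<in> carr (completion A)"
  shows "\<exists>X. X \<in> cauchy_seqs A \<and> (\<forall>n. X n \<in> carr A) \<and> P = cauchy_class A X"
  using assms cauchy_seqsD unfolding carr_completion by blast

lemma cstar_seminormed_completion: "cstar_seminormed (completion A)"
proof (intro cstar_seminormed.intro star_algebra_completion cstar_seminormed_axioms.intro)
  fix P assume "P \<in> carr (completion A)"
  then obtain X where X: "X \<in> cauchy_seqs A" "\<And>n. X n \<in> carr A" "P = cauchy_class A X"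
    using completion_ex by blast
  have lim: "(\<lambda>n. nrm A (X n)) \<longlonglongrightarrow> nrm (completion A) P"
    using X nrm_completion by simp
  show "0 \<le> nrm (completion A) P"
    by (rule LIMSEQ_le_const [OF lim]) (use X nrm_nonneg in auto)
  show "nrm (completion A) (scal (completion A) c P) = cmod c * nrm (completion A) P" for c
  proof (rule LIMSEQ_unique)
    show "(\<lambda>n. nrm A (scal A c (X n))) \<longlonglongrightarrow> nrm (completion A) (scal (completion A) c P)"
      using X nrm_completion [OF cauchy_scal] by (simp add: scal_completion)
    show "(\<lambda>n. nrm A (scal A c (X n))) \<longlonglongrightarrow> cmod c * nrm (completion A) P"
      using X tendsto_mult [OF tendsto_const lim] by (simp add: nrm_scal)
  qed
  show "nrm (completion A) (mul (completion A) (star (completion A) P) P) = (nrm (completion A) P)\<^sup>2"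
  proof (rule LIMSEQ_unique)
    show "(\<lambda>n. nrm A (mul A (star A (X n)) (X n)))
        \<longlonglongrightarrow> nrm (completion A) (mul (completion A) (star (completion A) P) P)"
      using X nrm_completion [OF cauchy_mul [OF cauchy_star]]
      by (simp add: star_completion mul_completion cauchy_star)
    show "(\<lambda>n. nrm A (mul A (star A (X n)) (X n))) \<longlonglongrightarrow> (nrm (completion A) P)\<^sup>2"
      using X tendsto_power [OF lim] by (simp add: nrm_star_mul)
  qed
  fix Q assume "Q \<in> carr (completion A)"
  then obtain Y where Y: "Y \<in> cauchy_seqs A" "\<And>n. Y n \<in> carr A" "Q = cauchy_class A Y"
    using completion_ex by blast
  have limY: "(\<lambda>n. nrm A (Y n)) \<longlonglongrightarrow> nrm (completion A) Q"
    using Y nrm_completion by simp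
  have "(\<lambda>n. nrm A (add A (X n) (Y n))) \<longlonglongrightarrow> nrm (completion A) (add (completion A) P Q)"
    using X Y nrm_completion [OF cauchy_add] by (simp add: add_completion)
  from LIMSEQ_le [OF this tendsto_add [OF lim limY]]
  show "nrm (completion A) (add (completion A) P Q) \<le> nrm (completion A) P + nrm (completion A) Q"
    using X Y nrm_add by blast
  have "(\<lambda>n. nrm A (mul A (X n) (Y n))) \<longlonglongrightarrow> nrm (completion A) (mul (completion A) P Q)"
    using X Y nrm_completion [OF cauchy_mul] by (simp add: mul_completion)
  from LIMSEQ_le [OF this tendsto_mult [OF lim limY]]
  show "nrm (completion A) (mul (completion A) P Q) \<le> nrm (completion A) P * nrm (completion A) Q"
    using X Y nrm_mul by blast
qed

lemma to_completion_closed [simp]: "x \<in> carr A \<Longrightarrow> to_completion A x \<in> carr (completion A)"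
  by (simp add: to_completion_def class_in_completion cauchy_const)

lemma star_hom_to_completion: "star_hom A (completion A) (to_completion A)"
  unfolding star_hom_def
  by (simp add: to_completion_closed) (simp add: to_completion_def completion_simps)

lemma nrm_to_completion [simp]:
  assumes "x \<in> carr A" shows "nrm (completion A) (to_completion A x) = nrm A x"
  using LIMSEQ_unique [OF nrm_completion [OF cauchy_const [OF assms]] tendsto_const]
  by (simp add: to_completion_def)

lemma to_completion_eq_iff:
  assumes "x \<in> carr A" "y \<in> carr A"
  shows "to_completion A x = to_completion A y \<longleftrightarrow> nrm A (sub A x y) = 0"
  unfolding to_completion_def
  by (subst cauchy_class_eq_iff) (use assms in \<open>auto simp: cauchy_const LIMSEQ_const_iff\<close>)

text \<open>The distance from the constant \<open>X n\<close> to the class of \<open>X\<close> is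
  the limit over \<open>m\<close> of \<open>nrm A (sub A (X n) (X m))\<close>, which is small for
  large \<open>n\<close> because \<open>X\<close> is Cauchy. Density of the constants
  follows.\<close>

lemma tendsto_cauchy_class:
  assumes X: "X \<in> cauchy_seqs A"
  shows "(\<lambda>n. nrm (completion A) (sub (completion A) (to_completion A (X n)) (cauchy_class A X))) \<longlonglongrightarrow> 0"
proof (rule LIMSEQ_I)
  note [simp] = X [THEN cauchy_seqsD]
  interpret C: cstar_seminormed "completion A" by (rule cstar_seminormed_completion)
  fix e :: real assume e: "e > 0"
  then obtain N where N: "\<forall>m\<ge>N. \<forall>n\<ge>N. nrm A (sub A (X m) (X n)) < e/2"
    using cauchy_seqs_eps [OF X, of "e/2"] by auto
  have "norm (nrm (completion A) (sub (completion A) (to_completion A (X n)) (cauchy_class A X)) - 0) < e"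
    if n: "n \<ge> N" for n
  proof -
    have c: "(\<lambda>m. sub A (X n) (X m)) \<in> cauchy_seqs A"
      using cauchy_sub [OF cauchy_const X] by simp
    have "sub (completion A) (to_completion A (X n)) (cauchy_class A X) = cauchy_class A (\<lambda>m. sub A (X n) (X m))"
      by (simp add: to_completion_def sub_completion X cauchy_const)
    then have lim: "(\<lambda>m. nrm A (sub A (X n) (X m)))
        \<longlonglongrightarrow> nrm (completion A) (sub (completion A) (to_completion A (X n)) (cauchy_class A X))"
      using nrm_completion [OF c] by simp
    have "nrm (completion A) (sub (completion A) (to_completion A (X n)) (cauchy_class A X)) \<le> e/2"
      by (rule LIMSEQ_le_const2 [OF lim]) (use N n less_imp_le in blast)
    moreover have "nrm (completion A) (sub (completion A) (to_completion A (X n)) (cauchy_class A X)) \<ge> 0"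
      using class_in_completion [OF X] by (simp add: C.nrm_nonneg)
    ultimately show ?thesis using e by simp
  qed
  then show "\<exists>no. \<forall>n\<ge>no. norm (nrm (completion A) (sub (completion A) (to_completion A (X n)) (cauchy_class A X)) - 0) < e"
    by blast
qed

lemma completion_dense:
  assumes "P \<in> carr (completion A)" "0 < e"
  shows "\<exists>x\<in>carr A. nrm (completion A) (sub (completion A) (to_completion A x) P) < e"
proof -
  obtain X where X: "X \<in> cauchy_seqs A" "\<And>n. X n \<in> carr A" "P = cauchy_class A X"
    using completion_ex [OF assms(1)] by blast
  obtain n where "norm (nrm (completion A) (sub (completion A) (to_completion A (X n)) P) - 0) < e"
    using LIMSEQ_D [OF tendsto_cauchy_class [OF X(1)] assms(2)] X(3) by blast
  then show ?thesis using X(2) by (intro bexI [of _ "X n"]) auto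
qed

lemma cstar_algebra_completion: "cstar_algebra (completion A)"
proof (intro cstar_algebra.intro cstar_seminormed_completion cstar_algebra_axioms.intro)
  interpret C: cstar_seminormed "completion A" by (rule cstar_seminormed_completion)
  fix P assume "P \<in> carr (completion A)" and 0: "nrm (completion A) P = 0"
  then obtain X where X: "X \<in> cauchy_seqs A" "\<And>n. X n \<in> carr A" "P = cauchy_class A X"
    using completion_ex by blast
  then have "(\<lambda>n. nrm A (sub A (X n) (zer A))) \<longlonglongrightarrow> 0"
    using nrm_completion [OF X(1)] 0 by simp
  then show "P = zer (completion A)"
    using X by (simp add: zer_completion cauchy_class_eq_iff cauchy_const)
next
  interpret C: cstar_seminormed "completion A" by (rule cstar_seminormed_completion)
  let ?d = "\<lambda>P Q. nrm (completion A) (sub (completion A) P Q)"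
  fix P assume P: "P \<in> cauchy_seqs (completion A)"
  note [simp] = P [THEN C.cauchy_seqsD]
  \<comment> \<open>Completeness by approximation: each class \<open>P k\<close> is replaced by a
    constant \<open>x k\<close> at distance below 1/(k+1). The sequence \<open>x\<close> is then
    Cauchy in \<open>A\<close>, and its own class is the limit sought.\<close>
  have "\<forall>k. \<exists>x\<in>carr A. ?d (to_completion A x) (P k) < inverse (real (Suc k))"
    by (intro allI completion_dense) auto
  then obtain x where x [simp]: "\<And>k. x k \<in> carr A"
    and d: "\<And>k. ?d (to_completion A (x k)) (P k) < inverse (real (Suc k))"
    by metis
  have X: "x \<in> cauchy_seqs A"
    unfolding cauchy_seqs_def
  proof (intro CollectI conjI allI impI)
    fix e :: real assume "e > 0"
    then obtain N1 where N1: "\<forall>m\<ge>N1. \<forall>n\<ge>N1. ?d (P m) (P n) < e/3"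
      using C.cauchy_seqs_eps [OF P, of "e/3"] by auto
    obtain N2 where N2: "inverse (real (Suc N2)) < e/3"
      using reals_Archimedean [of "e/3"] \<open>e > 0\<close> by auto
    have small: "?d (to_completion A (x n)) (P n) < e/3" if "n \<ge> N2" for n
    proof -
      have "inverse (real (Suc n)) \<le> inverse (real (Suc N2))" using that by (simp add: le_imp_inverse_le)
      then show ?thesis using d [of n] N2 by linarith
    qed
    have "nrm A (sub A (x m) (x n)) < e" if "m \<ge> max N1 N2" "n \<ge> max N1 N2" for m n
    proof -
      have "nrm A (sub A (x m) (x n)) = ?d (to_completion A (x m)) (to_completion A (x n))"
        by (subst star_hom_sub [OF star_hom_to_completion, symmetric]) (simp_all add: star_algebra_axioms)
      also have "\<dots> \<le> ?d (to_completion A (x m)) (P m) + (?d (P m) (P n) + ?d (P n) (to_completion A (x n)))"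
        using C.nrm_triangle [of "to_completion A (x m)" "P m" "to_completion A (x n)"]
          C.nrm_triangle [of "P m" "P n" "to_completion A (x n)"] by simp
      also have "\<dots> < e/3 + (e/3 + e/3)"
        using small [of m] small [of n] N1 that C.nrm_sub_commute [of "P n" "to_completion A (x n)"]
        by (intro add_strict_mono) auto
      finally show ?thesis by simp
    qed
    then show "\<exists>N. \<forall>m\<ge>N. \<forall>n\<ge>N. nrm A (sub A (x m) (x n)) < e" by blast
  qed simp
  have cl [simp]: "cauchy_class A x \<in> carr (completion A)" using X by (rule class_in_completion)
  have "(\<lambda>n. ?d (P n) (cauchy_class A x)) \<longlonglongrightarrow> 0"
  proof (rule C.nrm_null_le)
    show "(\<lambda>n. inverse (real (Suc n)) + ?d (to_completion A (x n)) (cauchy_class A x)) \<longlonglongrightarrow> 0"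
      using tendsto_add [OF LIMSEQ_inverse_real_of_nat tendsto_cauchy_class [OF X]] by simp
    show "?d (P n) (cauchy_class A x) \<le> inverse (real (Suc n)) + ?d (to_completion A (x n)) (cauchy_class A x)" for n
      using C.nrm_triangle [of "P n" "to_completion A (x n)" "cauchy_class A x"] d [of n]
        C.nrm_sub_commute [of "P n" "to_completion A (x n)"] by simp
  qed simp
  then show "\<exists>x\<in>carr (completion A). (\<lambda>n. ?d (P n) x) \<longlonglongrightarrow> 0" by (rule bexI [OF _ cl])
qed

end

section \<open>Limits in C*-algebras and extension by density\<close>

text \<open>Membership in the carrier is built in, because the norm laws hold only there and every
  use of a limit would otherwise carry these side conditions separately.\<close>

definition conv_to :: "'a star_alg \<Rightarrow> (nat \<Rightarrow> 'a) \<Rightarrow> 'a \<Rightarrow> bool" where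
  "conv_to A X x \<longleftrightarrow> (\<forall>n. X n \<in> carr A) \<and> x \<in> carr A \<and> (\<lambda>n. nrm A (sub A (X n) x)) \<longlonglongrightarrow> 0"

context cstar_seminormed
begin

lemma conv_to_add:
  assumes "conv_to A X x" "conv_to A Y y"
  shows "conv_to A (\<lambda>n. add A (X n) (Y n)) (add A x y)"
proof -
  have [simp]: "X n \<in> carr A" "Y n \<in> carr A" "x \<in> carr A" "y \<in> carr A" for n
    using assms by (auto simp: conv_to_def)
  have "(\<lambda>n. nrm A (sub A (X n) x) + nrm A (sub A (Y n) y)) \<longlonglongrightarrow> 0"
    using tendsto_add [of "\<lambda>n. nrm A (sub A (X n) x)" 0 sequentially "\<lambda>n. nrm A (sub A (Y n) y)" 0] assms
    by (simp add: conv_to_def)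
  then have "(\<lambda>n. nrm A (sub A (add A (X n) (Y n)) (add A x y))) \<longlonglongrightarrow> 0"
    by (rule nrm_null_le [rotated 2]) (simp_all add: nrm_sub_add_add)
  then show ?thesis by (simp add: conv_to_def)
qed

lemma conv_to_scal:
  assumes "conv_to A X x" shows "conv_to A (\<lambda>n. scal A c (X n)) (scal A c x)"
proof -
  have [simp]: "X n \<in> carr A" "x \<in> carr A" for n
    using assms by (auto simp: conv_to_def)
  have "(\<lambda>n. cmod c * nrm A (sub A (X n) x)) \<longlonglongrightarrow> cmod c * 0"
    by (intro tendsto_mult tendsto_const) (use assms in \<open>simp add: conv_to_def\<close>)
  then show ?thesis by (simp add: conv_to_def nrm_sub_scal)
qed

lemma conv_to_star: "conv_to A X x \<Longrightarrow> conv_to A (\<lambda>n. star A (X n)) (star A x)"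
  by (simp add: conv_to_def nrm_sub_star)

lemma conv_to_nrm:
  assumes "conv_to A X x" shows "(\<lambda>n. nrm A (X n)) \<longlonglongrightarrow> nrm A x"
proof -
  have "(\<lambda>n. nrm A (X n) - nrm A x) \<longlonglongrightarrow> 0"
    by (rule Lim_null_comparison [where g="\<lambda>n. nrm A (sub A (X n) x)"])
      (use assms in \<open>auto simp: conv_to_def abs_nrm_diff\<close>)
  then show ?thesis by (simp add: LIM_zero_iff)
qed

lemma conv_to_mul:
  assumes "conv_to A X x" "conv_to A Y y"
  shows "conv_to A (\<lambda>n. mul A (X n) (Y n)) (mul A x y)"
proof -
  have [simp]: "X n \<in> carr A" "Y n \<in> carr A" "x \<in> carr A" "y \<in> carr A" for n
    using assms by (auto simp: conv_to_def)
  have "(\<lambda>n. nrm A (X n) * nrm A (sub A (Y n) y) + nrm A (sub A (X n) x) * nrm A y)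
      \<longlonglongrightarrow> nrm A x * 0 + 0 * nrm A y"
    using assms by (intro tendsto_add tendsto_mult conv_to_nrm tendsto_const) (auto simp: conv_to_def)
  then have "(\<lambda>n. nrm A (X n) * nrm A (sub A (Y n) y) + nrm A (sub A (X n) x) * nrm A y) \<longlonglongrightarrow> 0"
    by simp
  then have "(\<lambda>n. nrm A (sub A (mul A (X n) (Y n)) (mul A x y))) \<longlonglongrightarrow> 0"
    by (rule nrm_null_le [rotated 2]) (simp_all add: nrm_sub_mul_mul)
  then show ?thesis by (simp add: conv_to_def)
qed

lemma conv_to_const: "x \<in> carr A \<Longrightarrow> conv_to A (\<lambda>n. x) x"
  by (simp add: conv_to_def)

lemma conv_to_Suc: "conv_to A X x \<Longrightarrow> conv_to A (\<lambda>n. X (Suc n)) x"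
  using LIMSEQ_Suc [of "\<lambda>n. nrm A (sub A (X n) x)" 0] by (auto simp: conv_to_def)

end

context cstar_algebra
begin

lemma nrm_sub_zero: "\<lbrakk>x \<in> carr A; y \<in> carr A; nrm A (sub A x y) = 0\<rbrakk> \<Longrightarrow> x = y"
  using nrm_definite [of "sub A x y"] by (simp add: sub_eq_zer_iff)

lemma conv_to_unique:
  assumes "conv_to A X x" "conv_to A X y" shows "x = y"
proof -
  have [simp]: "X n \<in> carr A" "x \<in> carr A" "y \<in> carr A" for n
    using assms by (auto simp: conv_to_def)
  have "conv_to A (\<lambda>n. add A (X n) (scal A (- 1) (X n))) (add A x (scal A (- 1) y))"
    using assms by (intro conv_to_add conv_to_scal)
  from conv_to_nrm [OF this] have "(\<lambda>n::nat. 0) \<longlonglongrightarrow> nrm A (sub A x y)"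
    by (simp add: sub_def)
  then show ?thesis by (intro nrm_sub_zero) (simp_all add: LIMSEQ_const_iff)
qed

lemma cauchy_conv_to: "X \<in> cauchy_seqs A \<Longrightarrow> \<exists>x. conv_to A X x"
  using complete [of X] cauchy_seqsD [of X] unfolding conv_to_def by blast

end

text \<open>The prescription is a relation \<open>R\<close> because one point of \<open>X\<close>
  may come with several representatives. \<open>contr\<close> makes approximating values a Cauchy
  sequence, whose limit is the value of \<open>T\<close>. Only distances enter; algebraic laws are
  transferred to \<open>T\<close> afterwards by passing to limits.\<close>

lemma dense_extension:
  assumes B: "cstar_algebra B" and R: "R \<subseteq> X \<times> carr B"
    and contr: "\<And>x b y c. \<lbrakk>(x, b) \<in> R; (y, c) \<in> R\<rbrakk> \<Longrightarrow> nrm B (sub B b c) \<le> \<delta> x y"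
    and sym: "\<And>x y. \<lbrakk>x \<in> X; y \<in> X\<rbrakk> \<Longrightarrow> \<delta> x y = \<delta> y x"
    and tri: "\<And>x y z. \<lbrakk>x \<in> X; y \<in> X; z \<in> X\<rbrakk> \<Longrightarrow> \<delta> x z \<le> \<delta> x y + \<delta> y z"
    and dense: "\<And>x e. \<lbrakk>x \<in> X; 0 < e\<rbrakk> \<Longrightarrow> \<exists>(y, b)\<in>R. \<delta> y x < e"
  shows "\<exists>T. \<forall>x\<in>X. T x \<in> carr B \<and> (\<forall>(y, b)\<in>R. nrm B (sub B b (T x)) \<le> \<delta> y x)"
proof -
  interpret B: cstar_algebra B by (rule B)
  have "\<exists>t\<in>carr B. \<forall>(y, b)\<in>R. nrm B (sub B b t) \<le> \<delta> y x" if x: "x \<in> X" for x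
  proof -
    have "\<forall>n. \<exists>p. p \<in> R \<and> \<delta> (fst p) x < inverse (real (Suc n))"
    proof
      fix n
      have "inverse (real (Suc n)) > 0" by simp
      from dense [OF x this] show "\<exists>p. p \<in> R \<and> \<delta> (fst p) x < inverse (real (Suc n))" by force
    qed
    then obtain p where p': "\<forall>n. p n \<in> R \<and> \<delta> (fst (p n)) x < inverse (real (Suc n))"
      using choice [of "\<lambda>n p. p \<in> R \<and> \<delta> (fst p) x < inverse (real (Suc n))"] by blast
    then have p: "p n \<in> R" "\<delta> (fst (p n)) x < inverse (real (Suc n))" for n
      by simp_all
    define y b where "y n = fst (p n)" and "b n = snd (p n)" for n
    have yb: "(y n, b n) \<in> R" and d: "\<delta> (y n) x < inverse (real (Suc n))" for n
      using p by (simp_all add: y_def b_def)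
    have y: "y n \<in> X" and b [simp]: "b n \<in> carr B" for n using yb [of n] R by auto
    have "b \<in> cauchy_seqs B"
      unfolding cauchy_seqs_def
    proof (intro CollectI conjI allI impI)
      fix e :: real assume "e > 0"
      then obtain N where N: "inverse (real (Suc N)) < e/2"
        using reals_Archimedean [of "e/2"] by auto
      have small: "\<delta> (y n) x < e/2" if "n \<ge> N" for n
      proof -
        have "inverse (real (Suc n)) \<le> inverse (real (Suc N))" using that by (simp add: le_imp_inverse_le)
        then show ?thesis using d [of n] N by linarith
      qed
      have "nrm B (sub B (b m) (b n)) < e" if "m \<ge> N" "n \<ge> N" for m n
        using contr [OF yb [of m] yb [of n]] tri [OF y [of m] x y [of n]] sym [OF x y [of n]]
          small [OF that(1)] small [OF that(2)] by linarith
      then show "\<exists>N. \<forall>m\<ge>N. \<forall>n\<ge>N. nrm B (sub B (b m) (b n)) < e" by blast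
    qed simp
    then obtain t where t: "conv_to B b t" using B.cauchy_conv_to by blast
    have t' [simp]: "t \<in> carr B" using t by (simp add: conv_to_def)
    \<comment> \<open>The estimate for an arbitrary pair of \<open>R\<close> survives the limit:
      compare \<open>c\<close> with \<open>b n\<close> by \<open>contr\<close>, move from
      \<open>y n\<close> to \<open>x\<close> by the triangle inequality, and let both error terms
      tend to 0.\<close>
    have "nrm B (sub B c t) \<le> \<delta> z x" if zc: "(z, c) \<in> R" for z c
    proof (rule LIMSEQ_le_const)
      have [simp]: "c \<in> carr B" and z: "z \<in> X" using zc R by auto
      show "(\<lambda>n. \<delta> z x + inverse (real (Suc n)) + nrm B (sub B (b n) t)) \<longlonglongrightarrow> \<delta> z x"
        using tendsto_add [OF tendsto_add [OF tendsto_const LIMSEQ_inverse_real_of_nat]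
            conjunct2 [OF conjunct2 [OF t [unfolded conv_to_def]]], of "\<delta> z x"] by simp
      have "nrm B (sub B c t) \<le> \<delta> z x + inverse (real (Suc n)) + nrm B (sub B (b n) t)" for n
        using B.nrm_triangle [of c "b n" t] contr [OF zc yb [of n]] tri [OF z x y [of n]]
          sym [OF x y [of n]] d [of n] by simp
      then show "\<exists>N. \<forall>n\<ge>N. nrm B (sub B c t) \<le> \<delta> z x + inverse (real (Suc n)) + nrm B (sub B (b n) t)"
        by blast
    qed
    then show ?thesis by (intro bexI [of _ t]) auto
  qed
  then have "\<forall>x\<in>X. \<exists>t. t \<in> carr B \<and> (\<forall>(y, b)\<in>R. nrm B (sub B b t) \<le> \<delta> y x)" by blast
  then show ?thesis by (rule bchoice)
qed

text \<open>The graph of \<open>h\<close> over the constant sequences is a dense contractive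
  relation, so \<open>dense_extension\<close> provides the map. Each homomorphism law then holds
  because both sides are limits of the same sequence in \<open>B\<close>.\<close>

lemma completion_extend:
  assumes "cstar_seminormed A" "cstar_algebra B" "star_hom A B h"
    and le: "\<And>x. x \<in> carr A \<Longrightarrow> nrm B (h x) \<le> nrm A x"
  shows "\<exists>H. star_hom (completion A) B H \<and> (\<forall>x\<in>carr A. H (to_completion A x) = h x)"
proof -
  interpret A: cstar_seminormed A by fact
  interpret C: cstar_algebra "completion A" by (rule A.cstar_algebra_completion)
  interpret B: cstar_algebra B by fact
  note \<iota> = star_homD [OF A.star_hom_to_completion]
  note h = star_homD [OF assms(3)]
  let ?C = "completion A"
  let ?d = "\<lambda>P Q. nrm ?C (sub ?C P Q)"
  let ?R = "(\<lambda>x. (to_completion A x, h x)) ` carr A"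
  have "\<exists>H. \<forall>P\<in>carr ?C. H P \<in> carr B \<and> (\<forall>(Q, b)\<in>?R. nrm B (sub B b (H P)) \<le> ?d Q P)"
  proof (rule dense_extension)
    show "?R \<subseteq> carr ?C \<times> carr B" using h(1) by auto
    show "nrm B (sub B b c) \<le> ?d P Q" if "(P, b) \<in> ?R" "(Q, c) \<in> ?R" for P b Q c
    proof -
      obtain x y where *: "x \<in> carr A" "y \<in> carr A" "P = to_completion A x" "Q = to_completion A y"
        "b = h x" "c = h y"
        using \<open>(P, b) \<in> ?R\<close> \<open>(Q, c) \<in> ?R\<close> by auto
      then have "sub B b c = h (sub A x y)" "sub ?C P Q = to_completion A (sub A x y)"
        using star_hom_sub [OF A.star_hom_to_completion A.star_algebra_axioms]
          star_hom_sub [OF assms(3) A.star_algebra_axioms] by simp_all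
      then show ?thesis using * le by simp
    qed
    show "\<exists>(y, b)\<in>?R. ?d y P < e" if "P \<in> carr ?C" "0 < e" for P and e :: real
      using A.completion_dense [OF that] by auto
  qed (fact assms(2) C.nrm_sub_commute C.nrm_triangle)+
  then obtain H where H': "\<forall>P\<in>carr ?C. H P \<in> carr B \<and> (\<forall>(Q, b)\<in>?R. nrm B (sub B b (H P)) \<le> ?d Q P)"
    by blast
  then have H [simp]: "H P \<in> carr B" if "P \<in> carr ?C" for P
    using that by blast
  have Hle: "nrm B (sub B (h x) (H P)) \<le> ?d (to_completion A x) P" if "P \<in> carr ?C" "x \<in> carr A" for P x
    using H' that by blast
  have conv: "conv_to B (\<lambda>n. h (x n)) (H P)"
    if "conv_to ?C (\<lambda>n. to_completion A (x n)) P" "\<And>n. x n \<in> carr A" for P x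
  proof -
    have P: "P \<in> carr ?C" and lim: "(\<lambda>n. ?d (to_completion A (x n)) P) \<longlonglongrightarrow> 0"
      using that(1) by (auto simp: conv_to_def)
    have "(\<lambda>n. nrm B (sub B (h (x n)) (H P))) \<longlonglongrightarrow> 0"
      by (rule B.nrm_null_le [OF _ Hle lim]) (use P that(2) h(1) in auto)
    then show ?thesis using P that(2) h(1) by (simp add: conv_to_def)
  qed
  have approx: "\<exists>x. (\<forall>n. x n \<in> carr A) \<and> conv_to ?C (\<lambda>n. to_completion A (x n)) P" if P: "P \<in> carr ?C" for P
  proof -
    obtain X where X: "X \<in> cauchy_seqs A" "\<And>n. X n \<in> carr A" "P = cauchy_class A X"
      using A.completion_ex [OF P] by blast
    then show ?thesis using A.tendsto_cauchy_class [OF X(1)] P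
      by (intro exI [of _ X]) (simp add: conv_to_def)
  qed
  have ext: "H (to_completion A x) = h x" if "x \<in> carr A" for x
    using Hle [of "to_completion A x" x] that h(1) B.nrm_nonneg [of "sub B (h x) (H (to_completion A x))"]
    by (intro B.nrm_sub_zero [symmetric]) auto
  have "star_hom ?C B H"
    unfolding star_hom_def
  proof (intro conjI ballI allI)
    fix P assume P: "P \<in> carr ?C"
    show "H P \<in> carr B" using P by simp
    obtain x where x: "\<And>n. x n \<in> carr A" "conv_to ?C (\<lambda>n. to_completion A (x n)) P"
      using approx [OF P] by blast
    show "H (scal ?C c P) = scal B c (H P)" for c
    proof (rule B.conv_to_unique)
      show "conv_to B (\<lambda>n. h (scal A c (x n))) (H (scal ?C c P))"
        using C.conv_to_scal [OF x(2)] by (intro conv) (simp_all add: \<iota> x)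
      show "conv_to B (\<lambda>n. h (scal A c (x n))) (scal B c (H P))"
        using B.conv_to_scal [OF conv [OF x(2,1)]] by (simp add: h x)
    qed
    show "H (star ?C P) = star B (H P)"
    proof (rule B.conv_to_unique)
      show "conv_to B (\<lambda>n. h (star A (x n))) (H (star ?C P))"
        using C.conv_to_star [OF x(2)] by (intro conv) (simp_all add: \<iota> x)
      show "conv_to B (\<lambda>n. h (star A (x n))) (star B (H P))"
        using B.conv_to_star [OF conv [OF x(2,1)]] by (simp add: h x)
    qed
    fix Q assume Q: "Q \<in> carr ?C"
    obtain y where y: "\<And>n. y n \<in> carr A" "conv_to ?C (\<lambda>n. to_completion A (y n)) Q"
      using approx [OF Q] by blast
    show "H (add ?C P Q) = add B (H P) (H Q)"
    proof (rule B.conv_to_unique)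
      show "conv_to B (\<lambda>n. h (add A (x n) (y n))) (H (add ?C P Q))"
        using C.conv_to_add [OF x(2) y(2)] by (intro conv) (simp_all add: \<iota> x y)
      show "conv_to B (\<lambda>n. h (add A (x n) (y n))) (add B (H P) (H Q))"
        using B.conv_to_add [OF conv [OF x(2,1)] conv [OF y(2,1)]] by (simp add: h x y)
    qed
    show "H (mul ?C P Q) = mul B (H P) (H Q)"
    proof (rule B.conv_to_unique)
      show "conv_to B (\<lambda>n. h (mul A (x n) (y n))) (H (mul ?C P Q))"
        using C.conv_to_mul [OF x(2) y(2)] by (intro conv) (simp_all add: \<iota> x y)
      show "conv_to B (\<lambda>n. h (mul A (x n) (y n))) (mul B (H P) (H Q))"
        using B.conv_to_mul [OF conv [OF x(2,1)] conv [OF y(2,1)]] by (simp add: h x y)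
    qed
  qed
  with ext show ?thesis by blast
qed

section \<open>Automatic contractivity of *-homomorphisms\<close>

context star_algebra
begin

lemma add_add_swap:
  "\<lbrakk>a \<in> carr A; b \<in> carr A; c \<in> carr A; d \<in> carr A\<rbrakk>
    \<Longrightarrow> add A (add A a b) (add A c d) = add A (add A a c) (add A b d)"
  by (simp add: add_assoc add_left_commute)

lemma scal_two: "x \<in> carr A \<Longrightarrow> scal A 2 x = add A x x"
  using add_scal [of x 1 1] by simp

lemma scal_add_left:
  "\<lbrakk>x \<in> carr A; y \<in> carr A\<rbrakk> \<Longrightarrow> add A (scal A c x) (add A (scal A c' x) y) = add A (scal A (c + c') x) y"
  by (simp add: add_scal add_assoc)

text \<open>Bookkeeping for the circle argument below: with y = tq and z = q^2, where q = b^2, it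
  turns the expansion of ((1 - t)b)^2 into q - q^2.\<close>

lemma add_sub_sub_cancel:
  assumes [simp]: "q \<in> carr A" "y \<in> carr A" "z \<in> carr A"
  shows "add A (sub A (sub A q y) (sub A y (sub A (scal A 2 y) z))) z = q"
proof -
  have "sub A (scal A 2 y) z = add A y (sub A y z)"
    by (simp add: scal_two sub_def add_assoc)
  then have "sub A y (sub A (scal A 2 y) z) = scal A (- 1) (sub A y z)"
    by (simp add: sub_def [of A y "add A y _"] scal_add)
  then have "sub A (sub A q y) (sub A y (sub A (scal A 2 y) z)) = add A (sub A q y) (sub A y z)"
    by (simp add: sub_def [of A "sub A q y"])
  also have "\<dots> = sub A q z" by (rule sub_split [symmetric]) simp_all
  finally show ?thesis by (simp add: add_sub_cancel)
qed

end

text \<open>With \<open>w = b\<^sup>2 + i(b - tb)\<close>, i.e. \<open>b\<close> times the unitary \<open>b + i(1 - t)\<close>, one has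
  \<open>w\<^sup>*w = b\<^sup>2\<close> and \<open>w + w\<^sup>* = 2b\<^sup>2\<close>; hence \<open>\<parallel>b\<parallel>\<^sup>2 \<le> \<parallel>w\<parallel> = \<parallel>b\<parallel>\<close>.\<close>

lemma (in cstar_seminormed) nrm_le_one_circle:
  assumes [simp]: "b \<in> carr A" "t \<in> carr A" and sa: "star A b = b" "star A t = t"
    and comm: "mul A b t = mul A t b"
    and circ: "add A (mul A t t) (mul A b b) = scal A 2 t"
  shows "nrm A b \<le> 1"
proof -
  define q c where "q = mul A b b" and "c = sub A b (mul A t b)"
  define w1 w2 where "w1 = add A q (scal A \<i> c)" and "w2 = add A q (scal A (- \<i>) c)"
  have [simp]: "q \<in> carr A" "c \<in> carr A" "w1 \<in> carr A" "w2 \<in> carr A"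
    by (simp_all add: q_def c_def w1_def w2_def)
  have tb: "mul A b (mul A t b) = mul A t q"
    using comm by (simp add: q_def mul_assoc [symmetric])
  have bc: "mul A b c = sub A q (mul A t q)"
    by (simp add: c_def mul_sub tb q_def [symmetric])
  have cb: "mul A c b = sub A q (mul A t q)"
    by (simp add: c_def sub_mul mul_assoc q_def [symmetric])
  have qc: "mul A q c = mul A c q"
    unfolding q_def by (metis (no_types) bc cb mul_assoc assms(1) \<open>c \<in> carr A\<close>)
  have sc: "star A c = c" and sq: "star A q = q"
    using comm by (simp_all add: c_def q_def star_sub star_mul sa)
  \<comment> \<open>In a unital algebra \<open>circ\<close> would say (1 - t)^2 = 1 - b^2. Without a
    unit the relation is multiplied by q = b^2, and it then reads c^2 = q - q^2 for c = (1 - t)b,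
    which is \<open>cc\<close>.\<close>
  have "mul A (add A (mul A t t) (mul A b b)) q = mul A (scal A 2 t) q"
    by (simp add: circ)
  then have e: "add A (mul A t (mul A t q)) (mul A q q) = scal A 2 (mul A t q)"
    by (simp add: add_mul scal_mul mul_assoc q_def [symmetric])
  have ttq: "mul A t (mul A t q) = sub A (scal A 2 (mul A t q)) (mul A q q)"
    unfolding e [symmetric] by (simp add: sub_def add_assoc)
  have "mul A c c = sub A (mul A b c) (mul A t (mul A b c))"
    by (subst (1) c_def) (simp add: sub_mul mul_assoc)
  also have "\<dots> = sub A (sub A q (mul A t q)) (sub A (mul A t q) (sub A (scal A 2 (mul A t q)) (mul A q q)))"
    by (simp add: bc mul_sub ttq)
  finally have cc: "add A (mul A c c) (mul A q q) = q"
    by (simp add: add_sub_sub_cancel)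
  have w2: "star A w1 = w2"
    by (simp add: w1_def w2_def star_add star_scal sc sq)
  have "mul A w2 w1 = add A (mul A q w1) (scal A (- \<i>) (mul A c w1))"
    by (simp add: w2_def add_mul scal_mul)
  also have "mul A q w1 = add A (mul A q q) (scal A \<i> (mul A c q))"
    by (simp add: w1_def mul_add mul_scal qc)
  also have "scal A (- \<i>) (mul A c w1) = add A (scal A (- \<i>) (mul A c q)) (mul A c c)"
    by (simp add: w1_def mul_add mul_scal scal_add)
  finally have "mul A w2 w1 = q"
    using cc by (simp add: add_assoc scal_add_left add_commute [of "mul A q q"])
  then have "(nrm A w1)\<^sup>2 = nrm A q" using nrm_star_mul [of w1] w2 by simp
  moreover have q: "nrm A q = (nrm A b)\<^sup>2" using nrm_star_mul [of b] sa by (simp add: q_def)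
  ultimately have n1: "nrm A w1 = nrm A b" using nrm_nonneg by (simp add: power2_eq_iff_nonneg)
  have n2: "nrm A w2 = nrm A b" using nrm_star [of w1] n1 w2 by simp
  have "add A w1 w2 = scal A 2 q"
    by (simp add: w1_def w2_def add_add_swap add_scal [symmetric] scal_two)
  then have "2 * nrm A q \<le> nrm A w1 + nrm A w2"
    using nrm_scal [of q 2] nrm_add [of w1 w2] by simp
  then have "nrm A b * nrm A b \<le> nrm A b * 1" by (simp add: n1 n2 q power2_eq_square)
  then show ?thesis
    using nrm_nonneg [of b] mult_left_le_imp_le [of "nrm A b" "nrm A b" 1] by fastforce
qed

text \<open>The element \<open>1 - \<surd>(1 - a\<^sup>2)\<close>, obtained as a fixed point of \<open>u \<mapsto> (u\<^sup>2 + a\<^sup>2)/2\<close>.\<close>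

lemma (in cstar_algebra) circle_exists:
  assumes [simp]: "a \<in> carr A" and sa: "star A a = a" and lt: "nrm A a < 1"
  shows "\<exists>t\<in>carr A. star A t = t \<and> mul A a t = mul A t a \<and> add A (mul A t t) (mul A a a) = scal A 2 t"
proof -
  define \<alpha> where "\<alpha> = nrm A a"
  have \<alpha>: "0 \<le> \<alpha>" "\<alpha> < 1" using lt nrm_nonneg by (simp_all add: \<alpha>_def)
  define F where "F u = scal A (1/2) (add A (mul A u u) (mul A a a))" for u
  define s where "s n = (F ^^ n) (zer A)" for n
  have s0: "s 0 = zer A" and sS: "s (Suc n) = F (s n)" for n by (simp_all add: s_def)
  have F: "F u \<in> carr A" if "u \<in> carr A" for u using that by (simp add: F_def)
  have s [simp]: "s n \<in> carr A" for n by (induction n) (simp_all add: s0 sS F)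
  have s_star: "star A (s n) = s n" for n
    by (induction n) (simp_all add: s0 sS F_def star_scal star_add star_mul sa)
  have s_comm: "mul A a (s n) = mul A (s n) a" for n
  proof (induction n)
    case (Suc n)
    have "mul A a (mul A (s n) (s n)) = mul A (mul A (s n) (s n)) a"
      by (metis Suc mul_assoc assms(1) s)
    then show ?case by (simp add: sS F_def mul_scal scal_mul mul_add add_mul mul_assoc)
  qed (simp add: s0)
  \<comment> \<open>The ball of radius \<open>\<alpha>\<close> is invariant: half of
    \<open>\<alpha>\<close> squared plus \<open>\<alpha>\<close> squared is at most
    \<open>\<alpha>\<close>, since \<open>\<alpha>\<close> is below 1.\<close>
  have s_nrm: "nrm A (s n) \<le> \<alpha>" for n
  proof (induction n)
    case (Suc n)
    have "nrm A (s (Suc n)) \<le> 1/2 * (nrm A (mul A (s n) (s n)) + nrm A (mul A a a))"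
      unfolding sS F_def using nrm_add [of "mul A (s n) (s n)" "mul A a a"] by (simp add: nrm_scal)
    also have "\<dots> \<le> 1/2 * (nrm A (s n) * nrm A (s n) + \<alpha> * \<alpha>)"
      using nrm_mul [of "s n" "s n"] nrm_mul [of a a] by (simp add: \<alpha>_def)
    also have "\<dots> \<le> 1/2 * (\<alpha> * \<alpha> + \<alpha> * \<alpha>)"
      using Suc \<alpha> by (intro mult_left_mono add_right_mono mult_mono) (auto simp: nrm_nonneg)
    also have "\<dots> \<le> \<alpha>" using \<alpha> mult_left_le [of \<alpha> \<alpha>] by simp
    finally show ?case .
  qed (simp add: s0 \<alpha>)
  \<comment> \<open>On that ball squaring has Lipschitz constant at most 2 \<open>\<alpha>\<close>,
    and the factor 1/2 in \<open>F\<close> leaves a strict contraction by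
    \<open>\<alpha>\<close>.\<close>
  have step: "nrm A (sub A (s (Suc m)) (s (Suc n))) \<le> \<alpha> * nrm A (sub A (s m) (s n))" for m n
  proof -
    have "sub A (s (Suc m)) (s (Suc n)) = scal A (1/2) (sub A (mul A (s m) (s m)) (mul A (s n) (s n)))"
      by (simp add: sS F_def scal_sub [symmetric] sub_add_add sub_self)
    then have "nrm A (sub A (s (Suc m)) (s (Suc n)))
        = 1/2 * nrm A (sub A (mul A (s m) (s m)) (mul A (s n) (s n)))"
      by (simp add: nrm_scal)
    also have "\<dots> \<le> 1/2 * (nrm A (s m) * nrm A (sub A (s m) (s n)) + nrm A (sub A (s m) (s n)) * nrm A (s n))"
      using nrm_sub_mul_mul [of "s m" "s m" "s n" "s n"] by simp
    also have "\<dots> \<le> 1/2 * (\<alpha> * nrm A (sub A (s m) (s n)) + nrm A (sub A (s m) (s n)) * \<alpha>)"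
      using s_nrm by (intro mult_left_mono add_mono mult_right_mono) (auto simp: nrm_nonneg)
    finally show ?thesis by simp
  qed
  have geo: "nrm A (sub A (s (n + k)) (s n)) \<le> \<alpha> ^ n" for n k
  proof (induction n)
    case 0
    then show ?case using s_nrm [of k] \<alpha> by (simp add: s0)
  next
    case (Suc n)
    have "nrm A (sub A (s (Suc n + k)) (s (Suc n))) \<le> \<alpha> * nrm A (sub A (s (n + k)) (s n))"
      using step [of "n + k" n] by simp
    also have "\<dots> \<le> \<alpha> * \<alpha> ^ n" using Suc \<alpha> by (intro mult_left_mono) auto
    finally show ?case by simp
  qed
  have "s \<in> cauchy_seqs A"
    unfolding cauchy_seqs_def
  proof (intro CollectI conjI allI impI)
    fix e :: real assume "e > 0"
    then obtain N where N: "\<alpha> ^ N < e" using real_arch_pow_inv [of e \<alpha>] \<alpha> by auto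
    have le: "nrm A (sub A (s m) (s n)) < e" if "n \<ge> N" "m \<ge> n" for m n
    proof -
      have "nrm A (sub A (s m) (s n)) \<le> \<alpha> ^ n" using geo [of n "m - n"] that by simp
      also have "\<dots> \<le> \<alpha> ^ N" using that \<alpha> by (intro power_decreasing) auto
      finally show ?thesis using N by simp
    qed
    have "nrm A (sub A (s m) (s n)) < e" if "m \<ge> N" "n \<ge> N" for m n
      using le [of n m] le [of m n] that nrm_sub_commute [of "s m" "s n"]
      by (cases "m \<ge> n") auto
    then show "\<exists>N. \<forall>m\<ge>N. \<forall>n\<ge>N. nrm A (sub A (s m) (s n)) < e" by blast
  qed simp
  then obtain t where t: "conv_to A s t" using cauchy_conv_to by blast
  have t' [simp]: "t \<in> carr A" using t by (simp add: conv_to_def)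
  have "conv_to A (\<lambda>n. s (Suc n)) (F t)"
    unfolding sS F_def by (intro conv_to_scal conv_to_add conv_to_mul conv_to_const t) simp
  with conv_to_Suc [OF t] have "t = F t" by (rule conv_to_unique)
  then have "scal A 2 t = add A (mul A t t) (mul A a a)"
    using scal_scal [of "add A (mul A t t) (mul A a a)" 2 "1/2"] unfolding F_def by simp
  moreover have "star A t = t"
    using conv_to_unique [OF conv_to_star [OF t]] t by (simp add: s_star)
  moreover have "mul A a t = mul A t a"
    using conv_to_unique [OF conv_to_mul [OF conv_to_const t] , of a "mul A t a"]
      conv_to_mul [OF t conv_to_const, of a] by (simp add: s_comm)
  ultimately show ?thesis by (intro bexI [of _ t]) simp_all
qed

text \<open>Scale x*x to \<open>a\<close> by a number \<open>r\<close> slightly above the norm of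
  \<open>x\<close>, so that \<open>a\<close> has norm below 1 and a circle element \<open>t\<close>
  exists in the complete algebra \<open>A\<close>. Its image is a circle element for
  \<open>\<phi> a\<close>, which bounds the norm of \<open>\<phi> a\<close> by 1; the C*-identity
  returns the bound for \<open>\<phi> x\<close>. The target may be merely seminormed.\<close>

lemma star_hom_contractive:
  assumes "cstar_algebra A" "cstar_seminormed B" and \<phi>: "star_hom A B \<phi>" and x: "x \<in> carr A"
  shows "nrm B (\<phi> x) \<le> nrm A x"
proof (rule field_le_epsilon)
  interpret A: cstar_algebra A by fact
  interpret B: cstar_seminormed B by fact
  note h = star_homD [OF \<phi>]
  fix e :: real assume "e > 0"
  define r where "r = nrm A x + e"
  have r: "r > 0" "nrm A x < r" using A.nrm_nonneg [OF x] \<open>e > 0\<close> by (auto simp: r_def)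
  define a where "a = scal A (of_real (1/r\<^sup>2)) (mul A (star A x) x)"
  have a [simp]: "a \<in> carr A" using x by (simp add: a_def)
  have sa: "star A a = a" using x by (simp add: a_def A.star_scal A.star_mul)
  have c: "cmod (of_real (1/r\<^sup>2)) = 1/r\<^sup>2" by (simp only: norm_of_real abs_of_nonneg zero_le_divide_1_iff zero_le_power2)
  have "nrm A a = 1/r\<^sup>2 * (nrm A x)\<^sup>2"
    unfolding a_def using x by (simp only: A.nrm_scal A.mul_closed A.star_closed A.nrm_star_mul c)
  moreover have "(nrm A x)\<^sup>2 < r\<^sup>2" by (intro power_strict_mono r A.nrm_nonneg x) simp
  ultimately have "nrm A a < 1" using r(1) by simp
  then obtain t where t: "t \<in> carr A" "star A t = t" "mul A a t = mul A t a"
    "add A (mul A t t) (mul A a a) = scal A 2 t"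
    using A.circle_exists [OF a sa] by blast
  have "nrm B (\<phi> a) \<le> 1"
  proof (rule B.nrm_le_one_circle [where t = "\<phi> t"])
    show "mul B (\<phi> a) (\<phi> t) = mul B (\<phi> t) (\<phi> a)" by (simp only: h(4) [symmetric] a t(1,3))
    show "add B (mul B (\<phi> t) (\<phi> t)) (mul B (\<phi> a) (\<phi> a)) = scal B 2 (\<phi> t)"
      using t(1) a t(4) by (simp add: h(2,3,4) [symmetric])
  qed (use t(1,2) sa h(1) a in \<open>simp_all add: h(5) [symmetric]\<close>)
  moreover have "nrm B (\<phi> a) = 1/r\<^sup>2 * (nrm B (\<phi> x))\<^sup>2"
    unfolding a_def using x
    by (simp only: h B.nrm_scal A.mul_closed A.star_closed B.mul_closed B.star_closed B.nrm_star_mul c)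
  ultimately have "(nrm B (\<phi> x))\<^sup>2 \<le> r\<^sup>2" using r(1) by simp
  then have "nrm B (\<phi> x) \<le> r" by (rule power2_le_imp_le) (use r(1) in simp)
  then show "nrm B (\<phi> x) \<le> nrm A x + e" by (simp only: r_def)
qed

section \<open>The free *-algebra\<close>

definition words :: "'g set \<Rightarrow> ('g \<times> bool) list set" where
  "words G = {w. w \<noteq> [] \<and> fst ` set w \<subseteq> G}"

definition monomial :: "('g \<times> bool) list \<Rightarrow> ('g \<times> bool) list \<Rightarrow> complex" where
  "monomial w = (\<lambda>u. if u = w then 1 else 0)"

definition word_star :: "('g \<times> bool) list \<Rightarrow> ('g \<times> bool) list" where
  "word_star w = rev (map (\<lambda>(g, b). (g, \<not> b)) w)"

lemma word_star_word_star [simp]: "word_star (word_star w) = w"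
  by (simp add: word_star_def rev_map o_def case_prod_unfold)

lemma length_word_star [simp]: "length (word_star w) = length w"
  by (simp add: word_star_def)

lemma word_star_append: "word_star (u @ v) = word_star v @ word_star u"
  by (simp add: word_star_def)

lemma word_star_in_words [simp]: "word_star w \<in> words G \<longleftrightarrow> w \<in> words G"
  by (simp add: words_def word_star_def image_image case_prod_unfold)

lemma free_gen_mono: "free_gen g = monomial [(g, False)]"
  by (simp add: free_gen_def monomial_def fun_eq_iff)

context
  fixes G :: "'g set" and F
  defines "F \<equiv> free_star_algebra G"
begin

lemma free_sel:
  "carr F = {p. finite {w. p w \<noteq> 0} \<and> {w. p w \<noteq> 0} \<subseteq> words G}"
  "zer F = (\<lambda>w. 0)" "add F p q = (\<lambda>w. p w + q w)" "scal F c p = (\<lambda>w. c * p w)"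
  "mul F p q = (\<lambda>w. \<Sum>k\<le>length w. p (take k w) * q (drop k w))"
  "star F p = (\<lambda>w. cnj (p (word_star w)))"
  by (auto simp: F_def free_star_algebra_def words_def word_star_def)

lemma take_rev_word_star: "take k (word_star w) = word_star (drop (length w - k) w)"
  "drop k (word_star w) = word_star (take (length w - k) w)"
  by (simp_all add: word_star_def take_rev drop_rev drop_map take_map)

lemma mul_free_carr:
  assumes "p \<in> carr F" "q \<in> carr F" shows "mul F p q \<in> carr F"
proof -
  have "w \<in> (\<lambda>(u, v). u @ v) ` ({w. p w \<noteq> 0} \<times> {w. q w \<noteq> 0})" if w: "mul F p q w \<noteq> 0" for w
  proof -
    obtain k where "p (take k w) * q (drop k w) \<noteq> 0"
      using w unfolding free_sel(5) by (rule sum.not_neutral_contains_not_neutral)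
    then show ?thesis by (intro image_eqI [of _ _ "(take k w, drop k w)"]) auto
  qed
  then have sub: "{w. mul F p q w \<noteq> 0} \<subseteq> (\<lambda>(u, v). u @ v) ` ({w. p w \<noteq> 0} \<times> {w. q w \<noteq> 0})" by blast
  have fin: "finite ((\<lambda>(u, v). u @ v) ` ({w. p w \<noteq> 0} \<times> {w. q w \<noteq> 0}))"
    using assms by (simp add: free_sel)
  have "u @ v \<in> words G" if "p u \<noteq> 0" "q v \<noteq> 0" for u v
    using assms that by (auto simp: free_sel words_def subset_iff)
  then have "(\<lambda>(u, v). u @ v) ` ({w. p w \<noteq> 0} \<times> {w. q w \<noteq> 0}) \<subseteq> words G"
    by auto
  with finite_subset [OF sub fin] sub show ?thesis
    unfolding free_sel(1) by blast
qed

lemma star_algebra_free: "star_algebra F"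
proof
  show "zer F \<in> carr F" by (simp add: free_sel)
  show "add F p q \<in> carr F" if "p \<in> carr F" "q \<in> carr F" for p q
  proof -
    have "{w. add F p q w \<noteq> 0} \<subseteq> {w. p w \<noteq> 0} \<union> {w. q w \<noteq> 0}" by (auto simp: free_sel)
    moreover have fin: "finite ({w. p w \<noteq> 0} \<union> {w. q w \<noteq> 0})" "{w. p w \<noteq> 0} \<union> {w. q w \<noteq> 0} \<subseteq> words G"
      using that by (auto simp: free_sel)
    ultimately show ?thesis unfolding free_sel(1) using finite_subset [OF _ fin(1)] by blast
  qed
  show "scal F c p \<in> carr F" if "p \<in> carr F" for c p
  proof -
    have "{w. scal F c p w \<noteq> 0} \<subseteq> {w. p w \<noteq> 0}" by (auto simp: free_sel)
    moreover have fin: "finite {w. p w \<noteq> 0}" "{w. p w \<noteq> 0} \<subseteq> words G"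
      using that by (auto simp: free_sel(1))
    ultimately show ?thesis unfolding free_sel(1) using finite_subset [OF _ fin(1)] by blast
  qed
  show "star F p \<in> carr F" if "p \<in> carr F" for p
  proof -
    have fin: "finite {w. p w \<noteq> 0}" "{w. p w \<noteq> 0} \<subseteq> words G"
      using that by (auto simp: free_sel(1))
    have mem: "w \<in> {w. star F p w \<noteq> 0} \<longleftrightarrow> word_star w \<in> {w. p w \<noteq> 0}" for w
      by (simp add: free_sel(6))
    have "w \<in> word_star ` {w. p w \<noteq> 0}" if "w \<in> {w. star F p w \<noteq> 0}" for w
      using mem [of w] that by (intro image_eqI [of _ _ "word_star w"]) simp_all
    then have "finite {w. star F p w \<noteq> 0}"
      using finite_subset [OF _ finite_imageI [OF fin(1), of word_star]] by blast
    moreover have "w \<in> words G" if "w \<in> {w. star F p w \<noteq> 0}" for w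
      using mem [of w] that fin(2) word_star_in_words by blast
    ultimately show ?thesis unfolding free_sel(1) by blast
  qed
  show "mul F p q \<in> carr F" if "p \<in> carr F" "q \<in> carr F" for p q
    using that by (rule mul_free_carr)
  show "sub F p p = zer F" for p by (simp add: sub_def free_sel)
  show "mul F (mul F p q) r = mul F p (mul F q r)" for p q r
  proof
    fix w :: "('g \<times> bool) list"
    let ?n = "length w"
    let ?f = "\<lambda>i j l. p (take i w) * q (take j (drop i w)) * r (drop (i + j) w)"
    have "mul F (mul F p q) r w
        = (\<Sum>k\<le>?n. (\<Sum>j\<le>k. p (take j (take k w)) * q (drop j (take k w))) * r (drop k w))"
      by (auto simp: free_sel min_absorb2 intro!: sum.cong)
    also have "\<dots> = (\<Sum>j=0..?n. \<Sum>i=0..j. ?f i (j - i) (?n - j))"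
      unfolding atMost_atLeast0
      by (intro sum.cong refl) (auto simp: sum_distrib_right min_absorb1 drop_take intro!: sum.cong)
    \<comment> \<open>Both sides run over the ways to cut \<open>w\<close> into three consecutive
      pieces. The change of indices is the one behind associativity of the Cauchy product of power
      series.\<close>
    also have "\<dots> = (\<Sum>j=0..?n. \<Sum>i=0..?n - j. ?f j i (?n - j - i))"
      by (rule fps_mult_assoc_lemma)
    also have "\<dots> = mul F p (mul F q r) w"
      unfolding free_sel atMost_atLeast0
      by (intro sum.cong refl) (auto simp: sum_distrib_left mult.assoc add.commute intro!: sum.cong)
    finally show "mul F (mul F p q) r w = mul F p (mul F q r) w" .
  qed
  show "star F (mul F p q) = mul F (star F q) (star F p)" for p q
  proof
    fix w :: "('g \<times> bool) list"
    have "star F (mul F p q) w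
        = (\<Sum>k\<le>length w. cnj (p (word_star (drop (length w - k) w))) * cnj (q (word_star (take (length w - k) w))))"
      by (simp add: free_sel take_rev_word_star)
    also have "\<dots> = (\<Sum>k\<le>length w. cnj (p (word_star (drop k w))) * cnj (q (word_star (take k w))))"
      by (rule sum.reindex_bij_witness [of _ "\<lambda>k. length w - k" "\<lambda>k. length w - k"]) auto
    finally show "star F (mul F p q) w = mul F (star F q) (star F p) w"
      by (simp add: free_sel mult.commute)
  qed
qed (auto simp: free_sel algebra_simps sum_distrib_left sum.distrib)

interpretation F: star_algebra F by (rule star_algebra_free)

lemma mono_carr [simp]: "w \<in> words G \<Longrightarrow> monomial w \<in> carr F"
  by (auto simp: free_sel monomial_def)

lemma star_mono: "star F (monomial w) = monomial (word_star w)"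
proof
  fix u
  show "star F (monomial w) u = monomial (word_star w) u"
  proof (cases "u = word_star w")
    case False
    then have "word_star u \<noteq> w" by (metis word_star_word_star)
    with False have "monomial w (word_star u) = 0" "monomial (word_star w) u = 0" by (simp_all only: monomial_def if_False)
    then show ?thesis by (simp only: free_sel(6) complex_cnj_zero)
  next
    case True
    then show ?thesis by (simp only: free_sel(6) monomial_def word_star_word_star simp_thms if_True complex_cnj_one)
  qed
qed

lemma mul_mono: "mul F (monomial u) (monomial v) = monomial (u @ v)"
proof
  fix w
  have "mul F (monomial u) (monomial v) w = (\<Sum>k\<le>length w. if k = length u then (if w = u @ v then 1 else 0) else 0)"
    unfolding free_sel
  proof (intro sum.cong refl)
    fix k assume "k \<in> {..length w}"
    then show "monomial u (take k w) * monomial v (drop k w)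
        = (if k = length u then if w = u @ v then 1 else 0 else 0)"
    proof (cases "k = length u")
      case True
      have "w = u @ v \<longleftrightarrow> take k w = u \<and> drop k w = v"
        using append_eq_conv_conj [of u v w] True by metis
      then show ?thesis using True by (simp add: monomial_def)
    next
      case False
      then have "take k w \<noteq> u" using \<open>k \<in> {..length w}\<close> by auto
      then show ?thesis using False by (simp add: monomial_def)
    qed
  qed
  also have "\<dots> = monomial (u @ v) w" by (auto simp: monomial_def)
  finally show "mul F (monomial u) (monomial v) w = monomial (u @ v) w" .
qed

text \<open>An element is a finite combination of word monomials. The induction runs over a finite
  superset of the support rather than the support itself, so removing one word from the superset is
  harmless even if its coefficient vanishes.\<close>

lemma free_induct [consumes 1, case_names zer monomial add scal]:
  assumes "p \<in> carr F" and "P (zer F)"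
    and m: "\<And>w. w \<in> words G \<Longrightarrow> P (monomial w)"
    and a: "\<And>p q. \<lbrakk>p \<in> carr F; q \<in> carr F; P p; P q\<rbrakk> \<Longrightarrow> P (add F p q)"
    and s: "\<And>c p. \<lbrakk>p \<in> carr F; P p\<rbrakk> \<Longrightarrow> P (scal F c p)"
  shows "P p"
proof -
  have "finite S \<Longrightarrow> S \<subseteq> words G \<Longrightarrow> {w. p w \<noteq> 0} \<subseteq> S \<Longrightarrow> P p" for S p
  proof (induction S arbitrary: p rule: finite_induct)
    case empty
    then have "p = zer F" by (auto simp: free_sel fun_eq_iff)
    then show ?case using assms(2) by simp
  next
    case (insert w S)
    let ?p = "p(w := 0)"
    have sub: "{u. ?p u \<noteq> 0} \<subseteq> S" using insert by auto
    have "finite {u. ?p u \<noteq> 0}" by (rule finite_subset [OF sub]) (use insert in auto)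
    moreover have "{u. ?p u \<noteq> 0} \<subseteq> words G" using sub insert by blast
    ultimately have pc: "?p \<in> carr F" unfolding free_sel(1) by blast
    have "P ?p" using insert sub by blast
    have w: "w \<in> words G" using insert by simp
    have "p = add F ?p (scal F (p w) (monomial w))" by (auto simp: free_sel monomial_def fun_eq_iff)
    moreover have "P (add F ?p (scal F (p w) (monomial w)))"
      by (intro a s m pc w mono_carr F.scal_closed \<open>P ?p\<close>)
    ultimately show ?case by simp
  qed
  then show ?thesis using assms(1) by (auto simp: free_sel(1))
qed

text \<open>Generators determine letters (a starred letter is the adjoint of a generator), letters
  determine words by multiplicativity, and words determine everything by linearity.\<close>

lemma star_hom_free_eqI:
  assumes \<phi>: "star_hom F B \<phi>" and \<psi>: "star_hom F B \<psi>" and B: "star_algebra B"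
    and gen: "\<And>g. g \<in> G \<Longrightarrow> \<phi> (free_gen g) = \<psi> (free_gen g)" and p: "p \<in> carr F"
  shows "\<phi> p = \<psi> p"
proof -
  have letter: "\<phi> (monomial [x]) = \<psi> (monomial [x])" if "fst x \<in> G" for x
  proof (cases x)
    case (Pair g b)
    have g: "monomial [(g, False)] \<in> carr F" using that Pair by (intro mono_carr) (simp add: words_def)
    show ?thesis
    proof (cases b)
      case True
      then have "monomial [x] = star F (monomial [(g, False)])" by (simp add: star_mono word_star_def Pair)
      then show ?thesis using gen [of g] that Pair g star_homD(5) [OF \<phi>] star_homD(5) [OF \<psi>]
        by (simp add: free_gen_mono)
    qed (use gen [of g] that Pair in \<open>simp add: free_gen_mono\<close>)
  qed
  have word: "\<phi> (monomial w) = \<psi> (monomial w)" if "w \<in> words G" for w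
    using that
  proof (induction w)
    case (Cons x w)
    show ?case
    proof (cases "w = []")
      case False
      then have "w \<in> words G" "[x] \<in> words G" using Cons by (auto simp: words_def)
      then show ?thesis
        using Cons letter [of x] mul_mono [of "[x]" w, symmetric] star_homD(4) [OF \<phi>] star_homD(4) [OF \<psi>]
        by (simp add: words_def)
    qed (use Cons letter in \<open>simp add: words_def\<close>)
  qed (simp add: words_def)
  from p show ?thesis
  proof (induction p rule: free_induct)
    case zer
    then show ?case by (simp add: star_hom_zer [OF \<phi> _ B] star_hom_zer [OF \<psi> _ B] F.star_algebra_axioms)
  qed (simp_all add: word star_homD [OF \<phi>] star_homD [OF \<psi>])
qed

end

text \<open>Addition is a record field, so the finite sum is written as a fold. The guard on the
  accumulator makes the folded steps commute for every accumulator, while the laws of addition are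
  available only inside the carrier.\<close>

definition fsum :: "'b star_alg \<Rightarrow> ('i \<Rightarrow> 'b) \<Rightarrow> 'i set \<Rightarrow> 'b" where
  "fsum B t S = Finite_Set.fold (\<lambda>i acc. if acc \<in> carr B then add B (t i) acc else acc) (zer B) S"

context star_algebra
begin

lemma fsum_empty [simp]: "fsum A t {} = zer A"
  by (simp add: fsum_def)

lemma fsum_insert_aux:
  assumes "finite S" "i \<notin> S" "t ` insert i S \<subseteq> carr A"
  shows "fsum A t (insert i S) = (if fsum A t S \<in> carr A then add A (t i) (fsum A t S) else fsum A t S)"
proof -
  interpret comp_fun_commute_on "insert i S" "\<lambda>i acc. if acc \<in> carr A then add A (t i) acc else acc"
    by unfold_locales (use assms(3) in \<open>auto simp: fun_eq_iff add_left_commute image_subset_iff\<close>)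
  show ?thesis unfolding fsum_def
    by (rule fold_insert) (use assms in auto)
qed

lemma fsum_closed [simp]: "\<lbrakk>finite S; t ` S \<subseteq> carr A\<rbrakk> \<Longrightarrow> fsum A t S \<in> carr A"
  by (induction S rule: finite_induct) (simp_all add: fsum_insert_aux)

lemma fsum_insert [simp]:
  "\<lbrakk>finite S; i \<notin> S; t i \<in> carr A; t ` S \<subseteq> carr A\<rbrakk> \<Longrightarrow> fsum A t (insert i S) = add A (t i) (fsum A t S)"
  by (simp add: fsum_insert_aux)

lemma fsum_add:
  "\<lbrakk>finite S; t ` S \<subseteq> carr A; u ` S \<subseteq> carr A\<rbrakk>
    \<Longrightarrow> fsum A (\<lambda>i. add A (t i) (u i)) S = add A (fsum A t S) (fsum A u S)"
proof (induction S rule: finite_induct)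
  case (insert i S)
  then have "(\<lambda>i. add A (t i) (u i)) ` S \<subseteq> carr A" by (auto simp: image_subset_iff)
  with insert show ?case by (simp add: add_add_swap)
qed simp

lemma fsum_scal:
  "\<lbrakk>finite S; t ` S \<subseteq> carr A\<rbrakk> \<Longrightarrow> fsum A (\<lambda>i. scal A c (t i)) S = scal A c (fsum A t S)"
proof (induction S rule: finite_induct)
  case (insert i S)
  then have "(\<lambda>i. scal A c (t i)) ` S \<subseteq> carr A" by auto
  with insert show ?case by (simp add: scal_add)
qed simp

lemma fsum_cong:
  "\<lbrakk>finite S; u ` S \<subseteq> carr A; \<And>i. i \<in> S \<Longrightarrow> t i = u i\<rbrakk> \<Longrightarrow> fsum A t S = fsum A u S"
  by (induction S rule: finite_induct) (simp_all add: image_subset_iff)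

lemma fsum_zeros:
  assumes "finite T" "finite S" "S \<inter> T = {}" "t ` S \<subseteq> carr A" "\<And>i. i \<in> T \<Longrightarrow> t i = zer A"
  shows "fsum A t (S \<union> T) = fsum A t S"
  using assms
proof (induction T rule: finite_induct)
  case (insert i T)
  have "t ` (S \<union> T) \<subseteq> carr A" using insert by (auto simp: image_subset_iff)
  then show ?case using insert by simp
qed simp

end

text \<open>The empty word has no value in an algebra without unit; \<open>zer B\<close> is a
  filler. The separate clause for one-letter words stops the recursion before the filler could enter
  a product.\<close>

fun weval :: "'b star_alg \<Rightarrow> ('g \<Rightarrow> 'b) \<Rightarrow> ('g \<times> bool) list \<Rightarrow> 'b" where
  "weval B \<gamma> [] = zer B"
| "weval B \<gamma> [(g, b)] = (if b then star B (\<gamma> g) else \<gamma> g)"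
| "weval B \<gamma> (x # y # w) = mul B (weval B \<gamma> [x]) (weval B \<gamma> (y # w))"

definition free_eval :: "'b star_alg \<Rightarrow> ('g \<Rightarrow> 'b) \<Rightarrow> (('g \<times> bool) list \<Rightarrow> complex) \<Rightarrow> 'b" where
  "free_eval B \<gamma> p = fsum B (\<lambda>w. scal B (p w) (weval B \<gamma> w)) {w. p w \<noteq> 0}"

lemma weval_closed:
  assumes "star_algebra B" "\<gamma> ` G \<subseteq> carr B" "w \<in> words G" shows "weval B \<gamma> w \<in> carr B"
  using assms(3)
proof (induction w rule: induct_list012)
  case (2 x)
  interpret B: star_algebra B by fact
  show ?case using 2 assms(2) by (cases x) (auto simp: words_def)
next
  case (3 x y w)
  interpret B: star_algebra B by fact
  have "weval B \<gamma> [x] \<in> carr B" using 3(3) assms(2) by (cases x) (auto simp: words_def)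
  then show ?case using 3 by (simp add: words_def)
qed (simp add: words_def)

lemma weval_append:
  assumes "star_algebra B" "\<gamma> ` G \<subseteq> carr B" "u \<in> words G" "v \<in> words G"
  shows "weval B \<gamma> (u @ v) = mul B (weval B \<gamma> u) (weval B \<gamma> v)"
  using assms(3)
proof (induction u rule: induct_list012)
  case (2 x)
  then show ?case using assms(4) by (cases v) (auto simp: words_def)
next
  case (3 x y u)
  interpret B: star_algebra B by fact
  have "[x] \<in> words G" "y # u \<in> words G" using 3(3) by (auto simp: words_def)
  then show ?case using 3 weval_closed [OF assms(1,2)] assms(4) by (simp add: B.mul_assoc)
qed (simp add: words_def)

lemma weval_star:
  assumes "star_algebra B" "\<gamma> ` G \<subseteq> carr B" "w \<in> words G"
  shows "weval B \<gamma> (word_star w) = star B (weval B \<gamma> w)"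
  using assms(3)
proof (induction w rule: induct_list012)
  case (2 x)
  interpret B: star_algebra B by fact
  show ?case using 2 assms(2) by (cases x) (auto simp: words_def word_star_def image_subset_iff)
next
  case (3 x y w)
  interpret B: star_algebra B by fact
  have w: "[x] \<in> words G" "y # w \<in> words G" using 3(3) by (auto simp: words_def)
  have x: "weval B \<gamma> (word_star [x]) = star B (weval B \<gamma> [x])"
    using w(1) assms(2) by (cases x) (auto simp: words_def word_star_def image_subset_iff)
  have "weval B \<gamma> (word_star (x # y # w)) = weval B \<gamma> (word_star (y # w) @ word_star [x])"
    by (simp add: word_star_append [symmetric])
  also have "\<dots> = mul B (weval B \<gamma> (word_star (y # w))) (weval B \<gamma> (word_star [x]))"
    using w by (intro weval_append [OF assms(1,2)]) simp_all
  also have "\<dots> = star B (weval B \<gamma> (x # y # w))"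
    using 3(2) w x weval_closed [OF assms(1,2)] by (simp add: B.star_mul)
  finally show ?case .
qed (simp add: words_def)

text \<open>The sum may be taken over any finite set of words that contains the support
  (\<open>super\<close>), which makes additivity a termwise matter. Multiplicativity is reduced to
  words by induction in the right factor (\<open>hmul1\<close>) and then in the left one; on words
  it is \<open>weval_append\<close>.\<close>

lemma free_eval:
  assumes B: "star_algebra B" and \<gamma>: "\<gamma> ` G \<subseteq> carr B"
  shows "star_hom (free_star_algebra G) B (free_eval B \<gamma>)"
    and "\<And>g. g \<in> G \<Longrightarrow> free_eval B \<gamma> (free_gen g) = \<gamma> g"
proof -
  interpret B: star_algebra B by fact
  let ?F = "free_star_algebra G"
  interpret F: star_algebra ?F by (rule star_algebra_free)
  let ?h = "free_eval B \<gamma>"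
  let ?t = "\<lambda>p w. scal B (p w) (weval B \<gamma> w)"
  note wc = weval_closed [OF B \<gamma>]
  have tc: "?t p ` S \<subseteq> carr B" if "S \<subseteq> words G" for p S
    using that wc by auto
  have supp: "finite {w. p w \<noteq> 0}" "{w. p w \<noteq> 0} \<subseteq> words G" if "p \<in> carr ?F" for p
    using that by (auto simp: free_sel)
  have super: "?h p = fsum B (?t p) S" if "finite S" "S \<subseteq> words G" "{w. p w \<noteq> 0} \<subseteq> S" for p S
  proof -
    have "fsum B (?t p) ({w. p w \<noteq> 0} \<union> (S - {w. p w \<noteq> 0})) = fsum B (?t p) {w. p w \<noteq> 0}"
      using that wc finite_subset by (intro B.fsum_zeros) auto
    moreover have "{w. p w \<noteq> 0} \<union> (S - {w. p w \<noteq> 0}) = S" using that by auto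
    ultimately show ?thesis by (simp add: free_eval_def)
  qed
  have hc [simp]: "?h p \<in> carr B" if "p \<in> carr ?F" for p
    unfolding free_eval_def using supp [OF that] tc by simp
  have hadd: "?h (add ?F p q) = add B (?h p) (?h q)" if "p \<in> carr ?F" "q \<in> carr ?F" for p q
  proof -
    let ?S = "{w. p w \<noteq> 0} \<union> {w. q w \<noteq> 0}"
    have S: "finite ?S" "?S \<subseteq> words G" using supp that by auto
    have "?h (add ?F p q) = fsum B (?t (add ?F p q)) ?S" by (rule super [OF S]) (auto simp: free_sel)
    also have "\<dots> = fsum B (\<lambda>w. add B (?t p w) (?t q w)) ?S"
      by (rule B.fsum_cong) (use S wc in \<open>auto simp: free_sel B.add_scal image_subset_iff subset_iff\<close>)
    also have "\<dots> = add B (fsum B (?t p) ?S) (fsum B (?t q) ?S)" by (rule B.fsum_add) (use S tc in auto)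
    also have "\<dots> = add B (?h p) (?h q)" using super [OF S, of p] super [OF S, of q] by (simp add: subset_iff)
    finally show ?thesis .
  qed
  have hscal: "?h (scal ?F c p) = scal B c (?h p)" if "p \<in> carr ?F" for p c
  proof -
    let ?S = "{w. p w \<noteq> 0}"
    have "?h (scal ?F c p) = fsum B (?t (scal ?F c p)) ?S" by (rule super [OF supp [OF that]]) (auto simp: free_sel)
    also have "\<dots> = fsum B (\<lambda>w. scal B c (?t p w)) ?S"
      by (rule B.fsum_cong) (use supp [OF that] wc in \<open>auto simp: free_sel image_subset_iff subset_iff\<close>)
    also have "\<dots> = scal B c (?h p)" unfolding free_eval_def by (rule B.fsum_scal) (use supp [OF that] tc in auto)
    finally show ?thesis .
  qed
  have hmono: "?h (monomial w) = weval B \<gamma> w" if "w \<in> words G" for w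
    using super [of "{w}" "monomial w"] that wc by (auto simp: monomial_def)
  have hzer: "?h (zer ?F) = zer B" by (simp add: free_eval_def free_sel)
  have hmul1: "?h (mul ?F (monomial u) q) = mul B (?h (monomial u)) (?h q)" if "u \<in> words G" "q \<in> carr ?F" for u q
    using that(2)
  proof (induction q rule: free_induct)
    case (monomial v)
    have "u @ v \<in> words G" using monomial that by (auto simp: words_def)
    then show ?case using monomial that by (simp add: mul_mono hmono weval_append [OF B \<gamma>])
  qed (use that in \<open>simp_all add: hzer hadd hscal hmono wc F.mul_add F.mul_scal B.mul_add B.mul_scal\<close>)
  have hmul: "?h (mul ?F p q) = mul B (?h p) (?h q)" if "p \<in> carr ?F" "q \<in> carr ?F" for p q
    using that(1)
    by (induction p rule: free_induct)
      (use that in \<open>simp_all add: hzer hmul1 hadd hscal F.add_mul F.scal_mul B.add_mul B.scal_mul\<close>)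
  have hstar: "?h (star ?F p) = star B (?h p)" if "p \<in> carr ?F" for p
    using that
    by (induction p rule: free_induct)
      (simp_all add: hzer hadd hscal hmono star_mono weval_star [OF B \<gamma>]
        F.star_add F.star_scal B.star_add B.star_scal)
  show "star_hom ?F B ?h" unfolding star_hom_def by (simp add: hadd hscal hmul hstar)
  show "?h (free_gen g) = \<gamma> g" if "g \<in> G" for g
    using hmono [of "[(g, False)]"] that by (simp add: free_gen_mono words_def)
qed

section \<open>Continuous functions vanishing at infinity\<close>

lemma continuous_map_euclidean_eps:
  fixes f :: "'a \<Rightarrow> 'b::metric_space"
  shows "continuous_map X euclidean f \<longleftrightarrow>
    (\<forall>x\<in>topspace X. \<forall>e>0. \<exists>U. openin X U \<and> x \<in> U \<and> (\<forall>y\<in>U. dist (f y) (f x) < e))"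
    (is "?lhs \<longleftrightarrow> ?rhs")
proof
  assume f: ?lhs
  show ?rhs
  proof (intro ballI allI impI)
    fix x and e :: real assume "x \<in> topspace X" "e > 0"
    then show "\<exists>U. openin X U \<and> x \<in> U \<and> (\<forall>y\<in>U. dist (f y) (f x) < e)"
      using openin_continuous_map_preimage [OF f, of "ball (f x) e"]
      by (intro exI [of _ "{y \<in> topspace X. f y \<in> ball (f x) e}"]) (auto simp: dist_commute)
  qed
next
  assume R: ?rhs
  show ?lhs
    unfolding continuous_map_def
  proof (intro conjI allI impI)
    fix V :: "'b set" assume V: "openin euclidean V"
    show "openin X {x \<in> topspace X. f x \<in> V}"
    proof (subst openin_subopen, intro ballI)
      fix x assume x: "x \<in> {x \<in> topspace X. f x \<in> V}"
      have "open V" using V by simp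
      then obtain e where e: "e > 0" "\<forall>y. dist y (f x) < e \<longrightarrow> y \<in> V"
        using x unfolding open_dist by blast
      from R x e(1) have "\<exists>U. openin X U \<and> x \<in> U \<and> (\<forall>y\<in>U. dist (f y) (f x) < e)"
        by simp
      then obtain U where U: "openin X U" "x \<in> U" "\<forall>y\<in>U. dist (f y) (f x) < e" by blast
      have "U \<subseteq> {x \<in> topspace X. f x \<in> V}"
        using U(3) e(2) openin_subset [OF U(1)] by blast
      with U show "\<exists>T. openin X T \<and> x \<in> T \<and> T \<subseteq> {x \<in> topspace X. f x \<in> V}"
        by blast
    qed
  qed simp
qed

lemma continuous_map_compose_isCont:
  fixes f :: "'a \<Rightarrow> 'b::topological_space" and h :: "'b \<Rightarrow> 'c::topological_space"
  assumes "continuous_map X euclidean f" "continuous_on UNIV h"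
  shows "continuous_map X euclidean (\<lambda>x. h (f x))"
proof -
  have "continuous_map X euclidean (h \<circ> f)"
    by (rule continuous_map_compose [OF assms(1)]) (simp add: assms(2))
  then show ?thesis by (simp add: o_def)
qed

lemma continuous_map_times:
  fixes f g :: "'a \<Rightarrow> 'b::real_normed_algebra"
  assumes "continuous_map X euclidean f" "continuous_map X euclidean g"
  shows "continuous_map X euclidean (\<lambda>x. f x * g x)"
  using assms by (simp add: continuous_map_atin tendsto_mult)

lemma C0D:
  assumes "f \<in> C0 X"
  shows C0_continuous: "continuous_map X euclidean f"
    and C0_outside: "\<And>x. x \<notin> topspace X \<Longrightarrow> f x = 0"
    and C0_compact: "\<And>\<epsilon>. 0 < \<epsilon> \<Longrightarrow> compactin X {x \<in> topspace X. \<epsilon> \<le> cmod (f x)}"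
  using assms by (auto simp: C0_def)

lemma closedin_norm_ge:
  fixes f :: "'a \<Rightarrow> 'b::real_normed_vector"
  assumes "continuous_map X euclidean f" shows "closedin X {x \<in> topspace X. \<epsilon> \<le> norm (f x)}"
proof -
  have "closed {z::'b. \<epsilon> \<le> norm z}" by (intro closed_Collect_le continuous_intros)
  then show ?thesis using closedin_continuous_map_preimage [OF assms, of "{z. \<epsilon> \<le> norm z}"] by simp
qed

text \<open>A compact superset of each level set suffices, because the level set is closed.\<close>

lemma C0I:
  assumes f: "continuous_map X euclidean f" and "\<And>x. x \<notin> topspace X \<Longrightarrow> f x = 0"
    and K: "\<And>\<epsilon>. 0 < \<epsilon> \<Longrightarrow> \<exists>K. compactin X K \<and> {x \<in> topspace X. \<epsilon> \<le> cmod (f x)} \<subseteq> K"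
  shows "f \<in> C0 X"
  unfolding C0_def
proof (intro CollectI conjI allI impI)
  fix \<epsilon> :: real assume "0 < \<epsilon>"
  then obtain K' where "compactin X K'" "{x \<in> topspace X. \<epsilon> \<le> cmod (f x)} \<subseteq> K'"
    using K by blast
  then show "compactin X {x \<in> topspace X. \<epsilon> \<le> cmod (f x)}"
    by (rule closed_compactin) (rule closedin_norm_ge [OF f])
qed (use assms in auto)

lemma C0_dominated:
  assumes g: "continuous_map X euclidean g" "\<And>x. x \<notin> topspace X \<Longrightarrow> g x = 0" and f: "f \<in> C0 X"
    and le: "\<And>x. x \<in> topspace X \<Longrightarrow> cmod (g x) \<le> c * cmod (f x)"
  shows "g \<in> C0 X"
proof (rule C0I [OF g])
  fix \<epsilon> :: real assume \<epsilon>: "0 < \<epsilon>"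
  \<comment> \<open>The maximum makes the divisor positive whatever the sign of
    \<open>c\<close>.\<close>
  let ?c = "max c 1"
  have "\<epsilon> / ?c \<le> cmod (f x)" if x: "x \<in> topspace X" "\<epsilon> \<le> cmod (g x)" for x
  proof -
    have "\<epsilon> \<le> c * cmod (f x)" using le [OF x(1)] x(2) by linarith
    also have "\<dots> \<le> ?c * cmod (f x)" by (intro mult_right_mono) auto
    finally show ?thesis by (simp add: divide_le_eq mult.commute)
  qed
  then have "{x \<in> topspace X. \<epsilon> \<le> cmod (g x)} \<subseteq> {x \<in> topspace X. \<epsilon> / ?c \<le> cmod (f x)}" by blast
  moreover have "compactin X {x \<in> topspace X. \<epsilon> / ?c \<le> cmod (f x)}"
    by (rule C0_compact [OF f]) (use \<epsilon> in simp)
  ultimately show "\<exists>K. compactin X K \<and> {x \<in> topspace X. \<epsilon> \<le> cmod (g x)} \<subseteq> K" by blast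
qed

lemma C0_bounded:
  assumes f: "f \<in> C0 X" shows "\<exists>M>0. \<forall>x. cmod (f x) \<le> M"
proof -
  have "compactin euclidean (f ` {x \<in> topspace X. 1 \<le> cmod (f x)})"
    by (rule image_compactin [OF C0_compact [OF f] C0_continuous [OF f]]) simp
  then have "bounded (f ` {x \<in> topspace X. 1 \<le> cmod (f x)})"
    by (simp add: compact_imp_bounded)
  then obtain M where M: "\<And>x. x \<in> topspace X \<Longrightarrow> 1 \<le> cmod (f x) \<Longrightarrow> cmod (f x) \<le> M"
    unfolding bounded_iff by auto
  have "cmod (f x) \<le> max M 1" for x
  proof (cases "x \<in> topspace X \<and> 1 \<le> cmod (f x)")
    case True
    then show ?thesis using M [of x] by simp
  next
    case False
    then show ?thesis using C0_outside [OF f, of x] by (cases "x \<in> topspace X") auto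
  qed
  then show ?thesis by (intro exI [of _ "max M 1"]) auto
qed

lemma C0_zero: "(\<lambda>x. 0) \<in> C0 X"
  by (rule C0I) auto

lemma C0_add:
  assumes f: "f \<in> C0 X" and g: "g \<in> C0 X" shows "(\<lambda>x. f x + g x) \<in> C0 X"
proof (rule C0I)
  show "continuous_map X euclidean (\<lambda>x. f x + g x)"
    by (intro continuous_map_add C0_continuous f g)
  fix \<epsilon> :: real assume \<epsilon>: "0 < \<epsilon>"
  let ?K = "\<lambda>h. {x \<in> topspace X. \<epsilon>/2 \<le> cmod (h x)}"
  have "compactin X (?K f \<union> ?K g)"
    by (intro compactin_Un C0_compact f g) (use \<epsilon> in auto)
  moreover have "x \<in> ?K f \<union> ?K g" if "x \<in> topspace X" "\<epsilon> \<le> cmod (f x + g x)" for x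
    using that norm_triangle_ineq [of "f x" "g x"] by auto
  ultimately show "\<exists>K. compactin X K \<and> {x \<in> topspace X. \<epsilon> \<le> cmod (f x + g x)} \<subseteq> K" by blast
qed (use C0_outside [OF f] C0_outside [OF g] in simp)

lemma C0_scal:
  assumes f: "f \<in> C0 X" shows "(\<lambda>x. c * f x) \<in> C0 X"
proof (rule C0_dominated [OF _ _ f])
  show "continuous_map X euclidean (\<lambda>x. c * f x)"
    by (intro continuous_map_times C0_continuous [OF f]) simp
  show "cmod (c * f x) \<le> cmod c * cmod (f x)" for x by (simp add: norm_mult)
qed (simp add: C0_outside [OF f])

lemma C0_times_bounded:
  assumes f: "f \<in> C0 X" and g: "continuous_map X euclidean g" "\<And>x. x \<in> topspace X \<Longrightarrow> cmod (g x) \<le> M"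
  shows "(\<lambda>x. f x * g x) \<in> C0 X"
proof (rule C0_dominated [OF _ _ f])
  show "continuous_map X euclidean (\<lambda>x. f x * g x)" by (intro continuous_map_times C0_continuous f g)
  show "cmod (f x * g x) \<le> M * cmod (f x)" if "x \<in> topspace X" for x
    using mult_left_mono [OF g(2) [OF that], of "cmod (f x)"] by (simp add: norm_mult mult.commute)
qed (simp add: C0_outside [OF f])

lemma C0_mult:
  assumes f: "f \<in> C0 X" and g: "g \<in> C0 X" shows "(\<lambda>x. f x * g x) \<in> C0 X"
proof -
  obtain M where "\<forall>x. cmod (g x) \<le> M" using C0_bounded [OF g] by blast
  then show ?thesis by (intro C0_times_bounded [OF f C0_continuous [OF g]]) blast
qed

lemma C0_cnj:
  assumes f: "f \<in> C0 X" shows "(\<lambda>x. cnj (f x)) \<in> C0 X"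
proof (rule C0_dominated [OF _ _ f])
  show "continuous_map X euclidean (\<lambda>x. cnj (f x))"
    by (intro continuous_map_compose_isCont [OF C0_continuous [OF f]] continuous_intros)
  show "cmod (cnj (f x)) \<le> 1 * cmod (f x)" for x by simp
qed (simp add: C0_outside [OF f])

lemma star_algebra_C0: "star_algebra (C0_algebra X)"
  by unfold_locales
    (auto simp: C0_algebra_def sub_def C0_zero C0_add C0_scal C0_mult C0_cnj algebra_simps fun_eq_iff)

text \<open>Only neighbourhoods of 0 need care: the preimage of one misses a closed subset of some
  level set, hence a compact set, and so is a neighbourhood of infinity.\<close>

lemma C0_eq_case_option:
  assumes f: "f \<in> C0 X"
  shows "continuous_map (Alexandroff_compactification X) euclidean (case_option 0 f)"
  unfolding continuous_map_def
proof (intro conjI allI impI)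
  fix V :: "complex set" assume V: "openin euclidean V"
  let ?P = "{x \<in> topspace (Alexandroff_compactification X). (case x of None \<Rightarrow> 0 | Some y \<Rightarrow> f y) \<in> V}"
  let ?W = "{x \<in> topspace X. f x \<in> V}"
  have W: "openin X ?W" by (rule openin_continuous_map_preimage [OF C0_continuous [OF f] V])
  show "openin (Alexandroff_compactification X) ?P"
  proof (cases "0 \<in> V")
    case False
    then have "?P = Some ` ?W" by (auto split: option.splits)
    then show ?thesis using W by simp
  next
    case True
    have "open V" using V by simp
    then obtain e where e': "e > 0" "\<forall>z. dist z 0 < e \<longrightarrow> z \<in> V"
      using True unfolding open_dist by blast
    then have e: "e > 0" "\<And>z. cmod z < e \<Longrightarrow> z \<in> V" by simp_all
    have cl: "closedin X (topspace X - ?W)" using W by blast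
    have "topspace X - ?W \<subseteq> {x \<in> topspace X. e \<le> cmod (f x)}"
      using e(2) not_less by blast
    then have "compactin X (topspace X - ?W)"
      by (rule closed_compactin [OF C0_compact [OF f e(1)] _ cl])
    moreover have "topspace X - (topspace X - ?W) = ?W" by blast
    moreover have "?P = insert None (Some ` ?W)"
    proof (rule set_eqI)
      fix x show "x \<in> ?P \<longleftrightarrow> x \<in> insert None (Some ` ?W)"
        using True by (cases x) auto
    qed
    ultimately show ?thesis
      unfolding openin_Alexandroff_compactification using cl by (metis (no_types, lifting))
  qed
qed simp

text \<open>The converse passage: a level set above a positive threshold is closed in the
  compactification and misses infinity, hence is compact. Together the two facts make
  \<open>C0\<close> stable under maps of compactifications that fix infinity.\<close>

lemma C0_of_compactification:
  assumes g: "continuous_map (Alexandroff_compactification X) euclidean g" and 0: "g None = 0"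
  shows "(\<lambda>x. if x \<in> topspace X then g (Some x) else 0) \<in> C0 X"
    (is "?f \<in> _")
proof (rule C0I)
  have "continuous_map X euclidean (g \<circ> Some)"
    by (rule continuous_map_compose [OF continuous_map_Some g])
  then show "continuous_map X euclidean ?f"
    by (rule continuous_map_eq) simp
  fix \<epsilon> :: real assume \<epsilon>: "0 < \<epsilon>"
  let ?C = "{x \<in> topspace (Alexandroff_compactification X). \<epsilon> \<le> cmod (g x)}"
  have "?C = Some ` {x \<in> topspace X. \<epsilon> \<le> cmod (?f x)}"
    using 0 \<epsilon> by auto
  then have "closedin (Alexandroff_compactification X) (Some ` {x \<in> topspace X. \<epsilon> \<le> cmod (?f x)})"
    using closedin_norm_ge [OF g, of \<epsilon>] by simp
  then have "compactin X {x \<in> topspace X. \<epsilon> \<le> cmod (?f x)}"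
    by (simp only: closedin_Alexandroff_compactification_image_Some)
  then show "\<exists>K. compactin X K \<and> {x \<in> topspace X. \<epsilon> \<le> cmod (?f x)} \<subseteq> K" by blast
qed simp

lemma pull_back_C0:
  assumes m: "continuous_map (Alexandroff_compactification X) (Alexandroff_compactification Y) m"
    and 0: "m None = None" and f: "f \<in> C0 Y"
  shows "pull_back X m f \<in> C0 X"
proof -
  have "continuous_map (Alexandroff_compactification X) euclidean (case_option 0 f \<circ> m)"
    by (rule continuous_map_compose [OF m C0_eq_case_option [OF f]])
  from C0_of_compactification [OF this] show ?thesis
    unfolding pull_back_def [abs_def] comp_def by (simp add: 0)
qed

section \<open>Sums over the fibres of a local homeomorphism\<close>

text \<open>For a topological graph the sheets cover the edge space; this is the local homeomorphism
  condition restated with a named set.\<close>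

definition sheet :: "('v, 'e) topgraph \<Rightarrow> 'e set \<Rightarrow> bool" where
  "sheet E U \<longleftrightarrow> openin (edges E) U \<and> openin (vertices E) (dmap E ` U) \<and>
     homeomorphic_map (subtopology (edges E) U) (subtopology (vertices E) (dmap E ` U)) (dmap E)"

lemma sheet_subset:
  assumes U: "sheet E U" and V: "openin (edges E) V" "V \<subseteq> U" shows "sheet E V"
proof -
  let ?X = "edges E" and ?Y = "vertices E" and ?d = "dmap E"
  have h: "homeomorphic_map (subtopology ?X U) (subtopology ?Y (?d ` U)) ?d"
    and op: "openin ?X U" "openin ?Y (?d ` U)" using U by (auto simp: sheet_def)
  have tU: "topspace (subtopology ?X U) = U" "topspace (subtopology ?Y (?d ` U)) = ?d ` U"
    using openin_subset [OF op(1)] openin_subset [OF op(2)] by auto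
  have "openin (subtopology ?X U) V" using V op by (simp add: openin_open_subtopology)
  then have "openin (subtopology ?Y (?d ` U)) (?d ` V)"
    using homeomorphic_map_openness_eq [OF h] by blast
  then have dV: "openin ?Y (?d ` V)" using op(2) by (rule openin_trans_full)
  have "homeomorphic_map (subtopology (subtopology ?X U) V) (subtopology (subtopology ?Y (?d ` U)) (?d ` V)) ?d"
    by (rule homeomorphic_map_subtopologies [OF h]) (use tU V in auto)
  moreover have "U \<inter> V = V" "?d ` U \<inter> ?d ` V = ?d ` V" using V by auto
  ultimately show ?thesis using V(1) dV by (simp add: sheet_def subtopology_subtopology)
qed

lemma sheet_exists:
  assumes "topological_graph E" "e \<in> topspace (edges E)" shows "\<exists>U. sheet E U \<and> e \<in> U"
  using assms by (auto simp: topological_graph_def local_homeomorphism_def sheet_def)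

definition section_of :: "('v, 'e) topgraph \<Rightarrow> 'e set \<Rightarrow> 'v \<Rightarrow> 'e" where
  "section_of E U = inv_into U (dmap E)"

lemma sheet_inj: "sheet E U \<Longrightarrow> inj_on (dmap E) U"
  using homeomorphic_imp_injective_map openin_subset
  unfolding sheet_def by (metis inf.absorb2 topspace_subtopology)

lemma section_of:
  assumes "sheet E U"
  shows "e \<in> U \<Longrightarrow> section_of E U (dmap E e) = e"
    and "v \<in> dmap E ` U \<Longrightarrow> section_of E U v \<in> U"
    and "v \<in> dmap E ` U \<Longrightarrow> dmap E (section_of E U v) = v"
  using sheet_inj [OF assms] by (simp_all add: section_of_def inv_into_into f_inv_into_f)

lemma continuous_section_of:
  assumes "sheet E U"
  shows "continuous_map (subtopology (vertices E) (dmap E ` U)) (edges E) (section_of E U)"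
proof -
  let ?X = "edges E" and ?Y = "vertices E" and ?d = "dmap E"
  have h: "homeomorphic_map (subtopology ?X U) (subtopology ?Y (?d ` U)) ?d"
    and op: "openin ?X U" "openin ?Y (?d ` U)" using assms by (auto simp: sheet_def)
  then obtain g where g: "homeomorphic_maps (subtopology ?X U) (subtopology ?Y (?d ` U)) ?d g"
    using homeomorphic_map_maps by blast
  then have "continuous_map (subtopology ?Y (?d ` U)) (subtopology ?X U) g"
    by (simp add: homeomorphic_maps_def)
  then have "continuous_map (subtopology ?Y (?d ` U)) ?X g"
    by (rule continuous_map_into_fulltopology)
  then show ?thesis
  proof (rule continuous_map_eq)
    fix v assume "v \<in> topspace (subtopology ?Y (?d ` U))"
    then obtain e where e: "e \<in> U" "v = ?d e" by auto
    then have "e \<in> topspace (subtopology ?X U)" using openin_subset [OF op(1)] by auto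
    then have "g (?d e) = e" using g by (simp add: homeomorphic_maps_def)
    then show "g v = section_of E U v" using e section_of(1) [OF assms] by simp
  qed
qed

text \<open>Not an evenly covered neighbourhood: edges over \<open>V\<close> outside the chosen
  sheets are allowed, possibly infinitely many in a fibre. Their contribution is treated as a
  tail.\<close>

definition sheets_over :: "('v, 'e) topgraph \<Rightarrow> 'v set \<Rightarrow> 'e set set \<Rightarrow> bool" where
  "sheets_over E V \<U> \<longleftrightarrow> openin (vertices E) V \<and> finite \<U> \<and> pairwise disjnt \<U> \<and>
     (\<forall>U\<in>\<U>. sheet E U \<and> V \<subseteq> dmap E ` U)"

lemma sheets_over_bij:
  assumes "sheets_over E V \<U>" "v \<in> V"
  shows "bij_betw (\<lambda>U. section_of E U v) \<U> (d_fibre E v \<inter> \<Union>\<U>)"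
proof (rule bij_betwI')
  have U: "section_of E U v \<in> U" "dmap E (section_of E U v) = v" "sheet E U" if "U \<in> \<U>" for U
  proof -
    show "sheet E U" using assms that by (simp add: sheets_over_def)
    moreover have "v \<in> dmap E ` U" using assms that by (auto simp: sheets_over_def)
    ultimately show "section_of E U v \<in> U" "dmap E (section_of E U v) = v"
      by (simp_all add: section_of)
  qed
  fix U U' assume "U \<in> \<U>" "U' \<in> \<U>"
  then have "disjnt U U'" if "U \<noteq> U'"
    using assms that by (auto simp: sheets_over_def pairwise_def)
  then show "(section_of E U v = section_of E U' v) = (U = U')"
    using U(1) [OF \<open>U \<in> \<U>\<close>] U(1) [OF \<open>U' \<in> \<U>\<close>] by (metis disjnt_iff)
next
  fix U assume U: "U \<in> \<U>"
  then have "sheet E U" "v \<in> dmap E ` U" using assms by (auto simp: sheets_over_def)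
  with section_of [OF this(1)] U show "section_of E U v \<in> d_fibre E v \<inter> \<Union>\<U>"
    using openin_subset [of "edges E" U] by (auto simp: d_fibre_def sheet_def)
next
  fix e assume e: "e \<in> d_fibre E v \<inter> \<Union>\<U>"
  then obtain U where "U \<in> \<U>" "e \<in> U" "dmap E e = v" by (auto simp: d_fibre_def)
  moreover from this have "sheet E U" using assms by (auto simp: sheets_over_def)
  ultimately show "\<exists>U\<in>\<U>. e = section_of E U v" using section_of(1) by metis
qed

text \<open>Every fibre over \<open>V\<close> meets each sheet exactly once, so the sum is a sum
  over the fixed finite index set \<open>\<U>\<close> of \<open>g\<close> composed with the
  continuous local sections.\<close>

lemma sheets_over_sum_continuous:
  fixes g :: "'e \<Rightarrow> 'b::real_normed_vector"
  assumes \<U>: "sheets_over E V \<U>" and g: "continuous_map (edges E) euclidean g"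
  shows "continuous_map (subtopology (vertices E) V) euclidean (\<lambda>v. \<Sum>e\<in>d_fibre E v \<inter> \<Union>\<U>. g e)"
proof -
  have "continuous_map (subtopology (vertices E) V) euclidean (\<lambda>v. g (section_of E U v))" if "U \<in> \<U>" for U
  proof -
    have U: "sheet E U" "V \<subseteq> dmap E ` U" using \<U> that by (auto simp: sheets_over_def)
    have "continuous_map (subtopology (vertices E) V) (edges E) (section_of E U)"
      by (rule continuous_map_from_subtopology_mono [OF continuous_section_of [OF U(1)] U(2)])
    from continuous_map_compose [OF this g] show ?thesis by (simp add: o_def)
  qed
  then have "continuous_map (subtopology (vertices E) V) euclidean (\<lambda>v. \<Sum>U\<in>\<U>. g (section_of E U v))"
    using \<U> by (intro continuous_map_sum) (auto simp: sheets_over_def)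
  then show ?thesis
  proof (rule continuous_map_eq)
    fix v assume "v \<in> topspace (subtopology (vertices E) V)"
    then have "v \<in> V" by simp
    from sum.reindex_bij_betw [OF sheets_over_bij [OF \<U> this], of g]
    show "(\<Sum>U\<in>\<U>. g (section_of E U v)) = (\<Sum>e\<in>d_fibre E v \<inter> \<Union>\<U>. g e)" .
  qed
qed

lemma finite_fibre_sheets:
  assumes "sheets_over E V \<U>" "v \<in> V" shows "finite (d_fibre E v \<inter> \<Union>\<U>)"
  using bij_betw_finite [OF sheets_over_bij [OF assms]] assms(1) by (simp add: sheets_over_def)

lemma card_fibre_sheets:
  assumes "sheets_over E V \<U>" "v \<in> V" shows "card (d_fibre E v \<inter> \<Union>\<U>) = card \<U>"
  using bij_betw_same_card [OF sheets_over_bij [OF assms]] by simp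

lemma infsum_fibre_split:
  fixes g :: "'e \<Rightarrow> 'b::banach"
  assumes "sheets_over E V \<U>" "v \<in> V" "g summable_on d_fibre E v"
  shows "infsum g (d_fibre E v) = (\<Sum>e\<in>d_fibre E v \<inter> \<Union>\<U>. g e) + infsum g (d_fibre E v - \<Union>\<U>)"
proof -
  have "infsum g ((d_fibre E v \<inter> \<Union>\<U>) \<union> (d_fibre E v - \<Union>\<U>))
      = infsum g (d_fibre E v \<inter> \<Union>\<U>) + infsum g (d_fibre E v - \<Union>\<U>)"
    by (rule infsum_Un_disjoint) (use assms summable_on_subset_banach in blast)+
  moreover have "(d_fibre E v \<inter> \<Union>\<U>) \<union> (d_fibre E v - \<Union>\<U>) = d_fibre E v" by blast
  ultimately show ?thesis using finite_fibre_sheets [OF assms(1,2)] by simp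
qed

lemma disjoint_sheets:
  assumes E: "topological_graph E" and F: "finite F" "F \<subseteq> topspace (edges E)"
  shows "\<exists>W. \<forall>e\<in>F. sheet E (W e) \<and> e \<in> W e \<and> (\<forall>e'\<in>F. e \<noteq> e' \<longrightarrow> disjnt (W e) (W e'))"
proof -
  define Q where "Q e e' P \<longleftrightarrow> openin (edges E) (fst P) \<and> openin (edges E) (snd P)
      \<and> e \<in> fst P \<and> e' \<in> snd P \<and> disjnt (fst P) (snd P)" for e e' and P :: "'b set \<times> 'b set"
  define P where "P e e' = (SOME p. Q e e' p)" for e e'
  have "\<exists>p. Q e e' p"
    if "e \<in> F" "e' \<in> F" "e \<noteq> e'" for e e'
  proof -
    have "Hausdorff_space (edges E)" using E by (simp add: topological_graph_def)
    moreover have "e \<in> topspace (edges E)" "e' \<in> topspace (edges E)" using that F(2) by auto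
    ultimately have "\<exists>U V. openin (edges E) U \<and> openin (edges E) V \<and> e \<in> U \<and> e' \<in> V \<and> disjnt U V"
      using \<open>e \<noteq> e'\<close> unfolding Hausdorff_space_def by simp
    then obtain U V where "openin (edges E) U" "openin (edges E) V" "e \<in> U" "e' \<in> V" "disjnt U V" by blast
    then show ?thesis by (intro exI [of _ "(U, V)"]) (simp add: Q_def)
  qed
  then have "Q e e' (P e e')" if "e \<in> F" "e' \<in> F" "e \<noteq> e'" for e e'
    using that unfolding P_def by (intro someI_ex [of "Q e e'"])
  then have P: "openin (edges E) (fst (P e e')) \<and> openin (edges E) (snd (P e e'))
      \<and> e \<in> fst (P e e') \<and> e' \<in> snd (P e e') \<and> disjnt (fst (P e e')) (snd (P e e'))"
    if "e \<in> F" "e' \<in> F" "e \<noteq> e'" for e e'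
    using that unfolding Q_def by blast
  have "\<forall>e\<in>F. \<exists>U. sheet E U \<and> e \<in> U" using sheet_exists [OF E] F(2) by blast
  then obtain U where U: "\<And>e. e \<in> F \<Longrightarrow> sheet E (U e) \<and> e \<in> U e" by metis
  \<comment> \<open>The separating pair \<open>P e e'\<close> is chosen without symmetry, so both
    roles of \<open>e\<close> are intersected: the first set of \<open>P e e'\<close> and the second
    set of \<open>P e' e\<close>. The whole space is included to keep the family nonempty when
    \<open>F\<close> is a singleton.\<close>
  define W where "W e = U e \<inter> \<Inter> ((\<lambda>e'. fst (P e e') \<inter> snd (P e' e)) ` (F - {e}) \<union> {topspace (edges E)})" for e
  have W: "openin (edges E) (W e)" "e \<in> W e" "W e \<subseteq> U e" if e: "e \<in> F" for e
  proof -
    show "e \<in> W e" "W e \<subseteq> U e" using P U e F(2) by (auto simp: W_def)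
    show "openin (edges E) (W e)"
      unfolding W_def
    proof (intro openin_Int openin_Inter)
      show "openin (edges E) (U e)" using U e by (simp add: sheet_def)
      show "finite ((\<lambda>e'. fst (P e e') \<inter> snd (P e' e)) ` (F - {e}) \<union> {topspace (edges E)})" using F by simp
      fix S assume "S \<in> (\<lambda>e'. fst (P e e') \<inter> snd (P e' e)) ` (F - {e}) \<union> {topspace (edges E)}"
      then show "openin (edges E) S" using P e by (auto intro!: openin_Int)
    qed simp
  qed
  have "disjnt (W e) (W e')" if "e \<in> F" "e' \<in> F" "e \<noteq> e'" for e e'
  proof -
    have "W e \<subseteq> fst (P e e')" "W e' \<subseteq> snd (P e e')" using that by (auto simp: W_def)
    moreover have "disjnt (fst (P e e')) (snd (P e e'))" using P that by blast
    ultimately show ?thesis unfolding disjnt_def by blast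
  qed
  moreover have "sheet E (W e)" if "e \<in> F" for e
    using sheet_subset W [OF that] U [OF that] by blast
  ultimately show ?thesis using W by (intro exI [of _ W]) blast
qed

text \<open>Finitely many edges over \<open>v0\<close> carry the sum up to
  \<open>\<epsilon>/2\<close>; put disjoint sheets around them. Over the common image the tail is
  the total sum, continuous by assumption, minus the continuous sum over the sheets. It is below
  \<open>\<epsilon>\<close> at \<open>v0\<close>, hence on a neighbourhood.\<close>

lemma fibre_tail:
  assumes E: "topological_graph E" and a: "continuous_map (edges E) euclideanreal a"
    and summable: "\<And>v. v \<in> topspace (vertices E) \<Longrightarrow> a summable_on d_fibre E v"
    and S: "continuous_map (vertices E) euclideanreal (\<lambda>v. infsum a (d_fibre E v))"
    and v0: "v0 \<in> topspace (vertices E)" and \<epsilon>: "0 < \<epsilon>"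
  shows "\<exists>V \<U>. sheets_over E V \<U> \<and> v0 \<in> V \<and> (\<forall>v\<in>V. infsum a (d_fibre E v - \<Union>\<U>) < \<epsilon>)"
proof -
  obtain F where F: "finite F" "F \<subseteq> d_fibre E v0" "dist (sum a F) (infsum a (d_fibre E v0)) \<le> \<epsilon>/2"
    using infsum_finite_approximation [OF summable [OF v0], of "\<epsilon>/2"] \<epsilon> by auto
  have "F \<subseteq> topspace (edges E)" using F(2) by (auto simp: d_fibre_def)
  then obtain W where W: "\<And>e. e \<in> F \<Longrightarrow> sheet E (W e) \<and> e \<in> W e"
    and disj: "\<And>e e'. \<lbrakk>e \<in> F; e' \<in> F; e \<noteq> e'\<rbrakk> \<Longrightarrow> disjnt (W e) (W e')"
    using disjoint_sheets [OF E F(1)] by blast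
  define \<U> where "\<U> = W ` F"
  define V0 where "V0 = \<Inter> ((\<lambda>U. dmap E ` U) ` \<U> \<union> {topspace (vertices E)})"
  have V0: "openin (vertices E) V0"
    unfolding V0_def using F(1) W by (intro openin_Inter) (auto simp: \<U>_def sheet_def)
  have dF: "dmap E e = v0" if "e \<in> F" for e using that F(2) by (auto simp: d_fibre_def)
  have v0V: "v0 \<in> V0"
    unfolding V0_def \<U>_def using v0 W dF by (force simp: image_iff)
  have so: "sheets_over E V0 \<U>"
    unfolding sheets_over_def
    using V0 F(1) W disj by (auto simp: \<U>_def V0_def pairwise_def)
  define h where "h v = infsum a (d_fibre E v) - (\<Sum>e\<in>d_fibre E v \<inter> \<Union>\<U>. a e)" for v
  have "continuous_map (subtopology (vertices E) V0) euclideanreal h"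
    unfolding h_def
    by (intro continuous_map_diff sheets_over_sum_continuous [OF so a] continuous_map_from_subtopology [OF S])
  then have "openin (subtopology (vertices E) V0) {v \<in> topspace (subtopology (vertices E) V0). h v \<in> {..<\<epsilon>}}"
    by (rule openin_continuous_map_preimage) simp
  then have op: "openin (vertices E) {v \<in> V0. h v < \<epsilon>}"
    using V0 openin_subset [OF V0] openin_trans_full by (fastforce simp: Int_absorb1)
  have h: "h v = infsum a (d_fibre E v - \<Union>\<U>)" if "v \<in> V0" for v
    using infsum_fibre_split [OF so that summable] that openin_subset [OF V0] by (auto simp: h_def)
  \<comment> \<open>Each sheet contains its own edge of \<open>F\<close> over \<open>v0\<close> and
    \<open>d\<close> is injective on it, so the sheets contribute no further edge over
    \<open>v0\<close>. The tail at \<open>v0\<close> is thus exactly the total minus the sum over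
    \<open>F\<close>.\<close>
  have "F = d_fibre E v0 \<inter> \<Union>\<U>"
  proof
    show "F \<subseteq> d_fibre E v0 \<inter> \<Union>\<U>" using F(2) W by (auto simp: \<U>_def)
    show "d_fibre E v0 \<inter> \<Union>\<U> \<subseteq> F"
    proof
      fix e assume "e \<in> d_fibre E v0 \<inter> \<Union>\<U>"
      then obtain e' where e': "e' \<in> F" "e \<in> W e'" "dmap E e = v0" by (auto simp: d_fibre_def \<U>_def)
      then have "e = e'" using inj_onD [OF sheet_inj] W [OF e'(1)] dF [OF e'(1)] by metis
      then show "e \<in> F" using e' by simp
    qed
  qed
  moreover have "infsum a (d_fibre E v0) - sum a F < \<epsilon>"
    using F(3) \<epsilon> unfolding dist_real_def by linarith
  ultimately have "h v0 < \<epsilon>" by (simp add: h_def)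
  moreover have "sheets_over E {v \<in> V0. h v < \<epsilon>} \<U>"
    using so op by (auto simp: sheets_over_def)
  ultimately show ?thesis
    using v0V h by (intro exI [of _ "{v \<in> V0. h v < \<epsilon>}"] exI [of _ \<U>]) auto
qed

lemma dmap_in_vertices:
  assumes "topological_graph E" "e \<in> topspace (edges E)" shows "dmap E e \<in> topspace (vertices E)"
proof -
  obtain U where "sheet E U" "e \<in> U" using sheet_exists [OF assms] by blast
  then have "openin (vertices E) (dmap E ` U)" "e \<in> U" by (simp_all add: sheet_def)
  then show ?thesis using openin_subset by blast
qed

lemma d_fibre_outside:
  assumes "topological_graph E" "v \<notin> topspace (vertices E)" shows "d_fibre E v = {}"
  using dmap_in_vertices [OF assms(1)] assms(2) by (auto simp: d_fibre_def)

text \<open>Dominating weights. The model is the squared modulus of an element of \<open>Cd\<close>,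
  and domination by such a weight plays the part of an integrable majorant.\<close>

definition fibre_C0 :: "('v, 'e) topgraph \<Rightarrow> ('e \<Rightarrow> real) \<Rightarrow> bool" where
  "fibre_C0 E a \<longleftrightarrow> continuous_map (edges E) euclideanreal a \<and> (\<forall>e. 0 \<le> a e) \<and>
     (\<forall>v\<in>topspace (vertices E). a summable_on d_fibre E v) \<and>
     (\<lambda>v. complex_of_real (infsum a (d_fibre E v))) \<in> C0 (vertices E)"

lemma fibre_C0D:
  assumes "fibre_C0 E a"
  shows "continuous_map (edges E) euclideanreal a" "\<And>e. 0 \<le> a e"
    and "\<And>v. v \<in> topspace (vertices E) \<Longrightarrow> a summable_on d_fibre E v"
    and "(\<lambda>v. complex_of_real (infsum a (d_fibre E v))) \<in> C0 (vertices E)"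
  using assms by (auto simp: fibre_C0_def)

lemma fibre_C0_continuous:
  assumes "fibre_C0 E a" shows "continuous_map (vertices E) euclideanreal (\<lambda>v. infsum a (d_fibre E v))"
proof -
  have "continuous_map (vertices E) euclidean (\<lambda>v. Re (complex_of_real (infsum a (d_fibre E v))))"
    by (rule continuous_map_compose_isCont [OF C0_continuous [OF fibre_C0D(4) [OF assms]]])
      (intro continuous_intros)
  then show ?thesis by simp
qed

lemma fibre_sum_nonneg: "fibre_C0 E a \<Longrightarrow> 0 \<le> infsum a A"
  by (simp add: infsum_nonneg fibre_C0D(2))

lemma fibre_abs_summable:
  fixes g :: "'e \<Rightarrow> complex"
  assumes a: "fibre_C0 E a" and v: "v \<in> topspace (vertices E)"
    and le: "\<And>e. e \<in> topspace (edges E) \<Longrightarrow> cmod (g e) \<le> a e"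
  shows "(\<lambda>e. cmod (g e)) summable_on d_fibre E v"
  by (rule summable_on_comparison_test [OF fibre_C0D(3) [OF a v]]) (auto simp: d_fibre_def le)

lemma norm_infsum_fibre_le:
  fixes g :: "'e \<Rightarrow> complex"
  assumes a: "fibre_C0 E a" and v: "v \<in> topspace (vertices E)"
    and le: "\<And>e. e \<in> topspace (edges E) \<Longrightarrow> cmod (g e) \<le> a e" and A: "A \<subseteq> d_fibre E v"
  shows "cmod (infsum g A) \<le> infsum a A"
proof -
  have g: "(\<lambda>e. cmod (g e)) summable_on A"
    by (rule summable_on_subset_banach [OF fibre_abs_summable [OF a v le] A])
  have aA: "a summable_on A" by (rule summable_on_subset_banach [OF fibre_C0D(3) [OF a v] A])
  have "cmod (infsum g A) \<le> infsum (\<lambda>e. cmod (g e)) A" by (rule norm_infsum_bound [OF g])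
  also have "\<dots> \<le> infsum a A"
    by (rule infsum_mono [OF g aA]) (use A le in \<open>auto simp: d_fibre_def\<close>)
  finally show ?thesis .
qed

text \<open>Dominated convergence, locally uniform in the base point: near \<open>v0\<close> the sum
  of \<open>g\<close> differs from the sum over finitely many sheets by at most the tail of
  \<open>a\<close>, below e/3, and the sum over the sheets is continuous.\<close>

lemma fibre_sum_C0:
  fixes g :: "'e \<Rightarrow> complex"
  assumes E: "topological_graph E" and a: "fibre_C0 E a" and g: "continuous_map (edges E) euclidean g"
    and le: "\<And>e. e \<in> topspace (edges E) \<Longrightarrow> cmod (g e) \<le> a e"
  shows "(\<lambda>v. infsum g (d_fibre E v)) \<in> C0 (vertices E)"
proof (rule C0_dominated [where c = 1, OF _ _ fibre_C0D(4) [OF a]])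
  show "cmod (infsum g (d_fibre E v)) \<le> 1 * cmod (complex_of_real (infsum a (d_fibre E v)))"
    if "v \<in> topspace (vertices E)" for v
    using norm_infsum_fibre_le [OF a that le order_refl] fibre_sum_nonneg [OF a, of "d_fibre E v"] by simp
  show "infsum g (d_fibre E v) = 0" if "v \<notin> topspace (vertices E)" for v
    using d_fibre_outside [OF E that] by simp
  show "continuous_map (vertices E) euclidean (\<lambda>v. infsum g (d_fibre E v))"
    unfolding continuous_map_euclidean_eps
  proof (intro ballI allI impI)
    fix v0 and e :: real assume v0: "v0 \<in> topspace (vertices E)" and e: "0 < e"
    then have "0 < e/3" by simp
    from fibre_tail [OF E fibre_C0D(1) [OF a] fibre_C0D(3) [OF a] fibre_C0_continuous [OF a] v0 this]
    obtain V \<U> where so: "sheets_over E V \<U>" and V: "v0 \<in> V"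
      and tail: "\<forall>v\<in>V. infsum a (d_fibre E v - \<Union>\<U>) < e/3" by blast
    define h where "h v = (\<Sum>e\<in>d_fibre E v \<inter> \<Union>\<U>. g e)" for v
    have opV: "openin (vertices E) V" using so by (simp add: sheets_over_def)
    have VY: "V \<subseteq> topspace (vertices E)" by (rule openin_subset [OF opV])
    have "continuous_map (subtopology (vertices E) V) euclidean h"
      unfolding h_def by (rule sheets_over_sum_continuous [OF so g])
    moreover have "v0 \<in> topspace (subtopology (vertices E) V)" using V VY by auto
    ultimately obtain W where W: "openin (subtopology (vertices E) V) W" "v0 \<in> W"
      "\<forall>v\<in>W. dist (h v) (h v0) < e/3"
      unfolding continuous_map_euclidean_eps using e by (meson \<open>0 < e/3\<close>)
    have W': "openin (vertices E) W" by (rule openin_trans_full [OF W(1) opV])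
    have WV: "W \<subseteq> V" using openin_subset [OF W(1)] by auto
    have near: "dist (infsum g (d_fibre E v)) (h v) < e/3" if "v \<in> V" for v
    proof -
      have v: "v \<in> topspace (vertices E)" using that VY by blast
      have "infsum g (d_fibre E v) = h v + infsum g (d_fibre E v - \<Union>\<U>)"
        unfolding h_def
        by (rule infsum_fibre_split [OF so that abs_summable_summable [OF fibre_abs_summable [OF a v le]]])
      moreover have "cmod (infsum g (d_fibre E v - \<Union>\<U>)) \<le> infsum a (d_fibre E v - \<Union>\<U>)"
        by (rule norm_infsum_fibre_le [OF a v le]) auto
      ultimately show ?thesis using tail that by (auto simp: dist_norm)
    qed
    have "dist (infsum g (d_fibre E v)) (infsum g (d_fibre E v0)) < e" if "v \<in> W" for v
    proof -
      have "dist (infsum g (d_fibre E v)) (h v) < e/3" "dist (h v) (h v0) < e/3"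
        "dist (h v0) (infsum g (d_fibre E v0)) < e/3"
        using near W(3) that WV V by (auto simp: dist_commute)
      then show ?thesis
        using dist_triangle [of "infsum g (d_fibre E v)" "infsum g (d_fibre E v0)" "h v"]
          dist_triangle [of "h v" "infsum g (d_fibre E v0)" "h v0"] by linarith
    qed
    then show "\<exists>U. openin (vertices E) U \<and> v0 \<in> U \<and>
        (\<forall>v\<in>U. dist (infsum g (d_fibre E v)) (infsum g (d_fibre E v0)) < e)"
      using W' W(2) by (intro exI [of _ W]) simp
  qed
qed

lemma fibre_C0_dominated:
  assumes E: "topological_graph E" and a: "fibre_C0 E a" and b: "continuous_map (edges E) euclideanreal b"
    and nn: "\<And>e. 0 \<le> b e" and le: "\<And>e. e \<in> topspace (edges E) \<Longrightarrow> b e \<le> a e"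
  shows "fibre_C0 E b"
proof -
  have s: "b summable_on d_fibre E v" if "v \<in> topspace (vertices E)" for v
    by (rule summable_on_comparison_test [OF fibre_C0D(3) [OF a that]]) (auto simp: d_fibre_def le nn)
  have "(\<lambda>v. infsum (\<lambda>e. complex_of_real (b e)) (d_fibre E v)) \<in> C0 (vertices E)"
  proof (rule fibre_sum_C0 [OF E a])
    show "continuous_map (edges E) euclidean (\<lambda>e. complex_of_real (b e))"
      by (rule continuous_map_compose_isCont [OF b]) (intro continuous_intros)
  qed (simp add: le nn)
  moreover have "infsum (\<lambda>e. complex_of_real (b e)) (d_fibre E v) = complex_of_real (infsum b (d_fibre E v))" for v
  proof (cases "v \<in> topspace (vertices E)")
    case True
    show ?thesis by (rule infsumI [OF has_sum_of_real [OF has_sum_infsum [OF s [OF True]]]])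
  next
    case False
    then show ?thesis using d_fibre_outside [OF E False] by simp
  qed
  ultimately show ?thesis using b nn s by (simp add: fibre_C0_def)
qed

lemma fibre_C0_scale:
  assumes "fibre_C0 E a" "0 \<le> c" shows "fibre_C0 E (\<lambda>e. c * a e)"
  using assms C0_scal [OF fibre_C0D(4) [OF assms(1)], of "of_real c"]
  by (simp add: fibre_C0_def summable_on_cmult_right infsum_cmult_right' continuous_map_real_mult_left)

lemma fibre_C0_add:
  assumes E: "topological_graph E" and a: "fibre_C0 E a" and b: "fibre_C0 E b"
  shows "fibre_C0 E (\<lambda>e. a e + b e)"
proof -
  have "infsum (\<lambda>e. a e + b e) (d_fibre E v) = infsum a (d_fibre E v) + infsum b (d_fibre E v)" for v
  proof (cases "v \<in> topspace (vertices E)")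
    case True
    then show ?thesis using fibre_C0D(3) [OF a] fibre_C0D(3) [OF b] by (simp add: infsum_add)
  next
    case False
    then show ?thesis using d_fibre_outside [OF E False] by simp
  qed
  moreover have "(\<lambda>v. complex_of_real (infsum a (d_fibre E v)) + complex_of_real (infsum b (d_fibre E v))) \<in> C0 (vertices E)"
    by (rule C0_add [OF fibre_C0D(4) [OF a] fibre_C0D(4) [OF b]])
  ultimately show ?thesis
    using fibre_C0D [OF a] fibre_C0D [OF b]
    by (simp add: fibre_C0_def summable_on_add continuous_map_add)
qed

text \<open>Compactness as an induction principle: a property that holds near each point and passes
  to unions holds near the whole compact set. It serves below for compact level sets, for the Dini
  estimate and for bump functions.\<close>

lemma compactin_local_induct:
  assumes K: "compactin X K" and loc: "\<And>x. x \<in> K \<Longrightarrow> \<exists>V. openin X V \<and> x \<in> V \<and> P V"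
    and 0: "P {}" and Un: "\<And>U V. \<lbrakk>P U; P V\<rbrakk> \<Longrightarrow> P (U \<union> V)"
  shows "\<exists>V. openin X V \<and> K \<subseteq> V \<and> P V"
proof -
  let ?\<V> = "{V. openin X V \<and> P V}"
  have "K \<subseteq> \<Union>?\<V>" using loc by blast
  moreover have "openin X U" if "U \<in> ?\<V>" for U using that by simp
  ultimately obtain \<F> where F: "finite \<F>" "\<F> \<subseteq> ?\<V>" "K \<subseteq> \<Union>\<F>"
    using compactinD [OF K, of ?\<V>] by blast
  from F(1,2) have "openin X (\<Union>\<F>) \<and> P (\<Union>\<F>)"
  proof (induction \<F> rule: finite_induct)
    case (insert V \<F>)
    then have "openin X V" "P V" "openin X (\<Union>\<F>)" "P (\<Union>\<F>)" by auto
    then show ?case by (simp add: openin_Un Un)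
  qed (simp add: 0)
  with F(3) show ?thesis by blast
qed

lemma fibre_le_infsum:
  assumes a: "fibre_C0 E a" and v: "v \<in> topspace (vertices E)" and A: "A \<subseteq> d_fibre E v" and e: "e \<in> A"
  shows "a e \<le> infsum a A"
proof -
  have "infsum a {e} \<le> infsum a A"
    by (rule infsum_mono2) (use e fibre_C0D(2) [OF a] summable_on_subset_banach [OF fibre_C0D(3) [OF a v] A] in auto)
  then show ?thesis by simp
qed

text \<open>An edge with weight at least \<open>\<epsilon>\<close> cannot belong to a tail below
  \<open>\<epsilon>\<close>. Over a compact neighbourhood \<open>N\<close> such edges therefore lie
  in the images of \<open>N\<close> under finitely many sections, a compact set. Their base points
  have fibre sum at least \<open>\<epsilon>\<close>, so they stay in the compact set
  \<open>?K\<close>, which is covered by finitely many such neighbourhoods.\<close>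

lemma fibre_C0_compact:
  assumes E: "topological_graph E" and a: "fibre_C0 E a" and \<epsilon>: "0 < \<epsilon>"
  shows "compactin (edges E) {e \<in> topspace (edges E). \<epsilon> \<le> a e}"
proof -
  let ?S = "\<lambda>v. infsum a (d_fibre E v)"
  let ?K = "{v \<in> topspace (vertices E). \<epsilon> \<le> cmod (complex_of_real (?S v))}"
  let ?P = "\<lambda>V. \<exists>C. compactin (edges E) C \<and> {e \<in> topspace (edges E). \<epsilon> \<le> a e \<and> dmap E e \<in> V} \<subseteq> C"
  have nb: "neighbourhood_base_of (compactin (vertices E)) (vertices E)"
    using E locally_compact_space_neighbourhood_base [of "vertices E"] by (simp add: topological_graph_def)
  have "\<exists>V. openin (vertices E) V \<and> ?K \<subseteq> V \<and> ?P V"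
  proof (rule compactin_local_induct [OF C0_compact [OF fibre_C0D(4) [OF a] \<epsilon>]])
    fix v0 assume "v0 \<in> ?K"
    then have v0: "v0 \<in> topspace (vertices E)" by simp
    from fibre_tail [OF E fibre_C0D(1) [OF a] fibre_C0D(3) [OF a] fibre_C0_continuous [OF a] v0 \<epsilon>]
    obtain V \<U> where so: "sheets_over E V \<U>" and V: "v0 \<in> V"
      and tail: "\<forall>v\<in>V. infsum a (d_fibre E v - \<Union>\<U>) < \<epsilon>" by blast
    have opV: "openin (vertices E) V" using so by (simp add: sheets_over_def)
    obtain V' N where N: "openin (vertices E) V'" "compactin (vertices E) N" "v0 \<in> V'" "V' \<subseteq> N" "N \<subseteq> V"
      using nb [unfolded neighbourhood_base_of, rule_format, OF conjI [OF opV V]] by blast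
    define C where "C = \<Union> ((\<lambda>U. section_of E U ` N) ` \<U>)"
    have "compactin (edges E) C"
      unfolding C_def
    proof (rule compactin_Union)
      fix S assume "S \<in> (\<lambda>U. section_of E U ` N) ` \<U>"
      then obtain U where U: "U \<in> \<U>" "S = section_of E U ` N" by blast
      then have "sheet E U" "N \<subseteq> dmap E ` U" using so N(5) by (auto simp: sheets_over_def)
      then show "compactin (edges E) S"
        unfolding U(2) using N(2)
        by (intro image_compactin [OF _ continuous_section_of]) (simp_all add: compactin_subtopology)
    qed (use so in \<open>simp add: sheets_over_def\<close>)
    moreover have "e \<in> C" if e: "e \<in> topspace (edges E)" "\<epsilon> \<le> a e" "dmap E e \<in> V'" for e
    proof -
      have v: "dmap E e \<in> V" "dmap E e \<in> topspace (vertices E)" using e N openin_subset [OF opV] by auto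
      have "e \<in> \<Union>\<U>"
      proof (rule ccontr)
        assume "e \<notin> \<Union>\<U>"
        then have "a e \<le> infsum a (d_fibre E (dmap E e) - \<Union>\<U>)"
          using e by (intro fibre_le_infsum [OF a v(2)]) (auto simp: d_fibre_def)
        then show False using tail v(1) e(2) by (auto dest: bspec)
      qed
      then obtain U where U: "U \<in> \<U>" "e \<in> U" by blast
      then have "section_of E U (dmap E e) = e" using so section_of(1) [of E U e] by (auto simp: sheets_over_def)
      then have "e \<in> section_of E U ` N" using e(3) N(4) by (metis image_eqI subsetD)
      then show ?thesis using U(1) by (auto simp: C_def)
    qed
    ultimately have "?P V'" by (intro exI [of _ C]) auto
    then show "\<exists>V. openin (vertices E) V \<and> v0 \<in> V \<and> ?P V" using N by blast
  next
    show "?P {}" by (intro exI [of _ "{}"]) simp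
  next
    fix U V assume "?P U" "?P V"
    then obtain C D where "compactin (edges E) C" "{e \<in> topspace (edges E). \<epsilon> \<le> a e \<and> dmap E e \<in> U} \<subseteq> C"
      "compactin (edges E) D" "{e \<in> topspace (edges E). \<epsilon> \<le> a e \<and> dmap E e \<in> V} \<subseteq> D" by blast
    then show "?P (U \<union> V)" by (intro exI [of _ "C \<union> D"]) (auto intro: compactin_Un)
  qed
  then obtain V C where V: "?K \<subseteq> V" and C: "compactin (edges E) C"
    "{e \<in> topspace (edges E). \<epsilon> \<le> a e \<and> dmap E e \<in> V} \<subseteq> C" by blast
  have "{e \<in> topspace (edges E). \<epsilon> \<le> a e} \<subseteq> C"
  proof
    fix e assume e: "e \<in> {e \<in> topspace (edges E). \<epsilon> \<le> a e}"
    then have v: "dmap E e \<in> topspace (vertices E)" using dmap_in_vertices [OF E] by simp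
    have "a e \<le> ?S (dmap E e)" using e by (intro fibre_le_infsum [OF a v]) (auto simp: d_fibre_def)
    then have "dmap E e \<in> ?K" using v e fibre_sum_nonneg [OF a, of "d_fibre E (dmap E e)"] by simp
    then show "e \<in> C" using V C(2) e by blast
  qed
  moreover have "closedin (edges E) {e \<in> topspace (edges E). \<epsilon> \<le> norm (a e)}"
    by (rule closedin_norm_ge [OF fibre_C0D(1) [OF a]])
  ultimately show ?thesis using closed_compactin [OF C(1)] fibre_C0D(2) [OF a] by simp
qed

text \<open>Truncating the weight at height \<open>\<delta>\<close> makes its fibre sums uniformly
  small. Near a point of \<open>?K\<close> the tail is below \<open>\<epsilon>/2\<close>, and the
  sheets contribute at most \<open>\<delta>\<close> each; compactness gives one
  \<open>\<delta>\<close> for all of \<open>?K\<close>. Off \<open>?K\<close> the untruncated sum is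
  already small.\<close>

lemma fibre_C0_dini:
  assumes E: "topological_graph E" and a: "fibre_C0 E a" and \<epsilon>: "0 < \<epsilon>"
  shows "\<exists>\<delta>>0. \<forall>v. infsum (\<lambda>e. min (a e) \<delta>) (d_fibre E v) \<le> \<epsilon>"
proof -
  let ?S = "\<lambda>v. infsum a (d_fibre E v)"
  let ?K = "{v \<in> topspace (vertices E). \<epsilon> \<le> cmod (complex_of_real (?S v))}"
  let ?P = "\<lambda>V. \<exists>\<delta>>0. \<forall>v\<in>V \<inter> topspace (vertices E). infsum (\<lambda>e. min (a e) \<delta>) (d_fibre E v) \<le> \<epsilon>"
  have sm: "(\<lambda>e. min (a e) \<delta>) summable_on A" if "v \<in> topspace (vertices E)" "0 < \<delta>" "A \<subseteq> d_fibre E v" for v \<delta> A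
    by (rule summable_on_comparison_test [OF summable_on_subset_banach [OF fibre_C0D(3) [OF a that(1)] that(3)]])
      (use that fibre_C0D(2) [OF a] in auto)
  have mono: "infsum (\<lambda>e. min (a e) \<delta>) (d_fibre E v) \<le> infsum (\<lambda>e. min (a e) \<delta>') (d_fibre E v)"
    if "v \<in> topspace (vertices E)" "0 < \<delta>" "\<delta> \<le> \<delta>'" for v \<delta> \<delta>'
    by (rule infsum_mono [OF sm [OF that(1,2) order_refl] sm [OF that(1) _ order_refl]]) (use that in auto)
  have "\<exists>V. openin (vertices E) V \<and> ?K \<subseteq> V \<and> ?P V"
  proof (rule compactin_local_induct [OF C0_compact [OF fibre_C0D(4) [OF a] \<epsilon>]])
    fix v0 assume "v0 \<in> ?K"
    then have v0: "v0 \<in> topspace (vertices E)" by simp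
    have "0 < \<epsilon>/2" using \<epsilon> by simp
    from fibre_tail [OF E fibre_C0D(1) [OF a] fibre_C0D(3) [OF a] fibre_C0_continuous [OF a] v0 this]
    obtain V \<U> where so: "sheets_over E V \<U>" and V: "v0 \<in> V"
      and tail: "\<forall>v\<in>V. infsum a (d_fibre E v - \<Union>\<U>) < \<epsilon>/2" by blast
    have opV: "openin (vertices E) V" using so by (simp add: sheets_over_def)
    \<comment> \<open>Chosen so that one edge per sheet, each counted with at most
      \<open>\<delta>\<close>, adds up to at most \<open>\<epsilon>/2\<close>; the 1 covers an empty
      family of sheets.\<close>
    define \<delta> where "\<delta> = \<epsilon> / (2 * (real (card \<U>) + 1))"
    have \<delta>: "0 < \<delta>" using \<epsilon> by (simp add: \<delta>_def)
    have c: "real (card \<U>) * \<delta> \<le> \<epsilon>/2" using \<epsilon> by (simp add: \<delta>_def field_simps)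
    have "infsum (\<lambda>e. min (a e) \<delta>) (d_fibre E v) \<le> \<epsilon>" if v: "v \<in> V" for v
    proof -
      have vY: "v \<in> topspace (vertices E)" using openin_subset [OF opV] v by blast
      have "infsum (\<lambda>e. min (a e) \<delta>) (d_fibre E v)
          = (\<Sum>e\<in>d_fibre E v \<inter> \<Union>\<U>. min (a e) \<delta>) + infsum (\<lambda>e. min (a e) \<delta>) (d_fibre E v - \<Union>\<U>)"
        by (rule infsum_fibre_split [OF so v sm [OF vY \<delta> order_refl]])
      moreover have "(\<Sum>e\<in>d_fibre E v \<inter> \<Union>\<U>. min (a e) \<delta>) \<le> real (card (d_fibre E v \<inter> \<Union>\<U>)) * \<delta>"
        by (rule sum_bounded_above) simp
      moreover have "infsum (\<lambda>e. min (a e) \<delta>) (d_fibre E v - \<Union>\<U>) \<le> infsum a (d_fibre E v - \<Union>\<U>)"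
        by (rule infsum_mono [OF sm [OF vY \<delta>] summable_on_subset_banach [OF fibre_C0D(3) [OF a vY]]]) auto
      ultimately show ?thesis using tail v c card_fibre_sheets [OF so v] by (auto dest: bspec)
    qed
    then have "?P V" using \<delta> by (intro exI [of _ \<delta>]) auto
    then show "\<exists>V. openin (vertices E) V \<and> v0 \<in> V \<and> ?P V" using opV V by blast
  next
    show "?P {}" by (intro exI [of _ 1]) simp
  next
    fix U V assume "?P U" "?P V"
    then obtain \<delta> \<delta>' where d: "0 < \<delta>" "\<forall>v\<in>U \<inter> topspace (vertices E). infsum (\<lambda>e. min (a e) \<delta>) (d_fibre E v) \<le> \<epsilon>"
      "0 < \<delta>'" "\<forall>v\<in>V \<inter> topspace (vertices E). infsum (\<lambda>e. min (a e) \<delta>') (d_fibre E v) \<le> \<epsilon>" by blast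
    have "infsum (\<lambda>e. min (a e) (min \<delta> \<delta>')) (d_fibre E v) \<le> \<epsilon>"
      if "v \<in> (U \<union> V) \<inter> topspace (vertices E)" for v
    proof -
      have v: "v \<in> topspace (vertices E)" using that by simp
      have p: "0 < min \<delta> \<delta>'" using d by simp
      show ?thesis
      proof (cases "v \<in> U")
        case True
        then show ?thesis using order_trans [OF mono [OF v p min.cobounded1]] d(2) v by blast
      next
        case False
        then show ?thesis using order_trans [OF mono [OF v p min.cobounded2]] d(4) that by blast
      qed
    qed
    then show "?P (U \<union> V)" using d(1,3) by (intro exI [of _ "min \<delta> \<delta>'"]) simp
  qed
  then obtain V \<delta> where V: "?K \<subseteq> V" and \<delta>: "\<delta> > 0"
    "\<forall>v\<in>V \<inter> topspace (vertices E). infsum (\<lambda>e. min (a e) \<delta>) (d_fibre E v) \<le> \<epsilon>" by blast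
  have "infsum (\<lambda>e. min (a e) \<delta>) (d_fibre E v) \<le> \<epsilon>" for v
  proof (cases "v \<in> topspace (vertices E)")
    case True
    show ?thesis
    proof (cases "v \<in> ?K")
      case False
      have "infsum (\<lambda>e. min (a e) \<delta>) (d_fibre E v) \<le> ?S v"
        by (rule infsum_mono [OF sm [OF True \<delta>(1) order_refl] fibre_C0D(3) [OF a True]]) simp
      then show ?thesis using False True fibre_sum_nonneg [OF a, of "d_fibre E v"] by simp
    qed (use V \<delta>(2) in blast)
  next
    case False
    then show ?thesis using d_fibre_outside [OF E False] \<epsilon> by simp
  qed
  then show ?thesis using \<delta>(1) by blast
qed

section \<open>The Hilbert module of a topological graph\<close>

lemma inner_Cd_self:
  assumes E: "topological_graph E" and s: "\<And>v. v \<in> topspace (vertices E) \<Longrightarrow> (\<lambda>e. (cmod (\<xi> e))\<^sup>2) summable_on d_fibre E v"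
  shows "inner_Cd E \<xi> \<xi> v = complex_of_real (infsum (\<lambda>e. (cmod (\<xi> e))\<^sup>2) (d_fibre E v))"
proof -
  have eq: "inner_Cd E \<xi> \<xi> v = infsum (\<lambda>e. complex_of_real ((cmod (\<xi> e))\<^sup>2)) (d_fibre E v)"
    unfolding inner_Cd_def by (rule infsum_cong) (simp only: complex_norm_square mult.commute)
  show ?thesis
  proof (cases "v \<in> topspace (vertices E)")
    case True
    show ?thesis unfolding eq by (rule infsumI [OF has_sum_of_real [OF has_sum_infsum [OF s [OF True]]]])
  next
    case False
    then show ?thesis unfolding eq using d_fibre_outside [OF E False] by simp
  qed
qed

lemma continuous_map_norm_square:
  assumes "continuous_map X euclidean \<xi>" shows "continuous_map X euclideanreal (\<lambda>e. (cmod (\<xi> e))\<^sup>2)"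
  by (rule continuous_map_compose_isCont [OF assms]) (intro continuous_intros)

text \<open>Membership in the module becomes a statement about the nonnegative weight formed by the
  squared modulus, so the domination lemmas apply to closure properties of
  \<open>Cd\<close>.\<close>

lemma Cd_iff:
  assumes E: "topological_graph E"
  shows "\<xi> \<in> Cd E \<longleftrightarrow> continuous_map (edges E) euclidean \<xi> \<and> (\<forall>e. e \<notin> topspace (edges E) \<longrightarrow> \<xi> e = 0)
    \<and> fibre_C0 E (\<lambda>e. (cmod (\<xi> e))\<^sup>2)"
proof -
  have "inner_Cd E \<xi> \<xi> = (\<lambda>v. complex_of_real (infsum (\<lambda>e. (cmod (\<xi> e))\<^sup>2) (d_fibre E v)))"
    if "\<forall>v\<in>topspace (vertices E). (\<lambda>e. (cmod (\<xi> e))\<^sup>2) summable_on d_fibre E v"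
    using inner_Cd_self [OF E] that by blast
  then show ?thesis
    unfolding Cd_def fibre_C0_def using continuous_map_norm_square by auto
qed

lemma CdD:
  assumes "topological_graph E" "\<xi> \<in> Cd E"
  shows Cd_continuous: "continuous_map (edges E) euclidean \<xi>"
    and Cd_outside: "\<And>e. e \<notin> topspace (edges E) \<Longrightarrow> \<xi> e = 0"
    and Cd_fibre_C0: "fibre_C0 E (\<lambda>e. (cmod (\<xi> e))\<^sup>2)"
  using assms Cd_iff by auto

lemma Cd_dominated:
  assumes E: "topological_graph E" and a: "fibre_C0 E a"
    and \<eta>: "continuous_map (edges E) euclidean \<eta>" "\<And>e. e \<notin> topspace (edges E) \<Longrightarrow> \<eta> e = 0"
    and le: "\<And>e. e \<in> topspace (edges E) \<Longrightarrow> (cmod (\<eta> e))\<^sup>2 \<le> a e"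
  shows "\<eta> \<in> Cd E"
  unfolding Cd_iff [OF E]
  using fibre_C0_dominated [OF E a continuous_map_norm_square [OF \<eta>(1)] _ le] \<eta> by simp

lemma square_norm_add_le: "(cmod (x + y))\<^sup>2 \<le> 2 * (cmod x)\<^sup>2 + 2 * (cmod y)\<^sup>2"
proof -
  have "(cmod (x + y))\<^sup>2 \<le> (cmod x + cmod y)\<^sup>2"
    by (intro power_mono norm_triangle_ineq norm_ge_zero)
  also have "\<dots> \<le> 2 * (cmod x)\<^sup>2 + 2 * (cmod y)\<^sup>2"
    using sum_squares_bound [of "cmod x" "cmod y"] by (simp add: power2_sum)
  finally show ?thesis .
qed

lemma Cd_add:
  assumes E: "topological_graph E" and \<xi>: "\<xi> \<in> Cd E" and \<eta>: "\<eta> \<in> Cd E"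
  shows "(\<lambda>e. \<xi> e + \<eta> e) \<in> Cd E"
proof (rule Cd_dominated [OF E])
  show "fibre_C0 E (\<lambda>e. 2 * (cmod (\<xi> e))\<^sup>2 + 2 * (cmod (\<eta> e))\<^sup>2)"
    using \<xi> \<eta> by (intro fibre_C0_add fibre_C0_scale E) (auto simp: Cd_iff [OF E])
qed (use CdD [OF E \<xi>] CdD [OF E \<eta>] square_norm_add_le in \<open>auto intro: continuous_map_add\<close>)

lemma Cd_times_bounded:
  assumes E: "topological_graph E" and \<xi>: "\<xi> \<in> Cd E" and g: "continuous_map (edges E) euclidean g"
    and M: "\<And>e. e \<in> topspace (edges E) \<Longrightarrow> cmod (g e) \<le> M"
  shows "(\<lambda>e. g e * \<xi> e) \<in> Cd E"
proof (rule Cd_dominated [OF E])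
  show "fibre_C0 E (\<lambda>e. M\<^sup>2 * (cmod (\<xi> e))\<^sup>2)"
    using \<xi> by (intro fibre_C0_scale) (auto simp: Cd_iff [OF E])
  show "(cmod (g e * \<xi> e))\<^sup>2 \<le> M\<^sup>2 * (cmod (\<xi> e))\<^sup>2" if "e \<in> topspace (edges E)" for e
    using power_mono [OF M [OF that], of 2] by (simp add: norm_mult power_mult_distrib mult_right_mono)
qed (use CdD [OF E \<xi>] g in \<open>auto intro: continuous_map_times\<close>)

lemma Cd_scal:
  assumes E: "topological_graph E" and \<xi>: "\<xi> \<in> Cd E" shows "(\<lambda>e. c * \<xi> e) \<in> Cd E"
  by (rule Cd_times_bounded [OF E \<xi>, where M="cmod c"]) auto

lemma left_act_Cd:
  assumes E: "topological_graph E" and f: "f \<in> C0 (vertices E)" and \<xi>: "\<xi> \<in> Cd E"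
  shows "left_act E f \<xi> \<in> Cd E"
proof -
  obtain M where M: "\<forall>x. cmod (f x) \<le> M" using C0_bounded [OF f] by blast
  have "continuous_map (edges E) (vertices E) (rmap E)" using E by (simp add: topological_graph_def)
  from continuous_map_compose [OF this C0_continuous [OF f]]
  have "continuous_map (edges E) euclidean (\<lambda>e. f (rmap E e))" by (simp add: o_def)
  from Cd_times_bounded [OF E \<xi> this] M show ?thesis
    unfolding left_act_def [abs_def] by blast
qed

lemma inner_C0:
  assumes E: "topological_graph E" and "\<xi> \<in> Cd E" "\<eta> \<in> Cd E"
  shows "inner_Cd E \<xi> \<eta> \<in> C0 (vertices E)"
proof -
  have a: "fibre_C0 E (\<lambda>e. (cmod (\<xi> e))\<^sup>2 + (cmod (\<eta> e))\<^sup>2)"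
    using assms by (intro fibre_C0_add E Cd_fibre_C0)
  have le: "cmod (cnj (\<xi> e) * \<eta> e) \<le> (cmod (\<xi> e))\<^sup>2 + (cmod (\<eta> e))\<^sup>2" for e
  proof -
    have "2 * (cmod (\<xi> e) * cmod (\<eta> e)) \<le> (cmod (\<xi> e))\<^sup>2 + (cmod (\<eta> e))\<^sup>2"
      using sum_squares_bound [of "cmod (\<xi> e)" "cmod (\<eta> e)"] by (simp only: mult.assoc)
    moreover have "0 \<le> cmod (\<xi> e) * cmod (\<eta> e)" by simp
    ultimately show ?thesis unfolding norm_mult complex_mod_cnj by linarith
  qed
  have "continuous_map (edges E) euclidean (\<lambda>e. cnj (\<xi> e) * \<eta> e)"
    using Cd_continuous [OF E] assms
    by (intro continuous_map_times continuous_map_compose_isCont [where h=cnj] continuous_intros) auto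
  from fibre_sum_C0 [OF E a this le] show "inner_Cd E \<xi> \<eta> \<in> C0 (vertices E)"
    by (simp add: inner_Cd_def [abs_def])
qed

text \<open>An instance of \<open>fibre_C0_compact\<close>. It is what allows elements of
  \<open>Cd\<close> to be extended by 0 at infinity, and hence to be pulled back continuously along
  factor maps.\<close>

lemma Cd_subset_C0:
  assumes E: "topological_graph E" and \<xi>: "\<xi> \<in> Cd E" shows "\<xi> \<in> C0 (edges E)"
proof (rule C0I)
  fix \<epsilon> :: real assume "0 < \<epsilon>"
  then have "compactin (edges E) {e \<in> topspace (edges E). \<epsilon>\<^sup>2 \<le> (cmod (\<xi> e))\<^sup>2}"
    by (intro fibre_C0_compact E Cd_fibre_C0 \<xi>) simp
  then show "\<exists>K. compactin (edges E) K \<and> {x \<in> topspace (edges E). \<epsilon> \<le> cmod (\<xi> x)} \<subseteq> K"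
    using \<open>0 < \<epsilon>\<close> by (intro exI conjI) (auto intro: power_mono)
qed (use CdD [OF E \<xi>] in auto)

lemma C0_algebra_sel:
  "carr (C0_algebra X) = C0 X" "add (C0_algebra X) u v = (\<lambda>x. u x + v x)"
  "scal (C0_algebra X) c u = (\<lambda>x. c * u x)" "mul (C0_algebra X) u v = (\<lambda>x. u x * v x)"
  "star (C0_algebra X) u = (\<lambda>x. cnj (u x))"
  by (simp_all add: C0_algebra_def)

section \<open>Pulling back along factor maps\<close>

lemma pull_back_apply:
  "x \<in> topspace X \<Longrightarrow> pull_back X m f x = case_option 0 f (m (Some x))"
  "x \<notin> topspace X \<Longrightarrow> pull_back X m f x = 0"
  by (simp_all add: pull_back_def)

lemma Alexandroff_map_in:
  assumes "continuous_map (Alexandroff_compactification X) (Alexandroff_compactification Y) m"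
    and "x \<in> topspace X" "m (Some x) = Some y"
  shows "y \<in> topspace Y"
  using continuous_map_image_subset_topspace [OF assms(1)] assms(2,3) by fastforce

lemma factor_mapD:
  assumes "factor_map F E m0 m1"
  shows "continuous_map (Alexandroff_compactification (vertices F)) (Alexandroff_compactification (vertices E)) m0"
    and "continuous_map (Alexandroff_compactification (edges F)) (Alexandroff_compactification (edges E)) m1"
    and "m0 None = None" "m1 None = None"
    and "\<And>e e'. \<lbrakk>e \<in> topspace (edges F); m1 (Some e) = Some e'\<rbrakk>
      \<Longrightarrow> Some (rmap E e') = m0 (Some (rmap F e)) \<and> Some (dmap E e') = m0 (Some (dmap F e))"
    and "\<And>e' v. \<lbrakk>e' \<in> topspace (edges E); v \<in> topspace (vertices F); Some (dmap E e') = m0 (Some v)\<rbrakk>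
      \<Longrightarrow> \<exists>!e. e \<in> topspace (edges F) \<and> m1 (Some e) = Some e' \<and> dmap F e = v"
proof -
  note f = assms [unfolded factor_map_def]
  show c: "continuous_map (Alexandroff_compactification (edges F)) (Alexandroff_compactification (edges E)) m1"
    using f by blast
  show "Some (rmap E e') = m0 (Some (rmap F e)) \<and> Some (dmap E e') = m0 (Some (dmap F e))"
    if "e \<in> topspace (edges F)" "m1 (Some e) = Some e'" for e e'
    using f that Alexandroff_map_in [OF c that] by blast
qed (use assms [unfolded factor_map_def] in blast)+

text \<open>The unique lifting condition says that \<open>m1\<close> maps the edges over
  \<open>v\<close> with finite image bijectively onto the fibre over \<open>m0 (Some v)\<close>. All
  other edges over \<open>v\<close> contribute 0, so the sum is merely reindexed.\<close>

lemma fibre_pull_back: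
  fixes G :: "'e \<Rightarrow> 'b::{topological_comm_monoid_add, t2_space}"
  assumes m: "factor_map F E m0 m1" and v: "v \<in> topspace (vertices F)"
  shows "infsum (\<lambda>e. case_option 0 G (m1 (Some e))) (d_fibre F v)
      = case_option 0 (\<lambda>w. infsum G (d_fibre E w)) (m0 (Some v))" (is ?infsum)
    and "(\<And>w. w \<in> topspace (vertices E) \<Longrightarrow> G summable_on d_fibre E w)
      \<Longrightarrow> (\<lambda>e. case_option 0 G (m1 (Some e))) summable_on d_fibre F v"
proof -
  note f = factor_mapD [OF m]
  let ?g = "\<lambda>e. case_option 0 G (m1 (Some e))"
  have "?infsum \<and> ((\<forall>w\<in>topspace (vertices E). G summable_on d_fibre E w) \<longrightarrow> ?g summable_on d_fibre F v)"
  proof (cases "m0 (Some v)")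
    case None
    \<comment> \<open>If an edge over \<open>v\<close> had a finite image, then compatibility with
      \<open>d\<close> would give \<open>m0 (Some v)\<close> a finite value, against the case
      assumption.\<close>
    have z: "?g e = 0" if "e \<in> d_fibre F v" for e
    proof (cases "m1 (Some e)")
      case (Some e')
      then show ?thesis using f(5) [of e e'] that None by (simp add: d_fibre_def)
    qed simp
    then have "?g summable_on d_fibre F v" using summable_on_cong [of "d_fibre F v" ?g "\<lambda>_. 0"] by simp
    then show ?thesis using None infsum_0 [of "d_fibre F v" ?g] z by simp
  next
    case (Some w)
    define A where "A = {e \<in> d_fibre F v. m1 (Some e) \<noteq> None}"
    have w: "w \<in> topspace (vertices E)" by (rule Alexandroff_map_in [OF f(1) v Some])
    have bij: "bij_betw (\<lambda>e. the (m1 (Some e))) A (d_fibre E w)"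
    proof (rule bij_betwI')
      fix e1 e2 assume e: "e1 \<in> A" "e2 \<in> A"
      then obtain e1' e2' where e': "m1 (Some e1) = Some e1'" "m1 (Some e2) = Some e2'" by (auto simp: A_def)
      have F: "e1 \<in> topspace (edges F)" "e2 \<in> topspace (edges F)" "dmap F e1 = v" "dmap F e2 = v"
        using e by (auto simp: A_def d_fibre_def)
      have "e1 = e2" if "e1' = e2'"
        using f(6) [OF Alexandroff_map_in [OF f(2) F(1) e'(1)] v] f(5) [OF F(1) e'(1)] F e' that by auto
      then show "(the (m1 (Some e1)) = the (m1 (Some e2))) = (e1 = e2)" using e' by auto
    next
      fix e assume e: "e \<in> A"
      then obtain e' where e': "m1 (Some e) = Some e'" by (auto simp: A_def)
      have "e \<in> topspace (edges F)" "dmap F e = v" using e by (auto simp: A_def d_fibre_def)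
      then show "the (m1 (Some e)) \<in> d_fibre E w"
        using f(5) [of e e'] Alexandroff_map_in [OF f(2), of e e'] e' Some by (simp add: d_fibre_def)
    next
      fix e' assume "e' \<in> d_fibre E w"
      then have "e' \<in> topspace (edges E)" "Some (dmap E e') = m0 (Some v)" by (auto simp: d_fibre_def Some)
      from f(6) [OF this(1) v this(2)] obtain e where "e \<in> topspace (edges F)" "m1 (Some e) = Some e'" "dmap F e = v"
        by blast
      then show "\<exists>e\<in>A. e' = the (m1 (Some e))" by (intro bexI [of _ e]) (auto simp: A_def d_fibre_def)
    qed
    have eqA: "?g e = G (the (m1 (Some e)))" if "e \<in> A" for e using that by (auto simp: A_def)
    have out: "?g e = 0" if "e \<in> d_fibre F v - A" for e using that by (auto simp: A_def)
    have AF: "A \<subseteq> d_fibre F v" by (auto simp: A_def)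
    have "infsum ?g (d_fibre F v) = infsum (\<lambda>e. G (the (m1 (Some e)))) A"
      by (rule infsum_cong_neutral) (use eqA out AF in auto)
    also have "\<dots> = infsum G (d_fibre E w)" by (rule infsum_reindex_bij_betw [OF bij])
    finally have 1: "infsum ?g (d_fibre F v) = infsum G (d_fibre E w)" .
    have "?g summable_on d_fibre F v \<longleftrightarrow> (\<lambda>e. G (the (m1 (Some e)))) summable_on A"
      by (rule summable_on_cong_neutral) (use eqA out AF in auto)
    also have "\<dots> \<longleftrightarrow> G summable_on d_fibre E w" by (rule summable_on_reindex_bij_betw [OF bij])
    finally show ?thesis using 1 w Some by simp
  qed
  then show ?infsum and "(\<And>w. w \<in> topspace (vertices E) \<Longrightarrow> G summable_on d_fibre E w)
      \<Longrightarrow> ?g summable_on d_fibre F v"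
    by blast+
qed

locale factor =
  fixes F :: "('w, 'f) topgraph" and E :: "('v, 'e) topgraph" and m0 m1
  assumes F: "topological_graph F" and E: "topological_graph E" and m: "factor_map F E m0 m1"
begin

abbreviation "p0 \<equiv> pull_back (vertices F) m0"
abbreviation "p1 \<equiv> pull_back (edges F) m1"

lemma p0_C0: "f \<in> C0 (vertices E) \<Longrightarrow> p0 f \<in> C0 (vertices F)"
  by (rule pull_back_C0 [OF factor_mapD(1,3) [OF m]])

lemma p1_C0: "f \<in> C0 (edges E) \<Longrightarrow> p1 f \<in> C0 (edges F)"
  by (rule pull_back_C0 [OF factor_mapD(2,4) [OF m]])

lemma inner_p1: "inner_Cd F (p1 \<xi>) (p1 \<eta>) = p0 (inner_Cd E \<xi> \<eta>)"
proof
  fix v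
  show "inner_Cd F (p1 \<xi>) (p1 \<eta>) v = p0 (inner_Cd E \<xi> \<eta>) v"
  proof (cases "v \<in> topspace (vertices F)")
    case True
    have "inner_Cd F (p1 \<xi>) (p1 \<eta>) v
        = infsum (\<lambda>e. case_option 0 (\<lambda>e. cnj (\<xi> e) * \<eta> e) (m1 (Some e))) (d_fibre F v)"
      unfolding inner_Cd_def
      by (rule infsum_cong) (auto simp: d_fibre_def pull_back_apply split: option.splits)
    also have "\<dots> = case_option 0 (\<lambda>w. infsum (\<lambda>e. cnj (\<xi> e) * \<eta> e) (d_fibre E w)) (m0 (Some v))"
      by (rule fibre_pull_back(1) [OF m True])
    finally show ?thesis using True by (simp add: pull_back_apply inner_Cd_def [abs_def])
  next
    case False
    then show ?thesis using d_fibre_outside [OF F False] by (simp add: inner_Cd_def pull_back_apply)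
  qed
qed

lemma p1_Cd:
  assumes \<xi>: "\<xi> \<in> Cd E" shows "p1 \<xi> \<in> Cd F"
proof -
  have 1: "p1 \<xi> \<in> C0 (edges F)" by (rule p1_C0 [OF Cd_subset_C0 [OF E \<xi>]])
  have "(\<lambda>e. (cmod (p1 \<xi> e))\<^sup>2) summable_on d_fibre F v" if v: "v \<in> topspace (vertices F)" for v
  proof -
    have "(\<lambda>e. case_option 0 (\<lambda>e. (cmod (\<xi> e))\<^sup>2) (m1 (Some e))) summable_on d_fibre F v"
      by (rule fibre_pull_back(2) [OF m v fibre_C0D(3) [OF Cd_fibre_C0 [OF E \<xi>]]])
    moreover have "(\<lambda>e. (cmod (p1 \<xi> e))\<^sup>2) summable_on d_fibre F v
        \<longleftrightarrow> (\<lambda>e. case_option 0 (\<lambda>e. (cmod (\<xi> e))\<^sup>2) (m1 (Some e))) summable_on d_fibre F v"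
      by (rule summable_on_cong) (auto simp: d_fibre_def pull_back_apply split: option.splits)
    ultimately show ?thesis by blast
  qed
  moreover have "inner_Cd F (p1 \<xi>) (p1 \<xi>) \<in> C0 (vertices F)"
  proof -
    have "inner_Cd E \<xi> \<xi> \<in> C0 (vertices E)" using \<xi> by (simp add: Cd_def)
    then show ?thesis unfolding inner_p1 by (rule p0_C0)
  qed
  ultimately show ?thesis using C0_continuous [OF 1] C0_outside [OF 1] by (simp add: Cd_def)
qed

lemma left_act_p1: "left_act F (p0 f) (p1 \<xi>) = p1 (left_act E f \<xi>)"
proof
  fix e
  show "left_act F (p0 f) (p1 \<xi>) e = p1 (left_act E f \<xi>) e"
  proof (cases "e \<in> topspace (edges F)")
    case True
    have "continuous_map (edges F) (vertices F) (rmap F)" using F by (simp add: topological_graph_def)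
    then have r: "rmap F e \<in> topspace (vertices F)"
      using True continuous_map_image_subset_topspace by blast
    show ?thesis
    proof (cases "m1 (Some e)")
      case (Some e')
      have "m0 (Some (rmap F e)) = Some (rmap E e')" using factor_mapD(5) [OF m True Some] by simp
      then show ?thesis using True r Some by (simp add: left_act_def pull_back_apply)
    qed (use True in \<open>simp add: left_act_def pull_back_apply\<close>)
  qed (simp add: left_act_def pull_back_apply)
qed

end

lemma pull_back_pull_back:
  assumes "continuous_map (Alexandroff_compactification X) (Alexandroff_compactification Y) m"
    and "m' None = None" and "\<And>x. x \<in> topspace X \<Longrightarrow> m'' (Some x) = m' (m (Some x))"
  shows "pull_back X m (pull_back Y m' f) = pull_back X m'' f"
proof
  fix x show "pull_back X m (pull_back Y m' f) x = pull_back X m'' f x"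
  proof (cases "x \<in> topspace X")
    case True
    then show ?thesis using assms(2,3) Alexandroff_map_in [OF assms(1) True]
      by (cases "m (Some x)") (simp_all add: pull_back_apply)
  qed (simp add: pull_back_apply)
qed

lemma pull_back_arith:
  "pull_back X m (\<lambda>x. f x + g x) = (\<lambda>x. pull_back X m f x + pull_back X m g x)"
  "pull_back X m (\<lambda>x. c * f x) = (\<lambda>x. c * pull_back X m f x)"
  "pull_back X m (\<lambda>x. f x * g x) = (\<lambda>x. pull_back X m f x * pull_back X m g x)"
  "pull_back X m (\<lambda>x. cnj (f x)) = (\<lambda>x. cnj (pull_back X m f x))"
  by (auto simp: pull_back_def fun_eq_iff split: option.splits)

section \<open>The universal Toeplitz algebra\<close>

lemma star_algebra_nrm_update:
  assumes "star_algebra A" shows "star_algebra (A\<lparr>nrm := p\<rparr>)"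
proof -
  interpret A: star_algebra A by fact
  have s: "sub (A\<lparr>nrm := p\<rparr>) x y = sub A x y" for x y by (simp add: sub_def)
  show ?thesis
    by unfold_locales
      (simp_all add: s A.add_assoc A.sub_self A.scal_add A.add_scal A.mul_assoc A.mul_add A.add_mul
        A.mul_scal A.scal_mul A.star_add A.star_scal A.star_mul, rule A.add_commute)
qed

lemma star_hom_nrm_update [simp]: "star_hom (A\<lparr>nrm := p\<rparr>) B h \<longleftrightarrow> star_hom A B h"
  by (simp add: star_hom_def)

lemma sub_nrm_update [simp]: "sub (A\<lparr>nrm := p\<rparr>) x y = sub A x y"
  by (simp add: sub_def)

text \<open>Continuity of the two homomorphisms is automatic by \<open>star_hom_contractive\<close>,
  so agreement on the dense image of \<open>A\<close> is enough.\<close>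

lemma completion_hom_eqI:
  assumes A: "cstar_seminormed A" and B: "cstar_algebra B"
    and \<phi>: "star_hom (completion A) B \<phi>" and \<psi>: "star_hom (completion A) B \<psi>"
    and eq: "\<And>x. x \<in> carr A \<Longrightarrow> \<phi> (to_completion A x) = \<psi> (to_completion A x)"
    and P: "P \<in> carr (completion A)"
  shows "\<phi> P = \<psi> P"
proof -
  interpret A: cstar_seminormed A by fact
  interpret C: cstar_algebra "completion A" by (rule A.cstar_algebra_completion)
  interpret B: cstar_algebra B by fact
  have [simp]: "\<phi> Q \<in> carr B" "\<psi> Q \<in> carr B" if "Q \<in> carr (completion A)" for Q
    using that star_homD(1) [OF \<phi>] star_homD(1) [OF \<psi>] by auto
  have "nrm B (sub B (\<phi> P) (\<psi> P)) \<le> 0"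
  proof (rule field_le_epsilon)
    fix e :: real assume "e > 0"
    then have "e/2 > 0" by simp
    from A.completion_dense [OF P this] obtain x where x: "x \<in> carr A"
      and d: "nrm (completion A) (sub (completion A) (to_completion A x) P) < e/2" by blast
    have c: "nrm B (sub B (h (to_completion A x)) (h P)) < e/2" if h: "star_hom (completion A) B h" for h
    proof -
      have "nrm B (h (sub (completion A) (to_completion A x) P)) < e/2"
        using star_hom_contractive [OF C.cstar_algebra_axioms B.cstar_seminormed_axioms h,
            of "sub (completion A) (to_completion A x) P"] d P x by simp
      then show ?thesis using star_hom_sub [OF h C.star_algebra_axioms] P x by simp
    qed
    have "nrm B (sub B (\<phi> P) (\<psi> P))
        \<le> nrm B (sub B (\<phi> P) (\<phi> (to_completion A x))) + nrm B (sub B (\<phi> (to_completion A x)) (\<psi> P))"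
      by (rule B.nrm_triangle) (use P x in auto)
    then show "nrm B (sub B (\<phi> P) (\<psi> P)) \<le> 0 + e"
      using c [OF \<phi>] c [OF \<psi>] eq [OF x] B.nrm_sub_commute [of "\<phi> P" "\<phi> (to_completion A x)"] P x by simp
  qed
  then have "nrm B (sub B (\<phi> P) (\<psi> P)) = 0" using B.nrm_nonneg [of "sub B (\<phi> P) (\<psi> P)"] P by simp
  then show ?thesis using P by (intro B.nrm_sub_zero) auto
qed

text \<open>The circle argument again, now with an explicit circle function in place of the fixed
  point. Writing it down directly spares a proof that \<open>C0_algebra X\<close> is complete, and
  yields the bound in terms of any pointwise majorant \<open>M\<close>.\<close>

lemma C0_hom_bound:
  assumes B: "cstar_seminormed B" and \<phi>: "star_hom (C0_algebra X) B \<phi>"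
    and f: "f \<in> C0 X" and M: "\<And>x. x \<in> topspace X \<Longrightarrow> cmod (f x) \<le> M" "0 \<le> M"
  shows "nrm B (\<phi> f) \<le> M"
proof (rule field_le_epsilon)
  interpret B: cstar_seminormed B by fact
  note h = star_homD [OF \<phi>, unfolded C0_algebra_sel]
  fix e :: real assume e: "0 < e"
  define r where "r = M + e"
  have r: "0 < r" using M(2) e by (simp add: r_def)
  have f_lt: "cmod (f x) \<le> r" for x
  proof (cases "x \<in> topspace X")
    case True
    then show ?thesis using M(1) e by (fastforce simp: r_def)
  next
    case False
    then show ?thesis using r C0_outside [OF f False] by simp
  qed
  define g where "g = (\<lambda>x. complex_of_real (1/r\<^sup>2) * (cnj (f x) * f x))"
  define s where "s x = (cmod (f x))\<^sup>2 / r\<^sup>2" for x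
  have s: "0 \<le> s x" "s x \<le> 1" for x
    using power_mono [OF f_lt [of x], of 2] r by (simp_all add: s_def)
  have gs: "g x = complex_of_real (s x)" for x
  proof -
    have "cnj (f x) * f x = complex_of_real ((cmod (f x))\<^sup>2)"
      by (simp only: complex_norm_square mult.commute)
    then show ?thesis by (simp add: g_def s_def)
  qed
  have g: "g \<in> C0 X" unfolding g_def by (intro C0_scal C0_mult C0_cnj f)
  \<comment> \<open>The scalar solution of (1 - t)^2 + s^2 = 1 that vanishes with s, where
    \<open>s\<close> is the squared modulus of \<open>f\<close> divided by the square of
    \<open>r\<close>.\<close>
  define t where "t x = complex_of_real (1 - sqrt (1 - s x * s x))" for x
  have ss: "s x * s x \<le> 1" "0 \<le> s x * s x" for x
    using s [of x] by (simp_all add: mult_le_one)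
  \<comment> \<open>Vanishing at infinity comes from the domination 1 - sqrt(1 - s^2) \<le> s^2
    \<le> s, valid for s between 0 and 1.\<close>
  have t: "t \<in> C0 X"
  proof (rule C0_dominated [where c=1, OF _ _ g])
    have "continuous_map X euclidean (\<lambda>x. complex_of_real (1 - sqrt (1 - Re (g x) * Re (g x))))"
      by (rule continuous_map_compose_isCont [OF C0_continuous [OF g]]) (intro continuous_intros)
    then show "continuous_map X euclidean t" unfolding t_def [abs_def] by (simp add: gs)
    show "t x = 0" if "x \<notin> topspace X" for x
      using C0_outside [OF f that] by (simp add: t_def s_def)
    show "cmod (t x) \<le> 1 * cmod (g x)" for x
    proof -
      let ?q = "s x * s x"
      have "(1 - ?q)\<^sup>2 \<le> 1 - ?q"
        using mult_left_le [of "1 - ?q" "1 - ?q"] ss [of x] by (simp add: power2_eq_square)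
      then have "1 - ?q \<le> sqrt (1 - ?q)" by (rule real_le_rsqrt)
      moreover have "sqrt (1 - ?q) \<le> 1" using ss [of x] by simp
      moreover have "?q \<le> s x" using mult_left_le [of "s x" "s x"] s [of x] by simp
      ultimately have "\<bar>1 - sqrt (1 - ?q)\<bar> \<le> s x" by linarith
      moreover have "cmod (t x) = \<bar>1 - sqrt (1 - ?q)\<bar>" unfolding t_def norm_of_real ..
      moreover have "cmod (g x) = s x" using s(1) [of x] by (simp add: gs)
      ultimately show ?thesis by simp
    qed
  qed
  have tt: "t x * t x + g x * g x = 2 * t x" for x
  proof -
    define q where "q = sqrt (1 - s x * s x)"
    have "q * q = 1 - s x * s x" using ss [of x] by (simp add: q_def)
    then have "(1 - q) * (1 - q) + s x * s x = 2 * (1 - q)" by (simp add: algebra_simps)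
    then have "complex_of_real ((1 - q) * (1 - q) + s x * s x) = complex_of_real (2 * (1 - q))" by simp
    then show ?thesis unfolding t_def gs q_def [symmetric] by simp
  qed
  have "nrm B (\<phi> g) \<le> 1"
  proof (rule B.nrm_le_one_circle)
    show "\<phi> g \<in> carr B" "\<phi> t \<in> carr B" using h(1) g t by auto
    have "(\<lambda>x. cnj (g x)) = g" "(\<lambda>x. cnj (t x)) = t" by (simp_all add: gs t_def fun_eq_iff)
    then show "star B (\<phi> g) = \<phi> g" "star B (\<phi> t) = \<phi> t"
      using h(5) [OF g] h(5) [OF t] by simp_all
    show "mul B (\<phi> g) (\<phi> t) = mul B (\<phi> t) (\<phi> g)"
      using h(4) [OF g t] h(4) [OF t g] by (simp add: mult.commute)
    show "add B (mul B (\<phi> t) (\<phi> t)) (mul B (\<phi> g) (\<phi> g)) = scal B 2 (\<phi> t)"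
      using h(4) [OF t t] h(4) [OF g g] h(2) [OF C0_mult [OF t t] C0_mult [OF g g]] h(3) [OF t, of 2]
      by (simp add: tt)
  qed
  moreover have "nrm B (\<phi> g) = 1/r\<^sup>2 * (nrm B (\<phi> f))\<^sup>2"
  proof -
    have "\<phi> g = scal B (complex_of_real (1/r\<^sup>2)) (mul B (star B (\<phi> f)) (\<phi> f))"
      unfolding g_def h(5) [OF f, symmetric] h(4) [OF C0_cnj [OF f] f, symmetric]
      by (rule h(3) [OF C0_mult [OF C0_cnj [OF f] f]])
    moreover have "\<phi> f \<in> carr B" by (rule h(1) [OF f])
    moreover have "cmod (complex_of_real (1/r\<^sup>2)) = 1/r\<^sup>2"
      by (simp only: norm_of_real abs_of_nonneg zero_le_divide_1_iff zero_le_power2)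
    ultimately show ?thesis by (simp only: B.nrm_scal B.mul_closed B.star_closed B.nrm_star_mul)
  qed
  ultimately have "(nrm B (\<phi> f))\<^sup>2 \<le> r\<^sup>2" using r by simp
  then have "nrm B (\<phi> f) \<le> r" by (rule power2_le_imp_le) (use r in simp)
  then show "nrm B (\<phi> f) \<le> M + e" by (simp add: r_def)
qed

text \<open>The defining equations of a Toeplitz pair as pairs of free elements. A homomorphism out
  of the free algebra gives a pair iff it identifies the two sides, and a seminorm does iff it
  vanishes on their differences.\<close>

definition toeplitz_relations :: "('v, 'e) topgraph \<Rightarrow> (('v, 'e) toeplitz_pre \<times> ('v, 'e) toeplitz_pre) set" where
  "toeplitz_relations E = (let F = toeplitz_free E; a = (\<lambda>f. free_gen (Inl f)); b = (\<lambda>\<xi>. free_gen (Inr \<xi>)) in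
    {(a (\<lambda>x. f x + g x), add F (a f) (a g)) | f g. f \<in> C0 (vertices E) \<and> g \<in> C0 (vertices E)} \<union>
    {(a (\<lambda>x. c * f x), scal F c (a f)) | c f. f \<in> C0 (vertices E)} \<union>
    {(a (\<lambda>x. f x * g x), mul F (a f) (a g)) | f g. f \<in> C0 (vertices E) \<and> g \<in> C0 (vertices E)} \<union>
    {(a (\<lambda>x. cnj (f x)), star F (a f)) | f. f \<in> C0 (vertices E)} \<union>
    {(b (\<lambda>x. \<xi> x + \<eta> x), add F (b \<xi>) (b \<eta>)) | \<xi> \<eta>. \<xi> \<in> Cd E \<and> \<eta> \<in> Cd E} \<union>
    {(b (\<lambda>x. c * \<xi> x), scal F c (b \<xi>)) | c \<xi>. \<xi> \<in> Cd E} \<union>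
    {(mul F (star F (b \<xi>)) (b \<eta>), a (inner_Cd E \<xi> \<eta>)) | \<xi> \<eta>. \<xi> \<in> Cd E \<and> \<eta> \<in> Cd E} \<union>
    {(mul F (a f) (b \<xi>), b (left_act E f \<xi>)) | f \<xi>. f \<in> C0 (vertices E) \<and> \<xi> \<in> Cd E})"

lemma star_algebra_toeplitz_free: "star_algebra (toeplitz_free E)"
  unfolding toeplitz_free_def by (rule star_algebra_free)

lemma free_gen_carr [simp]: "g \<in> G \<Longrightarrow> free_gen g \<in> carr (free_star_algebra G)"
  unfolding free_gen_mono by (rule mono_carr) (simp add: words_def)

lemma toeplitz_gen_carr [simp]:
  "f \<in> C0 (vertices E) \<Longrightarrow> free_gen (Inl f) \<in> carr (toeplitz_free E)"
  "\<xi> \<in> Cd E \<Longrightarrow> free_gen (Inr \<xi>) \<in> carr (toeplitz_free E)"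
  by (simp_all add: toeplitz_free_def InlI InrI)

lemma toeplitz_relations_carr:
  assumes E: "topological_graph E"
  shows "toeplitz_relations E \<subseteq> carr (toeplitz_free E) \<times> carr (toeplitz_free E)"
proof -
  interpret F: star_algebra "toeplitz_free E" by (rule star_algebra_toeplitz_free)
  note [simp] = C0_add C0_scal C0_mult C0_cnj Cd_add [OF E] Cd_scal [OF E] inner_C0 [OF E] left_act_Cd [OF E]
  show ?thesis unfolding toeplitz_relations_def Let_def by auto
qed

text \<open>Since \<open>T0\<close> and \<open>T1\<close> are the values of \<open>h\<close> on
  generators, and \<open>h\<close> respects the operations, each axiom of a pair is literally an
  equality between the images of the two sides of a relation.\<close>

lemma toeplitz_pair_iff:
  assumes E: "topological_graph E" and B: "cstar_algebra B" and h: "star_hom (toeplitz_free E) B h"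
    and T0: "\<And>f. f \<in> C0 (vertices E) \<Longrightarrow> T0 f = h (free_gen (Inl f))"
    and T1: "\<And>\<xi>. \<xi> \<in> Cd E \<Longrightarrow> T1 \<xi> = h (free_gen (Inr \<xi>))"
  shows "toeplitz_pair E B T0 T1 \<longleftrightarrow> (\<forall>(x, y)\<in>toeplitz_relations E. h x = h y)"
proof -
  interpret F: star_algebra "toeplitz_free E" by (rule star_algebra_toeplitz_free)
  note [simp] = C0_add C0_scal C0_mult C0_cnj Cd_add [OF E] Cd_scal [OF E] inner_C0 [OF E] left_act_Cd [OF E]
  have ball2: "(\<forall>(x, y)\<in>{(a u v, b u v) | u v. P u v}. h x = h y) \<longleftrightarrow> (\<forall>u v. P u v \<longrightarrow> h (a u v) = h (b u v))"
    for a b :: "'x \<Rightarrow> 'y \<Rightarrow> ('a, 'b) toeplitz_pre" and P by blast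
  have ball1: "(\<forall>(x, y)\<in>{(a u, b u) | u. P u}. h x = h y) \<longleftrightarrow> (\<forall>u. P u \<longrightarrow> h (a u) = h (b u))"
    for a b :: "'x \<Rightarrow> ('a, 'b) toeplitz_pre" and P by blast
  show ?thesis
    unfolding toeplitz_pair_def star_hom_def C0_algebra_sel toeplitz_relations_def Let_def ball_Un ball1 ball2
    using B by (simp add: T0 T1 star_homD [OF h]) blast
qed

lemma toeplitz_seminorm_iff:
  assumes E: "topological_graph E"
  shows "toeplitz_seminorm E p \<longleftrightarrow> cstar_seminormed ((toeplitz_free E)\<lparr>nrm := p\<rparr>) \<and>
    (\<forall>(x, y)\<in>toeplitz_relations E. p (sub (toeplitz_free E) x y) = 0)"
proof (cases "cstar_seminormed ((toeplitz_free E)\<lparr>nrm := p\<rparr>)")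
  case True
  let ?F = "(toeplitz_free E)\<lparr>nrm := p\<rparr>"
  interpret F: cstar_seminormed ?F by fact
  have h: "star_hom (toeplitz_free E) (completion ?F) (to_completion ?F)"
    using F.star_hom_to_completion by simp
  have "toeplitz_seminorm E p \<longleftrightarrow> (\<forall>(x, y)\<in>toeplitz_relations E. to_completion ?F x = to_completion ?F y)"
    unfolding toeplitz_seminorm_def Let_def
    using True toeplitz_pair_iff [OF E F.cstar_algebra_completion h] by simp
  also have "\<dots> \<longleftrightarrow> (\<forall>(x, y)\<in>toeplitz_relations E. p (sub (toeplitz_free E) x y) = 0)"
    using toeplitz_relations_carr [OF E] F.to_completion_eq_iff by (intro ball_cong refl) auto
  finally show ?thesis using True by simp
qed (simp add: toeplitz_seminorm_def Let_def)

lemma toeplitz_pair_bound: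
  assumes T: "toeplitz_pair E B T0 T1" and \<xi>: "\<xi> \<in> Cd E"
    and M: "\<And>v. v \<in> topspace (vertices E) \<Longrightarrow> cmod (inner_Cd E \<xi> \<xi> v) \<le> M\<^sup>2" "0 \<le> M"
  shows "nrm B (T1 \<xi>) \<le> M"
proof -
  interpret B: cstar_algebra B using T by (simp add: toeplitz_pair_def)
  have "T1 \<xi> \<in> carr B" "mul B (star B (T1 \<xi>)) (T1 \<xi>) = T0 (inner_Cd E \<xi> \<xi>)"
    using T \<xi> by (auto simp: toeplitz_pair_def)
  then have "(nrm B (T1 \<xi>))\<^sup>2 = nrm B (T0 (inner_Cd E \<xi> \<xi>))"
    using B.nrm_star_mul [of "T1 \<xi>"] by simp
  also have "\<dots> \<le> M\<^sup>2"
    by (rule C0_hom_bound [OF B.cstar_seminormed_axioms _ _ M(1)])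
      (use T \<xi> in \<open>auto simp: toeplitz_pair_def Cd_def\<close>)
  finally show ?thesis by (rule power2_le_imp_le) (rule M(2))
qed

text \<open>The bound depends on the generator alone: a sup bound for a vertex function, and the
  square root of a sup bound of the inner product for a module element. This is the reason why the
  supremum that defines the universal norm is finite.\<close>

lemma toeplitz_seminorm_gen_bound:
  assumes E: "topological_graph E" and g: "g \<in> C0 (vertices E) <+> Cd E"
  shows "\<exists>M\<ge>0. \<forall>p. toeplitz_seminorm E p \<longrightarrow> p (free_gen g) \<le> M"
proof -
  have hom: "cstar_seminormed ((toeplitz_free E)\<lparr>nrm := p\<rparr>)"
    "toeplitz_pair E (completion ((toeplitz_free E)\<lparr>nrm := p\<rparr>))
      (\<lambda>f. to_completion ((toeplitz_free E)\<lparr>nrm := p\<rparr>) (free_gen (Inl f)))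
      (\<lambda>\<xi>. to_completion ((toeplitz_free E)\<lparr>nrm := p\<rparr>) (free_gen (Inr \<xi>)))" if "toeplitz_seminorm E p" for p
    using that by (auto simp: toeplitz_seminorm_def Let_def)
  have nrm: "nrm (completion ((toeplitz_free E)\<lparr>nrm := p\<rparr>)) (to_completion ((toeplitz_free E)\<lparr>nrm := p\<rparr>) x) = p x"
    if "toeplitz_seminorm E p" "x \<in> carr (toeplitz_free E)" for p x
  proof -
    interpret F: cstar_seminormed "(toeplitz_free E)\<lparr>nrm := p\<rparr>" by (rule hom(1) [OF that(1)])
    show ?thesis using F.nrm_to_completion [of x] that(2) by simp
  qed
  from g show ?thesis
  proof
    fix f assume f: "f \<in> C0 (vertices E)" "g = Inl f"
    obtain M where M: "M > 0" "\<forall>x. cmod (f x) \<le> M" using C0_bounded [OF f(1)] by blast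
    have "p (free_gen g) \<le> M" if p: "toeplitz_seminorm E p" for p
    proof -
      interpret F: cstar_seminormed "(toeplitz_free E)\<lparr>nrm := p\<rparr>" by (rule hom(1) [OF p])
      interpret C: cstar_algebra "completion ((toeplitz_free E)\<lparr>nrm := p\<rparr>)" by (rule F.cstar_algebra_completion)
      have s: "star_hom (C0_algebra (vertices E)) (completion ((toeplitz_free E)\<lparr>nrm := p\<rparr>))
          (\<lambda>f. to_completion ((toeplitz_free E)\<lparr>nrm := p\<rparr>) (free_gen (Inl f)))"
        using hom(2) [OF p] by (simp add: toeplitz_pair_def)
      have "nrm (completion ((toeplitz_free E)\<lparr>nrm := p\<rparr>))
          (to_completion ((toeplitz_free E)\<lparr>nrm := p\<rparr>) (free_gen (Inl f))) \<le> M"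
        using C0_hom_bound [OF C.cstar_seminormed_axioms s f(1), of M] M by simp
      then show ?thesis using nrm [OF p] f by simp
    qed
    then show ?thesis using M by (intro exI [of _ M]) simp
  next
    fix \<xi> assume \<xi>: "\<xi> \<in> Cd E" "g = Inr \<xi>"
    obtain M where M: "M > 0" "\<forall>x. cmod (inner_Cd E \<xi> \<xi> x) \<le> M"
      using C0_bounded [of "inner_Cd E \<xi> \<xi>" "vertices E"] \<xi>(1) unfolding Cd_def by blast
    have "p (free_gen g) \<le> sqrt M" if p: "toeplitz_seminorm E p" for p
      using toeplitz_pair_bound [OF hom(2) [OF p] \<xi>(1), of "sqrt M"] M nrm [OF p] \<xi> by simp
    then show ?thesis using M by (intro exI [of _ "sqrt M"]) simp
  qed
qed

text \<open>Bounds propagate from generators to starred letters by isometry of the involution, to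
  words by submultiplicativity, and to combinations by the triangle inequality, always uniformly in
  the seminorm.\<close>

lemma toeplitz_seminorm_bound:
  assumes E: "topological_graph E" and x: "x \<in> carr (toeplitz_free E)"
  shows "\<exists>M\<ge>0. \<forall>p. toeplitz_seminorm E p \<longrightarrow> p x \<le> M"
proof -
  let ?F = "toeplitz_free E" and ?G = "C0 (vertices E) <+> Cd E"
  interpret F: star_algebra ?F by (rule star_algebra_toeplitz_free)
  have P: "cstar_seminormed (?F\<lparr>nrm := p\<rparr>)" if "toeplitz_seminorm E p" for p
    using that by (simp add: toeplitz_seminorm_def Let_def)
  have letter: "\<exists>M\<ge>0. \<forall>p. toeplitz_seminorm E p \<longrightarrow> p (monomial [l]) \<le> M" if l: "fst l \<in> ?G" for l
  proof (cases l)
    case (Pair g b)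
    then obtain M where M: "M \<ge> 0" "\<forall>p. toeplitz_seminorm E p \<longrightarrow> p (free_gen g) \<le> M"
      using toeplitz_seminorm_gen_bound [OF E, of g] l by auto
    have eq: "p (monomial [l]) = p (free_gen g)" if p: "toeplitz_seminorm E p" for p
    proof (cases b)
      case True
      interpret Fp: cstar_seminormed "?F\<lparr>nrm := p\<rparr>" by (rule P [OF p])
      have "monomial [l] = star ?F (free_gen g)"
        unfolding toeplitz_free_def free_gen_mono star_mono by (simp add: word_star_def Pair True)
      moreover have "free_gen g \<in> carr ?F" using \<open>fst l \<in> ?G\<close> Pair by (simp add: toeplitz_free_def)
      ultimately show ?thesis using Fp.nrm_star [of "free_gen g"] by simp
    qed (simp add: free_gen_mono Pair)
    show ?thesis
    proof (intro exI [of _ M] conjI allI impI M(1))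
      fix p assume p: "toeplitz_seminorm E p"
      show "p (monomial [l]) \<le> M" unfolding eq [OF p] using M(2) p by blast
    qed
  qed
  have word: "\<exists>M\<ge>0. \<forall>p. toeplitz_seminorm E p \<longrightarrow> p (monomial w) \<le> M" if "w \<in> words ?G" for w
    using that
  proof (induction w)
    case (Cons l w)
    have l: "fst l \<in> ?G" using Cons(2) by (simp add: words_def)
    show ?case
    proof (cases "w = []")
      case False
      then have w: "w \<in> words ?G" "[l] \<in> words ?G" using Cons(2) by (auto simp: words_def)
      obtain M N where M: "M \<ge> 0" "\<forall>p. toeplitz_seminorm E p \<longrightarrow> p (monomial [l]) \<le> M"
        and N: "N \<ge> 0" "\<forall>p. toeplitz_seminorm E p \<longrightarrow> p (monomial w) \<le> N"
        using letter [OF l] Cons(1) [OF w(1)] by blast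
      have "p (monomial (l # w)) \<le> M * N" if p: "toeplitz_seminorm E p" for p
      proof -
        interpret Fp: cstar_seminormed "?F\<lparr>nrm := p\<rparr>" by (rule P [OF p])
        have c: "monomial [l] \<in> carr ?F" "monomial w \<in> carr ?F" using w by (simp_all add: toeplitz_free_def)
        have "monomial (l # w) = mul ?F (monomial [l]) (monomial w)" by (simp add: toeplitz_free_def mul_mono)
        then have "p (monomial (l # w)) \<le> p (monomial [l]) * p (monomial w)"
          using Fp.nrm_mul [of "monomial [l]" "monomial w"] c by simp
        also have "\<dots> \<le> M * N"
          using M N p Fp.nrm_nonneg [of "monomial w"] c by (intro mult_mono) auto
        finally show ?thesis .
      qed
      then show ?thesis using M N by (intro exI [of _ "M * N"]) simp
    qed (use letter [OF l] in simp)
  qed (simp add: words_def)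
  show ?thesis using x unfolding toeplitz_free_def
  proof (induction x rule: free_induct)
    case zer
    have "p (zer ?F) \<le> 0" if p: "toeplitz_seminorm E p" for p
    proof -
      interpret Fp: cstar_seminormed "?F\<lparr>nrm := p\<rparr>" by (rule P [OF p])
      show ?thesis using Fp.nrm_zer by simp
    qed
    then show ?case by (auto simp: toeplitz_free_def)
  next
    case (monomial w)
    then show ?case by (rule word)
  next
    case (add x y)
    then obtain M N where M: "M \<ge> 0" "\<forall>p. toeplitz_seminorm E p \<longrightarrow> p x \<le> M"
      and N: "N \<ge> 0" "\<forall>p. toeplitz_seminorm E p \<longrightarrow> p y \<le> N" by blast
    have "p (star_alg.add ?F x y) \<le> M + N" if p: "toeplitz_seminorm E p" for p
    proof -
      interpret Fp: cstar_seminormed "?F\<lparr>nrm := p\<rparr>" by (rule P [OF p])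
      have "p (star_alg.add ?F x y) \<le> p x + p y"
        using Fp.nrm_add [of x y] add(1,2) by (simp add: toeplitz_free_def)
      then show ?thesis using M N p by fastforce
    qed
    then show ?case using M N by (intro exI [of _ "M + N"]) (simp add: toeplitz_free_def)
  next
    case (scal c x)
    then obtain M where M: "M \<ge> 0" "\<forall>p. toeplitz_seminorm E p \<longrightarrow> p x \<le> M" by blast
    have "p (star_alg.scal ?F c x) \<le> cmod c * M" if p: "toeplitz_seminorm E p" for p
    proof -
      interpret Fp: cstar_seminormed "?F\<lparr>nrm := p\<rparr>" by (rule P [OF p])
      have "p (star_alg.scal ?F c x) = cmod c * p x"
        using Fp.nrm_scal [of x c] scal(1) by (simp add: toeplitz_free_def)
      then show ?thesis using M p by (simp add: mult_left_mono)
    qed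
    then show ?case using M by (intro exI [of _ "cmod c * M"]) (simp add: toeplitz_free_def)
  qed
qed

text \<open>It makes the family of seminorms nonempty, so the supremum behaves, and it shows that
  the universal norm is nonnegative.\<close>

lemma toeplitz_seminorm_zero:
  assumes "topological_graph E" shows "toeplitz_seminorm E (\<lambda>x. 0)"
  unfolding toeplitz_seminorm_iff [OF assms] cstar_seminormed_def cstar_seminormed_axioms_def
  using star_algebra_nrm_update [OF star_algebra_toeplitz_free] by auto

section \<open>The universal norm and the universal property of the Toeplitz algebra\<close>

context
  fixes E :: "('v, 'e) topgraph"
  assumes E: "topological_graph E"
begin

lemma toeplitz_universal_sel:
  "carr (toeplitz_universal E) = carr (toeplitz_free E)" "zer (toeplitz_universal E) = zer (toeplitz_free E)"
  "add (toeplitz_universal E) = add (toeplitz_free E)" "scal (toeplitz_universal E) = scal (toeplitz_free E)"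
  "mul (toeplitz_universal E) = mul (toeplitz_free E)" "star (toeplitz_universal E) = star (toeplitz_free E)"
  by (simp_all add: toeplitz_universal_def)

lemma toeplitz_universal_upper:
  assumes "toeplitz_seminorm E p" "x \<in> carr (toeplitz_free E)"
  shows "p x \<le> nrm (toeplitz_universal E) x"
proof -
  obtain M where "\<forall>p. toeplitz_seminorm E p \<longrightarrow> p x \<le> M" using toeplitz_seminorm_bound [OF E assms(2)] by blast
  then have "bdd_above ((\<lambda>p. p x) ` {p. toeplitz_seminorm E p})" by (intro bdd_aboveI [of _ M]) auto
  from cSUP_upper [OF _ this, of p] assms(1) show ?thesis by (simp add: toeplitz_universal_def)
qed

lemma toeplitz_universal_least:
  assumes "\<And>p. toeplitz_seminorm E p \<Longrightarrow> p x \<le> M" shows "nrm (toeplitz_universal E) x \<le> M"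
proof -
  have "{p. toeplitz_seminorm E p} \<noteq> {}" using toeplitz_seminorm_zero [OF E] by blast
  from cSUP_least [OF this, of "\<lambda>p. p x" M] assms show ?thesis by (simp add: toeplitz_universal_def)
qed

text \<open>A pointwise finite supremum of C*-seminorms is again one. Subadditivity and
  submultiplicativity are immediate; homogeneity and the C*-identity each need a reverse
  inequality.\<close>

lemma cstar_seminormed_universal: "cstar_seminormed (toeplitz_universal E)"
proof (intro cstar_seminormed.intro cstar_seminormed_axioms.intro)
  let ?F = "toeplitz_free E" and ?u = "nrm (toeplitz_universal E)"
  interpret F: star_algebra ?F by (rule star_algebra_toeplitz_free)
  show "star_algebra (toeplitz_universal E)"
    unfolding toeplitz_universal_def by (rule star_algebra_nrm_update) (rule star_algebra_toeplitz_free)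
  have P: "cstar_seminormed (?F\<lparr>nrm := p\<rparr>)" if "toeplitz_seminorm E p" for p
    using that by (simp add: toeplitz_seminorm_def Let_def)
  note P' = cstar_seminormed.nrm_nonneg [OF P, simplified] cstar_seminormed.nrm_add [OF P, simplified]
    cstar_seminormed.nrm_scal [OF P, simplified] cstar_seminormed.nrm_mul [OF P, simplified]
    cstar_seminormed.nrm_star_mul [OF P, simplified]
  note up = toeplitz_universal_upper
  fix x assume "x \<in> carr (toeplitz_universal E)"
  then have x: "x \<in> carr ?F" by (simp add: toeplitz_universal_sel)
  show nn: "0 \<le> ?u x" using up [OF toeplitz_seminorm_zero [OF E] x] by simp
  have scal_le: "?u (scal ?F c y) \<le> cmod c * ?u y" if "y \<in> carr ?F" for c y
    by (rule toeplitz_universal_least) (simp add: P' that up mult_left_mono)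
  show "?u (scal (toeplitz_universal E) c x) = cmod c * ?u x" for c
  proof (cases "c = 0")
    case True
    have "?u (scal ?F 0 x) \<ge> 0" using up [OF toeplitz_seminorm_zero [OF E], of "scal ?F 0 x"] x by simp
    then show ?thesis using scal_le [OF x, of 0] True by (simp add: toeplitz_universal_sel)
  next
    case False
    \<comment> \<open>The reverse inequality for homogeneity: apply the upper bound to scaling back
      by 1/c.\<close>
    have "?u x = ?u (scal ?F (1/c) (scal ?F c x))" using x False by simp
    also have "\<dots> \<le> cmod (1/c) * ?u (scal ?F c x)" by (rule scal_le) (use x in simp)
    finally have "cmod c * ?u x \<le> ?u (scal ?F c x)"
      using False by (simp add: norm_divide field_simps)
    then show ?thesis using scal_le [OF x, of c] by (simp add: toeplitz_universal_sel)
  qed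
  show "?u (mul (toeplitz_universal E) (star (toeplitz_universal E) x) x) = (?u x)\<^sup>2"
  proof (rule antisym)
    show "?u (mul (toeplitz_universal E) (star (toeplitz_universal E) x) x) \<le> (?u x)\<^sup>2"
      unfolding toeplitz_universal_sel
      by (rule toeplitz_universal_least) (simp add: P' x up power_mono)
    \<comment> \<open>The reverse inequality for the C*-identity: each member of the family
      satisfies it exactly, so the square of \<open>p x\<close> is at most the supremum at x*x.
      Taking roots puts the bound in the form needed for the supremum over \<open>p\<close>.\<close>
    have "?u x \<le> sqrt (?u (mul ?F (star ?F x) x))"
    proof (rule toeplitz_universal_least)
      fix p assume p: "toeplitz_seminorm E p"
      have "(p x)\<^sup>2 \<le> ?u (mul ?F (star ?F x) x)"
        using up [OF p, of "mul ?F (star ?F x) x"] P'(5) [OF p x] x by simp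
      then show "p x \<le> sqrt (?u (mul ?F (star ?F x) x))" by (rule real_le_rsqrt)
    qed
    then have "(?u x)\<^sup>2 \<le> (sqrt (?u (mul ?F (star ?F x) x)))\<^sup>2" using nn by (rule power_mono)
    also have "\<dots> = ?u (mul ?F (star ?F x) x)"
      using up [OF toeplitz_seminorm_zero [OF E], of "mul ?F (star ?F x) x"] x by simp
    finally show "(?u x)\<^sup>2 \<le> ?u (mul (toeplitz_universal E) (star (toeplitz_universal E) x) x)"
      by (simp add: toeplitz_universal_sel)
  qed
  fix y assume "y \<in> carr (toeplitz_universal E)"
  then have y: "y \<in> carr ?F" by (simp add: toeplitz_universal_sel)
  have "0 \<le> ?u y" using up [OF toeplitz_seminorm_zero [OF E] y] by simp
  show "?u (add (toeplitz_universal E) x y) \<le> ?u x + ?u y"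
    unfolding toeplitz_universal_sel
  proof (rule toeplitz_universal_least)
    fix p assume p: "toeplitz_seminorm E p"
    show "p (add ?F x y) \<le> ?u x + ?u y"
      using P'(2) [OF p x y] up [OF p x] up [OF p y] by linarith
  qed
  show "?u (mul (toeplitz_universal E) x y) \<le> ?u x * ?u y"
    unfolding toeplitz_universal_sel
  proof (rule toeplitz_universal_least)
    fix p assume p: "toeplitz_seminorm E p"
    have "p (mul ?F x y) \<le> p x * p y" by (rule P'(4) [OF p x y])
    also have "\<dots> \<le> ?u x * ?u y" by (intro mult_mono up p x y nn P'(1) [OF p y])
    finally show "p (mul ?F x y) \<le> ?u x * ?u y" .
  qed
qed

interpretation U: cstar_seminormed "toeplitz_universal E" by (rule cstar_seminormed_universal)

lemma cstar_algebra_toeplitz: "cstar_algebra (toeplitz_algebra E)"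
  unfolding toeplitz_algebra_def by (rule U.cstar_algebra_completion)

lemma star_hom_toeplitz_universal [simp]: "star_hom (toeplitz_universal E) B h \<longleftrightarrow> star_hom (toeplitz_free E) B h"
  by (simp add: toeplitz_universal_def)

text \<open>Every admissible seminorm vanishes on the difference of the two sides of a relation,
  hence so does the supremum, and the completion identifies them.\<close>

lemma toeplitz_pair_univ: "toeplitz_pair E (toeplitz_algebra E) (univ_T0 E) (univ_T1 E)"
proof -
  have h: "star_hom (toeplitz_free E) (toeplitz_algebra E) (to_completion (toeplitz_universal E))"
    using U.star_hom_to_completion by (simp add: toeplitz_algebra_def)
  have "to_completion (toeplitz_universal E) x = to_completion (toeplitz_universal E) y"
    if r: "(x, y) \<in> toeplitz_relations E" for x y
  proof -
    have xy: "x \<in> carr (toeplitz_free E)" "y \<in> carr (toeplitz_free E)"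
      using toeplitz_relations_carr [OF E] r by auto
    have "nrm (toeplitz_universal E) (sub (toeplitz_free E) x y) \<le> 0"
      by (rule toeplitz_universal_least) (use r in \<open>auto simp: toeplitz_seminorm_iff [OF E]\<close>)
    moreover have "sub (toeplitz_universal E) x y = sub (toeplitz_free E) x y"
      by (simp add: sub_def toeplitz_universal_sel)
    moreover have "sub (toeplitz_free E) x y \<in> carr (toeplitz_free E)"
      using star_algebra.sub_closed [OF star_algebra_toeplitz_free] xy by blast
    ultimately have "nrm (toeplitz_universal E) (sub (toeplitz_universal E) x y) = 0"
      using U.nrm_nonneg [of "sub (toeplitz_universal E) x y"] xy by (simp add: toeplitz_universal_sel)
    then show ?thesis using xy U.to_completion_eq_iff [of x y] by (simp add: toeplitz_universal_sel)
  qed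
  then show ?thesis
    using toeplitz_pair_iff [OF E cstar_algebra_toeplitz h] by (auto simp: univ_T0_def univ_T1_def)
qed

text \<open>Evaluating free elements in \<open>B\<close> and taking the norm there gives a Toeplitz
  seminorm, which the universal norm dominates. The evaluation is therefore contractive and extends
  to the completion.\<close>

lemma toeplitz_algebra_universal:
  assumes T: "toeplitz_pair E B T0 T1"
  shows "\<exists>h. star_hom (toeplitz_algebra E) B h \<and> (\<forall>f\<in>C0 (vertices E). h (univ_T0 E f) = T0 f) \<and>
    (\<forall>\<xi>\<in>Cd E. h (univ_T1 E \<xi>) = T1 \<xi>)"
proof -
  let ?F = "toeplitz_free E" and ?G = "C0 (vertices E) <+> Cd E"
  have B: "cstar_algebra B" using T by (simp add: toeplitz_pair_def)
  interpret B: cstar_algebra B by (rule B)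
  interpret F: star_algebra ?F by (rule star_algebra_toeplitz_free)
  let ?\<gamma> = "case_sum T0 T1"
  have \<gamma>: "?\<gamma> ` ?G \<subseteq> carr B"
    using T by (auto simp: toeplitz_pair_def star_hom_def C0_algebra_def)
  define ev where "ev = free_eval B ?\<gamma>"
  have ev: "star_hom ?F B ev" unfolding toeplitz_free_def ev_def by (rule free_eval(1) [OF B.star_algebra_axioms \<gamma>])
  note h = star_homD [OF ev]
  have gen: "T0 f = ev (free_gen (Inl f))" if "f \<in> C0 (vertices E)" for f
    unfolding ev_def using free_eval(2) [OF B.star_algebra_axioms \<gamma>, of "Inl f"] that by (simp add: InlI)
  have gen': "T1 \<xi> = ev (free_gen (Inr \<xi>))" if "\<xi> \<in> Cd E" for \<xi>
    unfolding ev_def using free_eval(2) [OF B.star_algebra_axioms \<gamma>, of "Inr \<xi>"] that by (simp add: InrI)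
  have "toeplitz_seminorm E (\<lambda>x. nrm B (ev x))"
    unfolding toeplitz_seminorm_iff [OF E]
  proof (intro conjI cstar_seminormed.intro cstar_seminormed_axioms.intro star_algebra_nrm_update star_algebra_toeplitz_free)
    show "\<forall>(x, y)\<in>toeplitz_relations E. nrm B (ev (sub ?F x y)) = 0"
    proof clarify
      fix x y assume r: "(x, y) \<in> toeplitz_relations E"
      then have xy: "x \<in> carr ?F" "y \<in> carr ?F" using toeplitz_relations_carr [OF E] by auto
      have "ev x = ev y" using toeplitz_pair_iff [OF E B ev gen gen'] T r by auto
      then show "nrm B (ev (sub ?F x y)) = 0" using xy h(1) by (simp add: star_hom_sub [OF ev F.star_algebra_axioms])
    qed
  qed (simp_all add: h B.nrm_nonneg B.nrm_add B.nrm_scal B.nrm_mul B.nrm_star_mul)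
  then have le: "nrm B (ev x) \<le> nrm (toeplitz_universal E) x" if "x \<in> carr (toeplitz_universal E)" for x
    using toeplitz_universal_upper [of "\<lambda>x. nrm B (ev x)" x] that by (simp add: toeplitz_universal_sel)
  have ev': "star_hom (toeplitz_universal E) B ev" using ev by simp
  obtain H where H: "star_hom (toeplitz_algebra E) B H"
    "\<forall>x\<in>carr (toeplitz_universal E). H (to_completion (toeplitz_universal E) x) = ev x"
    using completion_extend [OF U.cstar_seminormed_axioms B ev' le] unfolding toeplitz_algebra_def by blast
  show ?thesis
    using H by (intro exI [of _ H]) (simp add: univ_T0_def univ_T1_def gen gen' toeplitz_universal_sel)
qed

lemma toeplitz_hom_eqI:
  assumes B: "cstar_algebra B" and \<phi>: "star_hom (toeplitz_algebra E) B \<phi>" and \<psi>: "star_hom (toeplitz_algebra E) B \<psi>"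
    and 0: "\<And>f. f \<in> C0 (vertices E) \<Longrightarrow> \<phi> (univ_T0 E f) = \<psi> (univ_T0 E f)"
    and 1: "\<And>\<xi>. \<xi> \<in> Cd E \<Longrightarrow> \<phi> (univ_T1 E \<xi>) = \<psi> (univ_T1 E \<xi>)"
    and x: "x \<in> carr (toeplitz_algebra E)"
  shows "\<phi> x = \<psi> x"
proof (rule completion_hom_eqI [OF U.cstar_seminormed_axioms B, folded toeplitz_algebra_def, OF \<phi> \<psi> _ x])
  interpret B: cstar_algebra B by (rule B)
  let ?\<iota> = "to_completion (toeplitz_universal E)"
  have \<iota>: "star_hom (toeplitz_free E) (toeplitz_algebra E) ?\<iota>"
    using U.star_hom_to_completion by (simp add: toeplitz_algebra_def)
  note c = star_hom_compose [OF \<iota> \<phi>, unfolded toeplitz_free_def] star_hom_compose [OF \<iota> \<psi>, unfolded toeplitz_free_def]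
  fix y assume "y \<in> carr (toeplitz_universal E)"
  then have y: "y \<in> carr (free_star_algebra (C0 (vertices E) <+> Cd E))"
    by (simp add: toeplitz_universal_sel toeplitz_free_def)
  show "\<phi> (?\<iota> y) = \<psi> (?\<iota> y)"
    by (rule star_hom_free_eqI [OF c B.star_algebra_axioms _ y])
      (use 0 1 in \<open>auto simp: univ_T0_def univ_T1_def\<close>)
qed

end

section \<open>Homomorphisms induced by factor maps\<close>

context factor
begin

lemma toeplitz_pair_pull_back:
  "toeplitz_pair E (toeplitz_algebra F) (\<lambda>f. univ_T0 F (p0 f)) (\<lambda>\<xi>. univ_T1 F (p1 \<xi>))"
proof -
  note T = toeplitz_pair_univ [OF F, unfolded toeplitz_pair_def star_hom_def C0_algebra_sel]
  show ?thesis
    unfolding toeplitz_pair_def star_hom_def C0_algebra_sel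
    using T by (simp add: pull_back_arith p0_C0 p1_Cd inner_p1 [symmetric] left_act_p1 [symmetric])
qed

text \<open>Existence is the universal property applied to the pulled back pair; uniqueness holds
  because generators determine a homomorphism. Restricting to the carrier selects the extensional
  representative that the definite description asks for.\<close>

lemma induced_hom:
  shows "star_hom (toeplitz_algebra E) (toeplitz_algebra F) (induced_hom F E m0 m1)"
    and "\<And>f. f \<in> C0 (vertices E) \<Longrightarrow> induced_hom F E m0 m1 (univ_T0 E f) = univ_T0 F (p0 f)"
    and "\<And>\<xi>. \<xi> \<in> Cd E \<Longrightarrow> induced_hom F E m0 m1 (univ_T1 E \<xi>) = univ_T1 F (p1 \<xi>)"
proof -
  let ?A = "toeplitz_algebra E" and ?B = "toeplitz_algebra F"
  let ?Q = "\<lambda>\<mu>. star_hom ?A ?B \<mu> \<and> \<mu> \<in> extensional (carr ?A) \<and>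
     (\<forall>f\<in>C0 (vertices E). \<mu> (univ_T0 E f) = univ_T0 F (p0 f)) \<and>
     (\<forall>\<xi>\<in>Cd E. \<mu> (univ_T1 E \<xi>) = univ_T1 F (p1 \<xi>))"
  interpret A: cstar_algebra ?A by (rule cstar_algebra_toeplitz [OF E])
  have B: "cstar_algebra ?B" by (rule cstar_algebra_toeplitz [OF F])
  obtain h where h: "star_hom ?A ?B h" "\<forall>f\<in>C0 (vertices E). h (univ_T0 E f) = univ_T0 F (p0 f)"
    "\<forall>\<xi>\<in>Cd E. h (univ_T1 E \<xi>) = univ_T1 F (p1 \<xi>)"
    using toeplitz_algebra_universal [OF E toeplitz_pair_pull_back] by blast
  have in_A: "univ_T0 E f \<in> carr ?A" if "f \<in> C0 (vertices E)" for f
    using toeplitz_pair_univ [OF E] that by (auto simp: toeplitz_pair_def star_hom_def C0_algebra_def)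
  have in_A1: "univ_T1 E \<xi> \<in> carr ?A" if "\<xi> \<in> Cd E" for \<xi>
    using toeplitz_pair_univ [OF E] that by (auto simp: toeplitz_pair_def)
  have "?Q (restrict h (carr ?A))"
    using h in_A in_A1 by (simp add: star_hom_def)
  moreover have "\<mu> = restrict h (carr ?A)" if \<mu>: "?Q \<mu>" for \<mu>
  proof (rule extensionalityI [of _ "carr ?A"])
    fix x assume x: "x \<in> carr ?A"
    have "\<mu> x = h x" by (rule toeplitz_hom_eqI [OF E B _ h(1) _ _ x]) (use \<mu> h in auto)
    then show "\<mu> x = restrict h (carr ?A) x" using x by simp
  qed (use \<mu> in auto)
  ultimately have "?Q (induced_hom F E m0 m1)"
    unfolding induced_hom_def by (rule theI)
  then show "star_hom ?A ?B (induced_hom F E m0 m1)"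
    "\<And>f. f \<in> C0 (vertices E) \<Longrightarrow> induced_hom F E m0 m1 (univ_T0 E f) = univ_T0 F (p0 f)"
    "\<And>\<xi>. \<xi> \<in> Cd E \<Longrightarrow> induced_hom F E m0 m1 (univ_T1 E \<xi>) = univ_T1 F (p1 \<xi>)"
    by auto
qed

end

section \<open>Inductive limits of C*-algebras\<close>

locale inductive_system =
  fixes \<Lambda> :: "'l set" and le :: "'l \<Rightarrow> 'l \<Rightarrow> bool" and A :: "'l \<Rightarrow> 'a star_alg"
    and \<mu> :: "'l \<Rightarrow> 'l \<Rightarrow> 'a \<Rightarrow> 'a"
  assumes dir: "directed_set \<Lambda> le" and cA: "\<And>l. l \<in> \<Lambda> \<Longrightarrow> cstar_algebra (A l)"
    and \<mu>: "\<And>l k. \<lbrakk>l \<in> \<Lambda>; k \<in> \<Lambda>; le l k\<rbrakk> \<Longrightarrow> star_hom (A l) (A k) (\<mu> l k)"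
    and \<mu>_refl: "\<And>l x. \<lbrakk>l \<in> \<Lambda>; x \<in> carr (A l)\<rbrakk> \<Longrightarrow> \<mu> l l x = x"
    and \<mu>_trans: "\<And>l k j x. \<lbrakk>l \<in> \<Lambda>; k \<in> \<Lambda>; j \<in> \<Lambda>; le l k; le k j; x \<in> carr (A l)\<rbrakk> \<Longrightarrow> \<mu> k j (\<mu> l k x) = \<mu> l j x"

lemma directed_setD:
  assumes "directed_set \<Lambda> le"
  shows "\<Lambda> \<noteq> {}" "\<And>a. a \<in> \<Lambda> \<Longrightarrow> le a a"
    "\<And>a b c. \<lbrakk>a \<in> \<Lambda>; b \<in> \<Lambda>; c \<in> \<Lambda>; le a b; le b c\<rbrakk> \<Longrightarrow> le a c"
    "\<And>a b. \<lbrakk>a \<in> \<Lambda>; b \<in> \<Lambda>\<rbrakk> \<Longrightarrow> \<exists>c\<in>\<Lambda>. le a c \<and> le b c"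
  using assms unfolding directed_set_def by blast+

lemma eventually_net_filter:
  assumes d: "directed_set \<Lambda> le"
  shows "eventually P (net_filter \<Lambda> le) \<longleftrightarrow> (\<exists>a\<in>\<Lambda>. \<forall>b\<in>\<Lambda>. le a b \<longrightarrow> P b)"
proof -
  note D = directed_setD [OF d]
  have "eventually P (net_filter \<Lambda> le) \<longleftrightarrow> (\<exists>a\<in>\<Lambda>. eventually P (principal {b \<in> \<Lambda>. le a b}))"
    unfolding net_filter_def
  proof (rule eventually_INF_base [OF D(1)])
    fix a b assume ab: "a \<in> \<Lambda>" "b \<in> \<Lambda>"
    then obtain c where c: "c \<in> \<Lambda>" "le a c" "le b c" using D(4) by blast
    have "{d \<in> \<Lambda>. le c d} \<subseteq> {d \<in> \<Lambda>. le a d}" "{d \<in> \<Lambda>. le c d} \<subseteq> {d \<in> \<Lambda>. le b d}"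
      using D(3) [OF ab(1) c(1)] D(3) [OF ab(2) c(1)] c by blast+
    then show "\<exists>x\<in>\<Lambda>. principal {b \<in> \<Lambda>. le x b} \<le> inf (principal {b \<in> \<Lambda>. le a b}) (principal {c \<in> \<Lambda>. le b c})"
      using c(1) by (intro bexI [of _ c]) auto
  qed
  also have "\<dots> \<longleftrightarrow> (\<exists>a\<in>\<Lambda>. \<forall>b\<in>\<Lambda>. le a b \<longrightarrow> P b)" by (auto simp: eventually_principal)
  finally show ?thesis .
qed

lemma net_filter_nontrivial:
  assumes d: "directed_set \<Lambda> le" shows "net_filter \<Lambda> le \<noteq> bot"
proof
  assume "net_filter \<Lambda> le = bot"
  then have "eventually (\<lambda>x. False) (net_filter \<Lambda> le)" by simp
  then obtain a where "a \<in> \<Lambda>" "\<forall>b\<in>\<Lambda>. \<not> le a b" unfolding eventually_net_filter [OF d] by blast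
  then show False using directed_setD(2) [OF d] by blast
qed

context inductive_system
begin

abbreviation "EF \<equiv> eventual_families \<Lambda> le A \<mu>"
abbreviation "net \<equiv> net_filter \<Lambda> le"

lemmas D = directed_setD [OF dir]
lemmas ev = eventually_net_filter [OF dir]
lemmas nt = net_filter_nontrivial [OF dir]

lemma sA: "l \<in> \<Lambda> \<Longrightarrow> star_algebra (A l)" and nA: "l \<in> \<Lambda> \<Longrightarrow> cstar_seminormed (A l)"
  using cA cstar_algebra.axioms(1) cstar_seminormed.axioms(1) by blast+

lemmas \<mu>D = star_homD [OF \<mu>]

lemma \<mu>_zer: "\<lbrakk>l \<in> \<Lambda>; k \<in> \<Lambda>; le l k\<rbrakk> \<Longrightarrow> \<mu> l k (zer (A l)) = zer (A k)"
  by (intro star_hom_zer \<mu> sA)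

definition from_index :: "'l \<Rightarrow> ('l \<Rightarrow> 'a) \<Rightarrow> bool" where
  "from_index l0 a \<longleftrightarrow> l0 \<in> \<Lambda> \<and> (\<forall>l\<in>\<Lambda>. le l0 l \<longrightarrow> a l = \<mu> l0 l (a l0))"

lemma EF_sel:
  "carr EF = {a \<in> (\<Pi>\<^sub>E l\<in>\<Lambda>. carr (A l)). \<exists>l0. from_index l0 a}"
  "zer EF = (\<lambda>l\<in>\<Lambda>. zer (A l))" "add EF a b = (\<lambda>l\<in>\<Lambda>. add (A l) (a l) (b l))"
  "scal EF c a = (\<lambda>l\<in>\<Lambda>. scal (A l) c (a l))" "mul EF a b = (\<lambda>l\<in>\<Lambda>. mul (A l) (a l) (b l))"
  "star EF a = (\<lambda>l\<in>\<Lambda>. star (A l) (a l))" "nrm EF a = Lim net (\<lambda>l. nrm (A l) (a l))"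
  by (auto simp: eventual_families_def from_index_def)

lemma EF_in: "\<lbrakk>a \<in> carr EF; l \<in> \<Lambda>\<rbrakk> \<Longrightarrow> a l \<in> carr (A l)"
  unfolding EF_sel by auto

lemma EF_ex: "a \<in> carr EF \<Longrightarrow> \<exists>l0. from_index l0 a"
  unfolding EF_sel by auto

lemma EF_I: "\<lbrakk>\<And>l. l \<in> \<Lambda> \<Longrightarrow> a l \<in> carr (A l); from_index l0 a\<rbrakk> \<Longrightarrow> restrict a \<Lambda> \<in> carr EF"
  unfolding EF_sel from_index_def by auto

lemma from_index_raise:
  assumes a: "from_index l0 a" and al: "a l0 \<in> carr (A l0)" and k: "k \<in> \<Lambda>" "le l0 k"
  shows "from_index k a"
  unfolding from_index_def
proof (intro conjI ballI impI k(1))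
  fix l assume l: "l \<in> \<Lambda>" "le k l"
  have l0: "l0 \<in> \<Lambda>" using a by (simp add: from_index_def)
  have "le l0 l" by (rule D(3) [OF l0 k(1) l(1) k(2) l(2)])
  then show "a l = \<mu> k l (a k)"
    using a l k \<mu>_trans [OF l0 k(1) l(1) k(2) l(2) al] by (simp add: from_index_def)
qed

lemma from_index_common:
  assumes "a \<in> carr EF" "b \<in> carr EF" shows "\<exists>l0. from_index l0 a \<and> from_index l0 b"
proof -
  obtain l1 l2 where l: "from_index l1 a" "from_index l2 b" using EF_ex assms by blast
  then have "l1 \<in> \<Lambda>" "l2 \<in> \<Lambda>" by (auto simp: from_index_def)
  moreover from this obtain k where "k \<in> \<Lambda>" "le l1 k" "le l2 k" using D(4) by blast
  ultimately have "from_index k a" "from_index k b"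
    using from_index_raise [OF l(1) EF_in [OF assms(1)]] from_index_raise [OF l(2) EF_in [OF assms(2)]] by blast+
  then show ?thesis by blast
qed

lemma star_algebra_EF: "star_algebra EF"
proof -
  note s = star_algebra.zer_closed [OF sA] star_algebra.add_closed [OF sA] star_algebra.scal_closed [OF sA]
    star_algebra.mul_closed [OF sA] star_algebra.star_closed [OF sA]
  have add: "add EF a b \<in> carr EF" if ab: "a \<in> carr EF" "b \<in> carr EF" for a b
  proof -
    obtain l0 where l0: "from_index l0 a" "from_index l0 b" using from_index_common [OF ab] by blast
    then have l0': "l0 \<in> \<Lambda>" by (simp add: from_index_def)
    have "from_index l0 (\<lambda>l. add (A l) (a l) (b l))"
      unfolding from_index_def using l0 l0' ab EF_in \<mu>D(2) [OF l0'] by (simp add: from_index_def)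
    then show ?thesis unfolding EF_sel(3) using ab s EF_in by (intro EF_I) auto
  qed
  have mul: "mul EF a b \<in> carr EF" if ab: "a \<in> carr EF" "b \<in> carr EF" for a b
  proof -
    obtain l0 where l0: "from_index l0 a" "from_index l0 b" using from_index_common [OF ab] by blast
    then have l0': "l0 \<in> \<Lambda>" by (simp add: from_index_def)
    have "from_index l0 (\<lambda>l. mul (A l) (a l) (b l))"
      unfolding from_index_def using l0 l0' ab EF_in \<mu>D(4) [OF l0'] by (simp add: from_index_def)
    then show ?thesis unfolding EF_sel(5) using ab s EF_in by (intro EF_I) auto
  qed
  have scal: "scal EF c a \<in> carr EF" if a: "a \<in> carr EF" for a c
  proof -
    obtain l0 where l0: "from_index l0 a" using EF_ex a by blast
    then have l0': "l0 \<in> \<Lambda>" by (simp add: from_index_def)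
    have "from_index l0 (\<lambda>l. scal (A l) c (a l))"
      unfolding from_index_def using l0 l0' a EF_in \<mu>D(3) [OF l0'] by (simp add: from_index_def)
    then show ?thesis unfolding EF_sel(4) using a s EF_in by (intro EF_I) auto
  qed
  have star: "star EF a \<in> carr EF" if a: "a \<in> carr EF" for a
  proof -
    obtain l0 where l0: "from_index l0 a" using EF_ex a by blast
    then have l0': "l0 \<in> \<Lambda>" by (simp add: from_index_def)
    have "from_index l0 (\<lambda>l. star (A l) (a l))"
      unfolding from_index_def using l0 l0' a EF_in \<mu>D(5) [OF l0'] by (simp add: from_index_def)
    then show ?thesis unfolding EF_sel(6) using a s EF_in by (intro EF_I) auto
  qed
  have zer: "zer EF \<in> carr EF"
  proof -
    obtain l0 where l0: "l0 \<in> \<Lambda>" using D(1) by blast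
    then have "from_index l0 (\<lambda>l. zer (A l))" by (simp add: from_index_def \<mu>_zer)
    then show ?thesis unfolding EF_sel(2) using s by (intro EF_I) auto
  qed
  have eqI: "restrict f \<Lambda> = restrict g \<Lambda>" if "\<And>l. l \<in> \<Lambda> \<Longrightarrow> f l = g l" for f g :: "'l \<Rightarrow> 'a"
    using that by (rule restrict_ext)
  have res: "restrict a \<Lambda> = a" if "a \<in> carr EF" for a
    using that unfolding EF_sel by (auto intro: PiE_restrict)
  note [simp] = s star_algebra.add_zer [OF sA] star_algebra.scal_one [OF sA] star_algebra.star_star [OF sA]
    star_algebra.sub_self [OF sA] star_algebra.scal_scal [OF sA] star_algebra.add_minus [OF sA]
  show ?thesis
  proof
    show "add EF x (zer EF) = x" if "x \<in> carr EF" for x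
      unfolding EF_sel(2-6) by (subst (2) res [OF that, symmetric]) (rule eqI, use EF_in [OF that] in simp)
    show "scal EF 1 x = x" if "x \<in> carr EF" for x
      unfolding EF_sel(2-6) by (subst (2) res [OF that, symmetric]) (rule eqI, use EF_in [OF that] in simp)
    show "star EF (star EF x) = x" if "x \<in> carr EF" for x
      unfolding EF_sel(2-6) by (subst (2) res [OF that, symmetric]) (rule eqI, use EF_in [OF that] in simp)
    show "sub EF x x = zer EF" if "x \<in> carr EF" for x
      unfolding EF_sel(2-6) sub_def by (rule eqI, use EF_in [OF that] in simp)
    show "add EF x y = add EF y x" if "x \<in> carr EF" "y \<in> carr EF" for x y
      unfolding EF_sel(2-6) by (rule eqI, use EF_in [OF that(1)] EF_in [OF that(2)] star_algebra.add_commute [OF sA] in simp)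
    show "scal EF c (add EF x y) = add EF (scal EF c x) (scal EF c y)" if "x \<in> carr EF" "y \<in> carr EF" for x y c
      unfolding EF_sel(2-6) by (rule eqI, use EF_in [OF that(1)] EF_in [OF that(2)] star_algebra.scal_add [OF sA] in simp)
    show "scal EF (c + c') x = add EF (scal EF c x) (scal EF c' x)" if "x \<in> carr EF" for x c c'
      unfolding EF_sel(2-6) by (rule eqI, use EF_in [OF that] star_algebra.add_scal [OF sA] in simp)
    show "scal EF c (scal EF c' x) = scal EF (c * c') x" if "x \<in> carr EF" for x c c'
      unfolding EF_sel(2-6) by (rule eqI, use EF_in [OF that] star_algebra.scal_scal [OF sA] in simp)
    show "add EF (add EF x y) z = add EF x (add EF y z)" if "x \<in> carr EF" "y \<in> carr EF" "z \<in> carr EF" for x y z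
      unfolding EF_sel(2-6) by (rule eqI, use EF_in [OF that(1)] EF_in [OF that(2)] EF_in [OF that(3)] star_algebra.add_assoc [OF sA] in simp)
    show "mul EF (mul EF x y) z = mul EF x (mul EF y z)" if "x \<in> carr EF" "y \<in> carr EF" "z \<in> carr EF" for x y z
      unfolding EF_sel(2-6) by (rule eqI, use EF_in [OF that(1)] EF_in [OF that(2)] EF_in [OF that(3)] star_algebra.mul_assoc [OF sA] in simp)
    show "mul EF x (add EF y z) = add EF (mul EF x y) (mul EF x z)" if "x \<in> carr EF" "y \<in> carr EF" "z \<in> carr EF" for x y z
      unfolding EF_sel(2-6) by (rule eqI, use EF_in [OF that(1)] EF_in [OF that(2)] EF_in [OF that(3)] star_algebra.mul_add [OF sA] in simp)
    show "mul EF (add EF x y) z = add EF (mul EF x z) (mul EF y z)" if "x \<in> carr EF" "y \<in> carr EF" "z \<in> carr EF" for x y z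
      unfolding EF_sel(2-6) by (rule eqI, use EF_in [OF that(1)] EF_in [OF that(2)] EF_in [OF that(3)] star_algebra.add_mul [OF sA] in simp)
    show "mul EF x (scal EF c y) = scal EF c (mul EF x y)" if "x \<in> carr EF" "y \<in> carr EF" for x y c
      unfolding EF_sel(2-6) by (rule eqI, use EF_in [OF that(1)] EF_in [OF that(2)] star_algebra.mul_scal [OF sA] in simp)
    show "mul EF (scal EF c x) y = scal EF c (mul EF x y)" if "x \<in> carr EF" "y \<in> carr EF" for x y c
      unfolding EF_sel(2-6) by (rule eqI, use EF_in [OF that(1)] EF_in [OF that(2)] star_algebra.scal_mul [OF sA] in simp)
    show "star EF (add EF x y) = add EF (star EF x) (star EF y)" if "x \<in> carr EF" "y \<in> carr EF" for x y
      unfolding EF_sel(2-6) by (rule eqI, use EF_in [OF that(1)] EF_in [OF that(2)] star_algebra.star_add [OF sA] in simp)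
    show "star EF (scal EF c x) = scal EF (cnj c) (star EF x)" if "x \<in> carr EF" for x c
      unfolding EF_sel(2-6) by (rule eqI, use EF_in [OF that] star_algebra.star_scal [OF sA] in simp)
    show "star EF (mul EF x y) = mul EF (star EF y) (star EF x)" if "x \<in> carr EF" "y \<in> carr EF" for x y
      unfolding EF_sel(2-6) by (rule eqI, use EF_in [OF that(1)] EF_in [OF that(2)] star_algebra.star_mul [OF sA] in simp)
  qed (fact zer add scal mul star)+
qed

lemma nrm_\<mu>_le:
  "\<lbrakk>l \<in> \<Lambda>; k \<in> \<Lambda>; le l k; x \<in> carr (A l)\<rbrakk> \<Longrightarrow> nrm (A k) (\<mu> l k x) \<le> nrm (A l) x"
  by (intro star_hom_contractive cA nA \<mu>)

text \<open>From the stage where the family starts to be transported, the norms decrease along the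
  order, since the connecting homomorphisms are contractive. The net therefore converges to the
  infimum of these norms, and the \<open>Lim\<close> in the definition has the intended
  value.\<close>

lemma tendsto_nrm_EF:
  assumes a: "a \<in> carr EF" shows "((\<lambda>l. nrm (A l) (a l)) \<longlongrightarrow> nrm EF a) net"
proof -
  obtain l0 where l0: "from_index l0 a" using EF_ex a by blast
  then have l0': "l0 \<in> \<Lambda>" by (simp add: from_index_def)
  let ?N = "(\<lambda>l. nrm (A l) (a l)) ` {l \<in> \<Lambda>. le l0 l}"
  have ne: "?N \<noteq> {}" using l0' D(2) by blast
  have bd: "bdd_below ?N"
    by (rule bdd_belowI [of _ 0]) (use EF_in [OF a] cstar_seminormed.nrm_nonneg [OF nA] in auto)
  have "((\<lambda>l. nrm (A l) (a l)) \<longlongrightarrow> Inf ?N) net"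
  proof (rule tendstoI)
    fix e :: real assume "0 < e"
    then have "Inf ?N < Inf ?N + e" by simp
    then obtain k where k: "k \<in> \<Lambda>" "le l0 k" "nrm (A k) (a k) < Inf ?N + e"
      unfolding cInf_less_iff [OF ne bd] by blast
    have "dist (nrm (A l) (a l)) (Inf ?N) < e" if l: "l \<in> \<Lambda>" "le k l" for l
    proof -
      have "le l0 l" by (rule D(3) [OF l0' k(1) l(1) k(2) l(2)])
      then have "Inf ?N \<le> nrm (A l) (a l)" using l by (intro cInf_lower bd) blast
      moreover have "a l = \<mu> k l (a k)"
        using from_index_raise [OF l0 EF_in [OF a l0'] k(1,2)] l by (simp add: from_index_def)
      then have "nrm (A l) (a l) \<le> nrm (A k) (a k)" using nrm_\<mu>_le [OF k(1) l EF_in [OF a k(1)]] by simp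
      ultimately show ?thesis using k(3) by (simp add: dist_real_def)
    qed
    then show "\<forall>\<^sub>F l in net. dist (nrm (A l) (a l)) (Inf ?N) < e" unfolding ev using k(1) by blast
  qed
  with tendsto_Lim [OF nt this] show ?thesis unfolding EF_sel(7) by simp
qed

lemma ev_le:
  assumes "\<And>l. l \<in> \<Lambda> \<Longrightarrow> P l" shows "eventually P net"
  unfolding ev using assms D(1) by blast

lemma cstar_seminormed_EF: "cstar_seminormed EF"
proof (intro cstar_seminormed.intro cstar_seminormed_axioms.intro star_algebra_EF)
  interpret EF: star_algebra EF by (rule star_algebra_EF)
  fix a assume a: "a \<in> carr EF"
  note la = tendsto_nrm_EF [OF a]
  show "0 \<le> nrm EF a"
    by (rule tendsto_lowerbound [OF la _ nt], rule ev_le)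
      (use EF_in [OF a] cstar_seminormed.nrm_nonneg [OF nA] in auto)
  show "nrm EF (scal EF c a) = cmod c * nrm EF a" for c
  proof (rule tendsto_unique [OF nt tendsto_nrm_EF [OF EF.scal_closed [OF a]]])
    show "((\<lambda>l. nrm (A l) (scal EF c a l)) \<longlongrightarrow> cmod c * nrm EF a) net"
      by (rule Lim_transform_eventually [OF tendsto_mult [OF tendsto_const la]], rule ev_le)
        (use EF_in [OF a] cstar_seminormed.nrm_scal [OF nA] in \<open>simp add: EF_sel\<close>)
  qed
  show "nrm EF (mul EF (star EF a) a) = (nrm EF a)\<^sup>2"
  proof (rule tendsto_unique [OF nt tendsto_nrm_EF [OF EF.mul_closed [OF EF.star_closed [OF a] a]]])
    show "((\<lambda>l. nrm (A l) (mul EF (star EF a) a l)) \<longlongrightarrow> (nrm EF a)\<^sup>2) net"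
      by (rule Lim_transform_eventually [OF tendsto_power [OF la]], rule ev_le)
        (use EF_in [OF a] cstar_seminormed.nrm_star_mul [OF nA] in \<open>simp add: EF_sel\<close>)
  qed
  fix b assume b: "b \<in> carr EF"
  note lb = tendsto_nrm_EF [OF b]
  show "nrm EF (add EF a b) \<le> nrm EF a + nrm EF b"
    by (rule tendsto_le [OF nt tendsto_add [OF la lb] tendsto_nrm_EF [OF EF.add_closed [OF a b]]], rule ev_le)
      (use EF_in [OF a] EF_in [OF b] cstar_seminormed.nrm_add [OF nA] in \<open>simp add: EF_sel\<close>)
  show "nrm EF (mul EF a b) \<le> nrm EF a * nrm EF b"
    by (rule tendsto_le [OF nt tendsto_mult [OF la lb] tendsto_nrm_EF [OF EF.mul_closed [OF a b]]], rule ev_le)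
      (use EF_in [OF a] EF_in [OF b] cstar_seminormed.nrm_mul [OF nA] in \<open>simp add: EF_sel\<close>)
qed

sublocale EF: cstar_seminormed EF by (rule cstar_seminormed_EF)

abbreviation "B \<equiv> inductive_limit \<Lambda> le A \<mu>"

lemma cstar_algebra_B: "cstar_algebra B"
  unfolding inductive_limit_def by (rule EF.cstar_algebra_completion)

sublocale B: cstar_algebra B by (rule cstar_algebra_B)

text \<open>The value at indices not above \<open>l\<close> is an arbitrary filler; only eventual
  values matter for the class in the limit, and 0 is compatible with all operations.\<close>

definition fam :: "'l \<Rightarrow> 'a \<Rightarrow> 'l \<Rightarrow> 'a" where
  "fam l x = (\<lambda>k\<in>\<Lambda>. if le l k then \<mu> l k x else zer (A k))"

definition inj_lim :: "'l \<Rightarrow> 'a \<Rightarrow> (nat \<Rightarrow> 'l \<Rightarrow> 'a) set" where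
  "inj_lim l x = to_completion EF (fam l x)"

lemma fam_from_index: "\<lbrakk>l \<in> \<Lambda>; x \<in> carr (A l)\<rbrakk> \<Longrightarrow> from_index l (fam l x)"
  using D(2) by (simp add: from_index_def fam_def \<mu>_refl)

lemma star_hom_fam:
  assumes l: "l \<in> \<Lambda>" shows "star_hom (A l) EF (fam l)"
proof -
  have in_EF: "fam l x \<in> carr EF" if x: "x \<in> carr (A l)" for x
  proof -
    have "restrict (fam l x) \<Lambda> \<in> carr EF"
      by (rule EF_I [OF _ fam_from_index [OF l x]])
        (use l x \<mu>D(1) star_algebra.zer_closed [OF sA] in \<open>simp add: fam_def\<close>)
    then show ?thesis by (simp add: fam_def)
  qed
  have c: "k \<in> \<Lambda> \<Longrightarrow> zer (A k) \<in> carr (A k)" for k using star_algebra.zer_closed [OF sA] .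
  show ?thesis
    unfolding star_hom_def EF_sel(3-6)
    using l in_EF
    by (auto simp: fam_def fun_eq_iff restrict_def \<mu>D c star_algebra.scal_zer [OF sA] star_algebra.star_zer [OF sA]
        star_algebra.add_zer [OF sA] star_algebra.mul_zer [OF sA])
qed

lemma star_hom_inj_lim: "l \<in> \<Lambda> \<Longrightarrow> star_hom (A l) B (inj_lim l)"
  unfolding inj_lim_def [abs_def] inductive_limit_def
  by (rule star_hom_compose [OF star_hom_fam EF.star_hom_to_completion])

text \<open>The seminorm is a limit along the net, so it ignores what happens outside the indices
  above \<open>k\<close>.\<close>

lemma to_completion_EF_eq:
  assumes a: "a \<in> carr EF" and b: "b \<in> carr EF" and k: "k \<in> \<Lambda>" "\<And>l. \<lbrakk>l \<in> \<Lambda>; le k l\<rbrakk> \<Longrightarrow> a l = b l"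
  shows "to_completion EF a = to_completion EF b"
proof -
  have "((\<lambda>l. nrm (A l) (sub EF a b l)) \<longlongrightarrow> 0) net"
  proof (rule Lim_transform_eventually [OF tendsto_const])
    have "0 = nrm (A l) (sub EF a b l)" if l: "l \<in> \<Lambda>" "le k l" for l
    proof -
      have "sub EF a b l = sub (A l) (b l) (b l)" using l k(2) by (simp add: sub_def EF_sel)
      then show ?thesis using cstar_seminormed.nrm_sub_self [OF nA EF_in [OF b]] l by simp
    qed
    then show "\<forall>\<^sub>F l in net. 0 = nrm (A l) (sub EF a b l)" unfolding ev using k(1) by blast
  qed
  then have "nrm EF (sub EF a b) = 0"
    using tendsto_unique [OF nt tendsto_nrm_EF [OF EF.sub_closed [OF a b]]] by blast
  then show ?thesis using EF.to_completion_eq_iff [OF a b] by simp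
qed

lemma inj_lim_from_index:
  assumes a: "a \<in> carr EF" and l: "from_index l a" shows "inj_lim l (a l) = to_completion EF a"
proof -
  have l': "l \<in> \<Lambda>" using l by (simp add: from_index_def)
  show ?thesis
    unfolding inj_lim_def
    by (rule to_completion_EF_eq [OF star_homD(1) [OF star_hom_fam [OF l'] EF_in [OF a l']] a l'])
      (use l in \<open>simp add: from_index_def fam_def\<close>)
qed

lemma inj_lim_\<mu>:
  assumes "l \<in> \<Lambda>" "k \<in> \<Lambda>" "le l k" "x \<in> carr (A l)"
  shows "inj_lim k (\<mu> l k x) = inj_lim l x"
proof -
  have f: "fam l x \<in> carr EF" by (rule star_homD(1) [OF star_hom_fam [OF assms(1)] assms(4)])
  have "from_index k (fam l x)"
    by (rule from_index_raise [OF fam_from_index EF_in [OF f]]) (use assms in auto)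
  from inj_lim_from_index [OF f this] show ?thesis
    using assms by (simp add: inj_lim_def fam_def)
qed

text \<open>The map into the limit factors through every later stage \<open>k\<close>, so its size
  may be estimated at whichever later stage is favourable.\<close>

lemma nrm_inj_lim_le:
  assumes "l \<in> \<Lambda>" "k \<in> \<Lambda>" "le l k" "x \<in> carr (A l)"
  shows "nrm B (inj_lim l x) \<le> nrm (A k) (\<mu> l k x)"
  unfolding inj_lim_\<mu> [OF assms, symmetric]
  by (rule star_hom_contractive [OF cA B.cstar_seminormed_axioms star_hom_inj_lim])
    (use assms \<mu>D(1) in auto)

lemma inductive_limit_hom_eqI:
  assumes C: "cstar_algebra C" and \<phi>: "star_hom B C \<phi>" and \<psi>: "star_hom B C \<psi>"
    and eq: "\<And>l x. \<lbrakk>l \<in> \<Lambda>; x \<in> carr (A l)\<rbrakk> \<Longrightarrow> \<phi> (inj_lim l x) = \<psi> (inj_lim l x)"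
    and P: "P \<in> carr B"
  shows "\<phi> P = \<psi> P"
proof (rule completion_hom_eqI [OF EF.cstar_seminormed_axioms C, folded inductive_limit_def, OF \<phi> \<psi> _ P])
  fix a assume a: "a \<in> carr EF"
  obtain l where l: "from_index l a" using EF_ex a by blast
  then have "l \<in> \<Lambda>" by (simp add: from_index_def)
  then show "\<phi> (to_completion EF a) = \<psi> (to_completion EF a)"
    using eq EF_in [OF a] inj_lim_from_index [OF a l] by metis
qed

text \<open>On a family the map is read at one admissible index; \<open>compat\<close> at a common
  upper bound shows that the choice does not matter. Contractivity holds at every late index, hence
  against the limit norm, and the map extends to the completion.\<close>

lemma inductive_limit_universal:
  assumes C: "cstar_algebra C" and \<phi>: "\<And>l. l \<in> \<Lambda> \<Longrightarrow> star_hom (A l) C (\<phi> l)"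
    and compat: "\<And>l k x. \<lbrakk>l \<in> \<Lambda>; k \<in> \<Lambda>; le l k; x \<in> carr (A l)\<rbrakk> \<Longrightarrow> \<phi> k (\<mu> l k x) = \<phi> l x"
  shows "\<exists>\<Phi>. star_hom B C \<Phi> \<and> (\<forall>l\<in>\<Lambda>. \<forall>x\<in>carr (A l). \<Phi> (inj_lim l x) = \<phi> l x)"
proof -
  interpret C: cstar_algebra C by (rule C)
  define h where "h a = \<phi> (SOME l. from_index l a) (a (SOME l. from_index l a))" for a
  have h: "h a = \<phi> k (a k)" if a: "a \<in> carr EF" and k: "from_index k a" for a k
  proof -
    define l where "l = (SOME l. from_index l a)"
    have l: "from_index l a" unfolding l_def using k by (rule someI)
    have lk: "l \<in> \<Lambda>" "k \<in> \<Lambda>" using k l by (auto simp: from_index_def)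
    then obtain j where j: "j \<in> \<Lambda>" "le l j" "le k j" using D(4) by blast
    have aj: "a j = \<mu> l j (a l)" "a j = \<mu> k j (a k)" using k l j by (auto simp: from_index_def)
    have "\<phi> l (a l) = \<phi> j (a j)"
      unfolding aj(1) by (rule compat [OF lk(1) j(1,2) EF_in [OF a lk(1)], symmetric])
    also have "\<dots> = \<phi> k (a k)"
      unfolding aj(2) by (rule compat [OF lk(2) j(1,3) EF_in [OF a lk(2)]])
    finally have "\<phi> l (a l) = \<phi> k (a k)" .
    then show ?thesis by (simp add: h_def l_def)
  qed
  have idx: "from_index k (restrict f \<Lambda>) \<longleftrightarrow> from_index k f" for k f
    by (auto simp: from_index_def)
  have hom: "star_hom EF C h"
    unfolding star_hom_def
  proof (intro conjI ballI allI)
    fix a assume a: "a \<in> carr EF"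
    obtain k where k: "from_index k a" using EF_ex a by blast
    then have k': "k \<in> \<Lambda>" by (simp add: from_index_def)
    note ak = EF_in [OF a k']
    show "h a \<in> carr C" unfolding h [OF a k] by (rule star_homD(1) [OF \<phi> [OF k'] ak])
    show "h (scal EF c a) = scal C c (h a)" for c
    proof -
      have "from_index k (scal EF c a)"
        unfolding EF_sel idx using k k' EF_in [OF a] \<mu>D(3) [OF k'] by (simp add: from_index_def)
      from h [OF EF.scal_closed [OF a] this] show ?thesis
        unfolding h [OF a k] using k' star_homD(3) [OF \<phi> [OF k'] ak] by (simp add: EF_sel)
    qed
    show "h (star EF a) = star C (h a)"
    proof -
      have "from_index k (star EF a)"
        unfolding EF_sel idx using k k' EF_in [OF a] \<mu>D(5) [OF k'] by (simp add: from_index_def)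
      from h [OF EF.star_closed [OF a] this] show ?thesis
        unfolding h [OF a k] using k' star_homD(5) [OF \<phi> [OF k'] ak] by (simp add: EF_sel)
    qed
  next
    fix a b assume ab: "a \<in> carr EF" "b \<in> carr EF"
    then obtain k where k: "from_index k a" "from_index k b" using from_index_common by blast
    then have k': "k \<in> \<Lambda>" by (simp add: from_index_def)
    note abk = EF_in [OF ab(1) k'] EF_in [OF ab(2) k']
    show "h (add EF a b) = add C (h a) (h b)"
    proof -
      have "from_index k (add EF a b)"
        unfolding EF_sel idx using k k' EF_in [OF ab(1)] EF_in [OF ab(2)] \<mu>D(2) [OF k'] by (simp add: from_index_def)
      from h [OF EF.add_closed [OF ab] this] show ?thesis
        unfolding h [OF ab(1) k(1)] h [OF ab(2) k(2)] using k' star_homD(2) [OF \<phi> [OF k'] abk] by (simp add: EF_sel)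
    qed
    show "h (mul EF a b) = mul C (h a) (h b)"
    proof -
      have "from_index k (mul EF a b)"
        unfolding EF_sel idx using k k' EF_in [OF ab(1)] EF_in [OF ab(2)] \<mu>D(4) [OF k'] by (simp add: from_index_def)
      from h [OF EF.mul_closed [OF ab] this] show ?thesis
        unfolding h [OF ab(1) k(1)] h [OF ab(2) k(2)] using k' star_homD(4) [OF \<phi> [OF k'] abk] by (simp add: EF_sel)
    qed
  qed
  have le_nrm: "nrm C (h a) \<le> nrm EF a" if a: "a \<in> carr EF" for a
  proof (rule tendsto_lowerbound [OF tendsto_nrm_EF [OF a] _ nt])
    obtain k where k: "from_index k a" using EF_ex a by blast
    then have k': "k \<in> \<Lambda>" by (simp add: from_index_def)
    have "nrm C (h a) \<le> nrm (A l) (a l)" if l: "l \<in> \<Lambda>" "le k l" for l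
      unfolding h [OF a from_index_raise [OF k EF_in [OF a k'] l]]
      by (rule star_hom_contractive [OF cA [OF l(1)] C.cstar_seminormed_axioms \<phi> [OF l(1)] EF_in [OF a l(1)]])
    then show "\<forall>\<^sub>F l in net. nrm C (h a) \<le> nrm (A l) (a l)" unfolding ev using k' by blast
  qed
  from completion_extend [OF EF.cstar_seminormed_axioms C hom le_nrm, folded inductive_limit_def]
  obtain H where H: "star_hom B C H" "\<forall>a\<in>carr EF. H (to_completion EF a) = h a" by blast
  have "H (inj_lim l x) = \<phi> l x" if l: "l \<in> \<Lambda>" and x: "x \<in> carr (A l)" for l x
  proof -
    have f: "fam l x \<in> carr EF" by (rule star_homD(1) [OF star_hom_fam [OF l] x])
    show ?thesis
      unfolding inj_lim_def using H(2) f h [OF f fam_from_index [OF l x]] l x D(2) [OF l]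
      by (simp add: fam_def \<mu>_refl)
  qed
  then show ?thesis using H(1) by blast
qed

end

section \<open>Projective limits of one-point compactifications\<close>

lemma directed_finite_bound:
  assumes d: "directed_set \<Lambda> le" and "finite S" "S \<subseteq> \<Lambda>" shows "\<exists>k\<in>\<Lambda>. \<forall>l\<in>S. le l k"
  using assms(2,3)
proof (induction S rule: finite_induct)
  case empty
  then show ?case using directed_setD(1) [OF d] by blast
next
  case (insert i S)
  then obtain k where k: "k \<in> \<Lambda>" "\<forall>l\<in>S. le l k" by blast
  have i: "i \<in> \<Lambda>" using insert by simp
  obtain j where j: "j \<in> \<Lambda>" "le i j" "le k j" using directed_setD(4) [OF d i k(1)] by blast
  have "le l j" if "l \<in> S" for l
    by (rule directed_setD(3) [OF d _ k(1) j(1) _ j(3)]) (use that insert k in auto)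
  then show ?case using j by blast
qed

locale inv_sys =
  fixes \<Lambda> :: "'l set" and le :: "'l \<Rightarrow> 'l \<Rightarrow> bool" and X :: "'l \<Rightarrow> 'a topology"
    and m :: "'l \<Rightarrow> 'l \<Rightarrow> 'a option \<Rightarrow> 'a option"
  assumes dir: "directed_set \<Lambda> le"
    and lc: "\<And>l. l \<in> \<Lambda> \<Longrightarrow> locally_compact_space (X l)" and hd: "\<And>l. l \<in> \<Lambda> \<Longrightarrow> Hausdorff_space (X l)"
    and cont: "\<And>l k. \<lbrakk>l \<in> \<Lambda>; k \<in> \<Lambda>; le l k\<rbrakk>
      \<Longrightarrow> continuous_map (Alexandroff_compactification (X k)) (Alexandroff_compactification (X l)) (m l k)"
    and m_None: "\<And>l k. \<lbrakk>l \<in> \<Lambda>; k \<in> \<Lambda>; le l k\<rbrakk> \<Longrightarrow> m l k None = None"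
    and m_refl: "\<And>l x. \<lbrakk>l \<in> \<Lambda>; x \<in> topspace (Alexandroff_compactification (X l))\<rbrakk> \<Longrightarrow> m l l x = x"
    and m_trans: "\<And>l k j x. \<lbrakk>l \<in> \<Lambda>; k \<in> \<Lambda>; j \<in> \<Lambda>; le l k; le k j; x \<in> topspace (Alexandroff_compactification (X j))\<rbrakk>
      \<Longrightarrow> m l k (m k j x) = m l j x"
begin

abbreviation "K l \<equiv> Alexandroff_compactification (X l)"
abbreviation "Z \<equiv> lim_compact \<Lambda> le X m"
abbreviation "L \<equiv> lim_space \<Lambda> le X m"
abbreviation "P \<equiv> product_topology K \<Lambda>"

lemmas D = directed_setD [OF dir]

lemma K_Hausdorff: "l \<in> \<Lambda> \<Longrightarrow> Hausdorff_space (K l)"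
  by (simp add: Hausdorff_space_Alexandroff_compactification hd lc)

lemma m_in: "\<lbrakk>l \<in> \<Lambda>; k \<in> \<Lambda>; le l k; x \<in> topspace (K k)\<rbrakk> \<Longrightarrow> m l k x \<in> topspace (K l)"
  using continuous_map_image_subset_topspace [OF cont] by blast

lemma topspace_Z: "x \<in> topspace Z \<longleftrightarrow> x \<in> topspace P \<and> (\<forall>l\<in>\<Lambda>. \<forall>k\<in>\<Lambda>. le l k \<longrightarrow> m l k (x k) = x l)"
  unfolding lim_compact_def by simp

lemma Z_in: "\<lbrakk>x \<in> topspace Z; l \<in> \<Lambda>\<rbrakk> \<Longrightarrow> x l \<in> topspace (K l)"
  unfolding topspace_Z topspace_product_topology by (meson PiE_mem)

lemma Z_compat: "\<lbrakk>x \<in> topspace Z; l \<in> \<Lambda>; k \<in> \<Lambda>; le l k\<rbrakk> \<Longrightarrow> m l k (x k) = x l"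
  unfolding topspace_Z by blast

lemma Z_eqI_cofinal:
  assumes x: "x \<in> topspace Z" and y: "y \<in> topspace Z" and l0: "l0 \<in> \<Lambda>"
    and eq: "\<And>k. \<lbrakk>k \<in> \<Lambda>; le l0 k\<rbrakk> \<Longrightarrow> x k = y k"
  shows "x = y"
proof (rule extensionalityI [of _ \<Lambda>])
  show "x \<in> extensional \<Lambda>" "y \<in> extensional \<Lambda>"
    using x y unfolding topspace_Z topspace_product_topology by (auto simp: PiE_def)
  fix l assume l: "l \<in> \<Lambda>"
  obtain k where k: "k \<in> \<Lambda>" "le l k" "le l0 k" using D(4) [OF l l0] by blast
  show "x l = y l" using Z_compat [OF x l k(1,2)] Z_compat [OF y l k(1,2)] eq [OF k(1,3)] by simp
qed

text \<open>Points of the limit are often known only from some stage on. Lower coordinates are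
  forced: they are the images of a coordinate above both the given index and
  \<open>l0\<close>.\<close>

lemma Z_extend_cofinal:
  assumes l0: "l0 \<in> \<Lambda>" and z: "\<And>k. \<lbrakk>k \<in> \<Lambda>; le l0 k\<rbrakk> \<Longrightarrow> z k \<in> topspace (K k)"
    and compat: "\<And>k j. \<lbrakk>k \<in> \<Lambda>; j \<in> \<Lambda>; le l0 k; le k j\<rbrakk> \<Longrightarrow> m k j (z j) = z k"
  shows "\<exists>x\<in>topspace Z. \<forall>k\<in>\<Lambda>. le l0 k \<longrightarrow> x k = z k"
proof -
  define up where "up l = (SOME k. k \<in> \<Lambda> \<and> le l k \<and> le l0 k)" for l
  have up: "up l \<in> \<Lambda> \<and> le l (up l) \<and> le l0 (up l)" if "l \<in> \<Lambda>" for l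
    unfolding up_def by (rule someI_ex) (use D(4) [OF that l0] in blast)
  define x where "x = (\<lambda>l\<in>\<Lambda>. m l (up l) (z (up l)))"
  \<comment> \<open>The value does not depend on the upper bound used; two bounds are compared
    through a common one, \<open>j\<close>.\<close>
  have x: "x l = m l k (z k)" if l: "l \<in> \<Lambda>" and k: "k \<in> \<Lambda>" "le l k" "le l0 k" for l k
  proof -
    obtain j where j: "j \<in> \<Lambda>" "le (up l) j" "le k j" using D(4) [of "up l" k] up [OF l] k by blast
    have l0j: "le l0 j" by (rule D(3) [OF l0 k(1) j(1) k(3) j(3)])
    have "m l (up l) (z (up l)) = m l (up l) (m (up l) j (z j))"
      using compat [of "up l" j] up [OF l] j by simp
    also have "\<dots> = m l j (z j)" using up [OF l] j l z [OF j(1) l0j] by (intro m_trans) auto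
    also have "\<dots> = m l k (m k j (z j))" using k j l z [OF j(1) l0j] by (intro m_trans [symmetric]) auto
    also have "\<dots> = m l k (z k)" using compat [OF k(1) j(1) k(3) j(3)] by simp
    finally show ?thesis using l by (simp add: x_def)
  qed
  have "x \<in> topspace Z"
    unfolding topspace_Z topspace_product_topology
  proof (intro conjI ballI impI)
    show "x \<in> (\<Pi>\<^sub>E l\<in>\<Lambda>. topspace (K l))"
    proof (rule PiE_I)
      fix l assume l: "l \<in> \<Lambda>"
      show "x l \<in> topspace (K l)" using up [OF l] l z [of "up l"] m_in [of l "up l" "z (up l)"] x [of l "up l"] by metis
    qed (simp add: x_def)
    fix l k assume lk: "l \<in> \<Lambda>" "k \<in> \<Lambda>" "le l k"
    have u: "up k \<in> \<Lambda>" "le k (up k)" "le l0 (up k)" using up [OF lk(2)] by auto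
    have "le l (up k)" by (rule D(3) [OF lk(1,2) u(1) lk(3) u(2)])
    then have "x l = m l (up k) (z (up k))" by (rule x [OF lk(1) u(1) _ u(3)])
    moreover have "x k = m k (up k) (z (up k))" by (rule x [OF lk(2) u])
    ultimately show "m l k (x k) = x l" using lk u z by (simp add: m_trans)
  qed
  moreover have "x k = z k" if k: "k \<in> \<Lambda>" "le l0 k" for k
    using x [OF k(1) k(1) D(2) [OF k(1)] k(2)] m_refl [OF k(1) z [OF k]] by simp
  ultimately show ?thesis by blast
qed

lemma continuous_map_Z: "l \<in> \<Lambda> \<Longrightarrow> continuous_map Z (K l) (\<lambda>x. x l)"
  unfolding lim_compact_def
  by (rule continuous_map_from_subtopology) (rule continuous_map_product_projection)

lemma continuous_map_P: "l \<in> \<Lambda> \<Longrightarrow> continuous_map P (K l) (\<lambda>x. x l)"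
  by (rule continuous_map_product_projection)

lemma P_compact: "compact_space P"
  unfolding compact_space_product_topology by simp

lemma P_Hausdorff: "Hausdorff_space P"
  unfolding Hausdorff_space_product_topology using K_Hausdorff by blast

lemma closedin_compat:
  assumes "l \<in> \<Lambda>" "k \<in> \<Lambda>" "le l k" shows "closedin P {x \<in> topspace P. m l k (x k) = x l}"
proof (rule closedin_continuous_maps_eq [OF K_Hausdorff [OF assms(1)]])
  show "continuous_map P (K l) (\<lambda>x. x l)" by (rule continuous_map_P [OF assms(1)])
  have "continuous_map P (K l) (m l k \<circ> (\<lambda>x. x k))"
    by (rule continuous_map_compose [OF continuous_map_P [OF assms(2)] cont [OF assms]])
  then show "continuous_map P (K l) (\<lambda>x. m l k (x k))" by (simp add: o_def)
qed

lemma closedin_Z: "closedin P (topspace Z)"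
proof -
  obtain l0 where l0: "l0 \<in> \<Lambda>" using D(1) by blast
  let ?C = "\<lambda>(l, k). {x \<in> topspace P. m l k (x k) = x l}"
  let ?I = "{(l, k). l \<in> \<Lambda> \<and> k \<in> \<Lambda> \<and> le l k}"
  have ne: "?I \<noteq> {}" using l0 D(2) by blast
  have "closedin P (\<Inter>p\<in>?I. ?C p)"
  proof (rule closedin_INT [OF ne])
    fix p assume "p \<in> ?I"
    then obtain l k where p: "p = (l, k)" "l \<in> \<Lambda>" "k \<in> \<Lambda>" "le l k" by blast
    show "closedin P (?C p)" unfolding p(1) prod.case by (rule closedin_compat [OF p(2-4)])
  qed
  moreover have "(\<Inter>p\<in>?I. ?C p) = topspace Z"
  proof (intro set_eqI iffI)
    fix x assume "x \<in> (\<Inter>p\<in>?I. ?C p)"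
    then have x: "x \<in> ?C (l, k)" if "l \<in> \<Lambda>" "k \<in> \<Lambda>" "le l k" for l k using that by blast
    have "x \<in> topspace P" using x [OF l0 l0 D(2) [OF l0]] by simp
    then show "x \<in> topspace Z" unfolding topspace_Z using x by simp
  qed (unfold topspace_Z, clarify, simp)
  ultimately show ?thesis by (simp only:)
qed

lemma Z_compact: "compact_space Z" and Z_Hausdorff: "Hausdorff_space Z"
proof -
  have eq: "Z = subtopology P (topspace Z)"
    unfolding lim_compact_def by (simp only: topspace_subtopology subtopology_restrict)
  have "compactin P (topspace Z)" by (rule closedin_compact_space [OF P_compact closedin_Z])
  then show "compact_space Z" by (subst eq) (rule compact_space_subtopology)
  show "Hausdorff_space Z" unfolding lim_compact_def by (rule Hausdorff_space_subtopology [OF P_Hausdorff])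
qed

lemma infty_in: "lim_infty \<Lambda> \<in> topspace Z"
  unfolding topspace_Z by (auto simp: lim_infty_def m_None)

lemma topspace_L: "topspace L = topspace Z - {lim_infty \<Lambda>}"
  unfolding lim_space_def by auto

lemma openin_Z_L: "openin Z (topspace L)"
proof -
  have "closedin Z {lim_infty \<Lambda>}"
    using Hausdorff_imp_t1_space [OF Z_Hausdorff] infty_in by (simp add: t1_space_closedin_singleton)
  then show ?thesis unfolding topspace_L by (simp add: openin_diff)
qed

lemma L_subtopology: "L = subtopology Z (topspace L)"
  unfolding topspace_L by (simp add: lim_space_def)

lemma openin_L: "openin L U \<longleftrightarrow> openin Z U \<and> U \<subseteq> topspace L"
  by (subst L_subtopology) (rule openin_open_subtopology [OF openin_Z_L])

lemma L_lc: "locally_compact_space L" and L_Hausdorff: "Hausdorff_space L"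
proof -
  show "locally_compact_space L"
    by (subst L_subtopology)
      (intro locally_compact_space_open_subset disjI1 Z_Hausdorff compact_imp_locally_compact_space Z_compact openin_Z_L)
  show "Hausdorff_space L"
    by (subst L_subtopology) (rule Hausdorff_space_subtopology [OF Z_Hausdorff])
qed

lemma compactin_L: "compactin L C \<longleftrightarrow> compactin Z C \<and> C \<subseteq> topspace L"
  by (subst L_subtopology) (rule compactin_subtopology)

lemma L_ex: assumes "x \<in> topspace L" shows "\<exists>l\<in>\<Lambda>. x l \<noteq> None"
proof (rule ccontr)
  assume n: "\<not> (\<exists>l\<in>\<Lambda>. x l \<noteq> None)"
  have "x \<in> topspace Z" "x \<noteq> lim_infty \<Lambda>" using assms by (auto simp: topspace_L)
  then have "x \<in> extensional \<Lambda>" unfolding topspace_Z topspace_product_topology by (auto simp: PiE_def)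
  then have "x = lim_infty \<Lambda>"
    by (rule extensionalityI) (use n in \<open>auto simp: lim_infty_def\<close>)
  with \<open>x \<noteq> lim_infty \<Lambda>\<close> show False by simp
qed

lemma L_I: "\<lbrakk>x \<in> topspace Z; l \<in> \<Lambda>; x l \<noteq> None\<rbrakk> \<Longrightarrow> x \<in> topspace L"
  unfolding topspace_L by (auto simp: lim_infty_def)

lemma Z_Some_up:
  assumes x: "x \<in> topspace Z" and l: "l \<in> \<Lambda>" "k \<in> \<Lambda>" "le l k" and s: "x l \<noteq> None" shows "x k \<noteq> None"
proof
  assume "x k = None"
  then show False using Z_compat [OF x l] m_None [OF l] s by simp
qed

definition proj :: "'l \<Rightarrow> ('l \<Rightarrow> 'a option) option \<Rightarrow> 'a option" where
  "proj l z = (case z of None \<Rightarrow> None | Some x \<Rightarrow> x l)"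

lemma proj_simps [simp]: "proj l None = None" "proj l (Some x) = x l"
  by (simp_all add: proj_def)

text \<open>With \<open>continuous_from_Z\<close> this identifies the one-point compactification of
  the limit space with the limit of the one-point compactifications. Functions in
  \<open>C0 L\<close> can thus be studied on the compact space \<open>Z\<close>.\<close>

lemma continuous_to_Z: "continuous_map (Alexandroff_compactification L) Z (case_option (lim_infty \<Lambda>) (\<lambda>x. x))"
  unfolding continuous_map_def
proof (intro conjI allI impI)
  let ?j = "case_option (lim_infty \<Lambda>) (\<lambda>x. x)"
  show "?j \<in> topspace (Alexandroff_compactification L) \<rightarrow> topspace Z"
    using infty_in by (auto simp: topspace_L split: option.splits)
  fix W assume W: "openin Z W"
  let ?P = "{x \<in> topspace (Alexandroff_compactification L). ?j x \<in> W}"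
  show "openin (Alexandroff_compactification L) ?P"
  proof (cases "lim_infty \<Lambda> \<in> W")
    case False
    have "?P = Some ` (W \<inter> topspace L)"
    proof (rule set_eqI)
      fix x show "x \<in> ?P \<longleftrightarrow> x \<in> Some ` (W \<inter> topspace L)" using False by (cases x) auto
    qed
    moreover have "openin L (W \<inter> topspace L)" unfolding openin_L using W openin_Z_L by blast
    ultimately show ?thesis by simp
  next
    case True
    define C where "C = topspace Z - W"
    have C: "closedin Z C" using W unfolding C_def by blast
    have CL: "C \<subseteq> topspace L" using True by (auto simp: C_def topspace_L)
    have "compactin L C" unfolding compactin_L using closedin_compact_space [OF Z_compact C] CL by simp
    moreover from this have "closedin L C" by (rule compactin_imp_closedin [OF L_Hausdorff])
    moreover have "?P = insert None (Some ` (topspace L - C))"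
    proof (rule set_eqI)
      fix x show "x \<in> ?P \<longleftrightarrow> x \<in> insert None (Some ` (topspace L - C))"
        using True openin_subset [OF W] by (cases x) (auto simp: C_def topspace_L)
    qed
    ultimately show ?thesis unfolding openin_Alexandroff_compactification by blast
  qed
qed

lemma continuous_proj:
  assumes "l \<in> \<Lambda>" shows "continuous_map (Alexandroff_compactification L) (K l) (proj l)"
proof -
  have "continuous_map (Alexandroff_compactification L) (K l) ((\<lambda>x. x l) \<circ> case_option (lim_infty \<Lambda>) (\<lambda>x. x))"
    by (rule continuous_map_compose [OF continuous_to_Z continuous_map_Z [OF assms]])
  then show ?thesis
  proof (rule continuous_map_eq)
    fix x show "((\<lambda>x. x l) \<circ> case_option (lim_infty \<Lambda>) (\<lambda>x. x)) x = proj l x"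
      using assms by (cases x) (simp_all add: lim_infty_def)
  qed
qed

lemma continuous_from_Z:
  "continuous_map Z (Alexandroff_compactification L) (\<lambda>x. if x = lim_infty \<Lambda> then None else Some x)"
  unfolding continuous_map_def
proof (intro conjI allI impI)
  let ?i = "\<lambda>x. if x = lim_infty \<Lambda> then None else Some x"
  show "?i \<in> topspace Z \<rightarrow> topspace (Alexandroff_compactification L)" by (auto simp: topspace_L)
  fix W assume "openin (Alexandroff_compactification L) W"
  then consider U where "openin L U" "W = Some ` U"
    | C where "compactin L C" "W = insert None (Some ` (topspace L - C))"
    unfolding openin_Alexandroff_compactification by blast
  then show "openin Z {x \<in> topspace Z. ?i x \<in> W}"
  proof cases
    case 1
    then have "{x \<in> topspace Z. ?i x \<in> W} = U" using openin_subset [OF 1(1)] by (auto simp: topspace_L)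
    then show ?thesis using 1(1) openin_L by simp
  next
    case 2
    have "closedin Z C" using 2(1) compactin_imp_closedin [OF Z_Hausdorff] unfolding compactin_L by blast
    moreover have "{x \<in> topspace Z. ?i x \<in> W} = topspace Z - C"
      using 2 compactin_L infty_in by (auto simp: topspace_L)
    ultimately show ?thesis by (simp add: openin_diff)
  qed
qed

text \<open>The points of the product that are compatible below \<open>k\<close> and meet
  \<open>C\<close> at \<open>l\<close> form closed sets \<open>S k\<close>, decreasing in
  \<open>k\<close> and nonempty by hypothesis. By compactness of the product they have a common
  point, and it is compatible everywhere.\<close>

lemma Z_nonempty_fip:
  assumes l: "l \<in> \<Lambda>" and C: "closedin (K l) C"
    and ex: "\<And>k. \<lbrakk>k \<in> \<Lambda>; le l k\<rbrakk> \<Longrightarrow> \<exists>x\<in>topspace (K k). m l k x \<in> C"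
  shows "\<exists>x\<in>topspace Z. x l \<in> C"
proof (rule ccontr)
  assume none: "\<not> (\<exists>x\<in>topspace Z. x l \<in> C)"
  define I where "I = {k \<in> \<Lambda>. le l k}"
  define S where "S k = {y \<in> topspace P. y l \<in> C} \<inter> (\<Inter>i\<in>{i \<in> \<Lambda>. le i k}. {y \<in> topspace P. m i k (y k) = y i})" for k
  have S: "closedin P (S k)" if k: "k \<in> I" for k
    unfolding S_def
  proof (rule closedin_Int)
    show "closedin P {y \<in> topspace P. y l \<in> C}"
      by (rule closedin_continuous_map_preimage [OF continuous_map_P [OF l] C])
    show "closedin P (\<Inter>i\<in>{i \<in> \<Lambda>. le i k}. {y \<in> topspace P. m i k (y k) = y i})"
    proof (rule closedin_INT)
      show "{i \<in> \<Lambda>. le i k} \<noteq> {}" using k D(2) unfolding I_def by blast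
      fix i assume "i \<in> {i \<in> \<Lambda>. le i k}"
      then show "closedin P {y \<in> topspace P. m i k (y k) = y i}"
        using closedin_compat [of i k] k unfolding I_def by blast
    qed
  qed
  have anti: "S j \<subseteq> S k" if k: "k \<in> I" and j: "j \<in> \<Lambda>" "le k j" for k j
  proof
    fix y assume y: "y \<in> S j"
    have kL: "k \<in> \<Lambda>" using k by (simp add: I_def)
    have yP: "y \<in> topspace P" "y l \<in> C" and c: "m i j (y j) = y i" if "i \<in> \<Lambda>" "le i j" for i
      using y that by (auto simp: S_def)
    have "y \<in> topspace P" "y l \<in> C" using y by (auto simp: S_def)
    have yj: "y j \<in> topspace (K j)" using \<open>y \<in> topspace P\<close> j(1) by auto
    have "m i k (y k) = y i" if i: "i \<in> \<Lambda>" "le i k" for i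
    proof -
      have "m i k (m k j (y j)) = m i j (y j)" by (rule m_trans [OF i(1) kL j(1) i(2) j(2) yj])
      moreover have "le i j" by (rule D(3) [OF i(1) kL j(1) i(2) j(2)])
      ultimately show ?thesis using c [OF kL j(2)] c [OF i(1)] by simp
    qed
    then show "y \<in> S k" using \<open>y \<in> topspace P\<close> \<open>y l \<in> C\<close> by (auto simp: S_def)
  qed
  have ne: "S k \<noteq> {}" if k: "k \<in> I" for k
  proof -
    have kL: "k \<in> \<Lambda>" "le l k" using k by (auto simp: I_def)
    obtain x where x: "x \<in> topspace (K k)" "m l k x \<in> C" using ex [OF kL] by blast
    \<comment> \<open>Coordinates below \<open>k\<close> are pushed down from \<open>x\<close>; the
      remaining ones are unconstrained and receive the point at infinity.\<close>
    define y where "y = (\<lambda>i\<in>\<Lambda>. if le i k then m i k x else None)"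
    have "y \<in> topspace P"
      unfolding topspace_product_topology
      by (rule PiE_I) (use m_in kL x in \<open>auto simp: y_def simp del: topspace_Alexandroff_compactification\<close>, simp)
    moreover have "y k = x" using kL D(2) [OF kL(1)] m_refl [OF kL(1) x(1)] by (simp add: y_def)
    ultimately have "y \<in> S k" using x l kL by (auto simp: S_def y_def)
    then show ?thesis by blast
  qed
  have "topspace P \<subseteq> \<Union> ((\<lambda>k. topspace P - S k) ` I)"
  proof
    fix y assume y: "y \<in> topspace P"
    show "y \<in> \<Union> ((\<lambda>k. topspace P - S k) ` I)"
    proof (rule ccontr)
      assume "y \<notin> \<Union> ((\<lambda>k. topspace P - S k) ` I)"
      then have yS: "y \<in> S k" if "k \<in> I" for k using y that by blast
      have "m i j (y j) = y i" if ij: "i \<in> \<Lambda>" "j \<in> \<Lambda>" "le i j" for i j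
      proof -
        obtain k where k: "k \<in> \<Lambda>" "le l k" "le j k" using D(4) [OF l ij(2)] by blast
        have ik: "le i k" by (rule D(3) [OF ij(1,2) k(1) ij(3) k(3)])
        have "y \<in> S k" using yS k by (simp add: I_def)
        then have "m i k (y k) = y i" "m j k (y k) = y j" using ij ik k by (auto simp: S_def)
        moreover have "y k \<in> topspace (K k)" using y k(1) by auto
        ultimately show ?thesis using m_trans [OF ij(1,2) k(1) ij(3) k(3), of "y k"] by (simp only:)
      qed
      then have "y \<in> topspace Z" unfolding topspace_Z using y by blast
      moreover have "l \<in> I" using l D(2) by (simp add: I_def)
      then have "y l \<in> C" using yS [of l] by (auto simp: S_def)
      ultimately show False using none by blast
    qed
  qed
  moreover have "openin P U" if "U \<in> (\<lambda>k. topspace P - S k) ` I" for U using that S by blast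
  ultimately obtain \<F> where F: "finite \<F>" "\<F> \<subseteq> (\<lambda>k. topspace P - S k) ` I" "topspace P \<subseteq> \<Union>\<F>"
    using compactinD [of P "topspace P" "(\<lambda>k. topspace P - S k) ` I"] P_compact unfolding compact_space_def by blast
  obtain J where J: "J \<subseteq> I" "finite J" "\<F> = (\<lambda>k. topspace P - S k) ` J"
    using finite_subset_image [OF F(1,2)] by blast
  have "finite (insert l J)" "insert l J \<subseteq> \<Lambda>" using J l by (auto simp: I_def)
  then obtain k where k: "k \<in> \<Lambda>" "\<forall>i\<in>insert l J. le i k" using directed_finite_bound [OF dir] by blast
  have "k \<in> I" using k by (simp add: I_def)
  then obtain y where y: "y \<in> S k" using ne by blast
  then have "y \<in> topspace P" by (auto simp: S_def)
  then obtain i where i: "i \<in> J" "y \<notin> S i" using F(3) J(3) by blast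
  then show False using anti [of i k] J k y by blast
qed

text \<open>For disjoint \<open>A\<close> and \<open>B\<close> the open sets of pairs that differ in
  coordinate \<open>l\<close> cover the compact product of \<open>A\<close> and \<open>B\<close>.
  Differing at a coordinate persists at every later one, so an upper bound of a finite subcover
  separates all pairs at once.\<close>

lemma Z_separate:
  assumes A: "closedin Z A" and B: "closedin Z B" and AB: "A \<inter> B = {}"
  shows "\<exists>l\<in>\<Lambda>. \<forall>a\<in>A. \<forall>b\<in>B. a l \<noteq> b l"
proof -
  let ?ZZ = "prod_topology Z Z"
  let ?W = "\<lambda>l. topspace ?ZZ - {p \<in> topspace ?ZZ. fst p l = snd p l}"
  have op: "openin ?ZZ (?W l)" if l: "l \<in> \<Lambda>" for l
  proof -
    have "continuous_map ?ZZ (K l) ((\<lambda>x. x l) \<circ> fst)" "continuous_map ?ZZ (K l) ((\<lambda>x. x l) \<circ> snd)"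
      by (rule continuous_map_compose [OF continuous_map_fst continuous_map_Z [OF l]],
          rule continuous_map_compose [OF continuous_map_snd continuous_map_Z [OF l]])
    from closedin_continuous_maps_eq [OF K_Hausdorff [OF l] this]
    have "closedin ?ZZ {p \<in> topspace ?ZZ. fst p l = snd p l}" by simp
    then show ?thesis by blast
  qed
  have sub: "A \<subseteq> topspace Z" "B \<subseteq> topspace Z" using A B closedin_subset by blast+
  have "compactin ?ZZ (A \<times> B)"
    unfolding compactin_Times using closedin_compact_space [OF Z_compact] A B by blast
  moreover have "A \<times> B \<subseteq> \<Union> (?W ` \<Lambda>)"
  proof clarify
    fix a b assume ab: "a \<in> A" "b \<in> B"
    then have "a \<in> topspace Z" "b \<in> topspace Z" "a \<noteq> b" using sub AB by blast+
    then obtain l where "l \<in> \<Lambda>" "a l \<noteq> b l"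
      using D(1) Z_eqI_cofinal [of a b] by blast
    then show "(a, b) \<in> \<Union> (?W ` \<Lambda>)" using \<open>a \<in> topspace Z\<close> \<open>b \<in> topspace Z\<close> by auto
  qed
  ultimately obtain \<F> where F: "finite \<F>" "\<F> \<subseteq> ?W ` \<Lambda>" "A \<times> B \<subseteq> \<Union>\<F>"
    using compactinD [of ?ZZ "A \<times> B" "?W ` \<Lambda>"] op by blast
  obtain J where J: "J \<subseteq> \<Lambda>" "finite J" "\<F> = ?W ` J" using finite_subset_image [OF F(1,2)] by blast
  obtain k where k: "k \<in> \<Lambda>" "\<forall>l\<in>J. le l k" using directed_finite_bound [OF dir J(2,1)] by blast
  have "a k \<noteq> b k" if ab: "a \<in> A" "b \<in> B" for a b
  proof
    assume eq: "a k = b k"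
    have "(a, b) \<in> \<Union> (?W ` J)" by (rule subsetD [OF F(3) [unfolded J(3)]]) (use ab in simp)
    then obtain l where lJ: "l \<in> J" and "(a, b) \<in> ?W l" by (rule UN_E)
    then have al: "a l \<noteq> b l" and "a \<in> topspace Z" "b \<in> topspace Z" by simp_all
    moreover have "l \<in> \<Lambda>" using lJ J(1) by (rule rev_subsetD)
    ultimately have "m l k (a k) = a l" "m l k (b k) = b l" using Z_compat k lJ by simp_all
    with eq al show False by simp
  qed
  then show ?thesis using k(1) by blast
qed

text \<open>One step of the construction behind Tietze's theorem, carried out on a coordinate space.
  The sets where \<open>f\<close> is at most -c/3 and at least c/3 have disjoint closed images in
  some \<open>K l\<close>; a Urysohn function with values between -c/3 and c/3 leaves an error of at
  most 2c/3 in each of the three ranges of \<open>f\<close>.\<close>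

lemma Urysohn_step:
  assumes f: "continuous_map Z euclideanreal f" and c: "0 < c" "\<And>x. x \<in> topspace Z \<Longrightarrow> \<bar>f x\<bar> \<le> c"
  shows "\<exists>l\<in>\<Lambda>. \<exists>g. continuous_map (K l) euclideanreal g \<and> (\<forall>x\<in>topspace Z. \<bar>f x - g (x l)\<bar> \<le> 2/3 * c)"
proof -
  let ?A = "{x \<in> topspace Z. f x \<in> {..-c/3}}" and ?B = "{x \<in> topspace Z. f x \<in> {c/3..}}"
  have A: "closedin Z ?A" and B: "closedin Z ?B" by (intro closedin_continuous_map_preimage [OF f]; simp)+
  have "?A \<inter> ?B = {}" using c(1) by auto
  then obtain l where l: "l \<in> \<Lambda>" and sep: "\<forall>a\<in>?A. \<forall>b\<in>?B. a l \<noteq> b l" using Z_separate [OF A B] by blast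
  have im: "closedin (K l) ((\<lambda>x. x l) ` C)" if "closedin Z C" for C
    by (rule compactin_imp_closedin [OF K_Hausdorff [OF l]])
      (rule image_compactin [OF closedin_compact_space [OF Z_compact that] continuous_map_Z [OF l]])
  have "normal_space (K l)"
    by (rule compact_Hausdorff_or_regular_imp_normal_space) (simp_all add: K_Hausdorff [OF l])
  moreover have "disjnt ((\<lambda>x. x l) ` ?A) ((\<lambda>x. x l) ` ?B)" using sep unfolding disjnt_iff by blast
  moreover have "-c/3 \<le> c/3" using c(1) by simp
  ultimately obtain g where g: "continuous_map (K l) (top_of_set {-c/3..c/3}) g"
    "g ` ((\<lambda>x. x l) ` ?A) \<subseteq> {-c/3}" "g ` ((\<lambda>x. x l) ` ?B) \<subseteq> {c/3}"
    using Urysohn_lemma [OF _ im [OF A] im [OF B]] by blast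
  have g': "continuous_map (K l) euclideanreal g" using g(1) continuous_map_into_fulltopology by blast
  have "\<bar>f x - g (x l)\<bar> \<le> 2/3 * c" if x: "x \<in> topspace Z" for x
  proof -
    have "g \<in> topspace (K l) \<rightarrow> topspace (top_of_set {-c/3..c/3})" using g(1) unfolding continuous_map_def by blast
    then have "g (x l) \<in> topspace (top_of_set {-c/3..c/3})" using Z_in [OF x l] by (rule funcset_mem)
    then have "-c/3 \<le> g (x l)" "g (x l) \<le> c/3" by simp_all
    moreover have "g (x l) = -c/3" if "f x \<le> -c/3" using g(2) x that by (simp add: image_subset_iff)
    moreover have "g (x l) = c/3" if "c/3 \<le> f x" using g(3) x that by (simp add: image_subset_iff)
    ultimately show ?thesis
      using c(2) [OF x] c(1) unfolding abs_le_iff by (cases "f x \<le> -c/3"; cases "c/3 \<le> f x") (simp_all add: field_simps; linarith)+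
  qed
  then show ?thesis using l g' by blast
qed

lemma Z_approx_pow:
  assumes f: "continuous_map Z euclideanreal f" and c: "0 < c" "\<And>x. x \<in> topspace Z \<Longrightarrow> \<bar>f x\<bar> \<le> c"
  shows "\<exists>l\<in>\<Lambda>. \<exists>g. continuous_map (K l) euclideanreal g \<and> (\<forall>x\<in>topspace Z. \<bar>f x - g (x l)\<bar> \<le> (2/3)^n * c)"
proof (induction n)
  case 0
  obtain l where "l \<in> \<Lambda>" using D(1) by blast
  then show ?case using c(2) by (intro bexI [of _ l] exI [of _ "\<lambda>x. 0"]) auto
next
  case (Suc n)
  then obtain l g where l: "l \<in> \<Lambda>" and g: "continuous_map (K l) euclideanreal g"
    and le: "\<forall>x\<in>topspace Z. \<bar>f x - g (x l)\<bar> \<le> (2/3)^n * c" by blast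
  have "continuous_map Z euclideanreal (g \<circ> (\<lambda>x. x l))"
    by (rule continuous_map_compose [OF continuous_map_Z [OF l] g])
  then have "continuous_map Z euclideanreal (\<lambda>x. f x - g (x l))"
    by (intro continuous_map_diff f) (simp add: o_def)
  from Urysohn_step [OF this, of "(2/3)^n * c"] obtain l' g' where l': "l' \<in> \<Lambda>"
    and g': "continuous_map (K l') euclideanreal g'"
    and le': "\<forall>x\<in>topspace Z. \<bar>f x - g (x l) - g' (x l')\<bar> \<le> 2/3 * ((2/3)^n * c)"
    using c(1) le by auto
  \<comment> \<open>The previous approximation and the correction live at different stages; both are
    pulled up to a common one before they are added.\<close>
  obtain k where k: "k \<in> \<Lambda>" "le l k" "le l' k" using D(4) [OF l l'] by blast
  have "continuous_map (K k) euclideanreal (g \<circ> m l k)" "continuous_map (K k) euclideanreal (g' \<circ> m l' k)"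
    by (rule continuous_map_compose [OF cont [OF l k(1,2)] g], rule continuous_map_compose [OF cont [OF l' k(1,3)] g'])
  then have "continuous_map (K k) euclideanreal (\<lambda>y. g (m l k y) + g' (m l' k y))"
    by (intro continuous_map_add) (simp_all add: o_def)
  moreover have "\<bar>f x - (g (m l k (x k)) + g' (m l' k (x k)))\<bar> \<le> (2/3)^Suc n * c" if "x \<in> topspace Z" for x
    using le' that Z_compat [OF that l k(1,2)] Z_compat [OF that l' k(1,3)] by (simp add: algebra_simps)
  ultimately show ?case using k(1) by blast
qed

lemma Z_approx:
  assumes f: "continuous_map Z euclideanreal f" and e: "0 < e"
  shows "\<exists>l\<in>\<Lambda>. \<exists>g. continuous_map (K l) euclideanreal g \<and> (\<forall>x\<in>topspace Z. \<bar>f x - g (x l)\<bar> \<le> e)"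
proof -
  have "compactin Z (topspace Z)" using Z_compact by (simp add: compact_space_def)
  then have "compact (f ` topspace Z)" using image_compactin [OF _ f] by fastforce
  then have "bounded (f ` topspace Z)" by (rule compact_imp_bounded)
  then obtain c where c: "0 < c" "\<forall>y\<in>f ` topspace Z. norm y \<le> c" unfolding bounded_pos by blast
  obtain n where n: "(2/3)^n < e / c" using real_arch_pow_inv [of "e/c" "2/3"] e c by auto
  then have "(2/3)^n * c \<le> e" using c(1) by (simp add: pos_less_divide_eq)
  moreover obtain l g where "l \<in> \<Lambda>" "continuous_map (K l) euclideanreal g"
    "\<forall>x\<in>topspace Z. \<bar>f x - g (x l)\<bar> \<le> (2/3)^n * c"
    using Z_approx_pow [OF f c(1), of n] c(2) by auto
  ultimately show ?thesis by fastforce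
qed

lemma C0_L_dense:
  assumes f: "f \<in> C0 L" and e: "0 < e"
  shows "\<exists>l\<in>\<Lambda>. \<exists>g\<in>C0 (X l). \<forall>x\<in>topspace L. cmod (f x - pull_back L (proj l) g x) \<le> e"
proof -
  let ?F = "\<lambda>x. case_option 0 f (if x = lim_infty \<Lambda> then None else Some x)"
  have F: "continuous_map Z euclidean ?F"
    using continuous_map_compose [OF continuous_from_Z C0_eq_case_option [OF f]] by (simp add: o_def)
  have Re: "continuous_map Z euclideanreal (\<lambda>x. Re (?F x))" and Im: "continuous_map Z euclideanreal (\<lambda>x. Im (?F x))"
    by (rule continuous_map_compose_isCont [OF F], intro continuous_intros)+
  \<comment> \<open>The budget: e/4 for each of the real and imaginary parts gives e/2 for
    \<open>G\<close>, and the later shift by \<open>G None\<close> costs another e/2.\<close>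
  have "0 < e/4" using e by simp
  then obtain l1 g1 l2 g2 where l1: "l1 \<in> \<Lambda>" and g1: "continuous_map (K l1) euclideanreal g1"
    and le1: "\<forall>x\<in>topspace Z. \<bar>Re (?F x) - g1 (x l1)\<bar> \<le> e/4"
    and l2: "l2 \<in> \<Lambda>" and g2: "continuous_map (K l2) euclideanreal g2"
    and le2: "\<forall>x\<in>topspace Z. \<bar>Im (?F x) - g2 (x l2)\<bar> \<le> e/4"
    using Z_approx [OF Re] Z_approx [OF Im] by meson
  obtain k where k: "k \<in> \<Lambda>" "le l1 k" "le l2 k" using D(4) [OF l1 l2] by blast
  define G where "G y = complex_of_real (g1 (m l1 k y)) + \<i> * complex_of_real (g2 (m l2 k y))" for y
  have c: "continuous_map (K k) euclideanreal (\<lambda>y. g1 (m l1 k y))" "continuous_map (K k) euclideanreal (\<lambda>y. g2 (m l2 k y))"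
    using continuous_map_compose [OF cont [OF l1 k(1,2)] g1] continuous_map_compose [OF cont [OF l2 k(1,3)] g2]
    by (simp_all add: o_def)
  have G: "continuous_map (K k) euclidean G"
    unfolding G_def [abs_def]
    by (intro continuous_map_add continuous_map_times
        continuous_map_compose_isCont [OF c(1)] continuous_map_compose_isCont [OF c(2)] continuous_intros) simp
  have near: "cmod (?F x - G (x k)) \<le> e/2" if x: "x \<in> topspace Z" for x
  proof -
    have eq: "m l1 k (x k) = x l1" "m l2 k (x k) = x l2"
      using Z_compat [OF x l1 k(1,2)] Z_compat [OF x l2 k(1,3)] by auto
    have "cmod (?F x - G (x k)) \<le> \<bar>Re (?F x - G (x k))\<bar> + \<bar>Im (?F x - G (x k))\<bar>" by (rule cmod_le)
    also have "\<dots> = \<bar>Re (?F x) - g1 (x l1)\<bar> + \<bar>Im (?F x) - g2 (x l2)\<bar>" by (simp add: G_def eq)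
    also have "\<dots> \<le> e/4 + e/4" using le1 le2 x by (intro add_mono) blast+
    finally show ?thesis by simp
  qed
  have G0: "cmod (G None) \<le> e/2" using near [OF infty_in] k(1) by (simp add: lim_infty_def)
  \<comment> \<open>Subtracting the value at infinity puts the approximant into \<open>C0\<close>.
    The shift is small because the extension of \<open>f\<close> vanishes at infinity and
    \<open>G\<close> is near it there as well.\<close>
  define g where "g x = (if x \<in> topspace (X k) then G (Some x) - G None else 0)" for x
  have "continuous_map (K k) euclidean (\<lambda>y. G y - G None)" by (intro continuous_map_diff G) simp
  from C0_of_compactification [OF this] have g: "g \<in> C0 (X k)" by (simp add: g_def [abs_def])
  have "cmod (f x - pull_back L (proj k) g x) \<le> e" if x: "x \<in> topspace L" for x
  proof -
    have xZ: "x \<in> topspace Z" "x \<noteq> lim_infty \<Lambda>" using x by (auto simp: topspace_L)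
    have "pull_back L (proj k) g x = G (x k) - G None"
      using x Z_in [OF xZ(1) k(1)] by (cases "x k") (auto simp: pull_back_apply g_def)
    then have "cmod (f x - pull_back L (proj k) g x) \<le> cmod (f x - G (x k)) + cmod (G None)"
      using norm_triangle_ineq [of "f x - G (x k)" "G None"] by (simp add: diff_diff_eq2 diff_add_eq)
    then show ?thesis using near [OF xZ(1)] xZ(2) G0 by simp
  qed
  then show ?thesis using k(1) g by blast
qed

text \<open>If every later stage had a point where the pullback exceeds c + e, then the closed set
  where the extended \<open>g\<close> has modulus at least c + e would be reached from all stages,
  hence by a point of \<open>Z\<close>. That point is not at infinity, since c + e is positive, and
  it contradicts the bound on the limit.\<close>

lemma C0_L_norm:
  assumes l: "l \<in> \<Lambda>" and g: "g \<in> C0 (X l)" and c: "\<And>x. x \<in> topspace L \<Longrightarrow> cmod (pull_back L (proj l) g x) \<le> c"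
    "0 \<le> c" and e: "0 < e"
  shows "\<exists>k\<in>\<Lambda>. le l k \<and> (\<forall>y\<in>topspace (X k). cmod (pull_back (X k) (m l k) g y) \<le> c + e)"
proof (rule ccontr)
  assume n: "\<not> ?thesis"
  let ?C = "{z \<in> topspace (K l). c + e \<le> norm (case_option 0 g z)}"
  have "closedin (K l) ?C" by (rule closedin_norm_ge [OF C0_eq_case_option [OF g]])
  moreover have "\<exists>x\<in>topspace (K k). m l k x \<in> ?C" if k: "k \<in> \<Lambda>" "le l k" for k
  proof -
    obtain y where y: "y \<in> topspace (X k)" "c + e < cmod (pull_back (X k) (m l k) g y)"
      using n k by (meson not_le)
    have "m l k (Some y) \<in> topspace (K l)" by (rule m_in [OF l k]) (simp add: y(1))
    then show ?thesis using y by (intro bexI [of _ "Some y"]) (auto simp: pull_back_apply)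
  qed
  ultimately obtain x where x: "x \<in> topspace Z" "x l \<in> ?C" using Z_nonempty_fip [OF l] by blast
  have "x l \<noteq> None" using x(2) c(2) e by auto
  then have "x \<in> topspace L" by (rule L_I [OF x(1) l])
  then show False using c(1) [of x] x(2) e by (auto simp: pull_back_apply)
qed

text \<open>Neighbourhoods can be taken as cylinders over a single stage, since the finitely many
  coordinates of a basic open set are all determined by one later coordinate. The freedom to demand
  \<open>le l1 k\<close> lets that stage lie above one where a given edge is finite.\<close>

lemma L_basis:
  assumes O: "openin L U" and x: "x \<in> U" and l1: "l1 \<in> \<Lambda>"
  shows "\<exists>k\<in>\<Lambda>. le l1 k \<and> (\<exists>W. openin (X k) W \<and> x k \<in> Some ` W \<and> {y \<in> topspace L. y k \<in> Some ` W} \<subseteq> U)"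
proof -
  have UZ: "openin Z U" "U \<subseteq> topspace L" using O by (auto simp: openin_L)
  then have xL: "x \<in> topspace L" using x by blast
  then have xZ: "x \<in> topspace Z" by (simp add: topspace_L)
  obtain T where T: "openin P T" "U = T \<inter> {x. \<forall>l\<in>\<Lambda>. \<forall>k\<in>\<Lambda>. le l k \<longrightarrow> m l k (x k) = x l}"
    using UZ(1) unfolding lim_compact_def openin_subtopology by blast
  then have "x \<in> T" using x by blast
  then obtain V where V: "finite {i \<in> \<Lambda>. V i \<noteq> topspace (K i)}" "\<forall>i\<in>\<Lambda>. openin (K i) (V i)"
    "x \<in> Pi\<^sub>E \<Lambda> V" "Pi\<^sub>E \<Lambda> V \<subseteq> T"
    using T(1) unfolding openin_product_topology_alt by blast
  let ?J = "{i \<in> \<Lambda>. V i \<noteq> topspace (K i)}"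
  \<comment> \<open>Including a stage where \<open>x\<close> is finite ensures that
    \<open>x k\<close> is a genuine point of \<open>X k\<close>, so the cylinder can be described
    inside \<open>X k\<close> rather than its compactification.\<close>
  obtain l0 where l0: "l0 \<in> \<Lambda>" "x l0 \<noteq> None" using L_ex [OF xL] by blast
  have "finite (insert l1 (insert l0 ?J))" "insert l1 (insert l0 ?J) \<subseteq> \<Lambda>" using V(1) l0 l1 by auto
  then obtain k where k: "k \<in> \<Lambda>" "\<forall>i\<in>insert l1 (insert l0 ?J). le i k" using directed_finite_bound [OF dir] by blast
  have xk: "x k \<noteq> None" by (rule Z_Some_up [OF xZ l0(1) k(1) _ l0(2)]) (use k in simp)
  let ?H = "\<Inter> ((\<lambda>i. {y \<in> topspace (K k). m i k y \<in> V i}) ` ?J \<union> {topspace (K k)})"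
  have "openin (K k) ?H"
    by (rule openin_Inter)
      (use V k in \<open>auto intro!: openin_continuous_map_preimage [OF cont] simp del: topspace_Alexandroff_compactification\<close>)
  then have "openin (X k) {y \<in> topspace (X k). Some y \<in> ?H}"
    by (rule openin_continuous_map_preimage [OF continuous_map_Some])
  moreover have "x k \<in> Some ` {y \<in> topspace (X k). Some y \<in> ?H}"
  proof -
    obtain y where y: "x k = Some y" using xk by blast
    have "y \<in> topspace (X k)" using Z_in [OF xZ k(1)] y by auto
    moreover have "Some y \<in> ?H"
      using Z_in [OF xZ k(1)] Z_compat [OF xZ _ k(1)] V(3) k(2) y by auto
    ultimately show ?thesis using y by blast
  qed
  moreover have "{y \<in> topspace L. y k \<in> Some ` {y \<in> topspace (X k). Some y \<in> ?H}} \<subseteq> U"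
  proof
    fix y assume y: "y \<in> {y \<in> topspace L. y k \<in> Some ` {y \<in> topspace (X k). Some y \<in> ?H}}"
    then have yZ: "y \<in> topspace Z" and yH: "y k \<in> ?H" by (auto simp: topspace_L)
    have "y i \<in> V i" if i: "i \<in> \<Lambda>" for i
    proof (cases "i \<in> ?J")
      case True
      then show ?thesis using yH Z_compat [OF yZ i k(1)] k(2) by auto
    next
      case False
      then have "V i = topspace (K i)" using i by blast
      then show ?thesis using Z_in [OF yZ i] by (simp only:)
    qed
    then have "y \<in> Pi\<^sub>E \<Lambda> V" using yZ unfolding topspace_Z topspace_product_topology by (auto simp: PiE_iff)
    then show "y \<in> U" using V(4) T(2) yZ unfolding topspace_Z by blast
  qed
  moreover have "le l1 k" using k(2) by simp
  ultimately show ?thesis using k(1) by blast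
qed

lemma openin_cylinder:
  assumes l: "l \<in> \<Lambda>" and W: "openin (X l) W" shows "openin L {y \<in> topspace L. y l \<in> Some ` W}"
proof -
  have "continuous_map L (K l) (\<lambda>x. x l)"
    by (subst L_subtopology) (rule continuous_map_from_subtopology [OF continuous_map_Z [OF l]])
  then show ?thesis by (rule openin_continuous_map_preimage) (simp add: W)
qed

end

section \<open>Projective limits of topological graphs\<close>

lemma dmap_open_map:
  assumes E: "topological_graph E" shows "open_map (edges E) (vertices E) (dmap E)"
  unfolding open_map_def
proof (intro allI impI)
  fix W assume W: "openin (edges E) W"
  show "openin (vertices E) (dmap E ` W)"
  proof (subst openin_subopen, intro ballI)
    fix v assume "v \<in> dmap E ` W"
    then obtain e where e: "e \<in> W" "v = dmap E e" by blast
    then have "e \<in> topspace (edges E)" using openin_subset [OF W] by blast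
    then obtain U where U: "sheet E U" "e \<in> U" using sheet_exists [OF E] by blast
    have "openin (edges E) (U \<inter> W)" using U(1) W unfolding sheet_def by blast
    then have "sheet E (U \<inter> W)" using sheet_subset [OF U(1)] by blast
    then have "openin (vertices E) (dmap E ` (U \<inter> W))" unfolding sheet_def by blast
    then show "\<exists>T. openin (vertices E) T \<and> v \<in> T \<and> T \<subseteq> dmap E ` W" using e U(2) by blast
  qed
qed

lemma continuous_dmap:
  assumes E: "topological_graph E" shows "continuous_map (edges E) (vertices E) (dmap E)"
  unfolding continuous_map_def
proof (intro conjI allI impI)
  show "dmap E \<in> topspace (edges E) \<rightarrow> topspace (vertices E)" using dmap_in_vertices [OF E] by blast
  fix V assume V: "openin (vertices E) V"
  show "openin (edges E) {e \<in> topspace (edges E). dmap E e \<in> V}"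
  proof (subst openin_subopen, intro ballI)
    fix e assume e: "e \<in> {e \<in> topspace (edges E). dmap E e \<in> V}"
    then obtain U where U: "sheet E U" "e \<in> U" using sheet_exists [OF E] by blast
    have "continuous_map (subtopology (edges E) U) (vertices E) (dmap E)"
      using U(1) homeomorphic_imp_continuous_map continuous_map_into_fulltopology unfolding sheet_def by blast
    then have "openin (subtopology (edges E) U) {x \<in> topspace (subtopology (edges E) U). dmap E x \<in> V}"
      using V by (rule openin_continuous_map_preimage)
    moreover have "openin (edges E) U" using U(1) unfolding sheet_def by blast
    ultimately have "openin (edges E) {x \<in> topspace (subtopology (edges E) U). dmap E x \<in> V}"
      using openin_open_subtopology by blast
    then show "\<exists>T. openin (edges E) T \<and> e \<in> T \<and> T \<subseteq> {e \<in> topspace (edges E). dmap E e \<in> V}"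
      using e U(2) by (intro exI [of _ "{x \<in> topspace (subtopology (edges E) U). dmap E x \<in> V}"] conjI) auto
  qed
qed

section \<open>The limit graph and its natural maps\<close>

locale graph_system =
  fixes \<Lambda> :: "'l set" and le :: "'l \<Rightarrow> 'l \<Rightarrow> bool" and E :: "'l \<Rightarrow> ('v, 'e) topgraph"
    and m0 :: "'l \<Rightarrow> 'l \<Rightarrow> 'v option \<Rightarrow> 'v option" and m1 :: "'l \<Rightarrow> 'l \<Rightarrow> 'e option \<Rightarrow> 'e option"
  assumes dir: "directed_set \<Lambda> le" and sys: "projective_system \<Lambda> le E m0 m1"
begin

lemma graph: "l \<in> \<Lambda> \<Longrightarrow> topological_graph (E l)"
  and fm: "\<lbrakk>l \<in> \<Lambda>; k \<in> \<Lambda>; le l k\<rbrakk> \<Longrightarrow> factor_map (E k) (E l) (m0 l k) (m1 l k)"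
  using sys unfolding projective_system_def by blast+

sublocale V: inv_sys \<Lambda> le "\<lambda>l. vertices (E l)" m0
proof
  show "\<And>l. l \<in> \<Lambda> \<Longrightarrow> locally_compact_space (vertices (E l))" "\<And>l. l \<in> \<Lambda> \<Longrightarrow> Hausdorff_space (vertices (E l))"
    using graph unfolding topological_graph_def by blast+
  show "\<And>l k. \<lbrakk>l \<in> \<Lambda>; k \<in> \<Lambda>; le l k\<rbrakk> \<Longrightarrow> continuous_map (Alexandroff_compactification (vertices (E k)))
      (Alexandroff_compactification (vertices (E l))) (m0 l k)"
    "\<And>l k. \<lbrakk>l \<in> \<Lambda>; k \<in> \<Lambda>; le l k\<rbrakk> \<Longrightarrow> m0 l k None = None"
    using fm factor_mapD by blast+
qed (use sys dir in \<open>unfold projective_system_def, blast+\<close>)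

sublocale G: inv_sys \<Lambda> le "\<lambda>l. edges (E l)" m1
proof
  show "\<And>l. l \<in> \<Lambda> \<Longrightarrow> locally_compact_space (edges (E l))" "\<And>l. l \<in> \<Lambda> \<Longrightarrow> Hausdorff_space (edges (E l))"
    using graph unfolding topological_graph_def by blast+
  show "\<And>l k. \<lbrakk>l \<in> \<Lambda>; k \<in> \<Lambda>; le l k\<rbrakk> \<Longrightarrow> continuous_map (Alexandroff_compactification (edges (E k)))
      (Alexandroff_compactification (edges (E l))) (m1 l k)"
    "\<And>l k. \<lbrakk>l \<in> \<Lambda>; k \<in> \<Lambda>; le l k\<rbrakk> \<Longrightarrow> m1 l k None = None"
    using fm factor_mapD by blast+
qed (use sys dir in \<open>unfold projective_system_def, blast+\<close>)

abbreviation "EE \<equiv> projective_limit \<Lambda> le E m0 m1"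

lemma EE_sel:
  "vertices EE = V.L" "edges EE = G.L" "dmap EE = lim_point \<Lambda> le E m0 (\<lambda>l. dmap (E l))"
  "rmap EE = lim_point \<Lambda> le E m0 (\<lambda>l. rmap (E l))"
  by (simp_all add: projective_limit_def)

lemma G_Some: "\<lbrakk>e \<in> topspace G.L; l \<in> \<Lambda>; e l = Some a\<rbrakk> \<Longrightarrow> a \<in> topspace (edges (E l))"
  using G.Z_in [of e l] by (auto simp: G.topspace_L)

lemma V_Some: "\<lbrakk>v \<in> topspace V.L; l \<in> \<Lambda>; v l = Some a\<rbrakk> \<Longrightarrow> a \<in> topspace (vertices (E l))"
  using V.Z_in [of v l] by (auto simp: V.topspace_L)

lemma G_up:
  assumes "e \<in> topspace G.L" "l \<in> \<Lambda>" "k \<in> \<Lambda>" "le l k" "e l \<noteq> None"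
  shows "\<exists>a\<in>topspace (edges (E k)). e k = Some a"
proof -
  have "e k \<noteq> None" by (rule G.Z_Some_up [of e l k]) (use assms in \<open>auto simp: G.topspace_L\<close>)
  then obtain a where a: "e k = Some a" by blast
  then show ?thesis using G_Some [OF assms(1,3) a] by blast
qed

lemma V_up:
  assumes "v \<in> topspace V.L" "l \<in> \<Lambda>" "k \<in> \<Lambda>" "le l k" "v l \<noteq> None"
  shows "\<exists>a\<in>topspace (vertices (E k)). v k = Some a"
proof -
  have "v k \<noteq> None" by (rule V.Z_Some_up [of v l k]) (use assms in \<open>auto simp: V.topspace_L\<close>)
  then obtain a where a: "v k = Some a" by blast
  then show ?thesis using V_Some [OF assms(1,3) a] by blast
qed

lemma G_compat: "\<lbrakk>e \<in> topspace G.L; l \<in> \<Lambda>; k \<in> \<Lambda>; le l k\<rbrakk> \<Longrightarrow> m1 l k (e k) = e l"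
  and V_compat: "\<lbrakk>v \<in> topspace V.L; l \<in> \<Lambda>; k \<in> \<Lambda>; le l k\<rbrakk> \<Longrightarrow> m0 l k (v k) = v l"
  by (simp_all add: G.Z_compat V.Z_compat G.topspace_L V.topspace_L)

text \<open>The maps \<open>d\<close> and \<open>r\<close> are handled together: \<open>g\<close>
  stands for either, and \<open>c\<close> is the compatibility that factor maps provide. Besides
  well-definedness it gives the coordinate formula at every stage where the edge is finite, since a
  lower coordinate is the image of a later one.\<close>

lemma lim_point_ex1:
  assumes g: "\<And>l. l \<in> \<Lambda> \<Longrightarrow> continuous_map (edges (E l)) (vertices (E l)) (g l)"
    and c: "\<And>l k a b. \<lbrakk>l \<in> \<Lambda>; k \<in> \<Lambda>; le l k; a \<in> topspace (edges (E k)); m1 l k (Some a) = Some b\<rbrakk>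
      \<Longrightarrow> m0 l k (Some (g k a)) = Some (g l b)"
    and e: "e \<in> topspace G.L"
  shows "lim_point \<Lambda> le E m0 g e \<in> topspace V.L
    \<and> (\<forall>l\<in>\<Lambda>. \<forall>b. e l = Some b \<longrightarrow> lim_point \<Lambda> le E m0 g e l = Some (g l b))"
proof -
  obtain l0 where l0: "l0 \<in> \<Lambda>" "e l0 \<noteq> None" using G.L_ex [OF e] by blast
  have up: "\<exists>a\<in>topspace (edges (E k)). e k = Some a" if "k \<in> \<Lambda>" "le l0 k" for k
    by (rule G_up [OF e l0(1) that l0(2)])
  define z where "z k = Some (g k (the (e k)))" for k
  have "z k \<in> topspace (Alexandroff_compactification (vertices (E k)))" if k: "k \<in> \<Lambda>" "le l0 k" for k
    using up [OF k] continuous_map_image_subset_topspace [OF g [OF k(1)]] by (auto simp: z_def)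
  moreover have "m0 k j (z j) = z k" if kj: "k \<in> \<Lambda>" "j \<in> \<Lambda>" "le l0 k" "le k j" for k j
  proof -
    have "le l0 j" by (rule V.D(3) [OF l0(1) kj])
    then obtain a where a: "a \<in> topspace (edges (E j))" "e j = Some a" using up [OF kj(2)] by blast
    obtain b where b: "e k = Some b" using up [OF kj(1,3)] by blast
    have "m1 k j (Some a) = Some b" using G_compat [OF e kj(1,2,4)] a b by simp
    from c [OF kj(1,2,4) a(1) this] show ?thesis using a b by (simp add: z_def)
  qed
  ultimately obtain x where x: "x \<in> topspace V.Z" "\<forall>k\<in>\<Lambda>. le l0 k \<longrightarrow> x k = z k"
    using V.Z_extend_cofinal [OF l0(1), of z] by blast
  have "x l0 = z l0" using x(2) l0(1) V.D(2) by blast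
  then have "x l0 \<noteq> None" by (simp add: z_def)
  with x(1) l0(1) have xL: "x \<in> topspace V.L" by (rule V.L_I)
  have "lim_point \<Lambda> le E m0 g e = x"
    unfolding lim_point_def
  proof (rule the_equality)
    show "x \<in> topspace V.L \<and> (\<exists>l0\<in>\<Lambda>. e l0 \<noteq> None \<and> (\<forall>l\<in>\<Lambda>. le l0 l \<longrightarrow> x l = Some (g l (the (e l)))))"
      using xL x(2) l0 unfolding z_def by blast
    fix v assume "v \<in> topspace V.L \<and> (\<exists>l0\<in>\<Lambda>. e l0 \<noteq> None \<and> (\<forall>l\<in>\<Lambda>. le l0 l \<longrightarrow> v l = Some (g l (the (e l)))))"
    then obtain l1 where v: "v \<in> topspace V.L" "l1 \<in> \<Lambda>" "\<forall>l\<in>\<Lambda>. le l1 l \<longrightarrow> v l = Some (g l (the (e l)))" by blast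
    obtain j where j: "j \<in> \<Lambda>" "le l0 j" "le l1 j" using V.D(4) [OF l0(1) v(2)] by blast
    show "v = x"
    proof (rule V.Z_eqI_cofinal [OF _ x(1) j(1)])
      show "v \<in> topspace V.Z" using v(1) by (simp add: V.topspace_L)
      fix k assume k: "k \<in> \<Lambda>" "le j k"
      have "le l0 k" "le l1 k" using V.D(3) [OF l0(1) j(1) k(1) j(2) k(2)] V.D(3) [OF v(2) j(1) k(1) j(3) k(2)] .
      then show "v k = x k" using v(3) x(2) k(1) by (simp add: z_def)
    qed
  qed
  moreover have "x l = Some (g l b)" if l: "l \<in> \<Lambda>" and b: "e l = Some b" for l b
  proof -
    obtain k where k: "k \<in> \<Lambda>" "le l k" "le l0 k" using V.D(4) [OF l l0(1)] by blast
    obtain a where a: "a \<in> topspace (edges (E k))" "e k = Some a" using up [OF k(1,3)] by blast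
    have "m1 l k (Some a) = Some b" using G_compat [OF e l k(1,2)] a b by simp
    from c [OF l k(1,2) a(1) this] have "m0 l k (x k) = Some (g l b)" using x(2) k a by (simp add: z_def)
    then show ?thesis using V_compat [OF xL l k(1,2)] by simp
  qed
  ultimately show ?thesis using xL by blast
qed

lemma continuous_lim_point:
  assumes g: "\<And>l. l \<in> \<Lambda> \<Longrightarrow> continuous_map (edges (E l)) (vertices (E l)) (g l)"
    and c: "\<And>l k a b. \<lbrakk>l \<in> \<Lambda>; k \<in> \<Lambda>; le l k; a \<in> topspace (edges (E k)); m1 l k (Some a) = Some b\<rbrakk>
      \<Longrightarrow> m0 l k (Some (g k a)) = Some (g l b)"
  shows "continuous_map G.L V.L (lim_point \<Lambda> le E m0 g)"
  unfolding continuous_map_def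
proof (intro conjI allI impI)
  let ?F = "lim_point \<Lambda> le E m0 g"
  have F: "?F e \<in> topspace V.L \<and> (\<forall>l\<in>\<Lambda>. \<forall>b. e l = Some b \<longrightarrow> ?F e l = Some (g l b))"
    if "e \<in> topspace G.L" for e by (rule lim_point_ex1 [OF g c that])
  show "?F \<in> topspace G.L \<rightarrow> topspace V.L" using F by blast
  fix U assume U: "openin V.L U"
  show "openin G.L {e \<in> topspace G.L. ?F e \<in> U}"
  proof (subst openin_subopen, intro ballI)
    fix e assume "e \<in> {e \<in> topspace G.L. ?F e \<in> U}"
    then have e: "e \<in> topspace G.L" "?F e \<in> U" by auto
    obtain l0 where l0: "l0 \<in> \<Lambda>" "e l0 \<noteq> None" using G.L_ex [OF e(1)] by blast
    obtain k W where k: "k \<in> \<Lambda>" "le l0 k" and W: "openin (vertices (E k)) W" "?F e k \<in> Some ` W"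
      "{y \<in> topspace V.L. y k \<in> Some ` W} \<subseteq> U"
      using V.L_basis [OF U e(2) l0(1)] by (elim bexE exE conjE)
    obtain a where a: "a \<in> topspace (edges (E k))" "e k = Some a" using G_up [OF e(1) l0(1) k l0(2)] by blast
    let ?T = "{a \<in> topspace (edges (E k)). g k a \<in> W}"
    have "openin (edges (E k)) ?T" by (rule openin_continuous_map_preimage [OF g [OF k(1)] W(1)])
    from G.openin_cylinder [OF k(1) this] have "openin G.L {y \<in> topspace G.L. y k \<in> Some ` ?T}" .
    moreover have "e \<in> {y \<in> topspace G.L. y k \<in> Some ` ?T}"
      using e(1) a W(2) F [OF e(1)] k(1) by auto
    moreover have "{y \<in> topspace G.L. y k \<in> Some ` ?T} \<subseteq> {e \<in> topspace G.L. ?F e \<in> U}"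
    proof
      fix y assume "y \<in> {y \<in> topspace G.L. y k \<in> Some ` ?T}"
      then obtain b where y: "y \<in> topspace G.L" "y k = Some b" "g k b \<in> W" by blast
      then have "?F y k = Some (g k b)" "?F y \<in> topspace V.L" using F [OF y(1)] k(1) by auto
      then have "?F y \<in> U" using W(3) y(3) by blast
      then show "y \<in> {e \<in> topspace G.L. ?F e \<in> U}" using y(1) by blast
    qed
    ultimately show "\<exists>T. openin G.L T \<and> e \<in> T \<and> T \<subseteq> {e \<in> topspace G.L. ?F e \<in> U}" by blast
  qed
qed

lemma rmap_continuous: "l \<in> \<Lambda> \<Longrightarrow> continuous_map (edges (E l)) (vertices (E l)) (rmap (E l))"
  using graph unfolding topological_graph_def by blast

lemma dmap_compat:
  assumes "l \<in> \<Lambda>" "k \<in> \<Lambda>" "le l k" "a \<in> topspace (edges (E k))" "m1 l k (Some a) = Some b"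
  shows "m0 l k (Some (dmap (E k) a)) = Some (dmap (E l) b)"
  using factor_mapD(5) [OF fm [OF assms(1-3)] assms(4,5)] by simp

lemma rmap_compat:
  assumes "l \<in> \<Lambda>" "k \<in> \<Lambda>" "le l k" "a \<in> topspace (edges (E k))" "m1 l k (Some a) = Some b"
  shows "m0 l k (Some (rmap (E k) a)) = Some (rmap (E l) b)"
  using factor_mapD(5) [OF fm [OF assms(1-3)] assms(4,5)] by simp

lemma dmap_EE:
  assumes "e \<in> topspace G.L"
  shows "dmap EE e \<in> topspace V.L" and "\<And>l b. \<lbrakk>l \<in> \<Lambda>; e l = Some b\<rbrakk> \<Longrightarrow> dmap EE e l = Some (dmap (E l) b)"
proof -
  have *: "lim_point \<Lambda> le E m0 (\<lambda>l. dmap (E l)) e \<in> topspace V.L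
    \<and> (\<forall>l\<in>\<Lambda>. \<forall>b. e l = Some b \<longrightarrow> lim_point \<Lambda> le E m0 (\<lambda>l. dmap (E l)) e l = Some (dmap (E l) b))"
    by (rule lim_point_ex1 [OF continuous_dmap [OF graph] dmap_compat assms])
  show "dmap EE e \<in> topspace V.L" unfolding EE_sel(3) by (rule conjunct1 [OF *])
  show "\<And>l b. \<lbrakk>l \<in> \<Lambda>; e l = Some b\<rbrakk> \<Longrightarrow> dmap EE e l = Some (dmap (E l) b)"
    unfolding EE_sel(3) by (rule conjunct2 [OF *, THEN bspec, THEN spec, THEN mp])
qed

lemma rmap_EE:
  assumes "e \<in> topspace G.L"
  shows "rmap EE e \<in> topspace V.L" and "\<And>l b. \<lbrakk>l \<in> \<Lambda>; e l = Some b\<rbrakk> \<Longrightarrow> rmap EE e l = Some (rmap (E l) b)"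
proof -
  have *: "lim_point \<Lambda> le E m0 (\<lambda>l. rmap (E l)) e \<in> topspace V.L
    \<and> (\<forall>l\<in>\<Lambda>. \<forall>b. e l = Some b \<longrightarrow> lim_point \<Lambda> le E m0 (\<lambda>l. rmap (E l)) e l = Some (rmap (E l) b))"
    by (rule lim_point_ex1 [OF rmap_continuous rmap_compat assms])
  show "rmap EE e \<in> topspace V.L" unfolding EE_sel(4) by (rule conjunct1 [OF *])
  show "\<And>l b. \<lbrakk>l \<in> \<Lambda>; e l = Some b\<rbrakk> \<Longrightarrow> rmap EE e l = Some (rmap (E l) b)"
    unfolding EE_sel(4) by (rule conjunct2 [OF *, THEN bspec, THEN spec, THEN mp])
qed

lemma continuous_dmap_EE: "continuous_map G.L V.L (dmap EE)"
  unfolding EE_sel by (rule continuous_lim_point [OF continuous_dmap [OF graph] dmap_compat])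

lemma continuous_rmap_EE: "continuous_map G.L V.L (rmap EE)"
  unfolding EE_sel by (rule continuous_lim_point [OF rmap_continuous rmap_compat])

lemma unique_lift:
  assumes "l \<in> \<Lambda>" "k \<in> \<Lambda>" "le l k" "b \<in> topspace (edges (E l))" "w \<in> topspace (vertices (E k))"
    "Some (dmap (E l) b) = m0 l k (Some w)"
  shows "\<exists>!a. a \<in> topspace (edges (E k)) \<and> m1 l k (Some a) = Some b \<and> dmap (E k) a = w"
  by (rule factor_mapD(6) [OF fm [OF assms(1-3)] assms(4-6)])

text \<open>At each \<open>k\<close> above \<open>l\<close> the edge \<open>b\<close> has exactly
  one lift over \<open>v k\<close>. The image at \<open>k\<close> of the lift at a later
  \<open>j\<close> is again such a lift, so uniqueness makes the lifts compatible and they form a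
  point of the limit.\<close>

lemma unique_lift_EE:
  assumes l: "l \<in> \<Lambda>" and b: "b \<in> topspace (edges (E l))" and v: "v \<in> topspace V.L"
    and eq: "Some (dmap (E l) b) = v l"
  shows "\<exists>!e. e \<in> topspace G.L \<and> e l = Some b \<and> dmap EE e = v"
proof -
  define L where "L k a \<longleftrightarrow> a \<in> topspace (edges (E k)) \<and> m1 l k (Some a) = Some b \<and> Some (dmap (E k) a) = v k" for k a
  have ex1: "\<exists>!a. L k a" if k: "k \<in> \<Lambda>" "le l k" for k
  proof -
    obtain w where w: "w \<in> topspace (vertices (E k))" "v k = Some w" using V_up [OF v l k] eq by force
    have "Some (dmap (E l) b) = m0 l k (Some w)" using eq V_compat [OF v l k] w(2) by simp
    from unique_lift [OF l k b w(1) this] show ?thesis unfolding L_def w(2) by simp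
  qed
  define \<epsilon> where "\<epsilon> k = (THE a. L k a)" for k
  have \<epsilon>: "L k (\<epsilon> k)" if "k \<in> \<Lambda>" "le l k" for k unfolding \<epsilon>_def by (rule theI' [OF ex1 [OF that]])
  have \<epsilon>_eq: "a = \<epsilon> k" if "k \<in> \<Lambda>" "le l k" "L k a" for k a
    using ex1 [OF that(1,2)] \<epsilon> [OF that(1,2)] that(3) by blast
  have in_K: "Some (\<epsilon> k) \<in> topspace (G.K k)" if "k \<in> \<Lambda>" "le l k" for k using \<epsilon> [OF that] by (simp add: L_def)
  have "m1 k j (Some (\<epsilon> j)) = Some (\<epsilon> k)" if kj: "k \<in> \<Lambda>" "j \<in> \<Lambda>" "le l k" "le k j" for k j
  proof -
    have lj: "le l j" by (rule V.D(3) [OF l kj])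
    have Lj: "L j (\<epsilon> j)" by (rule \<epsilon> [OF kj(2) lj])
    have "m1 l k (m1 k j (Some (\<epsilon> j))) = Some b"
      using G.m_trans [OF l kj in_K [OF kj(2) lj]] Lj by (simp add: L_def)
    then obtain a where a: "m1 k j (Some (\<epsilon> j)) = Some a" "m1 l k (Some a) = Some b"
      using G.m_None [OF l kj(1,3)] by (cases "m1 k j (Some (\<epsilon> j))") auto
    have "Some a \<in> topspace (G.K k)" using G.m_in [OF kj(1,2,4) in_K [OF kj(2) lj]] a(1) by simp
    then have "a \<in> topspace (edges (E k))" by auto
    moreover have "Some (dmap (E k) a) = v k"
      using dmap_compat [OF kj(1,2,4) _ a(1)] Lj V_compat [OF v kj(1,2,4)] by (simp add: L_def)
    ultimately have "L k a" using a(2) by (simp add: L_def)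
    then show ?thesis using \<epsilon>_eq [OF kj(1,3)] a(1) by simp
  qed
  then obtain x where x: "x \<in> topspace G.Z" "\<forall>k\<in>\<Lambda>. le l k \<longrightarrow> x k = Some (\<epsilon> k)"
    using G.Z_extend_cofinal [OF l in_K] by blast
  have ll: "le l l" by (rule V.D(2) [OF l])
  have "m1 l l (Some (\<epsilon> l)) = Some (\<epsilon> l)" by (rule G.m_refl [OF l in_K [OF l ll]])
  then have xl: "x l = Some b" using x(2) l ll \<epsilon> [OF l ll] by (simp add: L_def)
  have xL: "x \<in> topspace G.L" by (rule G.L_I [OF x(1) l]) (simp add: xl)
  have "dmap EE x = v"
  proof (rule V.Z_eqI_cofinal [OF _ _ l])
    show "dmap EE x \<in> topspace V.Z" "v \<in> topspace V.Z" using dmap_EE(1) [OF xL] v by (simp_all add: V.topspace_L)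
    fix k assume k: "k \<in> \<Lambda>" "le l k"
    show "dmap EE x k = v k" using dmap_EE(2) [OF xL k(1)] x(2) k \<epsilon> [OF k] by (simp add: L_def)
  qed
  moreover have "y = x" if y: "y \<in> topspace G.L" "y l = Some b" "dmap EE y = v" for y
  proof (rule G.Z_eqI_cofinal [OF _ x(1) l])
    show "y \<in> topspace G.Z" using y(1) by (simp add: G.topspace_L)
    fix k assume k: "k \<in> \<Lambda>" "le l k"
    obtain a where a: "a \<in> topspace (edges (E k))" "y k = Some a" using G_up [OF y(1) l k] y(2) by force
    have "L k a" using G_compat [OF y(1) l k] dmap_EE(2) [OF y(1) k(1) a(2)] a y by (simp add: L_def)
    then show "y k = x k" using \<epsilon>_eq [OF k] a(2) x(2) k by simp
  qed
  ultimately show ?thesis using xL xl by blast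
qed

lemma open_map_dmap_EE: "open_map G.L V.L (dmap EE)"
  unfolding open_map_def
proof (intro allI impI)
  fix U assume U: "openin G.L U"
  show "openin V.L (dmap EE ` U)"
  proof (subst openin_subopen, intro ballI)
    fix v assume "v \<in> dmap EE ` U"
    then obtain y where y: "y \<in> U" "v = dmap EE y" by blast
    have yL: "y \<in> topspace G.L" using y(1) openin_subset [OF U] by blast
    obtain l where l: "l \<in> \<Lambda>" using V.D(1) by blast
    obtain k W where k: "k \<in> \<Lambda>" and W: "openin (edges (E k)) W" "y k \<in> Some ` W"
      "{y \<in> topspace G.L. y k \<in> Some ` W} \<subseteq> U" using G.L_basis [OF U y(1) l] by (elim bexE exE conjE)
    have "openin (vertices (E k)) (dmap (E k) ` W)"
      using dmap_open_map [OF graph [OF k]] W(1) unfolding open_map_def by blast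
    from V.openin_cylinder [OF k this]
    have "openin V.L {v \<in> topspace V.L. v k \<in> Some ` dmap (E k) ` W}" .
    moreover have "v \<in> {v \<in> topspace V.L. v k \<in> Some ` dmap (E k) ` W}"
      using dmap_EE [OF yL] W(2) k y(2) by auto
    moreover have "{v \<in> topspace V.L. v k \<in> Some ` dmap (E k) ` W} \<subseteq> dmap EE ` U"
    proof
      fix u assume "u \<in> {v \<in> topspace V.L. v k \<in> Some ` dmap (E k) ` W}"
      then obtain w where u: "u \<in> topspace V.L" "w \<in> W" "Some (dmap (E k) w) = u k" by auto
      have "w \<in> topspace (edges (E k))" using u(2) openin_subset [OF W(1)] by blast
      from unique_lift_EE [OF k this u(1,3)] obtain e where "e \<in> topspace G.L" "e k = Some w" "dmap EE e = u" by blast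
      then show "u \<in> dmap EE ` U" using W(3) u(2) by blast
    qed
    ultimately show "\<exists>T. openin V.L T \<and> v \<in> T \<and> T \<subseteq> dmap EE ` U" by blast
  qed
qed

text \<open>The neighbourhood is the cylinder over a sheet of one \<open>E l\<close>. Two of its
  points with the same image under \<open>d\<close> have the same edge at \<open>l\<close>, as
  \<open>d\<close> is injective on the sheet, and then coincide by unique lifting.\<close>

lemma local_homeomorphism_EE: "local_homeomorphism G.L V.L (dmap EE)"
  unfolding local_homeomorphism_def
proof
  fix e assume e: "e \<in> topspace G.L"
  obtain l where l: "l \<in> \<Lambda>" "e l \<noteq> None" using G.L_ex [OF e] by blast
  then obtain a where a: "e l = Some a" by blast
  obtain S where S: "sheet (E l) S" "a \<in> S" using sheet_exists [OF graph [OF l(1)] G_Some [OF e l(1) a]] by blast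
  let ?U = "{y \<in> topspace G.L. y l \<in> Some ` S}"
  have "openin (edges (E l)) S" using S(1) unfolding sheet_def by blast
  from G.openin_cylinder [OF l(1) this] have U: "openin G.L ?U" .
  have dU: "openin V.L (dmap EE ` ?U)" using open_map_dmap_EE U unfolding open_map_def by blast
  have tU: "topspace (subtopology G.L ?U) = ?U" by auto
  have tV: "topspace (subtopology V.L (dmap EE ` ?U)) = dmap EE ` ?U"
    using openin_subset [OF dU] by auto
  have "homeomorphic_map (subtopology G.L ?U) (subtopology V.L (dmap EE ` ?U)) (dmap EE)"
  proof (rule bijective_open_imp_homeomorphic_map)
    show "continuous_map (subtopology G.L ?U) (subtopology V.L (dmap EE ` ?U)) (dmap EE)"
      unfolding continuous_map_in_subtopology tU
      using continuous_map_from_subtopology [OF continuous_dmap_EE] by blast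
    show "open_map (subtopology G.L ?U) (subtopology V.L (dmap EE ` ?U)) (dmap EE)"
      by (rule open_map_into_subtopology [OF open_map_from_subtopology [OF open_map_dmap_EE U]]) (unfold tU, blast)
    show "dmap EE ` topspace (subtopology G.L ?U) = topspace (subtopology V.L (dmap EE ` ?U))"
      unfolding tU tV ..
    show "inj_on (dmap EE) (topspace (subtopology G.L ?U))"
      unfolding tU
    proof (rule inj_onI)
      fix x y assume "x \<in> ?U" "y \<in> ?U" and xy: "dmap EE x = dmap EE y"
      then obtain b c where b: "x \<in> topspace G.L" "x l = Some b" "b \<in> S"
        and c: "y \<in> topspace G.L" "y l = Some c" "c \<in> S" by blast
      have "Some (dmap (E l) b) = Some (dmap (E l) c)"
        using dmap_EE(2) [OF b(1) l(1) b(2)] dmap_EE(2) [OF c(1) l(1) c(2)] xy by simp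
      then have "b = c" using sheet_inj [OF S(1)] b(3) c(3) by (simp add: inj_on_def)
      moreover have "\<exists>!e. e \<in> topspace G.L \<and> e l = Some b \<and> dmap EE e = dmap EE x"
        by (rule unique_lift_EE [OF l(1) G_Some [OF b(1) l(1) b(2)] dmap_EE(1) [OF b(1)]])
          (use dmap_EE(2) [OF b(1) l(1) b(2)] in simp)
      ultimately show "x = y" using b c xy by metis
    qed
  qed
  moreover have "e \<in> ?U" using e a S(2) by blast
  ultimately show "\<exists>U. openin G.L U \<and> e \<in> U \<and> openin V.L (dmap EE ` U)
      \<and> homeomorphic_map (subtopology G.L U) (subtopology V.L (dmap EE ` U)) (dmap EE)"
    using U dU by blast
qed

lemma topological_graph_EE: "topological_graph EE"
  unfolding topological_graph_def EE_sel(1,2)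
  using V.L_lc V.L_Hausdorff G.L_lc G.L_Hausdorff local_homeomorphism_EE continuous_rmap_EE by blast

lemma factor_map_proj:
  assumes l: "l \<in> \<Lambda>" shows "factor_map EE (E l) (V.proj l) (G.proj l)"
  unfolding factor_map_def EE_sel(1,2)
proof (intro conjI ballI impI)
  fix e b assume "e \<in> topspace G.L" "G.proj l (Some e) = Some b"
  then show "Some (rmap (E l) b) = V.proj l (Some (rmap EE e))" "Some (dmap (E l) b) = V.proj l (Some (dmap EE e))"
    using rmap_EE(2) dmap_EE(2) l by simp_all
next
  fix b v assume "b \<in> topspace (edges (E l))" "v \<in> topspace V.L" "Some (dmap (E l) b) = V.proj l (Some v)"
  then show "\<exists>!e. e \<in> topspace G.L \<and> G.proj l (Some e) = Some b \<and> dmap EE e = v"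
    using unique_lift_EE [OF l] by simp
qed (simp_all add: V.continuous_proj G.continuous_proj l)

lemma factor_proj: "l \<in> \<Lambda> \<Longrightarrow> factor EE (E l) (V.proj l) (G.proj l)"
  by (simp add: factor_def topological_graph_EE graph factor_map_proj)

lemma factor_m: "\<lbrakk>l \<in> \<Lambda>; k \<in> \<Lambda>; le l k\<rbrakk> \<Longrightarrow> factor (E k) (E l) (m0 l k) (m1 l k)"
  by (simp add: factor_def graph fm)

end

section \<open>Approximation in the module of a projective limit\<close>

text \<open>A bump function on the vertices, supported in a compact part of the image of a sheet, is
  lifted to that sheet and extended by 0. Fibres meet the sheet at most once, so the fibre sum is
  the original bump.\<close>

lemma sheet_bump:
  assumes E: "topological_graph E" and x: "x \<in> topspace (edges E)"
  shows "\<exists>V a. openin (edges E) V \<and> x \<in> V \<and> fibre_C0 E a \<and> (\<forall>e\<in>V. 1 \<le> a e)"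
proof -
  let ?X = "edges E" and ?Y = "vertices E" and ?d = "dmap E"
  have Y: "locally_compact_space ?Y" "Hausdorff_space ?Y" and X: "Hausdorff_space ?X"
    using E by (auto simp: topological_graph_def)
  have reg: "regular_space ?Y" "completely_regular_space ?Y"
    using Y locally_compact_Hausdorff_imp_regular_space locally_compact_regular_imp_completely_regular_space by blast+
  obtain U where U: "sheet E U" "x \<in> U" using sheet_exists [OF E x] by blast
  have op: "openin ?X U" "openin ?Y (?d ` U)" using U(1) by (auto simp: sheet_def)
  have nb: "neighbourhood_base_of (\<lambda>C. compactin ?Y C \<and> closedin ?Y C) ?Y"
    using locally_compact_regular_space_neighbourhood_base Y(1) reg(1) by blast
  have "?d x \<in> ?d ` U" using U(2) by blast
  then obtain V0 N where V0: "openin ?Y V0" "?d x \<in> V0" "V0 \<subseteq> N" and N: "compactin ?Y N" "N \<subseteq> ?d ` U"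
    using nb op(2) unfolding neighbourhood_base_of by meson
  have "closedin ?Y (topspace ?Y - V0)" using V0(1) by blast
  moreover have "?d x \<in> topspace ?Y - (topspace ?Y - V0)" using V0(2) dmap_in_vertices [OF E x] by simp
  ultimately obtain f where f: "continuous_map ?Y (top_of_set {0..1}) f" "f (?d x) = 0" "f ` (topspace ?Y - V0) \<subseteq> {1::real}"
    using reg(2) unfolding completely_regular_space_def by metis
  have fc: "continuous_map ?Y euclideanreal f" using f(1) continuous_map_into_fulltopology by blast
  have f01: "f v \<le> 1" if "v \<in> topspace ?Y" for v
    using continuous_map_image_subset_topspace [OF f(1)] that by auto
  \<comment> \<open>The separating function \<open>f\<close> is 0 at the chosen vertex, so
    \<open>h\<close> is 2 there; the factor 2 leaves room for a whole neighbourhood on which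
    \<open>h\<close> exceeds 1.\<close>
  define h where "h v = (if v \<in> topspace ?Y then 2 * (1 - f v) else 0)" for v
  have h: "continuous_map ?Y euclideanreal h"
  proof (rule continuous_map_eq)
    show "continuous_map ?Y euclideanreal (\<lambda>v. 2 * (1 - f v))"
      by (intro continuous_map_real_mult continuous_map_diff fc) auto
  qed (simp add: h_def)
  have h0: "h v = 0" if "v \<notin> V0" for v using that f(3) by (auto simp: h_def)
  have hnn: "0 \<le> h v" for v using f01 by (auto simp: h_def)
  have hd: "continuous_map ?X euclideanreal (\<lambda>e. h (?d e))"
    using continuous_map_compose [OF continuous_dmap [OF E] h] by (simp add: o_def)
  define a where "a e = (if e \<in> U then h (?d e) else 0)" for e
  define C where "C = section_of E U ` N"
  have "compactin (subtopology ?Y (?d ` U)) N" using N by (simp add: compactin_subtopology)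
  then have "compactin ?X C" unfolding C_def by (rule image_compactin [OF _ continuous_section_of [OF U(1)]])
  then have C: "closedin ?X C" by (rule compactin_imp_closedin [OF X])
  have aC: "a e = 0" if "e \<notin> C" for e
  proof (cases "e \<in> U")
    case True
    have "?d e \<notin> N" using that section_of(1) [OF U(1) True] unfolding C_def by (metis imageI)
    then show ?thesis using V0(3) h0 by (auto simp: a_def)
  qed (simp add: a_def)
  \<comment> \<open>The extension by 0 is continuous because the support lies in \<open>C\<close>,
    which is compact, hence closed, and contained in the open sheet.\<close>
  have ac: "continuous_map ?X euclideanreal a"
    unfolding continuous_map_euclidean_eps
  proof (intro ballI allI impI)
    fix e and \<epsilon> :: real assume e: "e \<in> topspace ?X" and \<epsilon>: "0 < \<epsilon>"
    show "\<exists>W. openin ?X W \<and> e \<in> W \<and> (\<forall>y\<in>W. dist (a y) (a e) < \<epsilon>)"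
    proof (cases "e \<in> U")
      case True
      obtain O' where O': "openin ?X O'" "e \<in> O'" "\<forall>y\<in>O'. dist (h (?d y)) (h (?d e)) < \<epsilon>"
        using hd e \<epsilon> unfolding continuous_map_euclidean_eps by blast
      have "openin ?X (O' \<inter> U)" using O'(1) op(1) by blast
      then show ?thesis using True O' by (intro exI [of _ "O' \<inter> U"]) (simp add: a_def)
    next
      case False
      have "C \<subseteq> U" using section_of(2) [OF U(1)] N(2) unfolding C_def by blast
      moreover have "openin ?X (topspace ?X - C)" using C by blast
      moreover have "a e = 0" using False by (simp add: a_def)
      ultimately show ?thesis using aC e False \<epsilon> by (intro exI [of _ "topspace ?X - C"]) auto
    qed
  qed
  have sum: "(a has_sum h v) (d_fibre E v)" if v: "v \<in> topspace ?Y" for v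
  proof (cases "v \<in> ?d ` U")
    case True
    then obtain e where e: "e \<in> U" "v = ?d e" by blast
    have "a y = 0" if "y \<in> d_fibre E v - {e}" for y
      using that e sheet_inj [OF U(1)] by (auto simp: a_def d_fibre_def inj_on_def)
    moreover have "e \<in> d_fibre E v" using e openin_subset [OF op(1)] by (auto simp: d_fibre_def)
    moreover have "(a has_sum a e) {e}" using has_sum_finite [of "{e}" a] by simp
    ultimately have "(a has_sum a e) (d_fibre E v)"
      by (subst has_sum_cong_neutral [where T = "{e}" and g = a]) auto
    then show ?thesis using e by (simp add: a_def)
  next
    case False
    then have "v \<notin> V0" using V0(3) N(2) by blast
    moreover have "a y = 0" if "y \<in> d_fibre E v" for y using that False by (auto simp: a_def d_fibre_def)
    ultimately show ?thesis using h0 has_sum_0 [of "d_fibre E v" a] by simp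
  qed
  have "(\<lambda>v. complex_of_real (infsum a (d_fibre E v))) \<in> C0 ?Y"
  proof (rule C0I)
    have "continuous_map ?Y euclidean (\<lambda>v. complex_of_real (h v))"
      by (rule continuous_map_compose_isCont [OF h]) (intro continuous_intros)
    then show "continuous_map ?Y euclidean (\<lambda>v. complex_of_real (infsum a (d_fibre E v)))"
      by (rule continuous_map_eq) (simp add: infsumI [OF sum])
    show "complex_of_real (infsum a (d_fibre E v)) = 0" if "v \<notin> topspace ?Y" for v
      using d_fibre_outside [OF E that] by simp
    fix \<epsilon> :: real assume \<epsilon>: "0 < \<epsilon>"
    have "{v \<in> topspace ?Y. \<epsilon> \<le> cmod (complex_of_real (infsum a (d_fibre E v)))} \<subseteq> N"
    proof clarify
      fix v assume v: "v \<in> topspace ?Y" "\<epsilon> \<le> cmod (complex_of_real (infsum a (d_fibre E v)))"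
      then have "h v \<noteq> 0" using \<epsilon> infsumI [OF sum [OF v(1)]] by auto
      then show "v \<in> N" using h0 V0(3) by blast
    qed
    then show "\<exists>K. compactin ?Y K \<and> {v \<in> topspace ?Y. \<epsilon> \<le> cmod (complex_of_real (infsum a (d_fibre E v)))} \<subseteq> K"
      using N(1) by blast
  qed
  then have a: "fibre_C0 E a"
    unfolding fibre_C0_def using ac sum hnn by (auto simp: a_def summable_on_def)
  let ?V = "U \<inter> {e \<in> topspace ?X. h (?d e) \<in> {1<..}}"
  have "openin ?X {e \<in> topspace ?X. h (?d e) \<in> {1<..}}"
    by (rule openin_continuous_map_preimage [OF hd]) simp
  then have "openin ?X ?V" using op(1) by blast
  moreover have "x \<in> ?V" using U(2) x f(2) dmap_in_vertices [OF E x] by (simp add: h_def)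
  ultimately show ?thesis using a by (intro exI [of _ ?V] exI [of _ a]) (auto simp: a_def)
qed

text \<open>Finitely many sheet bumps are added up. The result dominates functions supported in
  \<open>K\<close>, which is how compactly supported functions are seen to lie in
  \<open>Cd\<close>.\<close>

lemma compact_bump:
  assumes E: "topological_graph E" and K: "compactin (edges E) K"
  shows "\<exists>a. fibre_C0 E a \<and> (\<forall>e\<in>K. 1 \<le> a e)"
proof -
  have "\<exists>V. openin (edges E) V \<and> K \<subseteq> V \<and> (\<exists>a. fibre_C0 E a \<and> (\<forall>e\<in>V. 1 \<le> a e))"
  proof (rule compactin_local_induct [OF K])
    fix x assume "x \<in> K"
    then have x: "x \<in> topspace (edges E)" using compactin_subset_topspace [OF K] by blast
    show "\<exists>V. openin (edges E) V \<and> x \<in> V \<and> (\<exists>a. fibre_C0 E a \<and> (\<forall>e\<in>V. 1 \<le> a e))"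
      using sheet_bump [OF E x] by blast
  next
    have "(\<lambda>e. 0) \<in> Cd E" by (simp add: Cd_iff [OF E] fibre_C0_def C0_zero)
    from Cd_fibre_C0 [OF E this] show "\<exists>a. fibre_C0 E a \<and> (\<forall>e\<in>{}. 1 \<le> a e)" by blast
  next
    fix U V assume "\<exists>a. fibre_C0 E a \<and> (\<forall>e\<in>U. 1 \<le> a e)" "\<exists>a. fibre_C0 E a \<and> (\<forall>e\<in>V. 1 \<le> a e)"
    then obtain a b where a: "fibre_C0 E a" "\<forall>e\<in>U. 1 \<le> a e" and b: "fibre_C0 E b" "\<forall>e\<in>V. 1 \<le> b e" by blast
    have "1 \<le> a e + b e" if "e \<in> U \<union> V" for e
      using that a(2) b(2) fibre_C0D(2) [OF a(1), of e] fibre_C0D(2) [OF b(1), of e] by force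
    then show "\<exists>a. fibre_C0 E a \<and> (\<forall>e\<in>U \<union> V. 1 \<le> a e)" using fibre_C0_add [OF E a(1) b(1)] by blast
  qed
  then show ?thesis by blast
qed

text \<open>Soft thresholding: the modulus is reduced by \<open>s\<close>, and numbers of modulus at
  most \<open>s\<close> go to 0. The maximum keeps the denominator away from 0, so the map is
  continuous.\<close>

definition trunc :: "real \<Rightarrow> complex \<Rightarrow> complex" where
  "trunc s z = of_real (1 - s / max (cmod z) s) * z"

lemma continuous_trunc: "0 < s \<Longrightarrow> continuous_on UNIV (trunc s)"
  unfolding trunc_def [abs_def] by (intro continuous_intros) (simp add: max_def, force)

lemma trunc_0 [simp]: "trunc s 0 = 0"
  by (simp add: trunc_def)

lemma trunc_small: "\<lbrakk>0 < s; cmod z \<le> s\<rbrakk> \<Longrightarrow> trunc s z = 0"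
  by (simp add: trunc_def max_def)

lemma trunc_near:
  assumes s: "0 < s" shows "cmod (trunc s z - z) \<le> s"
proof (cases "cmod z \<le> s")
  case True
  then show ?thesis using trunc_small [OF s True] by simp
next
  case False
  then have "trunc s z - z = - (of_real (s / cmod z) * z)" by (simp add: trunc_def max_def algebra_simps)
  then have "cmod (trunc s z - z) = s / cmod z * cmod z" using s by (simp add: norm_mult norm_divide)
  then show ?thesis using s by (simp split: if_splits)
qed

lemma trunc_norm_le: assumes s: "0 < s" shows "cmod (trunc s z) \<le> cmod z"
proof -
  have "0 \<le> s / max (cmod z) s" "s / max (cmod z) s \<le> 1" using s by (auto simp: divide_le_eq max_def)
  then have "\<bar>1 - s / max (cmod z) s\<bar> \<le> 1" by linarith
  then have "\<bar>1 - s / max (cmod z) s\<bar> * cmod z \<le> 1 * cmod z" by (rule mult_right_mono) simp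
  then show ?thesis unfolding trunc_def norm_mult norm_of_real by simp
qed

text \<open>The truncated function vanishes off the compact set where \<open>g\<close> has modulus
  at least \<open>s\<close>, so its square is dominated by a multiple of a bump for that set. A
  function in \<open>C0\<close> itself need not have summable fibres.\<close>

lemma trunc_Cd:
  assumes E: "topological_graph E" and g: "g \<in> C0 (edges E)" and s: "0 < s"
  shows "(\<lambda>e. trunc s (g e)) \<in> Cd E"
proof -
  obtain M where M: "M > 0" "\<forall>e. cmod (g e) \<le> M" using C0_bounded [OF g] by blast
  obtain a where a: "fibre_C0 E a" and 1: "\<forall>e\<in>{e \<in> topspace (edges E). s \<le> cmod (g e)}. 1 \<le> a e"
    using compact_bump [OF E C0_compact [OF g s]] by blast
  show ?thesis
  proof (rule Cd_dominated [OF E fibre_C0_scale [OF a, of "M\<^sup>2"]])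
    show "continuous_map (edges E) euclidean (\<lambda>e. trunc s (g e))"
      by (rule continuous_map_compose_isCont [OF C0_continuous [OF g] continuous_trunc [OF s]])
    show "trunc s (g e) = 0" if "e \<notin> topspace (edges E)" for e using C0_outside [OF g that] by simp
    fix e assume e: "e \<in> topspace (edges E)"
    show "(cmod (trunc s (g e)))\<^sup>2 \<le> M\<^sup>2 * a e"
    proof (cases "s \<le> cmod (g e)")
      case True
      have "cmod (trunc s (g e)) \<le> M" using trunc_norm_le [OF s, of "g e"] M(2) order_trans by blast
      then have "(cmod (trunc s (g e)))\<^sup>2 \<le> M\<^sup>2" by (simp add: power_mono)
      also have "\<dots> \<le> M\<^sup>2 * a e" using 1 True e by (simp add: mult_le_cancel_left1)
      finally show ?thesis .
    next
      case False
      then show ?thesis using trunc_small [OF s, of "g e"] fibre_C0D(2) [OF a, of e] by simp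
    qed
  qed simp
qed

lemma fibre_infsum_mono:
  assumes E: "topological_graph E" and a: "fibre_C0 E a" and b: "fibre_C0 E b"
    and le: "\<And>e. e \<in> topspace (edges E) \<Longrightarrow> a e \<le> b e"
  shows "infsum a (d_fibre E v) \<le> infsum b (d_fibre E v)"
proof (cases "v \<in> topspace (vertices E)")
  case True
  show ?thesis by (rule infsum_mono [OF fibre_C0D(3) [OF a True] fibre_C0D(3) [OF b True]])
      (use le in \<open>simp add: d_fibre_def\<close>)
next
  case False
  then show ?thesis using d_fibre_outside [OF E] by simp
qed

lemma fibre_infsum_lin:
  assumes E: "topological_graph E" and a: "fibre_C0 E a" and b: "fibre_C0 E b"
  shows "infsum (\<lambda>e. c * a e + c' * b e) (d_fibre E v) = c * infsum a (d_fibre E v) + c' * infsum b (d_fibre E v)"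
proof (cases "v \<in> topspace (vertices E)")
  case True
  then show ?thesis
    using fibre_C0D(3) [OF a True] fibre_C0D(3) [OF b True]
    by (simp add: infsum_add summable_on_cmult_right infsum_cmult_right')
next
  case False
  then show ?thesis using d_fibre_outside [OF E] by simp
qed

lemma Cd_diff:
  assumes E: "topological_graph E" and "\<xi> \<in> Cd E" "\<eta> \<in> Cd E"
  shows "(\<lambda>e. \<xi> e - \<eta> e) \<in> Cd E"
  using Cd_add [OF E assms(2) Cd_scal [OF E assms(3), of "-1"]] by simp

text \<open>The bound \<open>M\<close> on the module norm, for nonnegative \<open>M\<close>, phrased
  pointwise so that no supremum has to be formed.\<close>

definition fibre_norm_le :: "('v, 'e) topgraph \<Rightarrow> real \<Rightarrow> ('e \<Rightarrow> complex) \<Rightarrow> bool" where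
  "fibre_norm_le E M \<xi> \<longleftrightarrow> (\<forall>v. infsum (\<lambda>e. (cmod (\<xi> e))\<^sup>2) (d_fibre E v) \<le> M\<^sup>2)"

text \<open>It replaces the Cauchy-Schwarz inequality for infinite sums: with suitably chosen
  weights, linear estimates of fibre sums give the sharp constants.\<close>

lemma weighted_am_gm:
  fixes x y t :: real assumes t: "0 < t" shows "2 * (x * y) \<le> t * x\<^sup>2 + inverse t * y\<^sup>2"
proof -
  have "0 \<le> inverse t * (t * x - y)\<^sup>2" using t by simp
  also have "\<dots> = t * x\<^sup>2 + inverse t * y\<^sup>2 - 2 * (x * y)"
    using t by (simp add: power2_eq_square field_simps)
  finally show ?thesis by simp
qed

text \<open>Minkowski's inequality. With the weight t = N/M the pointwise estimate sums to (1 + N/M)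
  M^2 + (1 + M/N) N^2, which is exactly (M + N)^2; positivity of both bounds is needed to form the
  weights.\<close>

lemma fibre_norm_le_add:
  assumes E: "topological_graph E" and \<xi>: "\<xi> \<in> Cd E" "fibre_norm_le E M \<xi>" and \<eta>: "\<eta> \<in> Cd E" "fibre_norm_le E N \<eta>"
    and pos: "0 < M" "0 < N"
  shows "fibre_norm_le E (M + N) (\<lambda>e. \<xi> e + \<eta> e)"
  unfolding fibre_norm_le_def
proof
  fix v
  note a = Cd_fibre_C0 [OF E \<xi>(1)] and b = Cd_fibre_C0 [OF E \<eta>(1)]
  let ?t = "N / M"
  have t: "0 < ?t" using pos by simp
  have le: "(cmod (x + y))\<^sup>2 \<le> (1 + ?t) * (cmod x)\<^sup>2 + (1 + inverse ?t) * (cmod y)\<^sup>2" for x y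
  proof -
    have "(cmod (x + y))\<^sup>2 \<le> (cmod x + cmod y)\<^sup>2" by (simp add: power_mono norm_triangle_ineq)
    also have "\<dots> = (cmod x)\<^sup>2 + 2 * (cmod x * cmod y) + (cmod y)\<^sup>2" by (simp add: power2_sum)
    also have "\<dots> \<le> (cmod x)\<^sup>2 + (?t * (cmod x)\<^sup>2 + inverse ?t * (cmod y)\<^sup>2) + (cmod y)\<^sup>2"
      using weighted_am_gm [OF t, of "cmod x" "cmod y"] by simp
    finally show ?thesis by (simp add: algebra_simps)
  qed
  have c: "0 \<le> 1 + ?t" "0 \<le> 1 + inverse ?t" using pos by (simp_all add: add_nonneg_nonneg less_imp_le)
  have "infsum (\<lambda>e. (cmod (\<xi> e + \<eta> e))\<^sup>2) (d_fibre E v)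
      \<le> infsum (\<lambda>e. (1 + ?t) * (cmod (\<xi> e))\<^sup>2 + (1 + inverse ?t) * (cmod (\<eta> e))\<^sup>2) (d_fibre E v)"
    by (rule fibre_infsum_mono [OF E Cd_fibre_C0 [OF E Cd_add [OF E \<xi>(1) \<eta>(1)]]
          fibre_C0_add [OF E fibre_C0_scale [OF a c(1)] fibre_C0_scale [OF b c(2)]] le])
  also have "\<dots> = (1 + ?t) * infsum (\<lambda>e. (cmod (\<xi> e))\<^sup>2) (d_fibre E v) + (1 + inverse ?t) * infsum (\<lambda>e. (cmod (\<eta> e))\<^sup>2) (d_fibre E v)"
    by (rule fibre_infsum_lin [OF E a b])
  also have "\<dots> \<le> (1 + ?t) * M\<^sup>2 + (1 + inverse ?t) * N\<^sup>2"
    using \<xi>(2) \<eta>(2) c by (intro add_mono mult_left_mono) (simp_all add: fibre_norm_le_def)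
  also have "\<dots> = (M + N)\<^sup>2" using pos by (simp add: power2_eq_square field_simps)
  finally show "infsum (\<lambda>e. (cmod (\<xi> e + \<eta> e))\<^sup>2) (d_fibre E v) \<le> (M + N)\<^sup>2" .
qed

lemma inner_summable:
  assumes E: "topological_graph E" and \<xi>: "\<xi> \<in> Cd E" and \<eta>: "\<eta> \<in> Cd E"
  shows "(\<lambda>e. cnj (\<xi> e) * \<eta> e) summable_on d_fibre E v"
proof (cases "v \<in> topspace (vertices E)")
  case True
  have "cmod (cnj (\<xi> e) * \<eta> e) \<le> (cmod (\<xi> e))\<^sup>2 + (cmod (\<eta> e))\<^sup>2" for e
  proof -
    have "2 * (cmod (\<xi> e) * cmod (\<eta> e)) \<le> (cmod (\<xi> e))\<^sup>2 + (cmod (\<eta> e))\<^sup>2"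
      using weighted_am_gm [of 1 "cmod (\<xi> e)" "cmod (\<eta> e)"] by simp
    moreover have "0 \<le> cmod (\<xi> e) * cmod (\<eta> e)" by simp
    ultimately have "cmod (\<xi> e) * cmod (\<eta> e) \<le> (cmod (\<xi> e))\<^sup>2 + (cmod (\<eta> e))\<^sup>2" by linarith
    then show ?thesis by (simp add: norm_mult)
  qed
  then have "(\<lambda>e. cmod (cnj (\<xi> e) * \<eta> e)) summable_on d_fibre E v"
    by (intro fibre_abs_summable [OF fibre_C0_add [OF E Cd_fibre_C0 [OF E \<xi>] Cd_fibre_C0 [OF E \<eta>]] True])
  then show ?thesis by (rule abs_summable_summable)
next
  case False
  then show ?thesis using d_fibre_outside [OF E] by simp
qed

lemma infsum_diff_complex:
  fixes f g :: "'x \<Rightarrow> complex"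
  assumes "f summable_on A" "g summable_on A"
  shows "infsum (\<lambda>x. f x - g x) A = infsum f A - infsum g A"
  using infsum_add [OF assms(1) summable_on_cmult_right [OF assms(2), of "-1"]]
  by (simp add: infsum_cmult_right' [of "-1", simplified])

lemma inner_diff:
  assumes E: "topological_graph E" and "\<xi> \<in> Cd E" "\<eta> \<in> Cd E" "\<xi>' \<in> Cd E" "\<eta>' \<in> Cd E"
  shows "inner_Cd E \<xi>' \<eta>' v - inner_Cd E \<xi> \<eta> v
    = inner_Cd E \<xi>' (\<lambda>e. \<eta>' e - \<eta> e) v + inner_Cd E (\<lambda>e. \<xi>' e - \<xi> e) \<eta> v"
proof -
  have "inner_Cd E \<xi>' (\<lambda>e. \<eta>' e - \<eta> e) v = inner_Cd E \<xi>' \<eta>' v - inner_Cd E \<xi>' \<eta> v"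
    unfolding inner_Cd_def right_diff_distrib using assms by (intro infsum_diff_complex inner_summable)
  moreover have "inner_Cd E (\<lambda>e. \<xi>' e - \<xi> e) \<eta> v = inner_Cd E \<xi>' \<eta> v - inner_Cd E \<xi> \<eta> v"
    unfolding inner_Cd_def complex_cnj_diff left_diff_distrib using assms by (intro infsum_diff_complex inner_summable)
  ultimately show ?thesis by simp
qed

text \<open>Cauchy-Schwarz in the form of bounds: with weights N/(2M) and M/(2N) the two summands
  each contribute MN/2.\<close>

lemma fibre_norm_le_inner:
  assumes E: "topological_graph E" and \<xi>: "\<xi> \<in> Cd E" "fibre_norm_le E M \<xi>" and \<eta>: "\<eta> \<in> Cd E" "fibre_norm_le E N \<eta>"
    and pos: "0 < M" "0 < N"
  shows "cmod (inner_Cd E \<xi> \<eta> v) \<le> M * N"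
proof (cases "v \<in> topspace (vertices E)")
  case True
  note a = Cd_fibre_C0 [OF E \<xi>(1)] and b = Cd_fibre_C0 [OF E \<eta>(1)]
  let ?t = "N / (2 * M)" and ?u = "M / (2 * N)"
  have c: "0 \<le> ?t" "0 \<le> ?u" using pos by simp_all
  have "cmod (cnj (\<xi> e) * \<eta> e) \<le> ?t * (cmod (\<xi> e))\<^sup>2 + ?u * (cmod (\<eta> e))\<^sup>2" for e
    using weighted_am_gm [of "N / M" "cmod (\<xi> e)" "cmod (\<eta> e)"] pos by (simp add: norm_mult)
  then have "cmod (infsum (\<lambda>e. cnj (\<xi> e) * \<eta> e) (d_fibre E v))
      \<le> infsum (\<lambda>e. ?t * (cmod (\<xi> e))\<^sup>2 + ?u * (cmod (\<eta> e))\<^sup>2) (d_fibre E v)"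
    by (intro norm_infsum_fibre_le [OF fibre_C0_add [OF E fibre_C0_scale [OF a c(1)] fibre_C0_scale [OF b c(2)]] True] subset_refl)
  also have "\<dots> = ?t * infsum (\<lambda>e. (cmod (\<xi> e))\<^sup>2) (d_fibre E v) + ?u * infsum (\<lambda>e. (cmod (\<eta> e))\<^sup>2) (d_fibre E v)"
    by (rule fibre_infsum_lin [OF E a b])
  also have "\<dots> \<le> ?t * M\<^sup>2 + ?u * N\<^sup>2"
    using \<xi>(2) \<eta>(2) c by (intro add_mono mult_left_mono) (simp_all add: fibre_norm_le_def)
  also have "\<dots> = M * N" using pos by (simp add: power2_eq_square field_simps)
  finally show ?thesis by (simp add: inner_Cd_def)
next
  case False
  then show ?thesis using d_fibre_outside [OF E] pos by (simp add: inner_Cd_def)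
qed

lemma fibre_norm_le_ex:
  assumes E: "topological_graph E" and \<xi>: "\<xi> \<in> Cd E" shows "\<exists>M>0. fibre_norm_le E M \<xi>"
proof -
  obtain M where M: "M > 0" "\<forall>v. cmod (complex_of_real (infsum (\<lambda>e. (cmod (\<xi> e))\<^sup>2) (d_fibre E v))) \<le> M"
    using C0_bounded [OF fibre_C0D(4) [OF Cd_fibre_C0 [OF E \<xi>]]] by blast
  have "infsum (\<lambda>e. (cmod (\<xi> e))\<^sup>2) (d_fibre E v) \<le> (sqrt M)\<^sup>2" for v
    using M(1) spec [OF M(2), of v] by simp
  then show ?thesis using M(1) by (intro exI [of _ "sqrt M"]) (simp add: fibre_norm_le_def)
qed

lemma fibre_norm_le_dominated:
  assumes E: "topological_graph E" and \<xi>: "\<xi> \<in> Cd E" "fibre_norm_le E M \<xi>" and \<eta>: "\<eta> \<in> Cd E"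
    and le: "\<And>e. cmod (\<eta> e) \<le> c * cmod (\<xi> e)"
  shows "fibre_norm_le E (c * M) \<eta>"
  unfolding fibre_norm_le_def
proof
  fix v
  have sq: "(cmod (\<eta> e))\<^sup>2 \<le> c\<^sup>2 * (cmod (\<xi> e))\<^sup>2" for e
    using power_mono [OF le [of e], of 2] by (simp add: power_mult_distrib)
  have "infsum (\<lambda>e. (cmod (\<eta> e))\<^sup>2) (d_fibre E v) \<le> infsum (\<lambda>e. c\<^sup>2 * (cmod (\<xi> e))\<^sup>2) (d_fibre E v)"
    by (rule fibre_infsum_mono [OF E Cd_fibre_C0 [OF E \<eta>] fibre_C0_scale [OF Cd_fibre_C0 [OF E \<xi>(1)]] sq]) simp
  also have "\<dots> = c\<^sup>2 * infsum (\<lambda>e. (cmod (\<xi> e))\<^sup>2) (d_fibre E v)" by (simp add: infsum_cmult_right')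
  also have "\<dots> \<le> c\<^sup>2 * M\<^sup>2" using \<xi>(2) by (intro mult_left_mono) (simp_all add: fibre_norm_le_def)
  finally show "infsum (\<lambda>e. (cmod (\<eta> e))\<^sup>2) (d_fibre E v) \<le> (c * M)\<^sup>2" by (simp add: power_mult_distrib)
qed

context graph_system
begin

text \<open>With \<open>g\<close> uniformly within \<open>s/2\<close> of \<open>\<xi>\<close>, the truncation of \<open>g\<close> at height \<open>s\<close> has compact support, and
  its error is controlled by both \<open>\<bar>\<xi>\<bar>\<close> and \<open>s\<close>; so the Dini-type lemma gives convergence in the module norm.\<close>

lemma Cd_EE_dense:
  assumes \<xi>: "\<xi> \<in> Cd EE" and e: "0 < e"
  shows "\<exists>l\<in>\<Lambda>. \<exists>\<eta>\<in>Cd (E l). fibre_norm_le EE e (\<lambda>x. \<xi> x - pull_back G.L (G.proj l) \<eta> x)"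
proof -
  note EE = topological_graph_EE
  note a = Cd_fibre_C0 [OF EE \<xi>]
  \<comment> \<open>The divisor 9 matches \<open>key\<close>, where the squared error is at most
    nine times the truncated weight.\<close>
  have "0 < e\<^sup>2 / 9" using e by simp
  then obtain \<delta> where \<delta>: "\<delta> > 0" "\<forall>v. infsum (\<lambda>x. min ((cmod (\<xi> x))\<^sup>2) \<delta>) (d_fibre EE v) \<le> e\<^sup>2 / 9"
    using fibre_C0_dini [OF EE a] by blast
  define s where "s = sqrt \<delta>"
  have s: "0 < s" "s\<^sup>2 = \<delta>" using \<delta>(1) by (simp_all add: s_def)
  have "\<xi> \<in> C0 G.L" using Cd_subset_C0 [OF EE \<xi>] by (simp add: EE_sel)
  then obtain l g where l: "l \<in> \<Lambda>" and g: "g \<in> C0 (edges (E l))"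
    and near: "\<forall>x\<in>topspace G.L. cmod (\<xi> x - pull_back G.L (G.proj l) g x) \<le> s/2"
    using G.C0_L_dense [of \<xi> "s/2"] s(1) by auto
  let ?\<eta> = "\<lambda>x. trunc s (g x)"
  have \<eta>: "?\<eta> \<in> Cd (E l)" by (rule trunc_Cd [OF graph [OF l] g s(1)])
  interpret f: factor EE "E l" "V.proj l" "G.proj l" by (rule factor_proj [OF l])
  have p\<eta>: "pull_back G.L (G.proj l) ?\<eta> \<in> Cd EE" using f.p1_Cd [OF \<eta>] by (simp add: EE_sel)
  have peq: "pull_back G.L (G.proj l) ?\<eta> x = trunc s (pull_back G.L (G.proj l) g x)" for x
    by (simp add: pull_back_def split: option.split)
  have key: "(cmod (\<xi> x - pull_back G.L (G.proj l) ?\<eta> x))\<^sup>2 \<le> 9 * min ((cmod (\<xi> x))\<^sup>2) \<delta>"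
    if x: "x \<in> topspace (edges EE)" for x
  proof -
    define y where "y = pull_back G.L (G.proj l) g x"
    have n: "cmod (\<xi> x - y) \<le> s/2" using near x by (simp add: EE_sel y_def)
    have tri: "cmod (\<xi> x - trunc s y) \<le> cmod (\<xi> x - y) + cmod (trunc s y - y)"
      using norm_triangle_ineq4 [of "\<xi> x - y" "trunc s y - y"] by simp
    then have 1: "cmod (\<xi> x - trunc s y) \<le> 3 * s" using n trunc_near [OF s(1), of y] s(1) by linarith
    \<comment> \<open>If \<open>y\<close> has modulus at most \<open>s\<close>, its truncation is 0
      and the error is \<open>\<xi> x\<close> itself. Otherwise \<open>\<xi> x\<close> has modulus
      at least s/2, while the error is at most s/2 + s.\<close>
    have 2: "cmod (\<xi> x - trunc s y) \<le> 3 * cmod (\<xi> x)"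
    proof (cases "cmod y \<le> s")
      case True
      then show ?thesis using trunc_small [OF s(1)] by simp
    next
      case False
      then have "s/2 \<le> cmod (\<xi> x)" using n norm_triangle_ineq2 [of y "\<xi> x"] by (simp add: norm_minus_commute)
      then show ?thesis using tri n trunc_near [OF s(1), of y] by linarith
    qed
    have "(cmod (\<xi> x - trunc s y))\<^sup>2 \<le> 9 * \<delta>" "(cmod (\<xi> x - trunc s y))\<^sup>2 \<le> 9 * (cmod (\<xi> x))\<^sup>2"
      using power_mono [OF 1, of 2] power_mono [OF 2, of 2] s(2) by (simp_all add: power_mult_distrib)
    then show ?thesis unfolding peq y_def by (simp add: min_def)
  qed
  have m: "fibre_C0 EE (\<lambda>x. min ((cmod (\<xi> x))\<^sup>2) \<delta>)"
    by (rule fibre_C0_dominated [OF EE a]) (use \<delta>(1) in \<open>auto intro!: continuous_map_real_min fibre_C0D(1) [OF a]\<close>)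
  have "infsum (\<lambda>x. (cmod (\<xi> x - pull_back G.L (G.proj l) ?\<eta> x))\<^sup>2) (d_fibre EE v) \<le> e\<^sup>2" for v
  proof -
    have "infsum (\<lambda>x. (cmod (\<xi> x - pull_back G.L (G.proj l) ?\<eta> x))\<^sup>2) (d_fibre EE v)
        \<le> infsum (\<lambda>x. 9 * min ((cmod (\<xi> x))\<^sup>2) \<delta>) (d_fibre EE v)"
      by (rule fibre_infsum_mono [OF EE Cd_fibre_C0 [OF EE Cd_diff [OF EE \<xi> p\<eta>]] fibre_C0_scale [OF m] key]) simp_all
    also have "\<dots> = 9 * infsum (\<lambda>x. min ((cmod (\<xi> x))\<^sup>2) \<delta>) (d_fibre EE v)" by (simp add: infsum_cmult_right')
    also have "\<dots> \<le> e\<^sup>2" using \<delta>(2) by (simp add: field_simps)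
    finally show ?thesis .
  qed
  then have "fibre_norm_le EE e (\<lambda>x. \<xi> x - pull_back G.L (G.proj l) ?\<eta> x)" by (simp add: fibre_norm_le_def)
  then show ?thesis using l \<eta> by blast
qed

end

text \<open>Distances are available only through bounds: \<open>near M x y\<close> says that
  \<open>M\<close> is an admissible one. Their infimum serves as the distance in
  \<open>dense_extension\<close>; as it need not be attained, the estimates are made with an
  arbitrary slack.\<close>

lemma dense_extension_near:
  fixes near :: "real \<Rightarrow> 'x \<Rightarrow> 'x \<Rightarrow> bool"
  assumes B: "cstar_algebra B" and R: "R \<subseteq> X \<times> carr B"
    and contr: "\<And>x b y c M. \<lbrakk>(x, b) \<in> R; (y, c) \<in> R; 0 < M; near M x y\<rbrakk> \<Longrightarrow> nrm B (sub B b c) \<le> M"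
    and sym: "\<And>x y M. \<lbrakk>x \<in> X; y \<in> X; near M x y\<rbrakk> \<Longrightarrow> near M y x"
    and tri: "\<And>x y z M N. \<lbrakk>x \<in> X; y \<in> X; z \<in> X; 0 < M; 0 < N; near M x y; near N y z\<rbrakk> \<Longrightarrow> near (M + N) x z"
    and ex: "\<And>x y. \<lbrakk>x \<in> X; y \<in> X\<rbrakk> \<Longrightarrow> \<exists>M>0. near M x y"
    and dense: "\<And>x e. \<lbrakk>x \<in> X; 0 < e\<rbrakk> \<Longrightarrow> \<exists>(y, b)\<in>R. near e y x"
  shows "\<exists>T. \<forall>x\<in>X. T x \<in> carr B \<and> (\<forall>(y, b)\<in>R. \<forall>M>0. near M y x \<longrightarrow> nrm B (sub B b (T x)) \<le> M)"
proof -
  define \<delta> where "\<delta> x y = Inf {M. 0 < M \<and> near M x y}" for x y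
  have bdd: "bdd_below {M. 0 < M \<and> near M x y}" for x y by (rule bdd_belowI [of _ 0]) auto
  have up: "\<delta> x y \<le> M" if "0 < M" "near M x y" for x y M
    unfolding \<delta>_def by (rule cInf_lower [OF _ bdd]) (use that in simp)
  have lo: "\<exists>M. 0 < M \<and> near M x y \<and> M < \<delta> x y + e" if xy: "x \<in> X" "y \<in> X" and e: "0 < e" for x y e
  proof -
    have "{M. 0 < M \<and> near M x y} \<noteq> {}" using ex [OF xy] by blast
    then have "\<exists>M\<in>{M. 0 < M \<and> near M x y}. M < \<delta> x y + e"
      by (subst cInf_less_iff [symmetric, OF _ bdd]) (use e in \<open>simp_all add: \<delta>_def\<close>)
    then show ?thesis by blast
  qed
  have "\<exists>T. \<forall>x\<in>X. T x \<in> carr B \<and> (\<forall>(y, b)\<in>R. nrm B (sub B b (T x)) \<le> \<delta> y x)"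
  proof (rule dense_extension [OF B R])
    fix x b y c assume r: "(x, b) \<in> R" "(y, c) \<in> R"
    then have X: "x \<in> X" "y \<in> X" using R by auto
    show "nrm B (sub B b c) \<le> \<delta> x y"
    proof (rule field_le_epsilon)
      fix e :: real assume "0 < e"
      then obtain M where "0 < M" "near M x y" "M < \<delta> x y + e" using lo [OF X] by blast
      then show "nrm B (sub B b c) \<le> \<delta> x y + e" using contr [OF r] by fastforce
    qed
  next
    fix x y assume X: "x \<in> X" "y \<in> X"
    have "{M. 0 < M \<and> near M x y} = {M. 0 < M \<and> near M y x}" using sym [OF X] sym [OF X(2,1)] by blast
    then show "\<delta> x y = \<delta> y x" by (simp add: \<delta>_def)
  next
    fix x y z assume X: "x \<in> X" "y \<in> X" "z \<in> X"
    show "\<delta> x z \<le> \<delta> x y + \<delta> y z"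
    proof (rule field_le_epsilon)
      fix e :: real assume "0 < e"
      then have e2: "0 < e/2" by simp
      obtain M where M: "0 < M" "near M x y" "M < \<delta> x y + e/2" using lo [OF X(1,2) e2] by blast
      obtain N where N: "0 < N" "near N y z" "N < \<delta> y z + e/2" using lo [OF X(2,3) e2] by blast
      have "\<delta> x z \<le> M + N" by (rule up) (use M N tri [OF X] in auto)
      then show "\<delta> x z \<le> \<delta> x y + \<delta> y z + e" using M N by simp
    qed
  next
    fix x and e :: real assume x: "x \<in> X" and e: "0 < e"
    obtain y b where yb: "(y, b) \<in> R" "near (e/2) y x" using dense [OF x, of "e/2"] e by auto
    have "\<delta> y x \<le> e/2" by (rule up) (use e yb in auto)
    with e have "\<delta> y x < e" by simp
    then show "\<exists>(y, b)\<in>R. \<delta> y x < e" using yb(1) by blast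
  qed
  then obtain T where T: "\<forall>x\<in>X. T x \<in> carr B \<and> (\<forall>(y, b)\<in>R. nrm B (sub B b (T x)) \<le> \<delta> y x)" by blast
  show ?thesis
  proof (intro exI [of _ T] ballI conjI)
    fix x assume x: "x \<in> X"
    show "T x \<in> carr B" using T x by blast
    fix p assume p: "p \<in> R"
    obtain y b where yb: "p = (y, b)" by fastforce
    have "nrm B (sub B b (T x)) \<le> \<delta> y x" using bspec [OF T x] p yb by auto
    then have "nrm B (sub B b (T x)) \<le> M" if "0 < M" "near M y x" for M using up [OF that] by linarith
    then show "case p of (y, b) \<Rightarrow> \<forall>M>0. near M y x \<longrightarrow> nrm B (sub B b (T x)) \<le> M" by (simp add: yb)
  qed
qed

section \<open>The Toeplitz algebra of the projective limit\<close>

lemma star_hom_id: "star_hom A A (\<lambda>x. x)"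
  by (simp add: star_hom_def)

lemma toeplitz_pairD:
  assumes "toeplitz_pair E A T0 T1"
  shows "cstar_algebra A" "star_hom (C0_algebra (vertices E)) A T0"
    and "\<And>\<xi>. \<xi> \<in> Cd E \<Longrightarrow> T1 \<xi> \<in> carr A"
    and "\<And>\<xi> \<eta>. \<lbrakk>\<xi> \<in> Cd E; \<eta> \<in> Cd E\<rbrakk> \<Longrightarrow> T1 (\<lambda>e. \<xi> e + \<eta> e) = add A (T1 \<xi>) (T1 \<eta>)"
    and "\<And>c \<xi>. \<xi> \<in> Cd E \<Longrightarrow> T1 (\<lambda>e. c * \<xi> e) = scal A c (T1 \<xi>)"
    and "\<And>\<xi> \<eta>. \<lbrakk>\<xi> \<in> Cd E; \<eta> \<in> Cd E\<rbrakk> \<Longrightarrow> mul A (star A (T1 \<xi>)) (T1 \<eta>) = T0 (inner_Cd E \<xi> \<eta>)"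
    and "\<And>f \<xi>. \<lbrakk>f \<in> C0 (vertices E); \<xi> \<in> Cd E\<rbrakk> \<Longrightarrow> mul A (T0 f) (T1 \<xi>) = T1 (left_act E f \<xi>)"
  using assms unfolding toeplitz_pair_def by blast+

lemma toeplitz_pair_hom:
  assumes E: "topological_graph E" and T: "toeplitz_pair E A T0 T1" and B: "cstar_algebra B" and h: "star_hom A B h"
  shows "toeplitz_pair E B (\<lambda>f. h (T0 f)) (\<lambda>\<xi>. h (T1 \<xi>))"
proof -
  interpret A: cstar_algebra A by (rule toeplitz_pairD(1) [OF T])
  note t = toeplitz_pairD [OF T] and hD = star_homD [OF h]
  have T0: "T0 f \<in> carr A" if "f \<in> C0 (vertices E)" for f
    using star_homD(1) [OF t(2)] that by (simp add: C0_algebra_sel)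
  have inner: "mul B (star B (h (T1 \<xi>))) (h (T1 \<eta>)) = h (T0 (inner_Cd E \<xi> \<eta>))" if "\<xi> \<in> Cd E" "\<eta> \<in> Cd E" for \<xi> \<eta>
    unfolding t(6) [OF that, symmetric] using that by (simp add: hD t(3) A.star_closed)
  have left: "mul B (h (T0 f)) (h (T1 \<xi>)) = h (T1 (left_act E f \<xi>))" if "f \<in> C0 (vertices E)" "\<xi> \<in> Cd E" for f \<xi>
    unfolding t(7) [OF that, symmetric] using that by (simp add: hD t(3) T0)
  show ?thesis
    unfolding toeplitz_pair_def
    by (intro conjI ballI allI B star_hom_compose [OF t(2) h]) (simp_all add: hD t(3-5) inner left)
qed

lemma (in cstar_algebra) eq_if_close:
  assumes "x \<in> carr A" "y \<in> carr A" "\<And>e. 0 < e \<Longrightarrow> nrm A (sub A x y) \<le> e" shows "x = y"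
proof (rule nrm_sub_zero [OF assms(1,2)])
  have "nrm A (sub A x y) \<le> 0" by (rule field_le_epsilon) (use assms(3) in simp)
  then show "nrm A (sub A x y) = 0" using nrm_nonneg [of "sub A x y"] assms(1,2) by simp
qed

section \<open>Toeplitz pairs of the stages inside the inductive limit, and their extension to the
  limit graph\<close>

context graph_system
begin

abbreviation "p0 l \<equiv> pull_back V.L (V.proj l)"
abbreviation "p1 l \<equiv> pull_back G.L (G.proj l)"
abbreviation "q0 l k \<equiv> pull_back (vertices (E k)) (m0 l k)"
abbreviation "q1 l k \<equiv> pull_back (edges (E k)) (m1 l k)"

lemma q0_refl: "\<lbrakk>l \<in> \<Lambda>; f \<in> C0 (vertices (E l))\<rbrakk> \<Longrightarrow> q0 l l f = f"
  using V.m_refl [of l] C0_outside [of f "vertices (E l)"] by (auto simp: pull_back_def fun_eq_iff)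

lemma q1_refl: "\<lbrakk>l \<in> \<Lambda>; \<xi> \<in> Cd (E l)\<rbrakk> \<Longrightarrow> q1 l l \<xi> = \<xi>"
  using G.m_refl [of l] Cd_outside [OF graph, of l \<xi>] by (auto simp: pull_back_def fun_eq_iff)

lemma q_trans:
  assumes "l \<in> \<Lambda>" "k \<in> \<Lambda>" "j \<in> \<Lambda>" "le l k" "le k j"
  shows "q0 k j (q0 l k f) = q0 l j f" "q1 k j (q1 l k \<xi>) = q1 l j \<xi>"
proof -
  show "q0 k j (q0 l k f) = q0 l j f"
    by (rule pull_back_pull_back [where m' = "m0 l k", OF V.cont [OF assms(2,3,5)] V.m_None [OF assms(1,2,4)]])
      (simp add: V.m_trans [OF assms])
  show "q1 k j (q1 l k \<xi>) = q1 l j \<xi>"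
    by (rule pull_back_pull_back [where m' = "m1 l k", OF G.cont [OF assms(2,3,5)] G.m_None [OF assms(1,2,4)]])
      (simp add: G.m_trans [OF assms])
qed

lemma p_q:
  assumes "l \<in> \<Lambda>" "k \<in> \<Lambda>" "le l k"
  shows "p0 k (q0 l k f) = p0 l f" "p1 k (q1 l k \<xi>) = p1 l \<xi>"
proof -
  show "p0 k (q0 l k f) = p0 l f"
    by (rule pull_back_pull_back [where m' = "m0 l k", OF V.continuous_proj [OF assms(2)] V.m_None [OF assms]])
      (simp add: V_compat assms)
  show "p1 k (q1 l k \<xi>) = p1 l \<xi>"
    by (rule pull_back_pull_back [where m' = "m1 l k", OF G.continuous_proj [OF assms(2)] G.m_None [OF assms]])
      (simp add: G_compat assms)
qed

lemma q_in:
  assumes "l \<in> \<Lambda>" "k \<in> \<Lambda>" "le l k"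
  shows "f \<in> C0 (vertices (E l)) \<Longrightarrow> q0 l k f \<in> C0 (vertices (E k))" "\<xi> \<in> Cd (E l) \<Longrightarrow> q1 l k \<xi> \<in> Cd (E k)"
  using factor.p0_C0 [OF factor_m [OF assms]] factor.p1_Cd [OF factor_m [OF assms]] by blast+

lemma p_in:
  assumes "l \<in> \<Lambda>"
  shows "f \<in> C0 (vertices (E l)) \<Longrightarrow> p0 l f \<in> C0 V.L" "\<xi> \<in> Cd (E l) \<Longrightarrow> p1 l \<xi> \<in> Cd EE"
  using factor.p0_C0 [OF factor_proj [OF assms]] factor.p1_Cd [OF factor_proj [OF assms]] unfolding EE_sel by blast+

lemma p_inner: "l \<in> \<Lambda> \<Longrightarrow> p0 l (inner_Cd (E l) \<xi> \<eta>) = inner_Cd EE (p1 l \<xi>) (p1 l \<eta>)"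
  and p_left: "l \<in> \<Lambda> \<Longrightarrow> p1 l (left_act (E l) f \<xi>) = left_act EE (p0 l f) (p1 l \<xi>)"
  using factor.inner_p1 [OF factor_proj] factor.left_act_p1 [OF factor_proj] unfolding EE_sel by metis+

abbreviation "\<mu> l k \<equiv> induced_hom (E k) (E l) (m0 l k) (m1 l k)"
abbreviation "\<phi> l \<equiv> induced_hom EE (E l) (V.proj l) (G.proj l)"

lemma \<mu>:
  assumes "l \<in> \<Lambda>" "k \<in> \<Lambda>" "le l k"
  shows "star_hom (toeplitz_algebra (E l)) (toeplitz_algebra (E k)) (\<mu> l k)"
    and "\<And>f. f \<in> C0 (vertices (E l)) \<Longrightarrow> \<mu> l k (univ_T0 (E l) f) = univ_T0 (E k) (q0 l k f)"
    and "\<And>\<xi>. \<xi> \<in> Cd (E l) \<Longrightarrow> \<mu> l k (univ_T1 (E l) \<xi>) = univ_T1 (E k) (q1 l k \<xi>)"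
  using factor.induced_hom [OF factor_m [OF assms]] by blast+

lemma \<phi>:
  assumes "l \<in> \<Lambda>"
  shows "star_hom (toeplitz_algebra (E l)) (toeplitz_algebra EE) (\<phi> l)"
    and "\<And>f. f \<in> C0 (vertices (E l)) \<Longrightarrow> \<phi> l (univ_T0 (E l) f) = univ_T0 EE (p0 l f)"
    and "\<And>\<xi>. \<xi> \<in> Cd (E l) \<Longrightarrow> \<phi> l (univ_T1 (E l) \<xi>) = univ_T1 EE (p1 l \<xi>)"
  using factor.induced_hom [OF factor_proj [OF assms]] unfolding EE_sel by blast+

sublocale I: inductive_system \<Lambda> le "\<lambda>l. toeplitz_algebra (E l)" "\<lambda>l k. induced_hom (E k) (E l) (m0 l k) (m1 l k)"
proof (rule inductive_system.intro)
  show "directed_set \<Lambda> le" by (rule dir)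
  show C: "cstar_algebra (toeplitz_algebra (E l))" if "l \<in> \<Lambda>" for l by (rule cstar_algebra_toeplitz [OF graph [OF that]])
  show "star_hom (toeplitz_algebra (E l)) (toeplitz_algebra (E k)) (\<mu> l k)" if "l \<in> \<Lambda>" "k \<in> \<Lambda>" "le l k" for l k
    by (rule \<mu>(1) [OF that])
  show "\<mu> l l x = x" if l: "l \<in> \<Lambda>" and x: "x \<in> carr (toeplitz_algebra (E l))" for l x
    by (rule toeplitz_hom_eqI [OF graph [OF l] C [OF l] \<mu>(1) [OF l l V.D(2) [OF l]] star_hom_id _ _ x])
      (simp_all add: \<mu>(2,3) [OF l l V.D(2) [OF l]] q0_refl q1_refl l)
  show "\<mu> k j (\<mu> l k x) = \<mu> l j x"
    if a: "l \<in> \<Lambda>" "k \<in> \<Lambda>" "j \<in> \<Lambda>" "le l k" "le k j" and x: "x \<in> carr (toeplitz_algebra (E l))" for l k j x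
  proof -
    have lj: "le l j" by (rule V.D(3) [OF a])
    note 1 = \<mu> [OF a(1,2,4)] and 2 = \<mu> [OF a(2,3,5)] and 3 = \<mu> [OF a(1,3) lj]
    show ?thesis
      by (rule toeplitz_hom_eqI [OF graph [OF a(1)] C [OF a(3)] star_hom_compose [OF 1(1) 2(1)] 3(1) _ _ x])
        (simp_all add: 1(2,3) 2(2,3) 3(2,3) q_in [OF a(1,2,4)] q_trans [OF a])
  qed
qed

text \<open>With \<open>J1\<close>, the universal pair of stage \<open>l\<close> carried into the
  inductive limit. These values are what the pair on the limit graph has to take on functions pulled
  back from stage \<open>l\<close>.\<close>

definition J0 :: "'l \<Rightarrow> ('v \<Rightarrow> complex) \<Rightarrow> (nat \<Rightarrow> 'l \<Rightarrow> ('v, 'e) toeplitz_elem) set" where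
  "J0 l f = I.inj_lim l (univ_T0 (E l) f)"

definition J1 :: "'l \<Rightarrow> ('e \<Rightarrow> complex) \<Rightarrow> (nat \<Rightarrow> 'l \<Rightarrow> ('v, 'e) toeplitz_elem) set" where
  "J1 l \<xi> = I.inj_lim l (univ_T1 (E l) \<xi>)"

lemma J_pair: "l \<in> \<Lambda> \<Longrightarrow> toeplitz_pair (E l) I.B (J0 l) (J1 l)"
  using toeplitz_pair_hom [OF graph toeplitz_pair_univ [OF graph] I.cstar_algebra_B I.star_hom_inj_lim]
  by (simp add: J0_def [abs_def] J1_def [abs_def])

lemmas J = toeplitz_pairD [OF J_pair]

lemma univ_in:
  assumes "topological_graph F"
  shows "f \<in> C0 (vertices F) \<Longrightarrow> univ_T0 F f \<in> carr (toeplitz_algebra F)"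
    and "\<xi> \<in> Cd F \<Longrightarrow> univ_T1 F \<xi> \<in> carr (toeplitz_algebra F)"
  using toeplitz_pairD(2,3) [OF toeplitz_pair_univ [OF assms]] star_homD(1) by (force simp: C0_algebra_sel)+

lemma J0_hom:
  assumes "l \<in> \<Lambda>"
  shows "f \<in> C0 (vertices (E l)) \<Longrightarrow> J0 l f \<in> carr I.B"
    and "\<lbrakk>f \<in> C0 (vertices (E l)); g \<in> C0 (vertices (E l))\<rbrakk> \<Longrightarrow> J0 l (\<lambda>x. f x + g x) = add I.B (J0 l f) (J0 l g)"
    and "f \<in> C0 (vertices (E l)) \<Longrightarrow> J0 l (\<lambda>x. c * f x) = scal I.B c (J0 l f)"
    and "\<lbrakk>f \<in> C0 (vertices (E l)); g \<in> C0 (vertices (E l))\<rbrakk> \<Longrightarrow> J0 l (\<lambda>x. f x * g x) = mul I.B (J0 l f) (J0 l g)"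
    and "f \<in> C0 (vertices (E l)) \<Longrightarrow> J0 l (\<lambda>x. cnj (f x)) = star I.B (J0 l f)"
  using star_homD [OF J(2) [OF assms]] unfolding C0_algebra_sel by blast+

lemma J_up:
  assumes "l \<in> \<Lambda>" "k \<in> \<Lambda>" "le l k"
  shows "f \<in> C0 (vertices (E l)) \<Longrightarrow> J0 k (q0 l k f) = J0 l f" "\<xi> \<in> Cd (E l) \<Longrightarrow> J1 k (q1 l k \<xi>) = J1 l \<xi>"
  using I.inj_lim_\<mu> [OF assms univ_in(1) [OF graph [OF assms(1)]], of f]
    I.inj_lim_\<mu> [OF assms univ_in(2) [OF graph [OF assms(1)]], of \<xi>] \<mu>(2,3) [OF assms]
  by (simp_all add: J0_def J1_def)

text \<open>The hypothesis bounds \<open>f\<close> only on the image of the limit space.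
  \<open>C0_L_norm\<close> finds a later stage where the pullback of \<open>f\<close> is bounded by
  M + e throughout, and the norm in the inductive limit can be estimated at that stage.\<close>

lemma J0_bound:
  assumes l: "l \<in> \<Lambda>" and f: "f \<in> C0 (vertices (E l))" and M: "0 \<le> M" "\<And>v. cmod (p0 l f v) \<le> M"
  shows "nrm I.B (J0 l f) \<le> M"
proof (rule field_le_epsilon)
  fix e :: real assume e: "0 < e"
  obtain k where k: "k \<in> \<Lambda>" "le l k" and le: "\<forall>y\<in>topspace (vertices (E k)). cmod (q0 l k f y) \<le> M + e"
    using V.C0_L_norm [OF l f M(2,1) e] by blast
  note T = toeplitz_pairD [OF toeplitz_pair_univ [OF graph [OF k(1)]]]
  have "nrm I.B (J0 l f) \<le> nrm (toeplitz_algebra (E k)) (\<mu> l k (univ_T0 (E l) f))"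
    unfolding J0_def by (rule I.nrm_inj_lim_le [OF l k univ_in(1) [OF graph [OF l] f]])
  also have "\<mu> l k (univ_T0 (E l) f) = univ_T0 (E k) (q0 l k f)" by (rule \<mu>(2) [OF l k f])
  also have "nrm (toeplitz_algebra (E k)) (univ_T0 (E k) (q0 l k f)) \<le> M + e"
    by (rule C0_hom_bound [OF cstar_algebra.axioms(1) [OF T(1)] T(2) q_in(1) [OF l k f]]) (use le M e in auto)
  finally show "nrm I.B (J0 l f) \<le> M + e" .
qed

text \<open>The C*-identity turns the norm of \<open>J1 l \<xi>\<close> into that of
  \<open>J0\<close> at the inner product, whose pullback is the inner product on the limit
  graph.\<close>

lemma J1_bound:
  assumes l: "l \<in> \<Lambda>" and \<xi>: "\<xi> \<in> Cd (E l)" and M: "0 < M" "fibre_norm_le EE M (p1 l \<xi>)"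
  shows "nrm I.B (J1 l \<xi>) \<le> M"
proof (rule power2_le_imp_le)
  have "(nrm I.B (J1 l \<xi>))\<^sup>2 = nrm I.B (J0 l (inner_Cd (E l) \<xi> \<xi>))"
    using I.B.nrm_star_mul [OF J(3) [OF l \<xi>]] J(6) [OF l \<xi> \<xi>] by simp
  also have "\<dots> \<le> M\<^sup>2"
  proof (rule J0_bound [OF l inner_C0 [OF graph [OF l] \<xi> \<xi>]])
    fix v show "cmod (p0 l (inner_Cd (E l) \<xi> \<xi>) v) \<le> M\<^sup>2"
      using fibre_norm_le_inner [OF topological_graph_EE p_in(2) [OF l \<xi>] M(2) p_in(2) [OF l \<xi>] M(2) M(1) M(1), of v]
      by (simp add: p_inner l power2_eq_square)
  qed simp
  finally show "(nrm I.B (J1 l \<xi>))\<^sup>2 \<le> M\<^sup>2" .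
qed (use M in simp)

lemma C0_EE_dense:
  assumes f: "f \<in> C0 V.L" and e: "0 < e"
  shows "\<exists>l\<in>\<Lambda>. \<exists>g\<in>C0 (vertices (E l)). \<forall>v. cmod (p0 l g v - f v) \<le> e"
proof -
  obtain l g where l: "l \<in> \<Lambda>" "g \<in> C0 (vertices (E l))" and n: "\<forall>x\<in>topspace V.L. cmod (f x - p0 l g x) \<le> e"
    using V.C0_L_dense [OF f e] by blast
  have "cmod (p0 l g v - f v) \<le> e" for v
  proof (cases "v \<in> topspace V.L")
    case True
    then show ?thesis using n norm_minus_commute by metis
  next
    case False
    then show ?thesis using C0_outside [OF f False] e by (simp add: pull_back_def)
  qed
  then show ?thesis using l by blast
qed

text \<open>The relation pairs each pulled back function with its prescribed value. That it is
  contractive, and in particular that equal pullbacks have equal values, is \<open>J0_bound\<close>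
  applied to a difference.\<close>

lemma extend_J0:
  "\<exists>T. \<forall>f\<in>C0 V.L. T f \<in> carr I.B \<and> (\<forall>l\<in>\<Lambda>. \<forall>g\<in>C0 (vertices (E l)). \<forall>M>0.
     (\<forall>v. cmod (p0 l g v - f v) \<le> M) \<longrightarrow> nrm I.B (sub I.B (J0 l g) (T f)) \<le> M)"
proof -
  let ?R = "{(p0 l g, J0 l g) | l g. l \<in> \<Lambda> \<and> g \<in> C0 (vertices (E l))}"
  have "\<exists>T. \<forall>f\<in>C0 V.L. T f \<in> carr I.B \<and> (\<forall>(h, b)\<in>?R. \<forall>M>0. (\<forall>v. cmod (h v - f v) \<le> M) \<longrightarrow> nrm I.B (sub I.B b (T f)) \<le> M)"
  proof (rule dense_extension_near [OF I.cstar_algebra_B, where near = "\<lambda>M f g. \<forall>v. cmod (f v - g v) \<le> M"])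
    show "?R \<subseteq> C0 V.L \<times> carr I.B" using p_in(1) J0_hom(1) by blast
  next
    fix h b h' b' and M :: real
    assume "(h, b) \<in> ?R" "(h', b') \<in> ?R" and M: "0 < M" "\<forall>v. cmod (h v - h' v) \<le> M"
    then obtain l g k g' where l: "l \<in> \<Lambda>" "g \<in> C0 (vertices (E l))" "h = p0 l g" "b = J0 l g"
      and k: "k \<in> \<Lambda>" "g' \<in> C0 (vertices (E k))" "h' = p0 k g'" "b' = J0 k g'" by blast
    \<comment> \<open>The two functions come from different stages; at a common later stage their
      difference is a single element of \<open>C0\<close>, to which the bound applies.\<close>
    obtain j where j: "j \<in> \<Lambda>" "le l j" "le k j" using V.D(4) [OF l(1) k(1)] by blast
    let ?a = "q0 l j g" and ?a' = "q0 k j g'"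
    have a: "?a \<in> C0 (vertices (E j))" "?a' \<in> C0 (vertices (E j))"
      using q_in(1) [OF l(1) j(1,2) l(2)] q_in(1) [OF k(1) j(1,3) k(2)] .
    have eq: "p0 j ?a = h" "p0 j ?a' = h'" "J0 j ?a = b" "J0 j ?a' = b'"
      using p_q(1) [OF l(1) j(1,2), of g] p_q(1) [OF k(1) j(1,3), of g'] J_up(1) [OF l(1) j(1,2) l(2)] J_up(1) [OF k(1) j(1,3) k(2)] l k by simp_all
    have "sub I.B b b' = J0 j (\<lambda>x. ?a x + (-1) * ?a' x)"
      using J0_hom(2) [OF j(1) a(1) C0_scal [OF a(2)], of "-1"] J0_hom(3) [OF j(1) a(2), of "-1"] eq by (simp add: sub_def)
    moreover have "nrm I.B (J0 j (\<lambda>x. ?a x + (-1) * ?a' x)) \<le> M"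
    proof (rule J0_bound [OF j(1) C0_add [OF a(1) C0_scal [OF a(2)]]])
      show "cmod (p0 j (\<lambda>x. ?a x + (-1) * ?a' x) v) \<le> M" for v
        unfolding pull_back_arith eq using M(2) by simp
    qed (use M in simp)
    ultimately show "nrm I.B (sub I.B b b') \<le> M" by simp
  next
    fix f g h :: "('l \<Rightarrow> 'v option) \<Rightarrow> complex" and M N :: real
    assume "\<forall>v. cmod (f v - g v) \<le> M" "\<forall>v. cmod (g v - h v) \<le> N"
    then show "\<forall>v. cmod (f v - h v) \<le> M + N" using norm_diff_triangle_le by blast
  next
    fix f g assume f: "f \<in> C0 V.L" and g: "g \<in> C0 V.L"
    have "(\<lambda>v. f v + (-1) * g v) \<in> C0 V.L" by (rule C0_add [OF f C0_scal [OF g]])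
    from C0_bounded [OF this] show "\<exists>M>0. \<forall>v. cmod (f v - g v) \<le> M" by simp
  next
    fix f and e :: real assume f: "f \<in> C0 V.L" and e: "0 < e"
    show "\<exists>(h, b)\<in>?R. \<forall>v. cmod (h v - f v) \<le> e" using C0_EE_dense [OF f e] by blast
  qed (simp_all add: norm_minus_commute)
  then show ?thesis by (elim exE) (intro exI, fast)
qed

lemma fibre_norm_le_minus:
  "fibre_norm_le F M (\<lambda>e. \<xi> e - \<eta> e) \<longleftrightarrow> fibre_norm_le F M (\<lambda>e. \<eta> e - \<xi> e)"
  unfolding fibre_norm_le_def by (subst norm_minus_commute) (rule refl)

lemma extend_J1:
  "\<exists>T. \<forall>\<xi>\<in>Cd EE. T \<xi> \<in> carr I.B \<and> (\<forall>l\<in>\<Lambda>. \<forall>\<eta>\<in>Cd (E l). \<forall>M>0.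
     fibre_norm_le EE M (\<lambda>e. p1 l \<eta> e - \<xi> e) \<longrightarrow> nrm I.B (sub I.B (J1 l \<eta>) (T \<xi>)) \<le> M)"
proof -
  let ?R = "{(p1 l \<eta>, J1 l \<eta>) | l \<eta>. l \<in> \<Lambda> \<and> \<eta> \<in> Cd (E l)}"
  note EE = topological_graph_EE
  have "\<exists>T. \<forall>\<xi>\<in>Cd EE. T \<xi> \<in> carr I.B \<and> (\<forall>(h, b)\<in>?R. \<forall>M>0. fibre_norm_le EE M (\<lambda>e. h e - \<xi> e) \<longrightarrow> nrm I.B (sub I.B b (T \<xi>)) \<le> M)"
  proof (rule dense_extension_near [OF I.cstar_algebra_B, where near = "\<lambda>M \<xi> \<eta>. fibre_norm_le EE M (\<lambda>e. \<xi> e - \<eta> e)"])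
    show "?R \<subseteq> Cd EE \<times> carr I.B" using p_in(2) J(3) by blast
  next
    fix h b h' b' and M :: real
    assume "(h, b) \<in> ?R" "(h', b') \<in> ?R" and M: "0 < M" "fibre_norm_le EE M (\<lambda>e. h e - h' e)"
    then obtain l g k g' where l: "l \<in> \<Lambda>" "g \<in> Cd (E l)" "h = p1 l g" "b = J1 l g"
      and k: "k \<in> \<Lambda>" "g' \<in> Cd (E k)" "h' = p1 k g'" "b' = J1 k g'" by blast
    obtain j where j: "j \<in> \<Lambda>" "le l j" "le k j" using V.D(4) [OF l(1) k(1)] by blast
    let ?a = "q1 l j g" and ?a' = "q1 k j g'"
    have a: "?a \<in> Cd (E j)" "?a' \<in> Cd (E j)"
      using q_in(2) [OF l(1) j(1,2) l(2)] q_in(2) [OF k(1) j(1,3) k(2)] .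
    have eq: "p1 j ?a = h" "p1 j ?a' = h'" "J1 j ?a = b" "J1 j ?a' = b'"
      using p_q(2) [OF l(1) j(1,2), of g] p_q(2) [OF k(1) j(1,3), of g'] J_up(2) [OF l(1) j(1,2) l(2)] J_up(2) [OF k(1) j(1,3) k(2)] l k by simp_all
    have s: "(\<lambda>e. (-1) * ?a' e) \<in> Cd (E j)" by (rule Cd_scal [OF graph [OF j(1)] a(2)])
    have "sub I.B b b' = J1 j (\<lambda>x. ?a x + (-1) * ?a' x)"
      using J(4) [OF j(1) a(1) s] J(5) [OF j(1) a(2), of "-1"] eq by (simp add: sub_def)
    moreover have "nrm I.B (J1 j (\<lambda>x. ?a x + (-1) * ?a' x)) \<le> M"
    proof (rule J1_bound [OF j(1) Cd_add [OF graph [OF j(1)] a(1) s] M(1)])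
      show "fibre_norm_le EE M (p1 j (\<lambda>x. ?a x + (-1) * ?a' x))"
        unfolding pull_back_arith eq using M(2) by simp
    qed
    ultimately show "nrm I.B (sub I.B b b') \<le> M" by simp
  next
    fix \<xi> \<eta> \<zeta> and M N :: real
    assume C: "\<xi> \<in> Cd EE" "\<eta> \<in> Cd EE" "\<zeta> \<in> Cd EE" and MN: "0 < M" "0 < N"
      and f: "fibre_norm_le EE M (\<lambda>e. \<xi> e - \<eta> e)" "fibre_norm_le EE N (\<lambda>e. \<eta> e - \<zeta> e)"
    from fibre_norm_le_add [OF EE Cd_diff [OF EE C(1,2)] f(1) Cd_diff [OF EE C(2,3)] f(2) MN]
    show "fibre_norm_le EE (M + N) (\<lambda>e. \<xi> e - \<zeta> e)" by simp
  next
    fix \<xi> \<eta> assume "\<xi> \<in> Cd EE" "\<eta> \<in> Cd EE"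
    then show "\<exists>M>0. fibre_norm_le EE M (\<lambda>e. \<xi> e - \<eta> e)" using fibre_norm_le_ex [OF EE Cd_diff [OF EE]] by blast
  next
    fix \<xi> and e :: real assume \<xi>: "\<xi> \<in> Cd EE" and e: "0 < e"
    obtain l \<eta> where "l \<in> \<Lambda>" "\<eta> \<in> Cd (E l)" and "fibre_norm_le EE e (\<lambda>x. \<xi> x - p1 l \<eta> x)"
      using Cd_EE_dense [OF \<xi> e] by blast
    then show "\<exists>(h, b)\<in>?R. fibre_norm_le EE e (\<lambda>x. h x - \<xi> x)" using fibre_norm_le_minus by blast
  qed (subst fibre_norm_le_minus)
  then show ?thesis by (elim exE) (intro exI, fast)
qed

text \<open>All four elements are approximated at one stage, because the pair relations that are to
  be transferred mix them within a single algebra.\<close>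

lemma common_approx:
  assumes f: "f \<in> C0 V.L" and g: "g \<in> C0 V.L" and \<xi>: "\<xi> \<in> Cd EE" and \<eta>: "\<eta> \<in> Cd EE" and e: "0 < e"
  shows "\<exists>l f' g' \<xi>' \<eta>'. l \<in> \<Lambda> \<and> f' \<in> C0 (vertices (E l)) \<and> g' \<in> C0 (vertices (E l)) \<and> \<xi>' \<in> Cd (E l) \<and> \<eta>' \<in> Cd (E l) \<and>
    (\<forall>v. cmod (p0 l f' v - f v) \<le> e) \<and> (\<forall>v. cmod (p0 l g' v - g v) \<le> e) \<and>
    fibre_norm_le EE e (\<lambda>x. p1 l \<xi>' x - \<xi> x) \<and> fibre_norm_le EE e (\<lambda>x. p1 l \<eta>' x - \<eta> x)"
proof -
  obtain l1 f1 where 1: "l1 \<in> \<Lambda>" "f1 \<in> C0 (vertices (E l1))" "\<forall>v. cmod (p0 l1 f1 v - f v) \<le> e" using C0_EE_dense [OF f e] by blast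
  obtain l2 f2 where 2: "l2 \<in> \<Lambda>" "f2 \<in> C0 (vertices (E l2))" "\<forall>v. cmod (p0 l2 f2 v - g v) \<le> e" using C0_EE_dense [OF g e] by blast
  obtain l3 f3 where 3: "l3 \<in> \<Lambda>" "f3 \<in> Cd (E l3)" "fibre_norm_le EE e (\<lambda>x. p1 l3 f3 x - \<xi> x)"
    using Cd_EE_dense [OF \<xi> e] fibre_norm_le_minus by blast
  obtain l4 f4 where 4: "l4 \<in> \<Lambda>" "f4 \<in> Cd (E l4)" "fibre_norm_le EE e (\<lambda>x. p1 l4 f4 x - \<eta> x)"
    using Cd_EE_dense [OF \<eta> e] fibre_norm_le_minus by blast
  have "finite {l1, l2, l3, l4}" "{l1, l2, l3, l4} \<subseteq> \<Lambda>" using 1 2 3 4 by auto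
  then obtain k where k: "k \<in> \<Lambda>" "\<forall>l\<in>{l1, l2, l3, l4}. le l k" using directed_finite_bound [OF dir] by blast
  then have le: "le l1 k" "le l2 k" "le l3 k" "le l4 k" by auto
  show ?thesis
    by (rule exI [of _ k], rule exI [of _ "q0 l1 k f1"], rule exI [of _ "q0 l2 k f2"], rule exI [of _ "q1 l3 k f3"],
        rule exI [of _ "q1 l4 k f4"])
      (use 1 2 3 4 k(1) le in \<open>simp add: p_q q_in\<close>)
qed

text \<open>Each law holds for \<open>J0\<close> and \<open>J1\<close> at the approximating stage.
  Both sides of the law on the limit are then limits of one sequence in the inductive limit, so they
  agree; what remains for each law is an explicit null sequence that bounds the approximation error
  of the compound expression.\<close>

lemma limit_pair:
  "\<exists>T0 T1. toeplitz_pair EE I.B T0 T1 \<and>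
    (\<forall>f\<in>C0 V.L. \<forall>l\<in>\<Lambda>. \<forall>g\<in>C0 (vertices (E l)). \<forall>M>0.
       (\<forall>v. cmod (p0 l g v - f v) \<le> M) \<longrightarrow> nrm I.B (sub I.B (J0 l g) (T0 f)) \<le> M) \<and>
    (\<forall>\<xi>\<in>Cd EE. \<forall>l\<in>\<Lambda>. \<forall>\<eta>\<in>Cd (E l). \<forall>M>0.
       fibre_norm_le EE M (\<lambda>e. p1 l \<eta> e - \<xi> e) \<longrightarrow> nrm I.B (sub I.B (J1 l \<eta>) (T1 \<xi>)) \<le> M)"
proof -
  note EE = topological_graph_EE
  obtain T0 where T0: "\<forall>f\<in>C0 V.L. T0 f \<in> carr I.B \<and> (\<forall>l\<in>\<Lambda>. \<forall>g\<in>C0 (vertices (E l)). \<forall>M>0.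
     (\<forall>v. cmod (p0 l g v - f v) \<le> M) \<longrightarrow> nrm I.B (sub I.B (J0 l g) (T0 f)) \<le> M)"
    using extend_J0 by (elim exE)
  obtain T1 where T1: "\<forall>\<xi>\<in>Cd EE. T1 \<xi> \<in> carr I.B \<and> (\<forall>l\<in>\<Lambda>. \<forall>\<eta>\<in>Cd (E l). \<forall>M>0.
     fibre_norm_le EE M (\<lambda>e. p1 l \<eta> e - \<xi> e) \<longrightarrow> nrm I.B (sub I.B (J1 l \<eta>) (T1 \<xi>)) \<le> M)"
    using extend_J1 by (elim exE)
  have near0: "nrm I.B (sub I.B (J0 l g) (T0 f)) \<le> M"
    if "f \<in> C0 V.L" "l \<in> \<Lambda>" "g \<in> C0 (vertices (E l))" "0 < M" "\<And>v. cmod (p0 l g v - f v) \<le> M" for l f g M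
    using T0 that by blast
  have near1: "nrm I.B (sub I.B (J1 l \<eta>) (T1 \<xi>)) \<le> M"
    if "\<xi> \<in> Cd EE" "l \<in> \<Lambda>" "\<eta> \<in> Cd (E l)" "0 < M" "fibre_norm_le EE M (\<lambda>e. p1 l \<eta> e - \<xi> e)" for l \<xi> \<eta> M
    using T1 that by blast
  have c0: "conv_to I.B (\<lambda>n. J0 (l n) (g n)) (T0 f)"
    if f: "f \<in> C0 V.L" and l: "\<And>n. l n \<in> \<Lambda>" and g: "\<And>n. g n \<in> C0 (vertices (E (l n)))"
      and M: "\<And>n. 0 < M n" "M \<longlonglongrightarrow> 0" and n: "\<And>n v. cmod (p0 (l n) (g n) v - f v) \<le> M n" for l g f M
    unfolding conv_to_def
  proof (intro conjI allI)
    show "(\<lambda>n. nrm I.B (sub I.B (J0 (l n) (g n)) (T0 f))) \<longlonglongrightarrow> 0"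
    proof (rule tendsto_sandwich [OF _ _ tendsto_const M(2)])
      show "eventually (\<lambda>n. 0 \<le> nrm I.B (sub I.B (J0 (l n) (g n)) (T0 f))) sequentially"
        using T0 f J0_hom(1) [OF l g] by (intro always_eventually allI I.B.nrm_nonneg I.B.sub_closed) auto
      show "eventually (\<lambda>n. nrm I.B (sub I.B (J0 (l n) (g n)) (T0 f)) \<le> M n) sequentially"
        by (intro always_eventually allI near0 [OF f l g M(1) n])
    qed
  qed (use T0 f J0_hom(1) [OF l g] in auto)
  have c1: "conv_to I.B (\<lambda>n. J1 (l n) (\<eta> n)) (T1 \<xi>)"
    if \<xi>: "\<xi> \<in> Cd EE" and l: "\<And>n. l n \<in> \<Lambda>" and \<eta>: "\<And>n. \<eta> n \<in> Cd (E (l n))"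
      and M: "\<And>n. 0 < M n" "M \<longlonglongrightarrow> 0" and n: "\<And>n. fibre_norm_le EE (M n) (\<lambda>e. p1 (l n) (\<eta> n) e - \<xi> e)" for l \<eta> \<xi> M
    unfolding conv_to_def
  proof (intro conjI allI)
    show "(\<lambda>n. nrm I.B (sub I.B (J1 (l n) (\<eta> n)) (T1 \<xi>))) \<longlonglongrightarrow> 0"
    proof (rule tendsto_sandwich [OF _ _ tendsto_const M(2)])
      show "eventually (\<lambda>n. 0 \<le> nrm I.B (sub I.B (J1 (l n) (\<eta> n)) (T1 \<xi>))) sequentially"
        using T1 \<xi> J(3) [OF l \<eta>] by (intro always_eventually allI I.B.nrm_nonneg I.B.sub_closed) auto
      show "eventually (\<lambda>n. nrm I.B (sub I.B (J1 (l n) (\<eta> n)) (T1 \<xi>)) \<le> M n) sequentially"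
        by (intro always_eventually allI near1 [OF \<xi> l \<eta> M(1) n])
    qed
  qed (use T1 \<xi> J(3) [OF l \<eta>] in auto)
  have laws: "T0 (\<lambda>x. f x + g x) = add I.B (T0 f) (T0 g) \<and> T0 (\<lambda>x. c * f x) = scal I.B c (T0 f)
      \<and> T0 (\<lambda>x. f x * g x) = mul I.B (T0 f) (T0 g) \<and> T0 (\<lambda>x. cnj (f x)) = star I.B (T0 f)
      \<and> T1 (\<lambda>x. \<xi> x + \<eta> x) = add I.B (T1 \<xi>) (T1 \<eta>) \<and> T1 (\<lambda>x. c * \<xi> x) = scal I.B c (T1 \<xi>)
      \<and> mul I.B (star I.B (T1 \<xi>)) (T1 \<eta>) = T0 (inner_Cd EE \<xi> \<eta>)
      \<and> mul I.B (T0 f) (T1 \<xi>) = T1 (left_act EE f \<xi>)"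
    if f: "f \<in> C0 V.L" and g: "g \<in> C0 V.L" and \<xi>: "\<xi> \<in> Cd EE" and \<eta>: "\<eta> \<in> Cd EE" for f g \<xi> \<eta> c
  proof -
    define r where "r n = inverse (real (Suc n))" for n
    have r: "0 < r n" for n by (simp add: r_def)
    have r0: "r \<longlonglongrightarrow> 0" unfolding r_def [abs_def] by (rule LIMSEQ_inverse_real_of_nat)
    define P where "P n l f' g' \<xi>' \<eta>' \<longleftrightarrow> l \<in> \<Lambda> \<and> f' \<in> C0 (vertices (E l)) \<and> g' \<in> C0 (vertices (E l)) \<and> \<xi>' \<in> Cd (E l) \<and> \<eta>' \<in> Cd (E l) \<and>
      (\<forall>v. cmod (p0 l f' v - f v) \<le> r n) \<and> (\<forall>v. cmod (p0 l g' v - g v) \<le> r n) \<and>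
      fibre_norm_le EE (r n) (\<lambda>x. p1 l \<xi>' x - \<xi> x) \<and> fibre_norm_le EE (r n) (\<lambda>x. p1 l \<eta>' x - \<eta> x)" for n l f' g' \<xi>' \<eta>'
    have "\<forall>n. \<exists>l f' g' \<xi>' \<eta>'. P n l f' g' \<xi>' \<eta>'"
      unfolding P_def using common_approx [OF f g \<xi> \<eta> r] by blast
    then obtain l f' g' \<xi>' \<eta>' where "\<forall>n. P n (l n) (f' n) (g' n) (\<xi>' n) (\<eta>' n)"
      by metis
    then have l: "\<And>n. l n \<in> \<Lambda>" and C0: "\<And>n. f' n \<in> C0 (vertices (E (l n)))" "\<And>n. g' n \<in> C0 (vertices (E (l n)))"
      and Cd: "\<And>n. \<xi>' n \<in> Cd (E (l n))" "\<And>n. \<eta>' n \<in> Cd (E (l n))"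
      and nf: "\<And>n v. cmod (p0 (l n) (f' n) v - f v) \<le> r n" and ng: "\<And>n v. cmod (p0 (l n) (g' n) v - g v) \<le> r n"
      and n\<xi>: "\<And>n. fibre_norm_le EE (r n) (\<lambda>x. p1 (l n) (\<xi>' n) x - \<xi> x)"
      and n\<eta>: "\<And>n. fibre_norm_le EE (r n) (\<lambda>x. p1 (l n) (\<eta>' n) x - \<eta> x)"
      unfolding P_def by blast+
    note cf = c0 [OF f l C0(1) r r0 nf] and cg = c0 [OF g l C0(2) r r0 ng]
      and c\<xi> = c1 [OF \<xi> l Cd(1) r r0 n\<xi>] and c\<eta> = c1 [OF \<eta> l Cd(2) r r0 n\<eta>]
    note gr = graph [OF l]
    obtain A where A: "0 < A" "\<And>x. cmod (f x) \<le> A" using C0_bounded [OF f] by blast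
    obtain A' where A': "0 < A'" "\<And>x. cmod (g x) \<le> A'" using C0_bounded [OF g] by blast
    obtain N where N: "0 < N" "fibre_norm_le EE N \<xi>" using fibre_norm_le_ex [OF EE \<xi>] by blast
    obtain N' where N': "0 < N'" "fibre_norm_le EE N' \<eta>" using fibre_norm_le_ex [OF EE \<eta>] by blast
    have rA: "0 < a + r n" if "0 < a" for a n using r [of n] that by simp
    \<comment> \<open>The error of a product: x'y' - xy = x'(y' - y) + (x' - x)y, where x' is
      bounded by \<open>a\<close> plus its own error \<open>r n\<close> and y by \<open>b\<close>.
      The same form serves for products, inner products and the left action.\<close>
    have bnd: "0 < (a + r n) * r n + r n * b" "(\<lambda>n. (a + r n) * r n + r n * b) \<longlonglongrightarrow> 0" if "0 < a" "0 < b" for a b n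
    proof -
      show "0 < (a + r n) * r n + r n * b" using r [of n] that by (simp add: add_pos_pos)
      have "(\<lambda>n. (a + r n) * r n + r n * b) \<longlonglongrightarrow> (a + 0) * 0 + 0 * b" by (intro tendsto_intros r0)
      then show "(\<lambda>n. (a + r n) * r n + r n * b) \<longlonglongrightarrow> 0" by simp
    qed
    \<comment> \<open>Errors of sums and of multiples. The 1 keeps the bound strictly positive for
      \<open>c = 0\<close>, as \<open>c0\<close> and \<open>c1\<close> require positive
      bounds.\<close>
    have r2: "0 < r n + r n" "(\<lambda>n. r n + r n) \<longlonglongrightarrow> 0" "0 < (cmod c + 1) * r n" "(\<lambda>n. (cmod c + 1) * r n) \<longlonglongrightarrow> 0" for n
    proof -
      show "0 < r n + r n" using r [of n] by simp
      show "0 < (cmod c + 1) * r n" using r [of n] by (simp add: add_nonneg_pos)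
      have "(\<lambda>n. r n + r n) \<longlonglongrightarrow> 0 + 0" "(\<lambda>n. (cmod c + 1) * r n) \<longlonglongrightarrow> (cmod c + 1) * 0" by (intro tendsto_intros r0)+
      then show "(\<lambda>n. r n + r n) \<longlonglongrightarrow> 0" "(\<lambda>n. (cmod c + 1) * r n) \<longlonglongrightarrow> 0" by simp_all
    qed
    have bf: "cmod (p0 (l n) (f' n) v) \<le> A + r n" for n v
      using nf [of n v] A(2) [of v] norm_triangle_sub [of "p0 (l n) (f' n) v" "f v"] by linarith
    have p\<xi>: "p1 (l n) (\<xi>' n) \<in> Cd EE" and p\<eta>: "p1 (l n) (\<eta>' n) \<in> Cd EE" for n
      using p_in(2) [OF l Cd(1)] p_in(2) [OF l Cd(2)] .
    have p\<xi>N: "fibre_norm_le EE (N + r n) (p1 (l n) (\<xi>' n))" for n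
      using fibre_norm_le_add [OF EE \<xi> N(2) Cd_diff [OF EE p\<xi> \<xi>] n\<xi> N(1) r, of n] by simp
    have "T0 (\<lambda>x. f x + g x) = add I.B (T0 f) (T0 g)"
    proof (rule I.B.conv_to_unique)
      show "conv_to I.B (\<lambda>n. J0 (l n) (\<lambda>x. f' n x + g' n x)) (T0 (\<lambda>x. f x + g x))"
      proof (rule c0 [OF C0_add [OF f g] l C0_add [OF C0] r2(1,2)])
        show "cmod (p0 (l n) (\<lambda>x. f' n x + g' n x) v - (f v + g v)) \<le> r n + r n" for n v
          unfolding pull_back_arith by (rule order_trans [OF norm_diff_triangle_ineq add_mono [OF nf ng]])
      qed
      show "conv_to I.B (\<lambda>n. J0 (l n) (\<lambda>x. f' n x + g' n x)) (add I.B (T0 f) (T0 g))"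
        unfolding J0_hom(2) [OF l C0] by (rule I.B.conv_to_add [OF cf cg])
    qed
    moreover have "T0 (\<lambda>x. c * f x) = scal I.B c (T0 f)"
    proof (rule I.B.conv_to_unique)
      show "conv_to I.B (\<lambda>n. J0 (l n) (\<lambda>x. c * f' n x)) (T0 (\<lambda>x. c * f x))"
      proof (rule c0 [OF C0_scal [OF f] l C0_scal [OF C0(1)] r2(3,4)])
        fix n v
        have "cmod (c * p0 (l n) (f' n) v - c * f v) = cmod c * cmod (p0 (l n) (f' n) v - f v)"
          by (simp add: right_diff_distrib [symmetric] norm_mult)
        also have "\<dots> \<le> (cmod c + 1) * r n" using nf [of n v] by (intro mult_mono) auto
        finally show "cmod (p0 (l n) (\<lambda>x. c * f' n x) v - c * f v) \<le> (cmod c + 1) * r n" unfolding pull_back_arith .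
      qed
      show "conv_to I.B (\<lambda>n. J0 (l n) (\<lambda>x. c * f' n x)) (scal I.B c (T0 f))"
        unfolding J0_hom(3) [OF l C0(1)] by (rule I.B.conv_to_scal [OF cf])
    qed
    moreover have "T0 (\<lambda>x. f x * g x) = mul I.B (T0 f) (T0 g)"
    proof (rule I.B.conv_to_unique)
      show "conv_to I.B (\<lambda>n. J0 (l n) (\<lambda>x. f' n x * g' n x)) (T0 (\<lambda>x. f x * g x))"
      proof (rule c0 [OF C0_mult [OF f g] l C0_mult [OF C0] bnd [OF A(1) A'(1)]])
        fix n v
        let ?a = "p0 (l n) (f' n) v" and ?b = "p0 (l n) (g' n) v"
        have "cmod (?a * ?b - f v * g v) = cmod (?a * (?b - g v) + (?a - f v) * g v)" by (simp add: algebra_simps)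
        also have "\<dots> \<le> cmod ?a * cmod (?b - g v) + cmod (?a - f v) * cmod (g v)"
          by (rule order_trans [OF norm_triangle_ineq]) (simp add: norm_mult)
        also have "\<dots> \<le> (A + r n) * r n + r n * A'"
          using bf [of n v] ng [of n v] nf [of n v] A'(2) [of v] rA [OF A(1), of n] r [of n]
          by (intro add_mono mult_mono) auto
        finally show "cmod (p0 (l n) (\<lambda>x. f' n x * g' n x) v - f v * g v) \<le> (A + r n) * r n + r n * A'"
          unfolding pull_back_arith .
      qed
      show "conv_to I.B (\<lambda>n. J0 (l n) (\<lambda>x. f' n x * g' n x)) (mul I.B (T0 f) (T0 g))"
        unfolding J0_hom(4) [OF l C0] by (rule I.B.conv_to_mul [OF cf cg])
    qed
    moreover have "T0 (\<lambda>x. cnj (f x)) = star I.B (T0 f)"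
    proof (rule I.B.conv_to_unique)
      show "conv_to I.B (\<lambda>n. J0 (l n) (\<lambda>x. cnj (f' n x))) (T0 (\<lambda>x. cnj (f x)))"
      proof (rule c0 [OF C0_cnj [OF f] l C0_cnj [OF C0(1)] r r0])
        show "cmod (p0 (l n) (\<lambda>x. cnj (f' n x)) v - cnj (f v)) \<le> r n" for n v
          unfolding pull_back_arith complex_cnj_diff [symmetric] complex_mod_cnj by (rule nf)
      qed
      show "conv_to I.B (\<lambda>n. J0 (l n) (\<lambda>x. cnj (f' n x))) (star I.B (T0 f))"
        unfolding J0_hom(5) [OF l C0(1)] by (rule I.B.conv_to_star [OF cf])
    qed
    moreover have "T1 (\<lambda>x. \<xi> x + \<eta> x) = add I.B (T1 \<xi>) (T1 \<eta>)"
    proof (rule I.B.conv_to_unique)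
      show "conv_to I.B (\<lambda>n. J1 (l n) (\<lambda>x. \<xi>' n x + \<eta>' n x)) (T1 (\<lambda>x. \<xi> x + \<eta> x))"
      proof (rule c1 [OF Cd_add [OF EE \<xi> \<eta>] l Cd_add [OF gr Cd] r2(1,2)])
        show "fibre_norm_le EE (r n + r n) (\<lambda>e. p1 (l n) (\<lambda>x. \<xi>' n x + \<eta>' n x) e - (\<xi> e + \<eta> e))" for n
          using fibre_norm_le_add [OF EE Cd_diff [OF EE p\<xi> \<xi>] n\<xi> Cd_diff [OF EE p\<eta> \<eta>] n\<eta> r r, of n n]
          by (simp add: pull_back_arith add_diff_add)
      qed
      show "conv_to I.B (\<lambda>n. J1 (l n) (\<lambda>x. \<xi>' n x + \<eta>' n x)) (add I.B (T1 \<xi>) (T1 \<eta>))"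
        unfolding J(4) [OF l Cd] by (rule I.B.conv_to_add [OF c\<xi> c\<eta>])
    qed
    moreover have "T1 (\<lambda>x. c * \<xi> x) = scal I.B c (T1 \<xi>)"
    proof (rule I.B.conv_to_unique)
      show "conv_to I.B (\<lambda>n. J1 (l n) (\<lambda>x. c * \<xi>' n x)) (T1 (\<lambda>x. c * \<xi> x))"
      proof (rule c1 [OF Cd_scal [OF EE \<xi>] l Cd_scal [OF gr Cd(1)] r2(3,4)])
        show "fibre_norm_le EE ((cmod c + 1) * r n) (\<lambda>e. p1 (l n) (\<lambda>x. c * \<xi>' n x) e - c * \<xi> e)" for n
          unfolding pull_back_arith right_diff_distrib [symmetric]
          by (rule fibre_norm_le_dominated [OF EE Cd_diff [OF EE p\<xi> \<xi>] n\<xi> Cd_scal [OF EE Cd_diff [OF EE p\<xi> \<xi>]]])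
            (simp add: norm_mult mult_right_mono)
      qed
      show "conv_to I.B (\<lambda>n. J1 (l n) (\<lambda>x. c * \<xi>' n x)) (scal I.B c (T1 \<xi>))"
        unfolding J(5) [OF l Cd(1)] by (rule I.B.conv_to_scal [OF c\<xi>])
    qed
    moreover have "mul I.B (star I.B (T1 \<xi>)) (T1 \<eta>) = T0 (inner_Cd EE \<xi> \<eta>)"
    proof (rule I.B.conv_to_unique)
      have iC: "inner_Cd EE \<xi> \<eta> \<in> C0 V.L" using inner_C0 [OF EE \<xi> \<eta>] by (simp add: EE_sel)
      show "conv_to I.B (\<lambda>n. J0 (l n) (inner_Cd (E (l n)) (\<xi>' n) (\<eta>' n))) (T0 (inner_Cd EE \<xi> \<eta>))"
      proof (rule c0 [OF iC l inner_C0 [OF gr Cd] bnd [OF N(1) N'(1)]])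
        fix n v
        have "cmod (inner_Cd EE (p1 (l n) (\<xi>' n)) (p1 (l n) (\<eta>' n)) v - inner_Cd EE \<xi> \<eta> v)
            \<le> cmod (inner_Cd EE (p1 (l n) (\<xi>' n)) (\<lambda>e. p1 (l n) (\<eta>' n) e - \<eta> e) v)
              + cmod (inner_Cd EE (\<lambda>e. p1 (l n) (\<xi>' n) e - \<xi> e) \<eta> v)"
          unfolding inner_diff [OF EE \<xi> \<eta> p\<xi> p\<eta>] by (rule norm_triangle_ineq)
        also have "\<dots> \<le> (N + r n) * r n + r n * N'"
          by (intro add_mono fibre_norm_le_inner [OF EE p\<xi> p\<xi>N Cd_diff [OF EE p\<eta> \<eta>] n\<eta> rA [OF N(1)] r]
              fibre_norm_le_inner [OF EE Cd_diff [OF EE p\<xi> \<xi>] n\<xi> \<eta> N'(2) r N'(1)])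
        finally show "cmod (p0 (l n) (inner_Cd (E (l n)) (\<xi>' n) (\<eta>' n)) v - inner_Cd EE \<xi> \<eta> v) \<le> (N + r n) * r n + r n * N'"
          unfolding p_inner [OF l] .
      qed
      show "conv_to I.B (\<lambda>n. J0 (l n) (inner_Cd (E (l n)) (\<xi>' n) (\<eta>' n))) (mul I.B (star I.B (T1 \<xi>)) (T1 \<eta>))"
        unfolding J(6) [OF l Cd, symmetric] by (rule I.B.conv_to_mul [OF I.B.conv_to_star [OF c\<xi>] c\<eta>])
    qed
    moreover have "mul I.B (T0 f) (T1 \<xi>) = T1 (left_act EE f \<xi>)"
    proof (rule I.B.conv_to_unique)
      have fE: "f \<in> C0 (vertices EE)" and pf: "\<And>n. p0 (l n) (f' n) \<in> C0 (vertices EE)"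
        using f p_in(1) [OF l C0(1)] by (simp_all add: EE_sel)
      have df: "(\<lambda>v. p0 (l n) (f' n) v - f v) \<in> C0 (vertices EE)" for n
        using C0_add [OF pf C0_scal [OF fE], of n "-1"] by simp
      show "conv_to I.B (\<lambda>n. J1 (l n) (left_act (E (l n)) (f' n) (\<xi>' n))) (T1 (left_act EE f \<xi>))"
      proof (rule c1 [OF left_act_Cd [OF EE fE \<xi>] l left_act_Cd [OF gr C0(1) Cd(1)] bnd [OF A(1) N(1)]])
        fix n
        note d = Cd_diff [OF EE p\<xi> \<xi>]
        have "fibre_norm_le EE ((A + r n) * r n) (left_act EE (p0 (l n) (f' n)) (\<lambda>e. p1 (l n) (\<xi>' n) e - \<xi> e))"
          by (rule fibre_norm_le_dominated [OF EE d n\<xi> left_act_Cd [OF EE pf d]])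
            (simp add: left_act_def norm_mult mult_right_mono bf)
        moreover have "fibre_norm_le EE (r n * N) (left_act EE (\<lambda>v. p0 (l n) (f' n) v - f v) \<xi>)"
          by (rule fibre_norm_le_dominated [OF EE \<xi> N(2) left_act_Cd [OF EE df \<xi>]])
            (simp add: left_act_def norm_mult mult_right_mono nf)
        ultimately have "fibre_norm_le EE ((A + r n) * r n + r n * N)
            (\<lambda>e. left_act EE (p0 (l n) (f' n)) (\<lambda>e. p1 (l n) (\<xi>' n) e - \<xi> e) e + left_act EE (\<lambda>v. p0 (l n) (f' n) v - f v) \<xi> e)"
          using rA [OF A(1), of n] r [of n] N(1)
          by (intro fibre_norm_le_add [OF EE left_act_Cd [OF EE pf d] _ left_act_Cd [OF EE df \<xi>]]) auto
        then show "fibre_norm_le EE ((A + r n) * r n + r n * N) (\<lambda>e. p1 (l n) (left_act (E (l n)) (f' n) (\<xi>' n)) e - left_act EE f \<xi> e)"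
          unfolding p_left [OF l] by (simp add: left_act_def algebra_simps)
      qed
      show "conv_to I.B (\<lambda>n. J1 (l n) (left_act (E (l n)) (f' n) (\<xi>' n))) (mul I.B (T0 f) (T1 \<xi>))"
        unfolding J(7) [OF l C0(1) Cd(1), symmetric] by (rule I.B.conv_to_mul [OF cf c\<xi>])
    qed
    ultimately show ?thesis by (intro conjI)
  qed
  \<comment> \<open>The laws were proved for two functions and two module elements at once; zeros
    fill the arguments that a particular law does not mention.\<close>
  have z0: "(\<lambda>v. 0) \<in> C0 V.L" by (rule C0_zero)
  have z1: "(\<lambda>e. 0) \<in> Cd EE" by (simp add: Cd_iff [OF EE] fibre_C0_def C0_zero)
  have h: "star_hom (C0_algebra (vertices EE)) I.B T0"
    unfolding star_hom_def C0_algebra_sel EE_sel(1)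
  proof (intro conjI ballI allI)
    fix f g c assume f: "f \<in> C0 V.L"
    show "T0 f \<in> carr I.B" using T0 f by blast
    show "T0 (\<lambda>x. c * f x) = scal I.B c (T0 f)" "T0 (\<lambda>x. cnj (f x)) = star I.B (T0 f)"
      using laws [OF f z0 z1 z1, where c = c] by - (elim conjE, assumption)+
    assume g: "g \<in> C0 V.L"
    show "T0 (\<lambda>x. f x + g x) = add I.B (T0 f) (T0 g)" "T0 (\<lambda>x. f x * g x) = mul I.B (T0 f) (T0 g)"
      using laws [OF f g z1 z1, where c = c] by - (elim conjE, assumption)+
  qed
  have "toeplitz_pair EE I.B T0 T1"
    unfolding toeplitz_pair_def
  proof (intro conjI ballI allI I.cstar_algebra_B h)
    fix \<xi> \<eta> c assume \<xi>: "\<xi> \<in> Cd EE"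
    show "T1 \<xi> \<in> carr I.B" using T1 \<xi> by blast
    show "T1 (\<lambda>e. c * \<xi> e) = scal I.B c (T1 \<xi>)" using laws [OF z0 z0 \<xi> z1, where c = c] by (elim conjE)
    assume \<eta>: "\<eta> \<in> Cd EE"
    show "T1 (\<lambda>e. \<xi> e + \<eta> e) = add I.B (T1 \<xi>) (T1 \<eta>)" "mul I.B (star I.B (T1 \<xi>)) (T1 \<eta>) = T0 (inner_Cd EE \<xi> \<eta>)"
      using laws [OF z0 z0 \<xi> \<eta>, where c = c] by - (elim conjE, assumption)+
  next
    fix f \<xi> assume f: "f \<in> C0 (vertices EE)" and \<xi>: "\<xi> \<in> Cd EE"
    show "mul I.B (T0 f) (T1 \<xi>) = T1 (left_act EE f \<xi>)"
      using laws [OF f [unfolded EE_sel(1)] z0 \<xi> z1, where c = 0] by (elim conjE)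
  qed
  then show ?thesis using T0 T1 by (intro exI [of _ T0] exI [of _ T1] conjI ballI) blast+
qed

text \<open>The universal property of the Toeplitz algebra gives \<open>\<psi>\<close> into the
  inductive limit, and that of the inductive limit gives \<open>\<Phi>\<close> back. Each
  composition is compared with the identity on generators only.\<close>

theorem toeplitz_lim_iso: "cstar_isomorphic (toeplitz_algebra EE) I.B"
proof -
  note EE = topological_graph_EE
  let ?A = "toeplitz_algebra EE"
  have cA: "cstar_algebra ?A" by (rule cstar_algebra_toeplitz [OF EE])
  interpret A: cstar_algebra ?A by (rule cA)
  note U = toeplitz_pairD [OF toeplitz_pair_univ [OF EE]]
  obtain T0 T1 where T: "toeplitz_pair EE I.B T0 T1"
    and T0: "\<forall>f\<in>C0 V.L. \<forall>l\<in>\<Lambda>. \<forall>g\<in>C0 (vertices (E l)). \<forall>M>0.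
       (\<forall>v. cmod (p0 l g v - f v) \<le> M) \<longrightarrow> nrm I.B (sub I.B (J0 l g) (T0 f)) \<le> M"
    and T1: "\<forall>\<xi>\<in>Cd EE. \<forall>l\<in>\<Lambda>. \<forall>\<eta>\<in>Cd (E l). \<forall>M>0.
       fibre_norm_le EE M (\<lambda>e. p1 l \<eta> e - \<xi> e) \<longrightarrow> nrm I.B (sub I.B (J1 l \<eta>) (T1 \<xi>)) \<le> M"
    using limit_pair by (elim exE conjE)
  have T0_in: "T0 f \<in> carr I.B" if "f \<in> C0 V.L" for f
    using star_homD(1) [OF toeplitz_pairD(2) [OF T]] that by (simp add: C0_algebra_sel EE_sel(1))
  note T1_in = toeplitz_pairD(3) [OF T]
  obtain \<psi> where \<psi>: "star_hom ?A I.B \<psi>" and \<psi>0: "\<forall>f\<in>C0 V.L. \<psi> (univ_T0 EE f) = T0 f"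
    and \<psi>1: "\<forall>\<xi>\<in>Cd EE. \<psi> (univ_T1 EE \<xi>) = T1 \<xi>"
    using toeplitz_algebra_universal [OF EE T] unfolding EE_sel(1) by (elim exE conjE)
  have compat: "\<phi> k (\<mu> l k x) = \<phi> l x" if a: "l \<in> \<Lambda>" "k \<in> \<Lambda>" "le l k" and x: "x \<in> carr (toeplitz_algebra (E l))" for l k x
    by (rule toeplitz_hom_eqI [OF graph [OF a(1)] cA star_hom_compose [OF \<mu>(1) [OF a] \<phi>(1) [OF a(2)]] \<phi>(1) [OF a(1)] _ _ x])
      (simp_all add: \<mu>(2,3) [OF a] \<phi>(2,3) [OF a(1)] \<phi>(2,3) [OF a(2)] q_in [OF a] p_q [OF a])
  have "\<exists>\<Phi>. star_hom I.B ?A \<Phi> \<and> (\<forall>l\<in>\<Lambda>. \<forall>x\<in>carr (toeplitz_algebra (E l)). \<Phi> (I.inj_lim l x) = \<phi> l x)"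
  proof (rule I.inductive_limit_universal [OF cA])
    show "star_hom (toeplitz_algebra (E l)) ?A (\<phi> l)" if "l \<in> \<Lambda>" for l by (rule \<phi>(1) [OF that])
    show "\<phi> k (\<mu> l k x) = \<phi> l x" if "l \<in> \<Lambda>" "k \<in> \<Lambda>" "le l k" "x \<in> carr (toeplitz_algebra (E l))" for l k x
      by (rule compat [OF that])
  qed
  then obtain \<Phi> where \<Phi>: "star_hom I.B ?A \<Phi>"
    and \<Phi>_inj: "\<forall>l\<in>\<Lambda>. \<forall>x\<in>carr (toeplitz_algebra (E l)). \<Phi> (I.inj_lim l x) = \<phi> l x"
    by (elim exE conjE)
  have \<Phi>J: "\<Phi> (J0 l f) = univ_T0 EE (p0 l f)" "\<Phi> (J1 l \<xi>) = univ_T1 EE (p1 l \<xi>)"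
    if "l \<in> \<Lambda>" "f \<in> C0 (vertices (E l))" "\<xi> \<in> Cd (E l)" for l f \<xi>
    using \<Phi>_inj univ_in [OF graph [OF that(1)]] that \<phi>(2,3) [OF that(1)] by (simp_all add: J0_def J1_def)
  have contr: "nrm ?A (sub ?A (\<Phi> b) (\<Phi> t)) \<le> nrm I.B (sub I.B b t)" if "b \<in> carr I.B" "t \<in> carr I.B" for b t
    using star_hom_contractive [OF I.cstar_algebra_B A.cstar_seminormed_axioms \<Phi>, of "sub I.B b t"] that
      star_hom_sub [OF \<Phi> I.B.star_algebra_axioms that] by simp
  have z0: "(\<lambda>v. 0) \<in> C0 X" for X by (rule C0_zero)
  have z1: "(\<lambda>e. 0) \<in> Cd F" if "topological_graph F" for F by (simp add: Cd_iff [OF that] fibre_C0_def C0_zero)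
  \<comment> \<open>\<open>T0 f\<close> is known only through its distance to values
    \<open>J0 l g\<close>, so the identity is reached by approximation: \<open>\<Phi>\<close> is
    contractive, it sends \<open>J0 l g\<close> to the universal generator of the pullback of
    \<open>g\<close>, and that generator is near the one of \<open>f\<close>.\<close>
  have \<Phi>T0: "\<Phi> (T0 f) = univ_T0 EE f" if f: "f \<in> C0 V.L" for f
  proof (rule A.eq_if_close)
    show in1: "\<Phi> (T0 f) \<in> carr ?A" and in2: "univ_T0 EE f \<in> carr ?A"
      using star_homD(1) [OF \<Phi> T0_in [OF f]] univ_in(1) [OF EE] f by (simp_all add: EE_sel(1))
    fix e :: real assume "0 < e"
    then have e: "0 < e/2" by simp
    obtain l g where l: "l \<in> \<Lambda>" and g: "g \<in> C0 (vertices (E l))" and n: "\<forall>v. cmod (p0 l g v - f v) \<le> e/2"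
      using common_approx [OF f f z1 [OF EE] z1 [OF EE] e] by blast
    have Jg: "J0 l g \<in> carr I.B" by (rule J0_hom(1) [OF l g])
    have \<Phi>g: "\<Phi> (J0 l g) = univ_T0 EE (p0 l g)" by (rule \<Phi>J(1) [OF l g z1 [OF graph [OF l]]])
    have "nrm I.B (sub I.B (J0 l g) (T0 f)) \<le> e/2" using T0 f l g e n by blast
    then have 1: "nrm ?A (sub ?A (\<Phi> (J0 l g)) (\<Phi> (T0 f))) \<le> e/2"
      using contr [OF Jg T0_in [OF f]] by linarith
    have p: "p0 l g \<in> carr (C0_algebra (vertices EE))" "f \<in> carr (C0_algebra (vertices EE))"
      using p_in(1) [OF l g] f by (simp_all add: C0_algebra_sel EE_sel(1))
    have "sub ?A (univ_T0 EE (p0 l g)) (univ_T0 EE f) = univ_T0 EE (\<lambda>v. p0 l g v + - 1 * f v)"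
      using star_hom_sub [OF U(2) star_algebra_C0 p] by (simp add: sub_def C0_algebra_sel)
    moreover have "nrm ?A (univ_T0 EE (\<lambda>v. p0 l g v + - 1 * f v)) \<le> e/2"
    proof (rule C0_hom_bound [OF A.cstar_seminormed_axioms U(2)])
      show "(\<lambda>v. p0 l g v + - 1 * f v) \<in> C0 (vertices EE)"
        by (rule C0_add [OF _ C0_scal]) (use p in \<open>simp_all only: C0_algebra_sel\<close>)
    qed (use n e in simp_all)
    ultimately have 2: "nrm ?A (sub ?A (\<Phi> (J0 l g)) (univ_T0 EE f)) \<le> e/2" by (simp add: \<Phi>g)
    have \<Phi>gin: "\<Phi> (J0 l g) \<in> carr ?A" by (rule star_homD(1) [OF \<Phi> Jg])
    show "nrm ?A (sub ?A (\<Phi> (T0 f)) (univ_T0 EE f)) \<le> e"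
      using A.nrm_triangle [OF in1 \<Phi>gin in2] A.nrm_sub_commute [OF in1 \<Phi>gin] 1 2 by simp
  qed
  have \<Phi>T1: "\<Phi> (T1 \<xi>) = univ_T1 EE \<xi>" if \<xi>: "\<xi> \<in> Cd EE" for \<xi>
  proof (rule A.eq_if_close)
    show in1: "\<Phi> (T1 \<xi>) \<in> carr ?A" and in2: "univ_T1 EE \<xi> \<in> carr ?A"
      using star_homD(1) [OF \<Phi> T1_in [OF \<xi>]] univ_in(2) [OF EE \<xi>] by simp_all
    fix e :: real assume "0 < e"
    then have e: "0 < e/2" by simp
    obtain l \<eta> where l: "l \<in> \<Lambda>" and \<eta>: "\<eta> \<in> Cd (E l)" and n: "fibre_norm_le EE (e/2) (\<lambda>x. p1 l \<eta> x - \<xi> x)"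
      using common_approx [OF z0 z0 \<xi> \<xi> e] by blast
    have J\<eta>: "J1 l \<eta> \<in> carr I.B" by (rule J(3) [OF l \<eta>])
    have \<Phi>\<eta>: "\<Phi> (J1 l \<eta>) = univ_T1 EE (p1 l \<eta>)" by (rule \<Phi>J(2) [OF l z0 \<eta>])
    have "nrm I.B (sub I.B (J1 l \<eta>) (T1 \<xi>)) \<le> e/2" using T1 \<xi> l \<eta> e n by blast
    then have 1: "nrm ?A (sub ?A (\<Phi> (J1 l \<eta>)) (\<Phi> (T1 \<xi>))) \<le> e/2"
      using contr [OF J\<eta> T1_in [OF \<xi>]] by linarith
    have p: "p1 l \<eta> \<in> Cd EE" by (rule p_in(2) [OF l \<eta>])
    have d: "(\<lambda>x. p1 l \<eta> x + -1 * \<xi> x) \<in> Cd EE" by (rule Cd_add [OF EE p Cd_scal [OF EE \<xi>]])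
    have n': "fibre_norm_le EE (e/2) (\<lambda>x. p1 l \<eta> x + -1 * \<xi> x)" using n by simp
    have "sub ?A (univ_T1 EE (p1 l \<eta>)) (univ_T1 EE \<xi>) = univ_T1 EE (\<lambda>x. p1 l \<eta> x + -1 * \<xi> x)"
      using U(4) [OF p Cd_scal [OF EE \<xi>], of "-1"] U(5) [OF \<xi>, of "-1"] by (simp add: sub_def)
    moreover have "nrm ?A (univ_T1 EE (\<lambda>x. p1 l \<eta> x + -1 * \<xi> x)) \<le> e/2"
    proof (rule toeplitz_pair_bound [OF toeplitz_pair_univ [OF EE] d])
      show "cmod (inner_Cd EE (\<lambda>x. p1 l \<eta> x + -1 * \<xi> x) (\<lambda>x. p1 l \<eta> x + -1 * \<xi> x) v) \<le> (e/2)\<^sup>2" for v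
        unfolding power2_eq_square by (rule fibre_norm_le_inner [OF EE d n' d n' e e])
    qed (use e in simp)
    ultimately have 2: "nrm ?A (sub ?A (\<Phi> (J1 l \<eta>)) (univ_T1 EE \<xi>)) \<le> e/2" by (simp add: \<Phi>\<eta>)
    have \<Phi>\<eta>in: "\<Phi> (J1 l \<eta>) \<in> carr ?A" by (rule star_homD(1) [OF \<Phi> J\<eta>])
    show "nrm ?A (sub ?A (\<Phi> (T1 \<xi>)) (univ_T1 EE \<xi>)) \<le> e"
      using A.nrm_triangle [OF in1 \<Phi>\<eta>in in2] A.nrm_sub_commute [OF in1 \<Phi>\<eta>in] 1 2 by simp
  qed
  have left: "\<Phi> (\<psi> x) = x" if x: "x \<in> carr ?A" for x
    by (rule toeplitz_hom_eqI [OF EE cA star_hom_compose [OF \<psi> \<Phi>] star_hom_id _ _ x])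
      (use \<psi>0 \<psi>1 \<Phi>T0 \<Phi>T1 in \<open>simp_all add: EE_sel(1)\<close>)
  \<comment> \<open>Here \<open>f\<close> itself approximates its own pullback with error 0, so the
    distance between the two sides is below every positive number.\<close>
  have T0J: "T0 (p0 l f) = J0 l f" if l: "l \<in> \<Lambda>" and f: "f \<in> C0 (vertices (E l))" for l f
  proof (rule I.B.eq_if_close [symmetric])
    show "nrm I.B (sub I.B (J0 l f) (T0 (p0 l f))) \<le> e" if "0 < e" for e
      using T0 p_in(1) [OF l f] l f that by force
  qed (use J0_hom(1) [OF l f] T0_in [OF p_in(1) [OF l f]] in auto)
  have T1J: "T1 (p1 l \<xi>) = J1 l \<xi>" if l: "l \<in> \<Lambda>" and \<xi>: "\<xi> \<in> Cd (E l)" for l \<xi>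
  proof (rule I.B.eq_if_close [symmetric])
    have "fibre_norm_le EE e (\<lambda>x. p1 l \<xi> x - p1 l \<xi> x)" for e by (simp add: fibre_norm_le_def)
    then show "nrm I.B (sub I.B (J1 l \<xi>) (T1 (p1 l \<xi>))) \<le> e" if "0 < e" for e
      using T1 p_in(2) [OF l \<xi>] l \<xi> that by blast
  qed (use J(3) [OF l \<xi>] T1_in [OF p_in(2) [OF l \<xi>]] in auto)
  have right: "\<psi> (\<Phi> P) = P" if P: "P \<in> carr I.B" for P
  proof (rule I.inductive_limit_hom_eqI [OF I.cstar_algebra_B star_hom_compose [OF \<Phi> \<psi>] star_hom_id _ P])
    fix l x assume l: "l \<in> \<Lambda>" and x: "x \<in> carr (toeplitz_algebra (E l))"
    have "\<psi> (\<phi> l x) = I.inj_lim l x"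
      by (rule toeplitz_hom_eqI [OF graph [OF l] I.cstar_algebra_B star_hom_compose [OF \<phi>(1) [OF l] \<psi>] I.star_hom_inj_lim [OF l] _ _ x])
        (use \<psi>0 \<psi>1 T0J [OF l] T1J [OF l] p_in [OF l] in \<open>simp_all add: \<phi>(2,3) [OF l] J0_def J1_def\<close>)
    then show "\<psi> (\<Phi> (I.inj_lim l x)) = I.inj_lim l x" using \<Phi>_inj l x by simp
  qed
  have "bij_betw \<psi> (carr ?A) (carr I.B)"
    by (rule bij_betw_byWitness [where f' = \<Phi>])
      (use left right star_homD(1) [OF \<psi>] star_homD(1) [OF \<Phi>] in auto)
  then show ?thesis unfolding cstar_isomorphic_def using cA I.cstar_algebra_B \<psi> by blast
qed

end

theorem proposition4p6:
  fixes \<Lambda> :: "'l set"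
    and le :: "'l \<Rightarrow> 'l \<Rightarrow> bool"
    and E :: "'l \<Rightarrow> ('v, 'e) topgraph"
    and m0 :: "'l \<Rightarrow> 'l \<Rightarrow> 'v option \<Rightarrow> 'v option"
    and m1 :: "'l \<Rightarrow> 'l \<Rightarrow> 'e option \<Rightarrow> 'e option"
  assumes "directed_set \<Lambda> le"
    and "projective_system \<Lambda> le E m0 m1"
  shows "cstar_isomorphic
           (toeplitz_algebra (projective_limit \<Lambda> le E m0 m1))
           (inductive_limit \<Lambda> le (\<lambda>l. toeplitz_algebra (E l))
              (\<lambda>l k. induced_hom (E k) (E l) (m0 l k) (m1 l k)))"
proof -
  interpret graph_system \<Lambda> le E m0 m1 by (rule graph_system.intro [OF assms])
  show ?thesis by (rule toeplitz_lim_iso)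
qed

end
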